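(* Let $s_0\in\mathbb{H}$ and $v_0\in L^1\cap L^\infty(\mathbb{R})$ with $\mathrm{supp}(v_0)\subseteq[s_0,\infty)$ and $v_0\le0$ a.e. Suppose $v_0(y)<-\lambda\kappa$ at some point $y\in(s_0,\infty)$ and that $v_0$ is right-continuous at that point. Then $$\mathbb{P}(\varsigma<+\infty)>0$$ for any càdlàg weak solution $(v,s)\in\mathfrak{D}(v_0,s_0)$ to the supercooled Stefan problem with transport noise, where $$\varsigma:=\inf\{t>0: v(t,\cdot)\ne v(t-,\cdot)\}=\inf\{t>0: s(t)\neq s(t-)\},\qquad \inf\emptyset=+\infty.$$
   Context: Constants: $\kappa,\lambda>0$ and $\theta\in\mathbb{R}$ with $\theta\ne0$ and $|\theta|<\sqrt{2\kappa}$. The equilibrium freezing temperature is $0$. $(\Omega,\mathcal{F},\mathbb{P})$ is a suitable complete probability space carrying a Brownian motion $W$, and $(\mathcal{F}_t)_{t\ge0}$ is the complete, right-continuous filtration generated by $W$. Write $\mathbb{H}=[0,\infty)$ and $\langle f,\phi\rangle=\int f\phi\,\mathrm{d}x$; "increasing" means non-decreasing. Path spaces: $\mathbf{D}_{\mathbb{R}}$ is the space of real-valued càdlàg paths on $[0,\infty)$. $f\in\mathbf{D}_{L^1(\mathbb{R})}$ iff $f(t,\cdot)\in L^1(\mathbb{R})$ for all $t\ge0$ and $t\mapsto\langle f(t,\cdot),\phi\rangle$ is in $\mathbf{D}_{\mathbb{R}}$ for all $\phi\in C_b(\mathbb{R})$. $\mathbf{D}^{\uparrow}_{\mathbb{H}}$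 is the space of increasing càdlàg paths on $[0,\infty)$ with values in $\mathbb{H}$. Define $$\mathbf{D}(v_0,s_0)=\{(v,s)\in\mathbf{D}_{L^1(\mathbb{R})}\times\mathbf{D}^{\uparrow}_{\mathbb{H}}: s(0)=s_0,\ v(0,\cdot)=v_0,\ \mathrm{supp}(v(t,\cdot))\subseteq[s(t),\infty),\ \|v(t,\cdot)\|_{L^\infty}\le\|v_0\|_{L^\infty}\ \forall t\ge0\},$$ and let $\mathfrak{D}(v_0,s_0)$ be the space of $\mathcal{F}_t$-adapted processes with paths in $\mathbf{D}(v_0,s_0)$. Here $s(t-)$ and $v(t-,\cdot)$ denote left limits in time (the latter tested against $C_b(\mathbb{R})$). Càdlàg weak solution: $(v,s)\in\mathfrak{D}(v_0,s_0)$ is a (global) càdlàg weak solution if, almost surely, $$\begin{aligned}\int_{s(t)}^{\infty}v(t,x)\phi(t,x)\,\mathrm{d}x-\int_{s_0}^{\infty}v_0(x)\phi(0,x)\,\mathrm{d}x=&\int_0^t\int_{s(r)}^{\infty}v(r,x)\partial_r\phi(r,x)\,\mathrm{d}x\,\mathrm{d}r+\kappa\int_0^t\int_{s(r)}^{\infty}v(r,x)\partial_{xx}\phi(r,x)\,\mathrm{d}x\,\mathrm{d}r\\&+\theta\int_0^t\int_{s(r)}^{\infty}v(r,x)\partial_x\phi(r,x)\,\mathrm{d}x\,\mathrm{d}W_r+\lambda\kappa\int_0^t\phi(r,s(r-))\,\mathrm{d}s(r)\\&+\sum_{0<r\le t}\int_{s(r-)}^{s(r)}v(r-,x)\bigl(\phi(r,s(r-))-\phi(r,x)\bigr)\,\mathrm{d}x\end{aligned}$$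 for all $t>0$ and all $\phi\in C^{1,2}_b([0,\infty)\times\mathbb{R})$. *)

theory Defs
  imports "HOL-Probability.Probability"
begin

text \<open>Processes are written path-first: \<open>X \<omega> t\<close> is the value of \<open>X\<close> at time \<open>t\<close> on the
  path \<open>\<omega>\<close>, and \<open>v \<omega> t x\<close> is the value at the point \<open>x\<close>. Values at negative times are
  irrelevant throughout. Elements of \<open>L\<^sup>1(\<real>)\<close> are represented by Lebesgue integrable functions
  and identified when they agree almost everywhere.\<close>

section \<open>Brownian motion and its augmented filtration\<close>

definition brownian_motion :: "'a measure \<Rightarrow> ('a \<Rightarrow> real \<Rightarrow> real) \<Rightarrow> bool" where
  "brownian_motion M W \<longleftrightarrow>
     (\<forall>t\<ge>0. (\<lambda>\<omega>. W \<omega> t) \<in> borel_measurable M) \<and>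
     (AE \<omega> in M. W \<omega> 0 = 0) \<and>
     (AE \<omega> in M. continuous_on {0..} (W \<omega>)) \<and>
     (\<forall>r t. 0 \<le> r \<and> r < t \<longrightarrow>
        distributed M lborel (\<lambda>\<omega>. W \<omega> t - W \<omega> r) (normal_density 0 (sqrt (t - r)))) \<and>
     (\<forall>n (\<tau> :: nat \<Rightarrow> real). 0 \<le> \<tau> 0 \<and> mono \<tau> \<longrightarrow>
        prob_space.indep_vars M (\<lambda>_. borel) (\<lambda>i \<omega>. W \<omega> (\<tau> (Suc i)) - W \<omega> (\<tau> i)) {..<n})"

definition augmented_history :: "'a measure \<Rightarrow> ('a \<Rightarrow> real \<Rightarrow> real) \<Rightarrow> real \<Rightarrow> 'a set set" where
  "augmented_history M W u =
     sigma_sets (space M)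
       ({(\<lambda>\<omega>. W \<omega> r) -` B \<inter> space M | r B. 0 \<le> r \<and> r \<le> u \<and> B \<in> sets borel} \<union> null_sets M)"

definition brownian_filtration :: "'a measure \<Rightarrow> ('a \<Rightarrow> real \<Rightarrow> real) \<Rightarrow> real \<Rightarrow> 'a measure" where
  "brownian_filtration M W t = sigma (space M) (\<Inter>u\<in>{t<..}. augmented_history M W u)"

definition adapted :: "(real \<Rightarrow> 'a measure) \<Rightarrow> ('a \<Rightarrow> real \<Rightarrow> real) \<Rightarrow> bool" where
  "adapted F X \<longleftrightarrow> (\<forall>t\<ge>0. (\<lambda>\<omega>. X \<omega> t) \<in> borel_measurable (F t))"

definition progressive :: "(real \<Rightarrow> 'a measure) \<Rightarrow> ('a \<Rightarrow> real \<Rightarrow> real) \<Rightarrow> bool" where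
  "progressive F X \<longleftrightarrow>
     (\<forall>t\<ge>0. (\<lambda>(r, \<omega>). X \<omega> r) \<in> borel_measurable (restrict_space borel {0..t} \<Otimes>\<^sub>M F t))"

section \<open>The It\^o integral\<close>

definition tends_to_0_in_probability :: "'a measure \<Rightarrow> (nat \<Rightarrow> 'a \<Rightarrow> ennreal) \<Rightarrow> bool" where
  "tends_to_0_in_probability M Z \<longleftrightarrow>
     (\<forall>n. Z n \<in> borel_measurable M) \<and>
     (\<forall>\<epsilon>>0. (\<lambda>n. measure M {\<omega> \<in> space M. Z n \<omega> > ennreal \<epsilon>}) \<longlonglongrightarrow> 0)"

definition elementary_integral ::
  "'a measure \<Rightarrow> (real \<Rightarrow> 'a measure) \<Rightarrow> ('a \<Rightarrow> real \<Rightarrow> real) \<Rightarrow>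
   ('a \<Rightarrow> real \<Rightarrow> real) \<Rightarrow> ('a \<Rightarrow> real \<Rightarrow> real) \<Rightarrow> bool" where
  "elementary_integral M F W H J \<longleftrightarrow>
     (\<exists>(n :: nat) (\<tau> :: nat \<Rightarrow> real) (\<xi> :: nat \<Rightarrow> 'a \<Rightarrow> real).
        0 \<le> \<tau> 0 \<and> mono \<tau> \<and>
        (\<forall>i<n. \<xi> i \<in> borel_measurable (F (\<tau> i)) \<and> (\<exists>C. \<forall>\<omega>\<in>space M. \<bar>\<xi> i \<omega>\<bar> \<le> C)) \<and>
        H = (\<lambda>\<omega> r. \<Sum>i<n. \<xi> i \<omega> * indicator {\<tau> i<..\<tau> (Suc i)} r) \<and>
        J = (\<lambda>\<omega> t. \<Sum>i<n. \<xi> i \<omega> * (W \<omega> (min t (\<tau> (Suc i))) - W \<omega> (min t (\<tau> i)))))"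

text \<open>\<open>has_ito_integral M F W H I\<close>: the process \<open>I\<close> is a continuous version of
  \<open>t \<mapsto> \<integral>\<^sub>0\<^sup>t H\<^sub>r dW\<^sub>r\<close>. It determines \<open>I\<close> up to indistinguishability.\<close>

definition has_ito_integral ::
  "'a measure \<Rightarrow> (real \<Rightarrow> 'a measure) \<Rightarrow> ('a \<Rightarrow> real \<Rightarrow> real) \<Rightarrow>
   ('a \<Rightarrow> real \<Rightarrow> real) \<Rightarrow> ('a \<Rightarrow> real \<Rightarrow> real) \<Rightarrow> bool" where
  "has_ito_integral M F W H I \<longleftrightarrow>
     progressive F H \<and> adapted F I \<and> (AE \<omega> in M. continuous_on {0..} (I \<omega>)) \<and>
     (\<exists>Hn Jn. (\<forall>n. elementary_integral M F W (Hn n) (Jn n)) \<and>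
        (\<forall>T>0.
           tends_to_0_in_probability M
             (\<lambda>n \<omega>. \<integral>\<^sup>+r\<in>{0..T}. ennreal ((Hn n \<omega> r - H \<omega> r)\<^sup>2) \<partial>lebesgue) \<and>
           tends_to_0_in_probability M
             (\<lambda>n \<omega>. SUP t\<in>{0..T}. ennreal \<bar>Jn n \<omega> t - I \<omega> t\<bar>)))"

section \<open>Path spaces\<close>

definition cadlag :: "(real \<Rightarrow> real) \<Rightarrow> bool" where
  "cadlag f \<longleftrightarrow> (\<forall>t\<ge>0. continuous (at_right t) f) \<and> (\<forall>t>0. \<exists>l. (f \<longlongrightarrow> l) (at_left t))"

definition pairing :: "(real \<Rightarrow> real) \<Rightarrow> (real \<Rightarrow> real) \<Rightarrow> real" where
  "pairing f \<phi> = (LINT x|lebesgue. f x * \<phi> x)"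

definition D_L1 :: "(real \<Rightarrow> real \<Rightarrow> real) set" where
  "D_L1 = {f. (\<forall>t\<ge>0. integrable lebesgue (f t)) \<and>
              (\<forall>\<phi>\<in>bcontfun. cadlag (\<lambda>t. pairing (f t) \<phi>))}"

definition D_up_H :: "(real \<Rightarrow> real) set" where
  "D_up_H = {f. cadlag f \<and> mono_on {0..} f \<and> (\<forall>t\<ge>0. f t \<in> {0..})}"

definition ess_supp :: "(real \<Rightarrow> real) \<Rightarrow> real set" where
  "ess_supp f = - \<Union>{U. open U \<and> (AE x in lebesgue. x \<in> U \<longrightarrow> f x = 0)}"

definition Linf_norm :: "(real \<Rightarrow> real) \<Rightarrow> ereal" where
  "Linf_norm f = esssup lebesgue (\<lambda>x. ereal \<bar>f x\<bar>)"

definition D_paths ::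
  "(real \<Rightarrow> real) \<Rightarrow> real \<Rightarrow> ((real \<Rightarrow> real \<Rightarrow> real) \<times> (real \<Rightarrow> real)) set" where
  "D_paths v0 s0 =
     {(v, s). v \<in> D_L1 \<and> s \<in> D_up_H \<and> s 0 = s0 \<and> (AE x in lebesgue. v 0 x = v0 x) \<and>
        (\<forall>t\<ge>0. ess_supp (v t) \<subseteq> {s t..} \<and> Linf_norm (v t) \<le> Linf_norm v0)}"

text \<open>Adaptedness of the \<open>L\<^sup>1(\<real>)\<close>-valued process \<open>v\<close> is stated through the evaluations against
  \<open>C\<^sub>b(\<real>)\<close>, which generate the Borel sets of \<open>L\<^sup>1(\<real>)\<close>.\<close>

definition D_processes ::
  "'a measure \<Rightarrow> (real \<Rightarrow> 'a measure) \<Rightarrow> (real \<Rightarrow> real) \<Rightarrow> real \<Rightarrow>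
   (('a \<Rightarrow> real \<Rightarrow> real \<Rightarrow> real) \<times> ('a \<Rightarrow> real \<Rightarrow> real)) set" where
  "D_processes M F v0 s0 =
     {(v, s). (\<forall>\<omega>\<in>space M. (v \<omega>, s \<omega>) \<in> D_paths v0 s0) \<and> adapted F s \<and>
        (\<forall>\<phi>\<in>bcontfun. adapted F (\<lambda>\<omega> t. pairing (v \<omega> t) \<phi>))}"

definition left_lim :: "(real \<Rightarrow> real) \<Rightarrow> real \<Rightarrow> real" where
  "left_lim s t = Lim (at_left t) s"

definition is_left_lim_L1 :: "(real \<Rightarrow> real \<Rightarrow> real) \<Rightarrow> real \<Rightarrow> (real \<Rightarrow> real) \<Rightarrow> bool" where
  "is_left_lim_L1 v t g \<longleftrightarrow> integrable lebesgue g \<and>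
     (\<forall>\<phi>\<in>bcontfun. ((\<lambda>r. pairing (v r) \<phi>) \<longlongrightarrow> pairing g \<phi>) (at_left t))"

definition left_lim_L1 :: "(real \<Rightarrow> real \<Rightarrow> real) \<Rightarrow> real \<Rightarrow> real \<Rightarrow> real" where
  "left_lim_L1 v t = (SOME g. is_left_lim_L1 v t g)"

section \<open>Test functions and the weak formulation\<close>

definition d_t :: "(real \<Rightarrow> real \<Rightarrow> real) \<Rightarrow> real \<Rightarrow> real \<Rightarrow> real" where
  "d_t \<phi> t x = vector_derivative (\<lambda>r. \<phi> r x) (at t within {0..})"

definition d_x :: "(real \<Rightarrow> real \<Rightarrow> real) \<Rightarrow> real \<Rightarrow> real \<Rightarrow> real" where
  "d_x \<phi> t x = deriv (\<phi> t) x"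

definition d_xx :: "(real \<Rightarrow> real \<Rightarrow> real) \<Rightarrow> real \<Rightarrow> real \<Rightarrow> real" where
  "d_xx \<phi> t x = deriv (deriv (\<phi> t)) x"

definition C12b :: "(real \<Rightarrow> real \<Rightarrow> real) set" where
  "C12b = {\<phi>.
     (\<forall>t\<ge>0. \<forall>x. (\<lambda>r. \<phi> r x) differentiable (at t within {0..}) \<and>
        \<phi> t differentiable (at x) \<and> deriv (\<phi> t) differentiable (at x)) \<and>
     (\<forall>\<psi>\<in>{\<phi>, d_t \<phi>, d_x \<phi>, d_xx \<phi>}.
        continuous_on ({0..} \<times> UNIV) (\<lambda>(t, x). \<psi> t x) \<and>
        bounded ((\<lambda>(t, x). \<psi> t x) ` ({0..} \<times> UNIV)))}"

text \<open>The Stieltjes measure \<open>ds\<close>; the path is extended by \<open>s(0)\<close> to negative times, so there is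
  no atom at \<open>0\<close>.\<close>

definition stieltjes :: "(real \<Rightarrow> real) \<Rightarrow> real measure" where
  "stieltjes s = interval_measure (\<lambda>r. s (max 0 r))"

text \<open>The identity at time \<open>t\<close> for one path; \<open>ito\<close> stands for
  \<open>\<integral>\<^sub>0\<^sup>t \<integral>\<^bsub>s(r)\<^esub>\<^sup>\<infinity> v(r,x) \<partial>\<^sub>x\<phi>(r,x) dx dW\<^sub>r\<close>.\<close>

definition weak_identity ::
  "real \<Rightarrow> real \<Rightarrow> real \<Rightarrow> (real \<Rightarrow> real) \<Rightarrow> real \<Rightarrow> (real \<Rightarrow> real \<Rightarrow> real) \<Rightarrow> (real \<Rightarrow> real) \<Rightarrow>
   (real \<Rightarrow> real \<Rightarrow> real) \<Rightarrow> real \<Rightarrow> real \<Rightarrow> bool" where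
  "weak_identity \<kappa> \<theta> l v0 s0 v s \<phi> ito t \<longleftrightarrow>
     (LINT x:{s t..}|lebesgue. v t x * \<phi> t x) - (LINT x:{s0..}|lebesgue. v0 x * \<phi> 0 x) =
       (LINT r:{0..t}|lebesgue. LINT x:{s r..}|lebesgue. v r x * d_t \<phi> r x)
       + \<kappa> * (LINT r:{0..t}|lebesgue. LINT x:{s r..}|lebesgue. v r x * d_xx \<phi> r x)
       + \<theta> * ito
       + l * \<kappa> * (LINT r:{0<..t}|stieltjes s. \<phi> r (left_lim s r))
       + (\<Sum>\<^sub>\<infinity>r\<in>{0<..t}. LINT x:{left_lim s r..s r}|lebesgue.
            left_lim_L1 v r x * (\<phi> r (left_lim s r) - \<phi> r x))"

text \<open>Each stochastic integral is only defined up to a null set depending on \<open>\<phi>\<close>; the identity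
  holds almost surely, simultaneously in \<open>t\<close> and \<open>\<phi>\<close>, for some choice \<open>I \<phi>\<close> of versions.\<close>

definition cadlag_weak_solution ::
  "'a measure \<Rightarrow> ('a \<Rightarrow> real \<Rightarrow> real) \<Rightarrow> real \<Rightarrow> real \<Rightarrow> real \<Rightarrow> (real \<Rightarrow> real) \<Rightarrow> real \<Rightarrow>
   ('a \<Rightarrow> real \<Rightarrow> real \<Rightarrow> real) \<Rightarrow> ('a \<Rightarrow> real \<Rightarrow> real) \<Rightarrow> bool" where
  "cadlag_weak_solution M W \<kappa> \<theta> l v0 s0 v s \<longleftrightarrow>
     (v, s) \<in> D_processes M (brownian_filtration M W) v0 s0 \<and>
     (\<exists>I. (\<forall>\<phi>\<in>C12b. has_ito_integral M (brownian_filtration M W) W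
              (\<lambda>\<omega> r. LINT x:{s \<omega> r..}|lebesgue. v \<omega> r x * d_x \<phi> r x) (I \<phi>)) \<and>
          (AE \<omega> in M. \<forall>\<phi>\<in>C12b. \<forall>t>0. weak_identity \<kappa> \<theta> l v0 s0 (v \<omega>) (s \<omega>) \<phi> (I \<phi> \<omega> t) t))"

section \<open>First jump times\<close>

text \<open>\<open>v(t,\<cdot>) \<noteq> v(t-,\<cdot>)\<close> in \<open>L\<^sup>1(\<real>)\<close> says that \<open>v(t,\<cdot>)\<close> is not the (unique) left limit of \<open>v\<close>
  at \<open>t\<close>.\<close>

definition first_jump_v :: "(real \<Rightarrow> real \<Rightarrow> real) \<Rightarrow> ereal" where
  "first_jump_v v = Inf (ereal ` {t. t > 0 \<and> \<not> is_left_lim_L1 v t (v t)})"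

definition first_jump_s :: "(real \<Rightarrow> real) \<Rightarrow> ereal" where
  "first_jump_s s = Inf (ereal ` {t. t > 0 \<and> s t \<noteq> left_lim s t})"

end

theory Submission
  imports Defs
begin

text \<open>Suppose that almost surely there is no jump. It\^o's formula for \<open>e\<^bsup>-i\<xi>\<theta>W\<^esub>\<close> times the Fourier
  transform of \<open>v\<close>, which is obtained here by discretising time, removes the stochastic integral: in
  the frame moving with \<open>\<theta>W\<close> the solution is pathwise the heat flow, with diffusivity
  \<open>\<kappa> - \<theta>\<^sup>2 / 2 > 0\<close>, of \<open>v0\<close> and of a source of strength \<open>l\<kappa> ds\<close> on the moving front
  \<open>s - \<theta>W\<close>. With positive probability \<open>-\<theta>W\<close> climbs, within an arbitrarily short time and nearly
  monotonically, so far that the front sweeps over an interval to the right of \<open>y\<close> on which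
  \<open>v0 \<le> -l\<kappa> - \<rho>\<close>. The mass met there exceeds what the displacement of the front can account for
  in the mass balance, a contradiction. On jump-free intervals the heat representation also shows that
  \<open>v\<close> is continuous, and by the mass balance every jump of \<open>s\<close> is one of \<open>v\<close>.\<close>

section \<open>Brownian motion and its filtration\<close>

text \<open>Test functions are deterministic, so one that moves with \<open>\<theta> * W\<close>
  cannot be inserted into the weak identity. Cosine and sine are used because differentiation only
  multiplies the complex exponential by \<open>\<i> * \<xi>\<close>: for each frequency the weak
  identity closes to a scalar linear equation whose stochastic integrand is a multiple of the
  unknown itself, and an exponential factor solves it. The stochastic integral is given as a limit
  in probability of elementary integrals; the product formula is therefore an exact telescoping
  identity for these, followed by limits along a subsequence. Its null set depends on frequency and
  time, so rational ones are treated at once and limits recover the others. Inverting the Fourier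
  transform concerns signed measures, which are split into positive parts before uniqueness is
  applied. Two demands on the short horizon conflict: diffusion must be negligible, yet the noise
  must carry the front a fixed distance. The horizon is fixed first, from the slack that diffusion
  may consume, and only then is the climb requested.\<close>

locale bm = prob_space M for M :: "'a measure" +
  fixes W :: "'a \<Rightarrow> real \<Rightarrow> real"
  assumes complete_M: "complete_measure M" and brownian: "brownian_motion M W"
begin

abbreviation F :: "real \<Rightarrow> 'a measure" where "F \<equiv> brownian_filtration M W"

abbreviation hist :: "real \<Rightarrow> 'a set set" where "hist \<equiv> augmented_history M W"

lemma W_measurable [measurable]: "0 \<le> t \<Longrightarrow> (\<lambda>\<omega>. W \<omega> t) \<in> borel_measurable M"
  using brownian by (auto simp: brownian_motion_def)

lemma increment_measurable [measurable]:
  "0 \<le> r \<Longrightarrow> 0 \<le> t \<Longrightarrow> (\<lambda>\<omega>. W \<omega> t - W \<omega> r) \<in> borel_measurable M"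
  by (intro borel_measurable_diff W_measurable)

lemma W_0: "AE \<omega> in M. W \<omega> 0 = 0"
  and W_continuous: "AE \<omega> in M. continuous_on {0..} (W \<omega>)"
  using brownian by (auto simp: brownian_motion_def)

lemma W_increment_distributed:
  "0 \<le> r \<Longrightarrow> r < t \<Longrightarrow>
    distributed M lborel (\<lambda>\<omega>. W \<omega> t - W \<omega> r) (normal_density 0 (sqrt (t - r)))"
  using brownian by (auto simp: brownian_motion_def)

lemma W_increments_indep:
  "0 \<le> \<tau> 0 \<Longrightarrow> mono \<tau> \<Longrightarrow>
    indep_vars (\<lambda>_. borel) (\<lambda>i \<omega>. W \<omega> (\<tau> (Suc i)) - W \<omega> (\<tau> i)) {..<n::nat}"
  using brownian by (auto simp: brownian_motion_def)

lemma hist_generators: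
  "{(\<lambda>\<omega>. W \<omega> r) -` B \<inter> space M | r B. 0 \<le> r \<and> r \<le> u \<and> B \<in> sets borel} \<union> null_sets M \<subseteq> sets M"
  by (auto intro!: measurable_sets[OF W_measurable])

lemma hist_subset_M: "hist u \<subseteq> sets M"
  unfolding augmented_history_def using hist_generators by (rule sets.sigma_sets_subset)

lemma sigma_algebra_hist: "sigma_algebra (space M) (hist u)"
  unfolding augmented_history_def using hist_generators sets.space_closed
  by (intro sigma_algebra_sigma_sets) (blast dest: sets.sets_into_space)

text \<open>An intersection of sigma-algebras is one already, so the closure taken in
  \<open>brownian_filtration\<close> adds nothing. Membership in \<open>F t\<close> thus means
  membership in \<open>hist u\<close> for every \<open>u > t\<close>, which is how the
  right-continuity of the filtration is used below.\<close>

lemma sets_F: "sets (F t) = (\<Inter>u\<in>{t<..}. hist u)"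
proof -
  have "sigma_algebra (space M) (\<Inter>u\<in>{t<..}. hist u)"
    unfolding sigma_algebra_iff2
  proof (intro conjI ballI allI impI)
    have "hist (t + 1) \<subseteq> Pow (space M)"
      using hist_subset_M sets.space_closed by blast
    then show "(\<Inter>u\<in>{t<..}. hist u) \<subseteq> Pow (space M)"
      by (intro INF_lower2[of "t + 1"]) auto
  next
    fix A :: "nat \<Rightarrow> 'a set" assume A: "range A \<subseteq> (\<Inter>u\<in>{t<..}. hist u)"
    then have *: "range A \<subseteq> hist u" if "t < u" for u
      by (rule order_trans) (use that in \<open>auto intro: INT_lower\<close>)
    then show "\<Union> (range A) \<in> (\<Inter>u\<in>{t<..}. hist u)"
      using sigma_algebra_hist * by (auto simp: sigma_algebra_iff2)
  qed (use sigma_algebra_hist in \<open>auto simp: sigma_algebra_iff2\<close>)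
  then show ?thesis
    unfolding brownian_filtration_def
    by (metis sigma_algebra.sets_measure_of_eq)
qed

lemma space_F [simp]: "space (F t) = space M"
  by (simp add: brownian_filtration_def space_measure_of_conv)

lemma F_mono: "t \<le> t' \<Longrightarrow> sets (F t) \<subseteq> sets (F t')"
  by (auto simp: sets_F)

lemma F_subset_M: "sets (F t) \<subseteq> sets M"
  unfolding sets_F using hist_subset_M[of "t + 1"] by (intro INF_lower2[of "t + 1"]) auto

lemma measurable_F_mono: "t \<le> t' \<Longrightarrow> f \<in> measurable (F t) N \<Longrightarrow> f \<in> measurable (F t') N"
  using F_mono[of t t'] by (auto simp: measurable_def)

lemma measurable_F_imp: "f \<in> measurable (F t) N \<Longrightarrow> f \<in> measurable M N"
  using F_subset_M[of t] by (auto simp: measurable_def)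

lemma W_measurable_F: "0 \<le> r \<Longrightarrow> r \<le> t \<Longrightarrow> (\<lambda>\<omega>. W \<omega> r) \<in> borel_measurable (F t)"
proof (rule measurableI)
  fix B :: "real set" assume "0 \<le> r" "r \<le> t" "B \<in> sets borel"
  then have "(\<lambda>\<omega>. W \<omega> r) -` B \<inter> space M \<in> hist u" if "u > t" for u
    unfolding augmented_history_def using that
    by (intro sigma_sets.Basic UnI1) (auto intro!: exI[of _ r] exI[of _ B])
  then show "(\<lambda>\<omega>. W \<omega> r) -` B \<inter> space (F t) \<in> sets (F t)"
    by (auto simp: sets_F)
qed simp

text \<open>The defining equivalence holds only up to a null set. Hence the null sets of the
  augmentation are cylinders themselves (take an empty \<open>B r\<close>), and one class stable
  under intersection generates the whole augmented history.\<close>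

definition cylinders :: "real \<Rightarrow> 'a set set" where
  "cylinders u = {A \<in> sets M. \<exists>R B. finite R \<and> R \<subseteq> {0..u} \<and> (\<forall>r. B r \<in> sets (borel :: real measure)) \<and>
     (AE \<omega> in M. \<omega> \<in> A \<longleftrightarrow> (\<forall>r\<in>R. W \<omega> r \<in> B r))}"

lemma Int_stable_cylinders: "Int_stable (cylinders u)"
proof (rule Int_stableI)
  fix A A' assume "A \<in> cylinders u" "A' \<in> cylinders u"
  then obtain R B R' B' where A: "A \<in> sets M" "finite R" "R \<subseteq> {0..u}" "\<And>r. B r \<in> sets (borel :: real measure)"
      "AE \<omega> in M. \<omega> \<in> A \<longleftrightarrow> (\<forall>r\<in>R. W \<omega> r \<in> B r)"
    and A': "A' \<in> sets M" "finite R'" "R' \<subseteq> {0..u}" "\<And>r. B' r \<in> sets (borel :: real measure)"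
      "AE \<omega> in M. \<omega> \<in> A' \<longleftrightarrow> (\<forall>r\<in>R'. W \<omega> r \<in> B' r)"
    by (auto simp: cylinders_def)
  define C where "C r = (if r \<in> R then B r else UNIV) \<inter> (if r \<in> R' then B' r else UNIV)" for r
  have "AE \<omega> in M. \<omega> \<in> A \<inter> A' \<longleftrightarrow> (\<forall>r\<in>R \<union> R'. W \<omega> r \<in> C r)"
    using A(5) A'(5) by eventually_elim (auto simp: C_def)
  moreover have "C r \<in> sets borel" for r
    using A(4) A'(4) by (auto simp: C_def)
  ultimately show "A \<inter> A' \<in> cylinders u"
    using A A' unfolding cylinders_def
    by (intro CollectI conjI exI[of _ "R \<union> R'"] exI[of _ C]) auto
qed

lemma cylinders_subset_M: "cylinders u \<subseteq> sets M"
  by (auto simp: cylinders_def)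

lemma hist_subset_cylinders: "0 \<le> u \<Longrightarrow> hist u \<subseteq> sigma_sets (space M) (cylinders u)"
  unfolding augmented_history_def
proof (intro sigma_sets_mono' Un_least subsetI)
  fix A assume "A \<in> {(\<lambda>\<omega>. W \<omega> r) -` B \<inter> space M | r B. 0 \<le> r \<and> r \<le> u \<and> B \<in> sets borel}"
  then obtain r B where "A = (\<lambda>\<omega>. W \<omega> r) -` B \<inter> space M" "0 \<le> r" "r \<le> u" "B \<in> sets borel"
    by auto
  then show "A \<in> cylinders u"
    unfolding cylinders_def
    by (intro CollectI conjI exI[of _ "{r}"] exI[of _ "\<lambda>_. B"]) auto
next
  fix A assume "0 \<le> u" "A \<in> null_sets M"
  then show "A \<in> cylinders u"
    unfolding cylinders_def
    by (intro CollectI conjI exI[of _ "{u}"] exI[of _ "\<lambda>_. {}"]) (auto simp: AE_not_in)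
qed

text \<open>Almost surely the values of \<open>W\<close> at the times in \<open>R\<close> are
  partial sums of increments over a grid with \<open>u\<close> as a node and \<open>t'\<close> as
  its last one. The cylinder is therefore a function of the increments before \<open>u\<close>,
  which are jointly independent of the last increment.\<close>

lemma indep_cylinder_increment:
  assumes A: "A \<in> cylinders u" and u: "0 \<le> u" "u \<le> t'" and B: "B \<in> sets borel"
  shows "prob (A \<inter> ((\<lambda>\<omega>. W \<omega> t' - W \<omega> u) -` B \<inter> space M)) =
         prob A * prob ((\<lambda>\<omega>. W \<omega> t' - W \<omega> u) -` B \<inter> space M)"
proof -
  obtain R C where R: "A \<in> sets M" "finite R" "R \<subseteq> {0..u}" "\<And>r. C r \<in> sets (borel :: real measure)"
      "AE \<omega> in M. \<omega> \<in> A \<longleftrightarrow> (\<forall>r\<in>R. W \<omega> r \<in> C r)"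
    using A by (auto simp: cylinders_def)
  \<comment> \<open>The node 0 lets the partial sums start from \<open>W \<omega> 0 = 0\<close>; the
    node \<open>u\<close> makes the increment under study the last one of the grid.\<close>
  define L where "L = sorted_list_of_set (insert 0 (insert u R))"
  define n where "n = length L - 1"
  have setL: "set L = insert 0 (insert u R)" and sL: "sorted L"
    using R by (auto simp: L_def simp del: sorted_list_of_set_insert_remove)
  have lenL: "length L = Suc n"
    using setL by (cases L) (auto simp: n_def)
  have L0: "L ! 0 = 0"
  proof -
    obtain i where i: "i < length L" "L ! i = 0" using setL by (metis in_set_conv_nth insertI1)
    then have "L ! 0 \<le> 0" using sL by (metis sorted_nth_mono le0)
    moreover have "L ! 0 \<in> {0..u}" using setL R u lenL nth_mem[of 0 L] by auto
    ultimately show ?thesis by simp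
  qed
  have Ln: "L ! n = u"
  proof -
    obtain i where i: "i < length L" "L ! i = u" using setL by (metis in_set_conv_nth insertI1 insertI2)
    then have "L ! n \<ge> u" using sL lenL by (metis sorted_nth_mono less_Suc_eq_le lessI)
    moreover have "L ! n \<in> {0..u}" using setL R u lenL nth_mem[of n L] by auto
    ultimately show ?thesis by simp
  qed
  \<comment> \<open>The constant continuation by \<open>t'\<close> makes this a monotone sequence on
    all naturals, the form in which \<open>brownian_motion\<close> provides independent
    increments.\<close>
  define \<tau> where "\<tau> i = (if i \<le> n then L ! i else t')" for i
  have mono: "mono \<tau>"
  proof (rule monoI)
    fix i j :: nat assume "i \<le> j"
    show "\<tau> i \<le> \<tau> j"
    proof (cases "j \<le> n")
      case True
      then show ?thesis using sL lenL \<open>i \<le> j\<close> by (auto simp: \<tau>_def intro: sorted_nth_mono)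
    next
      case False
      have "L ! i \<le> L ! n" if "i \<le> n" using sL lenL that by (auto intro: sorted_nth_mono)
      with False u Ln show ?thesis by (auto simp: \<tau>_def)
    qed
  qed
  have \<tau>: "\<tau> 0 = 0" "\<tau> n = u" "\<tau> (Suc n) = t'"
    using L0 Ln by (auto simp: \<tau>_def)
  define X where "X = (\<lambda>i \<omega>. W \<omega> (\<tau> (Suc i)) - W \<omega> (\<tau> i))"
  have "indep_vars (\<lambda>_. borel) X {..<Suc n}"
    unfolding X_def using W_increments_indep[of \<tau> "Suc n"] mono \<tau> by auto
  then have ind: "indep_var (PiM {..<n} (\<lambda>_. borel)) (\<lambda>\<omega>. restrict (\<lambda>i. X i \<omega>) {..<n})
      (PiM {n} (\<lambda>_. borel)) (\<lambda>\<omega>. restrict (\<lambda>i. X i \<omega>) {n})"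
    by (rule indep_var_restrict) auto
  have idx: "\<exists>k\<le>n. \<tau> k = r" if "r \<in> R" for r
  proof -
    have "r \<in> set L" using that setL by auto
    then obtain k where "k < length L" "L ! k = r" by (metis in_set_conv_nth)
    then show ?thesis using lenL by (intro exI[of _ k]) (auto simp: \<tau>_def)
  qed
  then obtain k where k: "\<And>r. r \<in> R \<Longrightarrow> k r \<le> n" "\<And>r. r \<in> R \<Longrightarrow> \<tau> (k r) = r"
    by metis
  define P where "P = (\<lambda>f. \<forall>r\<in>R. (\<Sum>i<k r. f i) \<in> C r)"
  have P_meas: "Measurable.pred (PiM {..<n} (\<lambda>_. borel)) P"
    unfolding P_def
  proof (rule pred_intros_finite)
    show "finite R" by fact
    fix r assume r: "r \<in> R"
    have "(\<lambda>f. \<Sum>i<k r. f i) \<in> borel_measurable (PiM {..<n} (\<lambda>_. borel :: real measure))"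
      using k(1)[OF r] by (intro borel_measurable_sum measurable_component_singleton) auto
    then show "Measurable.pred (PiM {..<n} (\<lambda>_. borel)) (\<lambda>f. (\<Sum>i<k r. f i) \<in> C r)"
      using R(4)[of r] by measurable
  qed
  have "indep_var borel ((\<lambda>f. of_bool (P f) :: real) \<circ> (\<lambda>\<omega>. restrict (\<lambda>i. X i \<omega>) {..<n}))
      borel ((\<lambda>f. f n) \<circ> (\<lambda>\<omega>. restrict (\<lambda>i. X i \<omega>) {n}))"
    using P_meas by (intro indep_var_compose[OF ind]) (auto simp: of_bool_def)
  moreover have "(\<lambda>f. f n) \<circ> (\<lambda>\<omega>. restrict (\<lambda>i. X i \<omega>) {n}) = (\<lambda>\<omega>. W \<omega> t' - W \<omega> u)"
    using \<tau> by (auto simp: X_def fun_eq_iff)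
  moreover define Q where "Q \<omega> = (of_bool (P (restrict (\<lambda>i. X i \<omega>) {..<n})) :: real)" for \<omega>
  ultimately have ind: "indep_var borel Q borel (\<lambda>\<omega>. W \<omega> t' - W \<omega> u)"
    by (simp add: comp_def Q_def[abs_def])
  have Qm [measurable]: "Q \<in> borel_measurable M"
    using indep_var_rv1[OF ind] by simp
  have Dm [measurable]: "(\<lambda>\<omega>. W \<omega> t' - W \<omega> u) \<in> borel_measurable M"
    using u by (intro increment_measurable) auto
  \<comment> \<open>The event is carried by the indicator \<open>Q\<close> of a condition on
    increments. Telescoping and \<open>W \<omega> 0 = 0\<close> identify it with \<open>A\<close> up
    to a null set.\<close>
  have AEQ: "AE \<omega> in M. \<omega> \<in> A \<longleftrightarrow> Q \<omega> = 1"
    using R(5) W_0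
  proof eventually_elim
    case (elim \<omega>)
    have "(\<Sum>i<k r. restrict (\<lambda>i. X i \<omega>) {..<n} i) = W \<omega> r" if r: "r \<in> R" for r
    proof -
      have "(\<Sum>i<k r. restrict (\<lambda>i. X i \<omega>) {..<n} i) = (\<Sum>i<k r. W \<omega> (\<tau> (Suc i)) - W \<omega> (\<tau> i))"
        using k(1)[OF r] by (intro sum.cong) (auto simp: X_def)
      also have "\<dots> = W \<omega> (\<tau> (k r)) - W \<omega> (\<tau> 0)"
        by (rule sum_lessThan_telescope)
      finally show ?thesis using k(2)[OF r] \<tau> elim by simp
    qed
    then show ?case using elim by (auto simp: Q_def P_def)
  qed
  have QD: "prob ((Q -` {1} \<inter> space M) \<inter> ((\<lambda>\<omega>. W \<omega> t' - W \<omega> u) -` B \<inter> space M)) =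
      prob (Q -` {1} \<inter> space M) * prob ((\<lambda>\<omega>. W \<omega> t' - W \<omega> u) -` B \<inter> space M)"
    using indep_varD[OF ind, of "{1}" B] B
    by (simp add: vimage_def Int_def conj_ac) 
  have 1: "prob A = prob (Q -` {1} \<inter> space M)"
    using AEQ R(1) by (intro finite_measure_eq_AE) auto
  have 2: "prob (A \<inter> ((\<lambda>\<omega>. W \<omega> t' - W \<omega> u) -` B \<inter> space M)) =
     prob ((Q -` {1} \<inter> space M) \<inter> ((\<lambda>\<omega>. W \<omega> t' - W \<omega> u) -` B \<inter> space M))"
    using AEQ R(1) B by (intro finite_measure_eq_AE) auto
  show ?thesis using 1 2 QD by simp
qed

lemma indep_hist_increment:
  assumes A: "A \<in> hist u" and u: "0 \<le> u" "u \<le> t'" and B: "B \<in> sets borel"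
  shows "prob (A \<inter> ((\<lambda>\<omega>. W \<omega> t' - W \<omega> u) -` B \<inter> space M)) =
         prob A * prob ((\<lambda>\<omega>. W \<omega> t' - W \<omega> u) -` B \<inter> space M)"
proof -
  let ?G = "{(\<lambda>\<omega>. W \<omega> t' - W \<omega> u) -` B \<inter> space M | B. B \<in> sets borel}"
  have Dm [measurable]: "(\<lambda>\<omega>. W \<omega> t' - W \<omega> u) \<in> borel_measurable M"
    using u by (intro increment_measurable) auto
  have "indep_set (cylinders u) ?G"
    using indep_cylinder_increment u cylinders_subset_M
    by (intro indep_setI) auto
  moreover have "Int_stable ?G"
  proof (rule Int_stableI)
    fix a b assume "a \<in> ?G" "b \<in> ?G"
    then obtain A B where "A \<in> sets borel" "B \<in> sets borel"
      "a = (\<lambda>\<omega>. W \<omega> t' - W \<omega> u) -` A \<inter> space M" "b = (\<lambda>\<omega>. W \<omega> t' - W \<omega> u) -` B \<inter> space M"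
      by auto
    then show "a \<inter> b \<in> ?G"
      by (intro CollectI exI[of _ "A \<inter> B"]) auto
  qed
  ultimately have "indep_set (sigma_sets (space M) (cylinders u)) (sigma_sets (space M) ?G)"
    by (rule indep_set_sigma_sets[OF _ Int_stable_cylinders])
  from indep_setD[OF this, of A "(\<lambda>\<omega>. W \<omega> t' - W \<omega> u) -` B \<inter> space M"] show ?thesis
    using A B u hist_subset_cylinders by blast
qed

lemma W_increment_distr:
  "0 \<le> r \<Longrightarrow> r < t \<Longrightarrow>
    distr M borel (\<lambda>\<omega>. W \<omega> t - W \<omega> r) = density lborel (normal_density 0 (sqrt (t - r)))"
  using distributed_distr_eq_density[OF W_increment_distributed[of r t]]
  by (simp add: distr_cong[of M M lborel borel])

text \<open>Without atoms the limit increment almost surely avoids the discontinuity of the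
  indicator of a half-line, so that \<open>prob_tendsto_AE\<close> can pass to the limit in
  \<open>indep_F_increment\<close>.\<close>

lemma prob_increment_atom:
  assumes "0 \<le> r" "r < t"
  shows "AE \<omega> in M. W \<omega> t - W \<omega> r \<noteq> x"
proof -
  have "AE z in lborel. z \<noteq> x" using AE_lborel_singleton[of x] .
  then have "AE z in density lborel (normal_density 0 (sqrt (t - r))). z \<noteq> x"
    by (auto simp: AE_density elim: eventually_mono)
  then show ?thesis
    unfolding W_increment_distr[OF assms, symmetric] using assms
    by (subst (asm) AE_distr_iff) (auto)
qed

lemma prob_tendsto_AE:
  assumes A: "A \<in> events"
    and D [measurable]: "\<And>n. D n \<in> borel_measurable M" "D' \<in> borel_measurable M"
    and lim: "AE \<omega> in M. (\<lambda>n. D n \<omega>) \<longlonglongrightarrow> D' \<omega>" and ne: "AE \<omega> in M. D' \<omega> \<noteq> (x::real)"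
  shows "(\<lambda>n. prob (A \<inter> {\<omega>\<in>space M. D n \<omega> \<le> x})) \<longlonglongrightarrow> prob (A \<inter> {\<omega>\<in>space M. D' \<omega> \<le> x})"
proof -
  note A [measurable]
  have "(\<lambda>n. \<integral>\<omega>. indicator (A \<inter> {\<omega>\<in>space M. D n \<omega> \<le> x}) \<omega> \<partial>M) \<longlonglongrightarrow>
      (\<integral>\<omega>. indicator (A \<inter> {\<omega>\<in>space M. D' \<omega> \<le> x}) \<omega> \<partial>M :: real)"
  proof (rule integral_dominated_convergence[where w = "\<lambda>_. 1"])
    show "AE \<omega> in M. (\<lambda>n. indicator (A \<inter> {\<omega>\<in>space M. D n \<omega> \<le> x}) \<omega> :: real)
        \<longlonglongrightarrow> indicator (A \<inter> {\<omega>\<in>space M. D' \<omega> \<le> x}) \<omega>"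
      using lim ne
    proof eventually_elim
      case (elim \<omega>)
      show ?case
      proof (cases "D' \<omega> < x")
        case True
        then have "\<forall>\<^sub>F n in sequentially. D n \<omega> < x" using elim(1) by (simp add: order_tendstoD)
        then show ?thesis
          using True by (intro tendsto_eventually) (auto elim!: eventually_mono simp: indicator_def)
      next
        case False
        then have "\<forall>\<^sub>F n in sequentially. D n \<omega> > x" using elim by (simp add: order_tendstoD)
        then show ?thesis
          using False elim(2) by (intro tendsto_eventually) (auto elim!: eventually_mono simp: indicator_def)
      qed
    qed
  qed (auto simp: indicator_def)
  then show ?thesis by simp
qed

text \<open>An event of \<open>F t\<close> is known only at times strictly after \<open>t\<close>,
  so \<open>indep_hist_increment\<close> applies to increments starting at \<open>u n > t\<close>.
  Path continuity then moves the starting point \<open>u n\<close> down to \<open>t\<close>.\<close>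

lemma indep_F_increment:
  assumes A: "A \<in> sets (F t)" and t: "0 \<le> t" "t < t'"
  shows "prob (A \<inter> {\<omega>\<in>space M. W \<omega> t' - W \<omega> t \<le> x}) = prob A * prob {\<omega>\<in>space M. W \<omega> t' - W \<omega> t \<le> x}"
proof -
  \<comment> \<open>The summand 2 keeps \<open>u n\<close> strictly below \<open>t'\<close> for
    \<open>n = 0\<close> as well.\<close>
  define u where "u n = t + (t' - t) / (real n + 2)" for n :: nat
  have u: "t < u n" "u n < t'" for n
  proof -
    have "(t' - t) / (real n + 2) < (t' - t) / 1" using t by (intro divide_strict_left_mono) auto
    then show "t < u n" "u n < t'" using t by (auto simp: u_def)
  qed
  have ul: "u \<longlonglongrightarrow> t"
    unfolding u_def by real_asymp
  have "A \<in> hist (u n)" for n using A u by (auto simp: sets_F)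
  then have eq: "prob (A \<inter> {\<omega>\<in>space M. W \<omega> t' - W \<omega> (u n) \<le> x}) =
      prob A * prob {\<omega>\<in>space M. W \<omega> t' - W \<omega> (u n) \<le> x}" for n
    using indep_hist_increment[of A "u n" t' "{..x}"] u[of n] t
    by (simp add: vimage_def Int_def conj_ac)
  have [measurable]: "(\<lambda>\<omega>. W \<omega> t' - W \<omega> t) \<in> borel_measurable M"
     "(\<lambda>\<omega>. W \<omega> t' - W \<omega> (u n)) \<in> borel_measurable M" for n
    using t u[of n] by (auto intro!: increment_measurable)
  have lim: "AE \<omega> in M. (\<lambda>n. W \<omega> t' - W \<omega> (u n)) \<longlonglongrightarrow> W \<omega> t' - W \<omega> t"
    using W_continuous
  proof eventually_elim
    case (elim \<omega>)
    then have "(\<lambda>n. W \<omega> (u n)) \<longlonglongrightarrow> W \<omega> t"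
      by (rule continuous_on_tendsto_compose[OF _ ul]) 
        (use t less_imp_le[OF order.strict_trans1[OF t(1) u(1)]] in \<open>auto\<close>)
    then show ?case by (intro tendsto_intros)
  qed
  have "(\<lambda>n. prob (A \<inter> {\<omega>\<in>space M. W \<omega> t' - W \<omega> (u n) \<le> x})) \<longlonglongrightarrow>
      prob (A \<inter> {\<omega>\<in>space M. W \<omega> t' - W \<omega> t \<le> x})"
    using A F_subset_M lim prob_increment_atom[OF t] by (intro prob_tendsto_AE) auto
  moreover have "(\<lambda>n. prob (space M \<inter> {\<omega>\<in>space M. W \<omega> t' - W \<omega> (u n) \<le> x})) \<longlonglongrightarrow>
      prob (space M \<inter> {\<omega>\<in>space M. W \<omega> t' - W \<omega> t \<le> x})"
    using lim prob_increment_atom[OF t] by (intro prob_tendsto_AE) auto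
  then have "(\<lambda>n. prob A * prob ({\<omega>\<in>space M. W \<omega> t' - W \<omega> (u n) \<le> x})) \<longlonglongrightarrow>
      prob A * prob ({\<omega>\<in>space M. W \<omega> t' - W \<omega> t \<le> x})"
    by (intro tendsto_mult tendsto_const) (simp add: Int_def)
  ultimately show ?thesis
    unfolding eq by (rule LIMSEQ_unique)
qed

lemma Int_stable_vimage: "Int_stable {Y -` A \<inter> space M | A. A \<in> sets L}"
proof (rule Int_stableI)
  fix a b assume "a \<in> {Y -` A \<inter> space M | A. A \<in> sets L}" "b \<in> {Y -` A \<inter> space M | A. A \<in> sets L}"
  then obtain A B where "A \<in> sets L" "B \<in> sets L" "a = Y -` A \<inter> space M" "b = Y -` B \<inter> space M"
    by auto
  then show "a \<inter> b \<in> {Y -` A \<inter> space M | A. A \<in> sets L}"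
    by (intro CollectI exI[of _ "A \<inter> B"]) auto
qed

text \<open>Half-lines are stable under intersection and generate the Borel sets, so
  \<open>indep_F_increment\<close> extends to the increment as a random variable. The map
  \<open>g\<close> is built in because the noise terms later are nonlinear functions of the
  increment.\<close>

lemma indep_var_F_increment:
  assumes X: "X \<in> measurable (F t) N" and t: "0 \<le> t" "t < t'"
    and g: "g \<in> measurable borel N'"
  shows "indep_var N X N' (\<lambda>\<omega>. g (W \<omega> t' - W \<omega> t))"
proof -
  let ?D = "\<lambda>\<omega>. W \<omega> t' - W \<omega> t"
  have D [measurable]: "?D \<in> borel_measurable M"
    using t by (intro increment_measurable) auto
  let ?G = "{?D -` A \<inter> space M | A. A \<in> range atMost}"
  have "indep_set (sets (F t)) ?G"
    using indep_F_increment[OF _ t] F_subset_M[of t] measurable_sets[OF D]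
    by (intro indep_setI) (auto simp: vimage_def Int_def conj_ac)
  moreover have "Int_stable (sets (F t))"
    by (rule sets.Int_stable)
  moreover have "Int_stable ?G"
  proof (rule Int_stableI)
    fix a b assume "a \<in> ?G" "b \<in> ?G"
    then obtain x y where "a = ?D -` {..x} \<inter> space M" "b = ?D -` {..y} \<inter> space M"
      by auto
    then show "a \<inter> b \<in> ?G"
      by (intro CollectI exI[of _ "{..min x y}"]) auto
  qed
  ultimately have "indep_set (sigma_sets (space M) (sets (F t))) (sigma_sets (space M) ?G)"
    by (rule indep_set_sigma_sets)
  moreover have "sigma_sets (space M) (sets (F t)) = sets (F t)"
    using sets.sigma_sets_eq[of "F t"] by simp
  moreover have "sigma_sets (space M) ?G = {?D -` A \<inter> space M | A. A \<in> sets borel}"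
    by (subst sigma_sets_vimage_commute[symmetric, where \<Omega>' = UNIV]) (auto simp: borel_eq_atMost)
  ultimately have ind: "indep_set (sets (F t)) {?D -` A \<inter> space M | A. A \<in> sets borel}"
    by simp
  have XM: "X \<in> measurable M N" using X by (rule measurable_F_imp)
  let ?Z = "\<lambda>\<omega>. g (?D \<omega>)"
  have Z: "?Z \<in> measurable M N'"
    using measurable_compose[OF D g] .
  have Z_sub: "{?Z -` A \<inter> space M | A. A \<in> sets N'} \<subseteq> {?D -` A \<inter> space M | A. A \<in> sets borel}"
  proof safe
    fix A assume "A \<in> sets N'"
    then show "\<exists>A'. ?Z -` A \<inter> space M = ?D -` A' \<inter> space M \<and> A' \<in> sets borel"
      using measurable_sets[OF g] by (intro exI[of _ "g -` A"]) auto
  qed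
  have "indep_set {X -` A \<inter> space M | A. A \<in> sets N} {?Z -` A \<inter> space M | A. A \<in> sets N'}"
  proof (rule indep_setI)
    fix a b assume "a \<in> {X -` A \<inter> space M | A. A \<in> sets N}" "b \<in> {?Z -` A \<inter> space M | A. A \<in> sets N'}"
    then show "prob (a \<inter> b) = prob a * prob b"
      using Z_sub measurable_sets[OF X] by (intro indep_setD[OF ind]) auto
  qed (use measurable_sets[OF XM] measurable_sets[OF Z] in auto)
  then have "indep_set (sigma_sets (space M) {X -` A \<inter> space M | A. A \<in> sets N})
     (sigma_sets (space M) {?Z -` A \<inter> space M | A. A \<in> sets N'})"
    by (rule indep_set_sigma_sets) (rule Int_stable_vimage)+
  then show ?thesis
    unfolding indep_var_eq using XM Z by blast
qed

text \<open>These are normal moments. The second and fourth bound the variances of the noise terms,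
  the first removes linear terms, and the third absolute one bounds the Taylor remainder of
  \<open>drift\<close>. The exact third absolute moment carries the factor
  \<open>sqrt (2 / pi)\<close>, which is at most 1.\<close>

lemma increment_integral:
  assumes t: "0 \<le> t" "t < t'"
  shows "has_bochner_integral M (\<lambda>\<omega>. (W \<omega> t' - W \<omega> t)\<^sup>2) (t' - t)"
    and "has_bochner_integral M (\<lambda>\<omega>. (W \<omega> t' - W \<omega> t) ^ 4) (3 * (t' - t)\<^sup>2)"
    and "has_bochner_integral M (\<lambda>\<omega>. W \<omega> t' - W \<omega> t) 0"
    and "integrable M (\<lambda>\<omega>. \<bar>W \<omega> t' - W \<omega> t\<bar> ^ 3)"
    and "expectation (\<lambda>\<omega>. \<bar>W \<omega> t' - W \<omega> t\<bar> ^ 3) \<le> 2 * sqrt (t' - t) * (t' - t)"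
proof -
  define d where "d = sqrt (t' - t)"
  have d: "d > 0" "d\<^sup>2 = t' - t" using t by (auto simp: d_def)
  note dist = W_increment_distributed[OF t, folded d_def]
  have int: "has_bochner_integral M (\<lambda>\<omega>. g (W \<omega> t' - W \<omega> t)) c"
    if "has_bochner_integral lborel (\<lambda>x. normal_density 0 d x * g x) c" "g \<in> borel_measurable borel"
    for g :: "real \<Rightarrow> real" and c
    using distributed_integrable[OF dist] distributed_integral[OF dist] that
    by (simp add: has_bochner_integral_iff normal_density_nonneg)
  show "has_bochner_integral M (\<lambda>\<omega>. (W \<omega> t' - W \<omega> t)\<^sup>2) (t' - t)"
    using int[OF normal_moment_even[OF d(1), of 0 1, simplified]] d by simp
  show "has_bochner_integral M (\<lambda>\<omega>. (W \<omega> t' - W \<omega> t) ^ 4) (3 * (t' - t)\<^sup>2)"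
    unfolding d(2)[symmetric] using int[OF _ , of "\<lambda>x. x ^ 4" "3 * (d\<^sup>2)\<^sup>2"] normal_moment_even[OF d(1), of 0 2]
    by (simp add: fact_numeral power2_eq_square mult.assoc)
  show "has_bochner_integral M (\<lambda>\<omega>. W \<omega> t' - W \<omega> t) 0"
    using int[OF _ , of "\<lambda>x. x"] normal_moment_odd[OF d(1), of 0 0] by simp
  have 3: "has_bochner_integral M (\<lambda>\<omega>. \<bar>W \<omega> t' - W \<omega> t\<bar> ^ 3) (2 * d ^ 3 * sqrt (2 / pi))"
    using int[OF _ , of "\<lambda>x. \<bar>x\<bar> ^ 3"] normal_moment_abs_odd[OF d(1), of 0 1] by (simp add: numeral_3_eq_3)
  then show "integrable M (\<lambda>\<omega>. \<bar>W \<omega> t' - W \<omega> t\<bar> ^ 3)" by (rule integrable.intros)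
  have "sqrt (2 / pi) \<le> 1"
    using pi_gt3 by (simp add: field_simps)
  then have "2 * d ^ 3 * sqrt (2 / pi) \<le> 2 * d ^ 3 * 1"
    using d by (intro mult_left_mono) auto
  also have "\<dots> = 2 * d * (t' - t)"
    unfolding d(2)[symmetric] by (simp add: power2_eq_square power3_eq_cube)
  finally show "expectation (\<lambda>\<omega>. \<bar>W \<omega> t' - W \<omega> t\<bar> ^ 3) \<le> 2 * sqrt (t' - t) * (t' - t)"
    using 3 by (simp add: has_bochner_integral_iff d_def)
qed

end

section \<open>Martingale transforms of Brownian increments\<close>

text \<open>A discrete stochastic integral. The noise is a centred function \<open>f i\<close> of
  the increment, since both \<open>growth\<close> and \<open>drift\<close> enter nonlinearly;
  complex values treat the cosine and sine parts together. \<open>C i\<close> bounds the variance of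
  the noise and is positive because \<open>transform_Lenglart\<close> divides by it.\<close>

locale martingale_transform = bm +
  fixes N :: nat and t :: "nat \<Rightarrow> real" and \<zeta> :: "nat \<Rightarrow> 'a \<Rightarrow> complex" and f :: "nat \<Rightarrow> real \<Rightarrow> complex"
    and C :: "nat \<Rightarrow> real"
  assumes t_nonneg: "0 \<le> t 0" and t_less: "\<And>i. i < N \<Longrightarrow> t i < t (Suc i)"
    and \<zeta>: "\<And>i. i < N \<Longrightarrow> \<zeta> i \<in> borel_measurable (F (t i))"
    and f [measurable]: "\<And>i. i < N \<Longrightarrow> f i \<in> borel_measurable borel"
    and f_mean: "\<And>i. i < N \<Longrightarrow>
      has_bochner_integral M (\<lambda>\<omega>. f i (W \<omega> (t (Suc i)) - W \<omega> (t i))) 0"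
    and f_square: "\<And>i. i < N \<Longrightarrow> integrable M (\<lambda>\<omega>. (norm (f i (W \<omega> (t (Suc i)) - W \<omega> (t i))))\<^sup>2)"
    and f_var: "\<And>i. i < N \<Longrightarrow>
      expectation (\<lambda>\<omega>. (norm (f i (W \<omega> (t (Suc i)) - W \<omega> (t i))))\<^sup>2) \<le> C i"
    and C_pos: "\<And>i. i < N \<Longrightarrow> C i > 0"
begin

lemma t_mono: "i \<le> j \<Longrightarrow> j \<le> N \<Longrightarrow> t i \<le> t j"
proof (induction j rule: dec_induct)
  case (step j)
  then show ?case using t_less[of j] by simp
qed simp

lemma t_ge_0: "i \<le> N \<Longrightarrow> 0 \<le> t i"
  using t_mono[of 0 i] t_nonneg by simp

definition D :: "nat \<Rightarrow> 'a \<Rightarrow> complex" where "D i \<omega> = f i (W \<omega> (t (Suc i)) - W \<omega> (t i))"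

lemma D_measurable: "i < N \<Longrightarrow> D i \<in> borel_measurable (F (t (Suc i)))"
  unfolding D_def
  by (intro measurable_compose[OF _ f] borel_measurable_diff W_measurable_F)
     (use t_ge_0 t_less in \<open>auto intro: less_imp_le\<close>)

lemma transform_measurable:
  assumes "n \<le> N" "\<And>i. i < N \<Longrightarrow> z i \<in> borel_measurable (F (t i))"
  shows "(\<lambda>\<omega>. \<Sum>i<n. z i \<omega> * D i \<omega>) \<in> borel_measurable (F (t n))"
proof (intro borel_measurable_sum borel_measurable_times)
  fix i assume i: "i \<in> {..<n}"
  show "z i \<in> borel_measurable (F (t n))"
    using assms i t_mono[of i n] by (intro measurable_F_mono[OF _ assms(2)]) auto
  show "D i \<in> borel_measurable (F (t n))"
    using assms i t_mono[of "Suc i" n] by (intro measurable_F_mono[OF _ D_measurable]) auto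
qed

text \<open>Induction on the number of terms. The cross term is the real part of
  \<open>cnj (S \<omega>) * z n \<omega> * D n \<omega>\<close>, whose first two factors are known
  at time \<open>t n\<close> and hence independent of the centred third. Boundedness of the
  coefficients provides the integrability for splitting the expectations.\<close>

lemma transform_isometry:
  assumes z: "\<And>i. i < N \<Longrightarrow> z i \<in> borel_measurable (F (t i))"
    and bound: "\<And>i \<omega>. i < N \<Longrightarrow> \<omega> \<in> space M \<Longrightarrow> norm (z i \<omega>) \<le> K i"
    and n: "n \<le> N"
  shows "integrable M (\<lambda>\<omega>. (norm (\<Sum>i<n. z i \<omega> * D i \<omega>))\<^sup>2) \<and>
    expectation (\<lambda>\<omega>. (norm (\<Sum>i<n. z i \<omega> * D i \<omega>))\<^sup>2) \<le> (\<Sum>i<n. expectation (\<lambda>\<omega>. (norm (z i \<omega>))\<^sup>2) * C i)"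
  using n
proof (induction n)
  case (Suc n)
  define S where "S \<omega> = (\<Sum>i<n. z i \<omega> * D i \<omega>)" for \<omega>
  from Suc have n: "n < N" by simp
  have IH: "integrable M (\<lambda>\<omega>. (norm (S \<omega>))\<^sup>2)"
    "expectation (\<lambda>\<omega>. (norm (S \<omega>))\<^sup>2) \<le> (\<Sum>i<n. expectation (\<lambda>\<omega>. (norm (z i \<omega>))\<^sup>2) * C i)"
    using Suc by (auto simp: S_def)
  have SF: "S \<in> borel_measurable (F (t n))"
    unfolding S_def using z n by (intro transform_measurable) auto
  note zF = z[OF n]
  have [measurable]: "S \<in> borel_measurable M" "z n \<in> borel_measurable M" "D n \<in> borel_measurable M"
    using SF zF D_measurable[OF n] by (auto intro: measurable_F_imp)
  have tt: "0 \<le> t n" "t n < t (Suc n)" using t_ge_0[of n] t_less n by auto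
  have intz: "integrable M (\<lambda>\<omega>. (norm (z n \<omega>))\<^sup>2)"
    using bound[OF n] by (intro integrable_const_bound[where B = "(K n)\<^sup>2"]) (auto intro!: AE_I2 power_mono)
  have intS: "integrable M S"
  proof (rule Bochner_Integration.integrable_bound)
    show "integrable M (\<lambda>\<omega>. 1 + (norm (S \<omega>))\<^sup>2)" using IH by simp
    have "x \<le> 1 + x\<^sup>2" if "x \<ge> 0" for x :: real
      using sum_squares_bound[of 1 x] that by (simp add: power2_eq_square)
    then show "AE \<omega> in M. norm (S \<omega>) \<le> norm (1 + (norm (S \<omega>))\<^sup>2)"
      by (intro AE_I2) (smt (verit) norm_ge_zero real_norm_def zero_le_power2)
  qed measurable
  have cross_F: "(\<lambda>\<omega>. cnj (S \<omega>) * z n \<omega>) \<in> borel_measurable (F (t n))"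
    using SF zF by (intro borel_measurable_times measurable_compose[OF SF]) (auto intro!: borel_measurable_continuous_onI continuous_intros)
  have intSz: "integrable M (\<lambda>\<omega>. cnj (S \<omega>) * z n \<omega>)"
  proof (rule Bochner_Integration.integrable_bound)
    show "integrable M (\<lambda>\<omega>. K n *\<^sub>R S \<omega>)" using intS by (rule integrable_scaleR_right)
    show "(\<lambda>\<omega>. cnj (S \<omega>) * z n \<omega>) \<in> borel_measurable M"
      using cross_F by (rule measurable_F_imp)
    show "AE \<omega> in M. norm (cnj (S \<omega>) * z n \<omega>) \<le> norm (K n *\<^sub>R S \<omega>)"
    proof (intro AE_I2)
      fix \<omega> assume "\<omega> \<in> space M"
      then have "norm (z n \<omega>) \<le> \<bar>K n\<bar>" using bound[OF n] by force
      then show "norm (cnj (S \<omega>) * z n \<omega>) \<le> norm (K n *\<^sub>R S \<omega>)"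
        using mult_left_mono[of "norm (z n \<omega>)" "\<bar>K n\<bar>" "norm (S \<omega>)"] by (simp add: norm_mult mult.commute)
    qed
  qed
  have intD: "integrable M (D n)" and D0: "expectation (D n) = 0"
    using f_mean[OF n] by (auto simp: D_def[abs_def] has_bochner_integral_iff)
  have intD2: "integrable M (\<lambda>\<omega>. (norm (D n \<omega>))\<^sup>2)"
    using f_square[OF n] by (auto simp: D_def)
  have ind: "indep_var borel (\<lambda>\<omega>. cnj (S \<omega>) * z n \<omega>) borel (D n)"
    unfolding D_def by (rule indep_var_F_increment[OF cross_F tt f[OF n]])
  have "(\<lambda>\<omega>. (norm (z n \<omega>))\<^sup>2) \<in> borel_measurable (F (t n))"
    by (rule measurable_compose[OF zF]) measurable
  moreover have "(\<lambda>x. (norm (f n x))\<^sup>2) \<in> borel_measurable borel"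
    by (rule measurable_compose[OF f[OF n]]) measurable
  ultimately have ind2: "indep_var borel (\<lambda>\<omega>. (norm (z n \<omega>))\<^sup>2) borel (\<lambda>\<omega>. (norm (D n \<omega>))\<^sup>2)"
    unfolding D_def by (rule indep_var_F_increment[OF _ tt])
  define R where "R \<omega> = Re (cnj (S \<omega>) * z n \<omega> * D n \<omega>)" for \<omega>
  have eq: "(norm (\<Sum>i<Suc n. z i \<omega> * D i \<omega>))\<^sup>2 =
      (norm (S \<omega>))\<^sup>2 + (norm (z n \<omega>))\<^sup>2 * (norm (D n \<omega>))\<^sup>2 + 2 * R \<omega>" for \<omega>
  proof -
    have "(norm (a + b))\<^sup>2 = (norm a)\<^sup>2 + (norm b)\<^sup>2 + 2 * Re (cnj a * b)" for a b :: complex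
      unfolding cmod_power2 by (simp add: power2_eq_square algebra_simps)
    from this[of "S \<omega>" "z n \<omega> * D n \<omega>"] show ?thesis
      by (simp only: R_def S_def sum.lessThan_Suc norm_mult power_mult_distrib mult.assoc)
  qed
  have cross_int: "integrable M R"
    unfolding R_def[abs_def] using indep_var_integrable[OF ind intSz intD] by (rule integrable_Re)
  have cross_0: "expectation R = 0"
    unfolding R_def[abs_def] using integral_Re[OF indep_var_integrable[OF ind intSz intD]] indep_var_lebesgue_integral[OF ind intSz intD] D0
    by simp
  note int2 = indep_var_integrable[OF ind2 intz intD2]
  have "expectation (\<lambda>\<omega>. (norm (\<Sum>i<Suc n. z i \<omega> * D i \<omega>))\<^sup>2) =
      expectation (\<lambda>\<omega>. (norm (S \<omega>))\<^sup>2) + expectation (\<lambda>\<omega>. (norm (z n \<omega>))\<^sup>2) * expectation (\<lambda>\<omega>. (norm (D n \<omega>))\<^sup>2)"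
    unfolding eq using IH(1) cross_int cross_0 int2 indep_var_lebesgue_integral[OF ind2 intz intD2] by simp
  also have "\<dots> \<le> (\<Sum>i<n. expectation (\<lambda>\<omega>. (norm (z i \<omega>))\<^sup>2) * C i) + expectation (\<lambda>\<omega>. (norm (z n \<omega>))\<^sup>2) * C n"
    using IH(2) f_var[OF n] by (intro add_mono mult_left_mono) (auto simp: D_def)
  finally show ?case
    unfolding eq using IH(1) cross_int int2 by simp
qed simp

text \<open>The coefficients are switched off as soon as the accumulated bound exceeds \<open>\<delta>\<close>.\<close>

lemma transform_Lenglart:
  assumes \<epsilon>: "\<epsilon> > 0" and \<delta>: "\<delta> \<ge> 0"
  shows "prob {\<omega>\<in>space M. norm (\<Sum>i<N. \<zeta> i \<omega> * D i \<omega>) > \<epsilon>} \<le>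
    \<delta> / \<epsilon>\<^sup>2 + prob {\<omega>\<in>space M. (\<Sum>i<N. (norm (\<zeta> i \<omega>))\<^sup>2 * C i) > \<delta>}"
proof -
  \<comment> \<open>The sum includes the current index: \<open>\<zeta> i\<close> is known at the
    left end point \<open>t i\<close>, so the decision to switch off can look at its own
    contribution. This is why the accumulated bound of the truncated coefficients never exceeds
    \<open>\<delta>\<close>.\<close>
  define V where "V i \<omega> = (\<Sum>j<Suc i. (norm (\<zeta> j \<omega>))\<^sup>2 * C j)" for i \<omega>
  define z where "z i \<omega> = (if V i \<omega> \<le> \<delta> then \<zeta> i \<omega> else 0)" for i \<omega>
  have V_meas: "V i \<in> borel_measurable (F (t i))" if "i < N" for i
    unfolding V_def
  proof (rule borel_measurable_sum)
    fix j assume "j \<in> {..<Suc i}"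
    then have [measurable]: "\<zeta> j \<in> borel_measurable (F (t i))"
      using that t_mono[of j i] by (intro measurable_F_mono[OF _ \<zeta>]) auto
    show "(\<lambda>\<omega>. (norm (\<zeta> j \<omega>))\<^sup>2 * C j) \<in> borel_measurable (F (t i))"
      by measurable
  qed
  have z_meas: "z i \<in> borel_measurable (F (t i))" if "i < N" for i
    unfolding z_def using V_meas[OF that] \<zeta>[OF that] by measurable
  have nn: "0 \<le> (norm (\<zeta> j \<omega>))\<^sup>2 * C j" if "j < N" for j \<omega>
    using C_pos[OF that] by simp
  \<comment> \<open>A coefficient that is still on contributes at most \<open>\<delta>\<close> by
    itself. This yields the deterministic bound required by
    \<open>transform_isometry\<close>.\<close>
  have z_bound: "norm (z i \<omega>) \<le> sqrt (\<delta> / C i)" if "i < N" for i \<omega>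
  proof (cases "V i \<omega> \<le> \<delta>")
    case True
    have "(norm (\<zeta> i \<omega>))\<^sup>2 * C i \<le> V i \<omega>"
      unfolding V_def using nn that by (auto intro!: sum_nonneg)
    then have "(norm (\<zeta> i \<omega>))\<^sup>2 \<le> \<delta> / C i"
      using True C_pos[OF that] by (simp add: field_simps)
    then have "norm (\<zeta> i \<omega>) \<le> sqrt (\<delta> / C i)" by (rule real_le_rsqrt)
    then show ?thesis using True by (simp add: z_def)
  qed (use \<delta> C_pos[OF that] in \<open>auto simp: z_def\<close>)
  have V_mono: "V i \<omega> \<le> V j \<omega>" if "i \<le> j" "j < N" for i j \<omega>
    unfolding V_def using that nn by (intro sum_mono2) auto
  have sum_le: "(\<Sum>i<n. (norm (z i \<omega>))\<^sup>2 * C i) \<le> \<delta>" if "n \<le> N" for n \<omega>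
    using that
  proof (induction n)
    case (Suc n)
    show ?case
    proof (cases "V n \<omega> \<le> \<delta>")
      case True
      have "(\<Sum>i<Suc n. (norm (z i \<omega>))\<^sup>2 * C i) \<le> (\<Sum>i<Suc n. (norm (\<zeta> i \<omega>))\<^sup>2 * C i)"
        using C_pos Suc.prems by (intro sum_mono mult_right_mono) (auto simp: z_def less_imp_le)
      then show ?thesis using True by (simp add: V_def)
    next
      case False
      then have "z n \<omega> = 0" by (simp add: z_def)
      then show ?thesis using Suc by simp
    qed
  qed (use \<delta> in simp)
  have [measurable]: "D i \<in> borel_measurable M" "z i \<in> borel_measurable M" "\<zeta> i \<in> borel_measurable M"
    if "i < N" for i
    using that D_measurable z_meas \<zeta> by (auto intro: measurable_F_imp)
  define S where "S = (\<lambda>\<omega>. \<Sum>i<N. z i \<omega> * D i \<omega>)"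
  have Sm [measurable]: "S \<in> borel_measurable M" unfolding S_def
    by (rule measurable_F_imp[OF transform_measurable]) (use z_meas in auto)
  have iso: "integrable M (\<lambda>\<omega>. (norm (S \<omega>))\<^sup>2)"
     "expectation (\<lambda>\<omega>. (norm (S \<omega>))\<^sup>2) \<le> (\<Sum>i<N. expectation (\<lambda>\<omega>. (norm (z i \<omega>))\<^sup>2) * C i)"
    using transform_isometry[of z "\<lambda>i. sqrt (\<delta> / C i)" N] z_meas z_bound by (auto simp: S_def)
  have int_z: "integrable M (\<lambda>\<omega>. (norm (z i \<omega>))\<^sup>2)" if "i < N" for i
    using that z_bound[OF that]
    by (intro integrable_const_bound[where B = "(sqrt (\<delta> / C i))\<^sup>2"]) (auto intro!: AE_I2 power_mono)
  have "(\<Sum>i<N. expectation (\<lambda>\<omega>. (norm (z i \<omega>))\<^sup>2) * C i) =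
      expectation (\<lambda>\<omega>. \<Sum>i<N. (norm (z i \<omega>))\<^sup>2 * C i)"
    using int_z by (subst Bochner_Integration.integral_sum) auto
  also have "\<dots> \<le> expectation (\<lambda>\<omega>. \<delta>)"
    using sum_le int_z by (intro integral_mono) auto
  finally have ES: "expectation (\<lambda>\<omega>. (norm (S \<omega>))\<^sup>2) \<le> \<delta>"
    using iso(2) by (simp add: prob_space)
  have "prob {\<omega>\<in>space M. norm (S \<omega>) > \<epsilon>} \<le> prob {\<omega>\<in>space M. (norm (S \<omega>))\<^sup>2 \<ge> \<epsilon>\<^sup>2}"
    using \<epsilon> by (intro finite_measure_mono) (auto intro: power_mono)
  also have "\<dots> \<le> expectation (\<lambda>\<omega>. (norm (S \<omega>))\<^sup>2) / \<epsilon>\<^sup>2"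
    using \<epsilon> by (intro integral_Markov_inequality_measure[OF iso(1), where A = "{}"]) auto
  also have "\<dots> \<le> \<delta> / \<epsilon>\<^sup>2" using ES by (intro divide_right_mono) auto
  finally have Sp: "prob {\<omega>\<in>space M. norm (S \<omega>) > \<epsilon>} \<le> \<delta> / \<epsilon>\<^sup>2" .
  have sets_S: "{\<omega>\<in>space M. norm (S \<omega>) > \<epsilon>} \<in> events"
    by measurable
  have "(\<lambda>\<omega>. \<Sum>i<N. (norm (\<zeta> i \<omega>))\<^sup>2 * C i) \<in> borel_measurable M"
    by (intro borel_measurable_sum borel_measurable_times borel_measurable_power borel_measurable_norm) auto
  then have sets_\<zeta>: "{\<omega>\<in>space M. (\<Sum>i<N. (norm (\<zeta> i \<omega>))\<^sup>2 * C i) > \<delta>} \<in> events"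
    by measurable
  have "prob {\<omega>\<in>space M. norm (\<Sum>i<N. \<zeta> i \<omega> * D i \<omega>) > \<epsilon>} \<le>
      prob ({\<omega>\<in>space M. norm (S \<omega>) > \<epsilon>} \<union> {\<omega>\<in>space M. (\<Sum>i<N. (norm (\<zeta> i \<omega>))\<^sup>2 * C i) > \<delta>})"
  proof (rule finite_measure_mono)
    show "{\<omega>\<in>space M. norm (\<Sum>i<N. \<zeta> i \<omega> * D i \<omega>) > \<epsilon>} \<subseteq>
       {\<omega>\<in>space M. norm (S \<omega>) > \<epsilon>} \<union> {\<omega>\<in>space M. (\<Sum>i<N. (norm (\<zeta> i \<omega>))\<^sup>2 * C i) > \<delta>}"
    proof
      fix \<omega> assume \<omega>: "\<omega> \<in> {\<omega>\<in>space M. norm (\<Sum>i<N. \<zeta> i \<omega> * D i \<omega>) > \<epsilon>}"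
      show "\<omega> \<in> {\<omega>\<in>space M. norm (S \<omega>) > \<epsilon>} \<union> {\<omega>\<in>space M. (\<Sum>i<N. (norm (\<zeta> i \<omega>))\<^sup>2 * C i) > \<delta>}"
      proof (cases "(\<Sum>i<N. (norm (\<zeta> i \<omega>))\<^sup>2 * C i) > \<delta>")
        case False
        have "V i \<omega> \<le> \<delta>" if "i < N" for i
        proof -
          have "V i \<omega> \<le> V (N - 1) \<omega>" using that by (intro V_mono) auto
          then show ?thesis using False that by (simp add: V_def del: sum.lessThan_Suc)
        qed
        then have "S \<omega> = (\<Sum>i<N. \<zeta> i \<omega> * D i \<omega>)"
          unfolding S_def by (intro sum.cong) (auto simp: z_def)
        then show ?thesis using \<omega> by simp
      qed (use \<omega> in auto)
    qed
  qed (use sets_S sets_\<zeta> in auto)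
  also have "\<dots> \<le> prob {\<omega>\<in>space M. norm (S \<omega>) > \<epsilon>} + prob {\<omega>\<in>space M. (\<Sum>i<N. (norm (\<zeta> i \<omega>))\<^sup>2 * C i) > \<delta>}"
    using sets_S sets_\<zeta> by (rule measure_Un_le)
  finally show ?thesis using Sp by simp
qed

end

section \<open>Brownian paths that climb with small drawdown\<close>

context bm
begin

text \<open>Dyadic times keep the event a finite union and make it grow with \<open>m\<close>, so a
  probability bound uniform in \<open>m\<close> survives the union over \<open>m\<close>; path
  continuity then turns the absence of dyadic excursions into a bound at all times in
  \<open>climb_bound\<close>.\<close>

definition excursion :: "real \<Rightarrow> real \<Rightarrow> real \<Rightarrow> real \<Rightarrow> nat \<Rightarrow> 'a set" where
  "excursion c a h x m = {\<omega>\<in>space M. \<exists>k\<in>{..2^m}. \<bar>c * (W \<omega> (a + real k * h / 2^m) - W \<omega> a)\<bar> > x}"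

lemma excursion_measurable:
  assumes "0 \<le> a" "0 < h"
  shows "excursion c a h x m \<in> sets (F (a + h))"
proof -
  have "{\<omega>\<in>space (F (a + h)). \<bar>c * (W \<omega> (a + real k * h / 2^m) - W \<omega> a)\<bar> > x} \<in> sets (F (a + h))"
    if "k \<le> 2 ^ m" for k
  proof -
    have "real k * h \<le> 2 ^ m * h"
      using that assms by (intro mult_right_mono) (auto simp flip: of_nat_power)
    then have [measurable]: "(\<lambda>\<omega>. W \<omega> (a + real k * h / 2^m)) \<in> borel_measurable (F (a + h))"
      using assms by (intro W_measurable_F) (auto simp: field_simps)
    have [measurable]: "(\<lambda>\<omega>. W \<omega> a) \<in> borel_measurable (F (a + h))"
      using assms by (intro W_measurable_F) auto
    show ?thesis by measurable
  qed
  then have "{\<omega>\<in>space (F (a + h)). \<exists>k\<in>{..2^m}. \<bar>c * (W \<omega> (a + real k * h / 2^m) - W \<omega> a)\<bar> > x} \<in> sets (F (a + h))"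
    by (intro sets.sets_Collect_finite_Ex finite_atMost) (simp only: atMost_iff)
  then show ?thesis
    by (simp only: excursion_def space_F)
qed

lemma excursion_mono: "m \<le> n \<Longrightarrow> excursion c a h x m \<subseteq> excursion c a h x n"
proof (induction n rule: dec_induct)
  case (step n)
  have "excursion c a h x n \<subseteq> excursion c a h x (Suc n)"
  proof
    fix \<omega> assume "\<omega> \<in> excursion c a h x n"
    then obtain k where k: "\<omega> \<in> space M" "k \<le> 2 ^ n" "\<bar>c * (W \<omega> (a + real k * h / 2^n) - W \<omega> a)\<bar> > x"
      by (auto simp: excursion_def)
    have "a + real (2 * k) * h / 2^Suc n = a + real k * h / 2^n" by simp
    then have "\<bar>c * (W \<omega> (a + real (2 * k) * h / 2^Suc n) - W \<omega> a)\<bar> > x" using k by (simp only:)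
    moreover have "2 * k \<in> {..2 ^ Suc n}" using k by simp
    ultimately show "\<omega> \<in> excursion c a h x (Suc n)"
      unfolding excursion_def using k(1) by blast
  qed
  with step show ?case by blast
qed simp

text \<open>Kolmogorov's maximal inequality, conditionally on the past: the walk is stopped when it
  first leaves \<open>[-x, x]\<close>.\<close>

lemma prob_excursion_le:
  assumes a: "0 \<le> a" "0 < h" and x: "x > 0" and A: "A \<in> sets (F a)"
  shows "prob (A \<inter> excursion c a h x m) \<le> prob A * (c\<^sup>2 * h / x\<^sup>2)"
proof -
  define t where "t i = a + real i * h / 2^m" for i
  define N :: nat where "N = 2 ^ m"
  define z :: "nat \<Rightarrow> 'a \<Rightarrow> complex" where
    "z i \<omega> = (if \<omega> \<in> A \<and> (\<forall>k\<in>{..i}. \<bar>c * (W \<omega> (t k) - W \<omega> a)\<bar> \<le> x) then of_real c else 0)" for i \<omega>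
  have t0: "t 0 = a" and tN: "t N = a + h" by (auto simp: t_def N_def)
  have t_mono: "t i \<le> t j" if "i \<le> j" for i j
    using that a by (auto simp: t_def intro!: divide_right_mono mult_right_mono)
  have t_step: "t (Suc i) - t i = h / 2^m" for i
    by (simp add: t_def field_simps)
  have z_meas: "z i \<in> borel_measurable (F (t i))" for i
  proof -
    have [measurable]: "A \<in> sets (F (t i))" using A F_mono[of a "t i"] t0 t_mono[of 0 i] by auto
    have [measurable]: "(\<lambda>\<omega>. W \<omega> a) \<in> borel_measurable (F (t i))"
      using a t0 t_mono[of 0 i] by (intro W_measurable_F) auto
    have "{\<omega>\<in>space (F (t i)). \<bar>c * (W \<omega> (t k) - W \<omega> a)\<bar> \<le> x} \<in> sets (F (t i))" if "k \<in> {..i}" for k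
    proof -
      have [measurable]: "(\<lambda>\<omega>. W \<omega> (t k)) \<in> borel_measurable (F (t i))"
        using a t0 t_mono[of 0 k] t_mono[of k i] that by (intro W_measurable_F) auto
      show ?thesis by measurable
    qed
    then have [measurable]: "{\<omega>\<in>space (F (t i)). \<forall>k\<in>{..i}. \<bar>c * (W \<omega> (t k) - W \<omega> a)\<bar> \<le> x} \<in> sets (F (t i))"
      by (intro sets.sets_Collect_finite_All) auto
    have "z i \<in> borel_measurable (F (t i)) \<longleftrightarrow> (\<lambda>\<omega>. if \<omega> \<in> A \<inter>
        {\<omega>\<in>space (F (t i)). \<forall>k\<in>{..i}. \<bar>c * (W \<omega> (t k) - W \<omega> a)\<bar> \<le> x} then of_real c else 0 :: complex)
        \<in> borel_measurable (F (t i))"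
      by (intro measurable_cong) (simp add: z_def)
    moreover have "\<dots>" by measurable
    ultimately show ?thesis by blast
  qed
  have inc: "t i \<ge> 0" "t i < t (Suc i)" for i
    using a t0 t_mono[of 0 i] t_step[of i] by (auto simp: algebra_simps)
  interpret martingale_transform M W N t z "\<lambda>_. of_real" "\<lambda>_. h / 2 ^ m"
  proof unfold_locales
    fix i assume "i < N"
    note int = increment_integral[OF inc(1)[of i] inc(2)[of i]]
    show "has_bochner_integral M (\<lambda>\<omega>. complex_of_real (W \<omega> (t (Suc i)) - W \<omega> (t i))) 0"
      using has_bochner_integral_of_real[OF int(3)] by simp
    show "integrable M (\<lambda>\<omega>. (norm (complex_of_real (W \<omega> (t (Suc i)) - W \<omega> (t i))))\<^sup>2)"
      "expectation (\<lambda>\<omega>. (norm (complex_of_real (W \<omega> (t (Suc i)) - W \<omega> (t i))))\<^sup>2) \<le> h / 2 ^ m"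
      using int(1) t_step[of i] by (simp_all only: norm_of_real power2_abs has_bochner_integral_iff order_refl)
  qed (use a t0 inc z_meas in auto)
  define S where "S \<omega> = (\<Sum>i<N. z i \<omega> * D i \<omega>)" for \<omega>
  have iso: "integrable M (\<lambda>\<omega>. (norm (S \<omega>))\<^sup>2)"
     "expectation (\<lambda>\<omega>. (norm (S \<omega>))\<^sup>2) \<le> (\<Sum>i<N. expectation (\<lambda>\<omega>. (norm (z i \<omega>))\<^sup>2) * (h / 2 ^ m))"
    using transform_isometry[of z "\<lambda>_. \<bar>c\<bar>" N] z_meas by (auto simp: S_def z_def)
  have A': "A \<in> events" using A F_subset_M by blast
  have zi: "z i \<in> borel_measurable M" for i using z_meas by (rule measurable_F_imp)
  note iso(2)
  also have "(\<Sum>i<N. expectation (\<lambda>\<omega>. (norm (z i \<omega>))\<^sup>2) * (h / 2 ^ m)) \<le> (\<Sum>i<N. (c\<^sup>2 * prob A) * (h / 2 ^ m))"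
  proof (intro sum_mono mult_right_mono)
    fix i
    have "expectation (\<lambda>\<omega>. (norm (z i \<omega>))\<^sup>2) \<le> expectation (\<lambda>\<omega>. c\<^sup>2 * indicator A \<omega>)"
    proof (rule integral_mono)
      show "integrable M (\<lambda>\<omega>. (norm (z i \<omega>))\<^sup>2)"
      proof (rule integrable_const_bound[where B = "c\<^sup>2"])
        show "(\<lambda>\<omega>. (norm (z i \<omega>))\<^sup>2) \<in> borel_measurable M"
          by (rule measurable_compose[OF zi]) measurable
      qed (auto simp: z_def)
    qed (use A' in \<open>auto simp: z_def less_top[symmetric]\<close>)
    then show "expectation (\<lambda>\<omega>. (norm (z i \<omega>))\<^sup>2) \<le> c\<^sup>2 * prob A" using A' by simp
  qed (use a in auto)
  also have "\<dots> = c\<^sup>2 * prob A * h" by (simp add: N_def)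
  finally have ES: "expectation (\<lambda>\<omega>. (norm (S \<omega>))\<^sup>2) \<le> c\<^sup>2 * prob A * h" .
  \<comment> \<open>Let \<open>k\<close> be the first exit index. The coefficients equal
    \<open>c\<close> exactly before \<open>k\<close>, so the stopped sum telescopes to the exit
    value, whose modulus is above \<open>x\<close>.\<close>
  have exceed: "x\<^sup>2 \<le> (norm (S \<omega>))\<^sup>2" if \<omega>: "\<omega> \<in> A \<inter> excursion c a h x m" for \<omega>
  proof -
    define P where "P k \<longleftrightarrow> \<bar>c * (W \<omega> (t k) - W \<omega> a)\<bar> > x" for k
    obtain k0 where k0: "k0 \<le> N" "P k0" using \<omega> by (auto simp: excursion_def N_def P_def t_def)
    define k where "k = (LEAST k. P k)"
    have k: "P k" "k \<le> N" using LeastI[of P, OF k0(2)] Least_le[of P, OF k0(2)] k0(1) by (auto simp: k_def)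
    have k_less: "\<not> P i" if "i < k" for i using not_less_Least[of i P] that by (auto simp: k_def)
    have z1: "z i \<omega> = (if i < k then of_real c else 0)" for i
    proof (cases "i < k")
      case True
      then have "\<forall>k\<in>{..i}. \<not> P k" using k_less by auto
      then show ?thesis using True \<omega> by (auto simp: z_def P_def not_less)
    next
      case False
      then have "\<exists>k\<in>{..i}. P k" using k(1) by (intro bexI[of _ k]) auto
      then show ?thesis using False by (auto simp: z_def P_def not_le[symmetric])
    qed
    have "S \<omega> = (\<Sum>i<k. of_real (c * (W \<omega> (t (Suc i)) - W \<omega> (t i))))"
      unfolding S_def using k(2) by (intro sum.mono_neutral_cong_right) (auto simp: z1 D_def)
    also have "\<dots> = of_real (c * (\<Sum>i<k. W \<omega> (t (Suc i)) - W \<omega> (t i)))"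
      by (simp only: sum_distrib_left of_real_sum)
    also have "\<dots> = of_real (c * (W \<omega> (t k) - W \<omega> a))"
      using sum_lessThan_telescope[of "\<lambda>i. W \<omega> (t i)" k] t0 by simp
    finally have "norm (S \<omega>) > x" using k(1) by (simp only: norm_of_real P_def)
    then show ?thesis using x by (intro power_mono) auto
  qed
  have Sm: "S \<in> borel_measurable M"
    unfolding S_def using z_meas by (intro measurable_F_imp[OF transform_measurable]) auto
  have "prob (A \<inter> excursion c a h x m) \<le> prob {\<omega>\<in>space M. (norm (S \<omega>))\<^sup>2 \<ge> x\<^sup>2}"
    using exceed Sm sets.sets_into_space[OF A'] by (intro finite_measure_mono) auto
  also have "\<dots> \<le> expectation (\<lambda>\<omega>. (norm (S \<omega>))\<^sup>2) / x\<^sup>2"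
    using x by (intro integral_Markov_inequality_measure[OF iso(1), where A = "{}"]) auto
  also have "\<dots> \<le> c\<^sup>2 * prob A * h / x\<^sup>2" using ES by (intro divide_right_mono) auto
  finally show ?thesis by (simp add: mult_ac)
qed

definition climb :: "real \<Rightarrow> real \<Rightarrow> real \<Rightarrow> real \<Rightarrow> real \<Rightarrow> 'a set" where
  "climb c a h x g = {\<omega>\<in>space M. c * (W \<omega> (a + h) - W \<omega> a) \<ge> g} - (\<Union>m. excursion c a h x m)"

lemma climb_measurable:
  assumes "0 \<le> a" "0 < h"
  shows "climb c a h x g \<in> sets (F (a + h))"
proof -
  have [measurable]: "(\<lambda>\<omega>. W \<omega> (a + h)) \<in> borel_measurable (F (a + h))"
     "(\<lambda>\<omega>. W \<omega> a) \<in> borel_measurable (F (a + h))"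
    using assms by (auto intro!: W_measurable_F)
  have "{\<omega>\<in>space (F (a + h)). c * (W \<omega> (a + h) - W \<omega> a) \<ge> g} \<in> sets (F (a + h))"
    by measurable
  then show ?thesis
    using excursion_measurable[OF assms] unfolding climb_def by auto
qed

definition gauss_tail :: real where "gauss_tail = measure (density lborel std_normal_density) {1..}"

lemma gauss_tail_pos: "gauss_tail > 0"
proof -
  have "gauss_tail \<noteq> 0"
  proof
    assume "gauss_tail = 0"
    interpret N: prob_space "density lborel (std_normal_density)"
      by (rule prob_space_normal_density) simp
    have "emeasure (density lborel std_normal_density) {1..} = 0"
      using \<open>gauss_tail = 0\<close> by (simp add: gauss_tail_def N.emeasure_eq_measure)
    then have "(\<integral>\<^sup>+x. ennreal (std_normal_density x) * indicator {1..} x \<partial>lborel) = 0"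
      by (simp add: emeasure_density)
    then have "AE x in lborel. ennreal (std_normal_density x) * indicator {1..} x = 0"
      by (subst (asm) nn_integral_0_iff_AE) auto
    then have "AE x in lborel. x \<notin> {1..2::real}"
      by (auto elim!: eventually_mono simp: indicator_def normal_density_def split: if_splits)
    moreover have "{x \<in> space lborel. \<not> x \<notin> {1..2::real}} = {1..2}" by auto
    ultimately have "emeasure lborel {1..2::real} = 0"
      using AE_iff_measurable[of "{1..2::real}" lborel "\<lambda>x. x \<notin> {1..2}"] by simp
    then show False by (simp add: emeasure_lborel_Icc)
  qed
  then show ?thesis unfolding gauss_tail_def using measure_nonneg less_eq_real_def by metis
qed

lemma prob_increment_ge:
  assumes a: "0 \<le> a" "0 < h" and c: "c \<noteq> 0" and g: "g \<le> \<bar>c\<bar> * sqrt h"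
  shows "prob {\<omega>\<in>space M. c * (W \<omega> (a + h) - W \<omega> a) \<ge> g} \<ge> gauss_tail"
proof -
  define \<alpha> where "\<alpha> = c / (\<bar>c\<bar> * sqrt h)"
  have \<alpha>: "\<alpha> \<noteq> 0" "\<bar>\<alpha>\<bar> * sqrt h = 1" using a c by (auto simp: \<alpha>_def abs_mult)
  have "distributed M lborel (\<lambda>\<omega>. 0 + \<alpha> * (W \<omega> (a + h) - W \<omega> a)) (normal_density (0 + \<alpha> * 0) (\<bar>\<alpha>\<bar> * sqrt h))"
    using W_increment_distributed[of a "a + h"] a \<alpha> by (intro normal_density_affine) auto
  then have "distributed M lborel (\<lambda>\<omega>. \<alpha> * (W \<omega> (a + h) - W \<omega> a)) std_normal_density"
    using \<alpha> by simp
  then have d: "distr M borel (\<lambda>\<omega>. \<alpha> * (W \<omega> (a + h) - W \<omega> a)) = density lborel std_normal_density"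
    using distributed_distr_eq_density by (fastforce simp: distr_cong[of M M lborel borel])
  have [measurable]: "(\<lambda>\<omega>. W \<omega> (a + h) - W \<omega> a) \<in> borel_measurable M"
    using a by (intro increment_measurable) auto
  have "gauss_tail = prob {\<omega>\<in>space M. \<alpha> * (W \<omega> (a + h) - W \<omega> a) \<ge> 1}"
    unfolding gauss_tail_def d[symmetric] by (subst measure_distr) (auto intro!: arg_cong[where f = prob])
  also have "\<dots> \<le> prob {\<omega>\<in>space M. c * (W \<omega> (a + h) - W \<omega> a) \<ge> g}"
  proof (rule finite_measure_mono, safe)
    fix \<omega> assume "1 \<le> \<alpha> * (W \<omega> (a + h) - W \<omega> a)"
    then have "\<bar>c\<bar> * sqrt h \<le> c * (W \<omega> (a + h) - W \<omega> a)"
      using a c by (simp add: \<alpha>_def field_simps)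
    then show "g \<le> c * (W \<omega> (a + h) - W \<omega> a)" using g by simp
  qed measurable
  finally show ?thesis .
qed

text \<open>Whatever the past, a rise by \<open>g\<close> has probability at least
  \<open>gauss_tail\<close>, since \<open>g\<close> is at most one standard deviation of
  \<open>c\<close> times the increment. The maximal inequality \<open>prob_excursion_le\<close>
  bounds the part of that event lost to excursions.\<close>

lemma prob_climb_ge:
  assumes a: "0 \<le> a" "0 < h" and c: "c \<noteq> 0" and g: "g \<le> \<bar>c\<bar> * sqrt h" and x: "x > 0"
    and A: "A \<in> sets (F a)"
  shows "prob (A \<inter> climb c a h x g) \<ge> prob A * (gauss_tail - c\<^sup>2 * h / x\<^sup>2)"
proof -
  have A': "A \<in> events" using A F_subset_M by blast
  have exM: "excursion c a h x m \<in> events" for m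
    using excursion_measurable[OF a] F_subset_M by blast
  define U where "U = {\<omega>\<in>space M. c * (W \<omega> (a + h) - W \<omega> a) \<ge> g}"
  have [measurable]: "(\<lambda>\<omega>. W \<omega> (a + h) - W \<omega> a) \<in> borel_measurable M"
    using a by (intro increment_measurable) auto
  have U: "U \<in> events" unfolding U_def by measurable
  have "indep_var borel (indicator A :: 'a \<Rightarrow> real) borel (\<lambda>\<omega>. indicator {w. c * w \<ge> g} (W \<omega> (a + h) - W \<omega> a))"
    using a A by (intro indep_var_F_increment[where t = a]) auto
  from indep_varD[OF this, of "{1}" "{1}"]
  have "prob ({\<omega>\<in>space M. indicator A \<omega> = (1::real)} \<inter>
        {\<omega>\<in>space M. indicator {w. c * w \<ge> g} (W \<omega> (a + h) - W \<omega> a) = (1::real)}) =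
      prob {\<omega>\<in>space M. indicator A \<omega> = (1::real)} *
      prob {\<omega>\<in>space M. indicator {w. c * w \<ge> g} (W \<omega> (a + h) - W \<omega> a) = (1::real)}"
    by (simp add: vimage_def Int_def conj_ac)
  moreover have "{\<omega>\<in>space M. indicator A \<omega> = (1::real)} = A"
    using sets.sets_into_space[OF A'] by (auto simp: indicator_def)
  moreover have "{\<omega>\<in>space M. indicator {w. c * w \<ge> g} (W \<omega> (a + h) - W \<omega> a) = (1::real)} = U"
    by (auto simp: indicator_def U_def)
  ultimately have "prob (A \<inter> U) = prob A * prob U" by simp
  also have "\<dots> \<ge> prob A * gauss_tail"
    unfolding U_def using prob_increment_ge[OF a c g] by (intro mult_left_mono) auto
  finally have 1: "prob A * gauss_tail \<le> prob (A \<inter> U)" .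
  have "(\<lambda>m. prob (A \<inter> excursion c a h x m)) \<longlonglongrightarrow> prob (\<Union>m. A \<inter> excursion c a h x m)"
    using A' exM by (intro finite_Lim_measure_incseq) (auto simp: incseq_def dest: subsetD[OF excursion_mono])
  then have 2: "prob (\<Union>m. A \<inter> excursion c a h x m) \<le> prob A * (c\<^sup>2 * h / x\<^sup>2)"
    using prob_excursion_le[OF a x A] by (intro LIMSEQ_le_const2) auto
  have "A \<inter> U \<subseteq> (A \<inter> climb c a h x g) \<union> (\<Union>m. A \<inter> excursion c a h x m)"
    by (auto simp: U_def climb_def)
  then have "prob (A \<inter> U) \<le> prob ((A \<inter> climb c a h x g) \<union> (\<Union>m. A \<inter> excursion c a h x m))"
    using A' exM U by (intro finite_measure_mono) (auto simp: climb_def U_def[symmetric])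
  also have "\<dots> \<le> prob (A \<inter> climb c a h x g) + prob (\<Union>m. A \<inter> excursion c a h x m)"
    using A' exM U by (intro measure_Un_le) (auto simp: climb_def U_def[symmetric])
  finally show ?thesis using 1 2 unfolding right_diff_distrib by linarith
qed

text \<open>The dyadic points just below \<open>t\<close> converge to \<open>t\<close>, so
  continuity of the path carries the bound over.\<close>

lemma climb_bound:
  assumes cont: "continuous_on {0..} (W \<omega>)" and a: "0 \<le> a" "0 < h" and \<omega>: "\<omega> \<in> climb c a h x g"
    and t: "a \<le> t" "t \<le> a + h"
  shows "\<bar>c * (W \<omega> t - W \<omega> a)\<bar> \<le> x"
proof -
  define k where "k m = nat \<lfloor>(t - a) / h * 2 ^ m\<rfloor>" for m
  define p where "p m = a + real (k m) * h / 2 ^ m" for m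
  have k: "real (k m) \<le> (t - a) / h * 2 ^ m" "(t - a) / h * 2 ^ m < real (k m) + 1" for m
  proof -
    have "0 \<le> (t - a) / h * 2 ^ m" using t a by simp
    then show "real (k m) \<le> (t - a) / h * 2 ^ m" "(t - a) / h * 2 ^ m < real (k m) + 1"
      unfolding k_def by linarith+
  qed
  have kN: "k m \<le> 2 ^ m" for m
  proof -
    have "(t - a) / h \<le> 1" using t a by (simp add: field_simps)
    then have "(t - a) / h * 2 ^ m \<le> 1 * 2 ^ m" by (intro mult_right_mono) auto
    with k(1)[of m] have "real (k m) \<le> 2 ^ m" by linarith
    then have "real (k m) \<le> real (2 ^ m)" by simp
    then show ?thesis by (simp only: of_nat_le_iff)
  qed
  have "p \<longlonglongrightarrow> t"
  proof (rule Lim_null_comparison[where g = "\<lambda>m. h / 2 ^ m", THEN LIM_zero_cancel], intro always_eventually allI)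
    fix m
    have "p m \<le> t" "t \<le> p m + h / 2 ^ m"
      using k[of m] a by (simp_all add: p_def field_simps)
    then show "norm (p m - t) \<le> h / 2 ^ m" by simp
  qed real_asymp
  moreover have "p m \<ge> 0" for m using a by (simp add: p_def)
  ultimately have "(\<lambda>m. W \<omega> (p m)) \<longlonglongrightarrow> W \<omega> t"
    using a t by (intro continuous_on_tendsto_compose[OF cont]) auto
  then have "(\<lambda>m. \<bar>c * (W \<omega> (p m) - W \<omega> a)\<bar>) \<longlonglongrightarrow> \<bar>c * (W \<omega> t - W \<omega> a)\<bar>"
    by (intro tendsto_intros)
  moreover have "\<bar>c * (W \<omega> (p m) - W \<omega> a)\<bar> \<le> x" for m
    using \<omega> kN[of m] by (fastforce simp: climb_def excursion_def p_def not_less)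
  ultimately show ?thesis by (intro LIMSEQ_le_const2) auto
qed

text \<open>Many short climbs are chained; each of them succeeds with conditional probability bounded
  below, whatever happened before.\<close>

lemma brownian_climb:
  assumes c: "c \<noteq> 0" and \<epsilon>: "\<epsilon> > 0" and x: "x > 0"
  shows "\<exists>G\<in>events. prob G > 0 \<and> (AE \<omega> in M. \<omega> \<in> G \<longrightarrow>
    c * W \<omega> \<epsilon> \<ge> L \<and> (\<forall>r t. 0 \<le> r \<and> r \<le> t \<and> t \<le> \<epsilon> \<longrightarrow> c * W \<omega> t - c * W \<omega> r \<ge> - 2 * x))"
proof -
  \<comment> \<open>With \<open>N\<close> blocks of length \<open>\<epsilon> / N\<close>, a rise of
    one standard deviation per block adds up to
    \<open>\<bar>c\<bar> * sqrt (\<epsilon> * N)\<close>, which is unbounded in \<open>N\<close>,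
    while the bound on the probability lost to excursions in each block tends to 0. Hence any target
    \<open>L\<close> and any tolerance \<open>x\<close> are met for large \<open>N\<close>.\<close>
  have eq: "\<bar>c\<bar> * sqrt (\<epsilon> / real (Suc N)) * real (Suc N) = \<bar>c\<bar> * sqrt \<epsilon> * sqrt (real (Suc N))" for N
    using real_sqrt_mult_self[of "real (Suc N)"] by (simp add: real_sqrt_divide field_simps del: real_sqrt_mult_self)
  have "filterlim (\<lambda>N. \<bar>c\<bar> * sqrt \<epsilon> * sqrt (real (Suc N))) at_top sequentially"
    using c \<epsilon> by (intro filterlim_tendsto_pos_mult_at_top[OF tendsto_const] 
      filterlim_compose[OF sqrt_at_top] filterlim_compose[OF filterlim_real_sequentially] filterlim_Suc) auto
  then have "\<forall>\<^sub>F N in sequentially. L \<le> \<bar>c\<bar> * sqrt (\<epsilon> / real (Suc N)) * real (Suc N)"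
    unfolding eq filterlim_at_top by blast
  moreover have "(\<lambda>N. c\<^sup>2 * (\<epsilon> / real (Suc N)) / x\<^sup>2) \<longlonglongrightarrow> 0"
    using LIMSEQ_Suc[OF lim_const_over_n[of "c\<^sup>2 * \<epsilon> / x\<^sup>2"]] by (simp add: field_simps)
  then have "\<forall>\<^sub>F N in sequentially. c\<^sup>2 * (\<epsilon> / real (Suc N)) / x\<^sup>2 < gauss_tail / 2"
    using gauss_tail_pos by (intro order_tendstoD(2)) auto
  ultimately have "\<forall>\<^sub>F N in sequentially. L \<le> \<bar>c\<bar> * sqrt (\<epsilon> / real (Suc N)) * real (Suc N) \<and> c\<^sup>2 * (\<epsilon> / real (Suc N)) / x\<^sup>2 < gauss_tail / 2"
    by eventually_elim auto
  then obtain N' where N': "L \<le> \<bar>c\<bar> * sqrt (\<epsilon> / real (Suc N')) * real (Suc N')" "c\<^sup>2 * (\<epsilon> / real (Suc N')) / x\<^sup>2 < gauss_tail / 2"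
    by (auto simp: eventually_sequentially)
  define N where "N = Suc N'"
  define h where "h = \<epsilon> / N"
  define g where "g = \<bar>c\<bar> * sqrt h"
  have h: "h > 0" using \<epsilon> by (simp add: h_def N_def)
  have N: "L \<le> g * N" "c\<^sup>2 * h / x\<^sup>2 < gauss_tail / 2" "N > 0" "N * h = \<epsilon>"
    using N' by (simp_all add: h_def g_def N_def)
  have g: "g \<ge> 0" using h by (simp add: g_def)
  define C where "C j = climb c (real j * h) h x g" for j
  define G where "G j = space M \<inter> (\<Inter>i\<in>{..<j}. C i)" for j
  have C_meas: "C j \<in> sets (F (real (Suc j) * h))" for j
    using climb_measurable[of "real j * h" h c x g] h by (simp add: C_def algebra_simps)
  have G_Suc: "G (Suc j) = G j \<inter> C j" for j
    by (auto simp: G_def lessThan_Suc)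
  have G_meas: "G j \<in> sets (F (real j * h))" for j
  proof (induction j)
    case 0
    then show ?case using sets.top[of "F 0"] by (simp add: G_def)
  next
    case (Suc j)
    then have "G j \<in> sets (F (real (Suc j) * h))"
      using F_mono[of "real j * h" "real (Suc j) * h"] h by auto
    then show ?case using C_meas[of j] unfolding G_Suc by (rule sets.Int)
  qed
  have "prob (G j) \<ge> (gauss_tail / 2) ^ j" for j
  proof (induction j)
    case (Suc j)
    have "prob (G j) * (gauss_tail - c\<^sup>2 * h / x\<^sup>2) \<le> prob (G (Suc j))"
      unfolding G_Suc C_def using h c x G_meas by (intro prob_climb_ge) (auto simp: g_def)
    moreover have "prob (G j) * (gauss_tail / 2) \<le> prob (G j) * (gauss_tail - c\<^sup>2 * h / x\<^sup>2)"
      using N(2) by (intro mult_left_mono) auto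
    moreover have "(gauss_tail / 2) ^ j * (gauss_tail / 2) \<le> prob (G j) * (gauss_tail / 2)"
      using Suc gauss_tail_pos by (intro mult_right_mono) auto
    ultimately have "(gauss_tail / 2) ^ j * (gauss_tail / 2) \<le> prob (G (Suc j))" by linarith
    then show ?case by (simp add: mult.commute)
  qed (simp add: G_def prob_space)
  then have pos: "prob (G N) > 0"
    using gauss_tail_pos by (smt (verit) zero_less_power half_gt_zero)
  have climbs: "c * W \<omega> \<epsilon> \<ge> L \<and> (\<forall>r t. 0 \<le> r \<and> r \<le> t \<and> t \<le> \<epsilon> \<longrightarrow> c * W \<omega> t - c * W \<omega> r \<ge> - 2 * x)"
    if \<omega>: "\<omega> \<in> G N" and W0: "W \<omega> 0 = 0" and cont: "continuous_on {0..} (W \<omega>)" for \<omega>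
  proof -
    define B where "B t = c * W \<omega> t" for t
    have CN: "\<omega> \<in> C j" if "j < N" for j using \<omega> that by (auto simp: G_def)
    have step: "B (real (Suc j) * h) - B (real j * h) \<ge> g" if "j < N" for j
      using CN[OF that] by (simp add: C_def climb_def B_def algebra_simps)
    have osc: "\<bar>B t - B (real j * h)\<bar> \<le> x" if "j < N" "real j * h \<le> t" "t \<le> real (Suc j) * h" for j t
      using climb_bound[OF cont _ h CN[OF that(1), unfolded C_def], of t] that h
      by (simp add: B_def algebra_simps)
    have mono: "B (real i * h) + real (j - i) * g \<le> B (real j * h)" if "i \<le> j" "j \<le> N" for i j
      using that
    proof (induction j rule: dec_induct)
      case (step j)
      then show ?case using \<open>\<And>j. j < N \<Longrightarrow> g \<le> B (real (Suc j) * h) - B (real j * h)\<close>[of j]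
        by (simp add: Suc_diff_le algebra_simps)
    qed simp
    have "B \<epsilon> \<ge> L"
      using mono[of 0 N] N W0 by (simp add: B_def mult.commute)
    \<comment> \<open>From block start to block start the path never falls. Within the first and the
      last block it deviates by at most \<open>x\<close> from the value at the block start, which
      accounts for \<open>2 * x\<close>.\<close>
    moreover have "B t - B r \<ge> - 2 * x" if "0 \<le> r" "r \<le> t" "t \<le> \<epsilon>" for r t
    proof -
      have block: "\<exists>j<N. real j * h \<le> t \<and> t \<le> real (Suc j) * h" if "0 \<le> t" "t \<le> \<epsilon>" for t
      proof (cases "t = \<epsilon>")
        case True
        then show ?thesis using N h by (intro exI[of _ N']) (auto simp: N_def algebra_simps)
      next
        case False
        define j where "j = nat \<lfloor>t / h\<rfloor>"
        have "0 \<le> t / h" using that h by simp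
        then have j: "real j \<le> t / h" "t / h < real j + 1" unfolding j_def by linarith+
        have "t / h < N" using False that N(4) h by (simp add: field_simps)
        then have "j < N" using j(1) by linarith
        then show ?thesis using j h by (intro exI[of _ j]) (auto simp: field_simps)
      qed
      obtain i where i: "i < N" "real i * h \<le> r" "r \<le> real (Suc i) * h" using block[of r] \<open>0 \<le> r\<close> \<open>r \<le> t\<close> \<open>t \<le> \<epsilon>\<close> by auto
      obtain j where j: "j < N" "real j * h \<le> t" "t \<le> real (Suc j) * h" using block[of t] \<open>0 \<le> r\<close> \<open>r \<le> t\<close> \<open>t \<le> \<epsilon>\<close> by auto
      show ?thesis
      proof (cases "i < j")
        case True
        have "B (real (Suc i) * h) \<le> B (real j * h)"
          using mono[of "Suc i" j] True j g by (smt (verit) Suc_leI less_imp_le mult_nonneg_nonneg of_nat_0_le_iff)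
        then show ?thesis using osc[OF i] osc[OF j] step[OF i(1)] g x by (auto simp: abs_le_iff)
      next
        case False
        show ?thesis
        proof (cases "i = j")
          case True
          then show ?thesis using osc[OF i] osc[OF j] by (auto simp: abs_le_iff)
        next
          case neq: False
          then have "real (Suc j) * h \<le> real i * h" using False h by (intro mult_right_mono) auto
          then have "t = r" using i j \<open>r \<le> t\<close> by linarith
          then show ?thesis using x by simp
        qed
      qed
    qed
    ultimately show ?thesis by (auto simp: B_def)
  qed
  have "AE \<omega> in M. \<omega> \<in> G N \<longrightarrow>
    c * W \<omega> \<epsilon> \<ge> L \<and> (\<forall>r t. 0 \<le> r \<and> r \<le> t \<and> t \<le> \<epsilon> \<longrightarrow> c * W \<omega> t - c * W \<omega> r \<ge> - 2 * x)"
    using W_0 W_continuous by eventually_elim (use climbs in blast)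
  moreover have "G N \<in> events" using G_meas F_subset_M by blast
  ultimately show ?thesis using pos by blast
qed

end

section \<open>Cadlag paths and subdivisions\<close>

lemma cadlag_right:
  assumes "cadlag f" "0 \<le> r" "x \<longlonglongrightarrow> r" "\<And>n. r \<le> x n"
  shows "(\<lambda>n::nat. f (x n)) \<longlonglongrightarrow> f r"
proof (rule tendstoI)
  fix e :: real assume e: "e > 0"
  have "(f \<longlongrightarrow> f r) (at_right r)" using assms by (auto simp: cadlag_def continuous_within)
  then have "\<forall>\<^sub>F y in at_right r. dist (f y) (f r) < e" using e by (rule tendstoD)
  then obtain b where b: "b > r" "\<And>y. r < y \<Longrightarrow> y < b \<Longrightarrow> dist (f y) (f r) < e"
    by (auto simp: eventually_at_right_field)
  have "\<forall>\<^sub>F n in sequentially. x n < b" using assms(3) b(1) by (simp add: order_tendstoD)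
  then show "\<forall>\<^sub>F n in sequentially. dist (f (x n)) (f r) < e"
  proof eventually_elim
    case (elim n)
    then show ?case using b(2)[of "x n"] assms(4)[of n] e by (cases "x n = r") auto
  qed
qed

lemma tendsto_at_left_sequence:
  fixes f :: "real \<Rightarrow> 'b::metric_space"
  assumes "(f \<longlongrightarrow> L) (at_left r)" "x \<longlonglongrightarrow> r" "\<And>n. x n < r"
  shows "(\<lambda>n::nat. f (x n)) \<longlonglongrightarrow> L"
  using assms by (intro filterlim_compose[OF assms(1)] tendsto_imp_filterlim_at_left) auto

text \<open>The gaps to the right of distinct points are disjoint, and a rational chosen from each
  gives an injection into a countable set.\<close>

lemma countable_right_isolated:
  fixes S :: "real set"
  assumes "\<And>t. t \<in> S \<Longrightarrow> \<exists>u>t. {t<..<u} \<inter> S = {}"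
  shows "countable S"
proof -
  obtain u where u: "\<And>t. t \<in> S \<Longrightarrow> u t > t" "\<And>t. t \<in> S \<Longrightarrow> {t<..<u t} \<inter> S = {}"
    using assms by metis
  have "\<exists>q\<in>\<rat>. t < q \<and> q < u t" if "t \<in> S" for t
    using Rats_dense_in_real[OF u(1)[OF that]] by auto
  then obtain q where q: "\<And>t. t \<in> S \<Longrightarrow> q t \<in> \<rat>" "\<And>t. t \<in> S \<Longrightarrow> t < q t" "\<And>t. t \<in> S \<Longrightarrow> q t < u t"
    by metis
  have "inj_on q S"
  proof (rule linorder_inj_onI)
    fix x y assume "x < y" "x \<in> S" "y \<in> S"
    then have "y \<ge> u x" using u(2)[of x] by force
    then show "q x \<noteq> q y" using q(3)[of x] q(2)[of y] \<open>x \<in> S\<close> \<open>y \<in> S\<close> by auto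
  qed auto
  then show ?thesis
    using q(1) countable_rat by (metis countable_subset image_subsetI countable_image_inj_on)
qed

text \<open>Jumps of size above \<open>1 / real (Suc n)\<close> are isolated from the right:
  right-continuity keeps \<open>f\<close> within half that size of \<open>f t\<close> on some
  interval after \<open>t\<close>, where no such jump fits.\<close>

lemma cadlag_countable_jumps:
  assumes f: "cadlag f"
  shows "countable {t. 0 < t \<and> \<not> (f \<longlongrightarrow> f t) (at_left t)}"
proof -
  define S where "S n = {t. 0 < t \<and> (\<exists>L. (f \<longlongrightarrow> L) (at_left t) \<and> \<bar>f t - L\<bar> > 1 / real (Suc n))}" for n
  have "countable (S n)" for n
  proof (rule countable_right_isolated)
    fix t assume t: "t \<in> S n"
    define e where "e = 1 / real (Suc n) / 2"
    have e: "e > 0" by (simp add: e_def)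
    have "(f \<longlongrightarrow> f t) (at_right t)" using f t by (auto simp: cadlag_def continuous_within S_def)
    then have "\<forall>\<^sub>F y in at_right t. dist (f y) (f t) < e" using e by (rule tendstoD)
    then obtain b where b: "b > t" "\<And>y. t < y \<Longrightarrow> y < b \<Longrightarrow> dist (f y) (f t) < e"
      by (auto simp: eventually_at_right_field)
    have "y \<notin> S n" if y: "t < y" "y < b" for y
    proof
      assume "y \<in> S n"
      then obtain L where L: "(f \<longlongrightarrow> L) (at_left y)" "\<bar>f y - L\<bar> > 1 / real (Suc n)"
        by (auto simp: S_def)
      have "\<forall>\<^sub>F z in at_left y. \<bar>f z - f t\<bar> \<le> e"
        using eventually_at_left_real[OF y(1)]
      proof eventually_elim
        case (elim z)
        then show ?case using b(2)[of z] y by (auto simp: dist_real_def)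
      qed
      then have "\<bar>L - f t\<bar> \<le> e"
        using L(1) by (intro tendsto_upperbound[where f = "\<lambda>z. \<bar>f z - f t\<bar>"] tendsto_intros) auto
      moreover have "\<bar>f y - f t\<bar> < e" using b(2)[OF y] by (simp add: dist_real_def)
      moreover have "e + e = 1 / real (Suc n)" unfolding e_def by (rule field_sum_of_halves)
      ultimately show False using L(2) by linarith
    qed
    then show "\<exists>u>t. {t<..<u} \<inter> S n = {}" using b(1) by auto
  qed
  then have "countable (\<Union>n. S n)" by auto
  moreover have "{t. 0 < t \<and> \<not> (f \<longlongrightarrow> f t) (at_left t)} \<subseteq> (\<Union>n. S n)"
  proof safe
    fix t assume t: "0 < t" "\<not> (f \<longlongrightarrow> f t) (at_left t)"
    then obtain L where L: "(f \<longlongrightarrow> L) (at_left t)" using f by (auto simp: cadlag_def)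
    then have "L \<noteq> f t" using t by auto
    then obtain n where "1 / real (Suc n) < \<bar>f t - L\<bar>"
      using reals_Archimedean[of "\<bar>f t - L\<bar>"] by (auto simp: inverse_eq_divide)
    then show "t \<in> (\<Union>n. S n)" using t L by (auto simp: S_def)
  qed
  ultimately show ?thesis by (rule countable_subset[rotated])
qed

lemma cadlag_AE_left_continuous:
  assumes "cadlag f"
  shows "AE r in lborel. 0 < r \<longrightarrow> (f \<longlongrightarrow> f r) (at_left r)"
proof (rule AE_I')
  show "{t. 0 < t \<and> \<not> (f \<longlongrightarrow> f t) (at_left t)} \<in> null_sets lborel"
    using cadlag_countable_jumps[OF assms] by (rule countable_imp_null_set_lborel)
qed auto

text \<open>Times of unboundedly large values would accumulate at some \<open>l\<close>. A
  subsequence approaches \<open>l\<close> from the right, where \<open>f\<close> converges to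
  \<open>f l\<close>, or strictly from the left, where the left limit exists; either way the values
  stay bounded along it.\<close>

lemma cadlag_bounded:
  assumes f: "cadlag f"
  shows "\<exists>B. \<forall>t\<in>{0..T}. \<bar>f t\<bar> \<le> B"
proof (rule ccontr)
  assume "\<not> ?thesis"
  then have "\<forall>n::nat. \<exists>t\<in>{0..T}. \<bar>f t\<bar> > real n" by (auto simp: not_le)
  then obtain t where t: "\<And>n. t n \<in> {0..T}" "\<And>n. \<bar>f (t n)\<bar> > real n" by metis
  obtain l r where l: "l \<in> {0..T}" "strict_mono r" "(t \<circ> r) \<longlonglongrightarrow> l"
    using compact_Icc[of 0 T] t(1) unfolding compact_def by metis
  have unb: "\<not> Bseq (\<lambda>n. f (t (r (\<rho> n))))" if "strict_mono \<rho>" for \<rho> :: "nat \<Rightarrow> nat"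
  proof
    assume "Bseq (\<lambda>n. f (t (r (\<rho> n))))"
    then obtain K where K: "\<And>n. \<bar>f (t (r (\<rho> n)))\<bar> \<le> K" by (auto simp: Bseq_def)
    obtain n where "real n > K" using reals_Archimedean2 by blast
    moreover have "n \<le> r (\<rho> n)" using l(2) that by (meson order_trans seq_suble strict_mono_def strict_mono_o)
    ultimately show False using K[of n] t(2)[of "r (\<rho> n)"] by linarith
  qed
  define s where "s = t \<circ> r"
  have sl: "s \<longlonglongrightarrow> l" using l by (simp add: s_def)
  show False
  proof (cases "infinite {n. s n \<ge> l}")
    case True
    then obtain \<rho> :: "nat \<Rightarrow> nat" where \<rho>: "strict_mono \<rho>" "\<And>n. s (\<rho> n) \<ge> l"
      using infinite_enumerate[OF True] by auto
    have "(\<lambda>n. f (s (\<rho> n))) \<longlonglongrightarrow> f l"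
      using cadlag_right[OF f, of l "s \<circ> \<rho>"] l(1) \<rho> LIMSEQ_subseq_LIMSEQ[OF sl \<rho>(1)] by (simp add: comp_def)
    then have "Bseq (\<lambda>n. f (s (\<rho> n)))" by (intro convergent_imp_Bseq convergentI)
    then show False using unb[OF \<rho>(1)] by (simp add: s_def)
  next
    case False
    moreover have "(UNIV :: nat set) = {n. s n \<ge> l} \<union> {n. s n < l}" by auto
    ultimately have inf: "infinite {n. s n < l}" by (metis finite_Un infinite_UNIV_nat)
    obtain \<rho> :: "nat \<Rightarrow> nat" where \<rho>: "strict_mono \<rho>" "\<And>n. s (\<rho> n) < l"
      using infinite_enumerate[OF inf] by auto
    have "l > 0" using \<rho>(2)[of 0] t(1)[of "r (\<rho> 0)"] by (simp add: s_def)
    then obtain L where L: "(f \<longlongrightarrow> L) (at_left l)" using f by (auto simp: cadlag_def)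
    then have "(\<lambda>n. f (s (\<rho> n))) \<longlonglongrightarrow> L"
      using tendsto_at_left_sequence[OF L, of "s \<circ> \<rho>"] \<rho> LIMSEQ_subseq_LIMSEQ[OF sl \<rho>(1)] by (simp add: comp_def)
    then have "Bseq (\<lambda>n. f (s (\<rho> n)))" by (intro convergent_imp_Bseq convergentI)
    then show False using unb[OF \<rho>(1)] by (simp add: s_def)
  qed
qed

lemma cadlag_borel:
  assumes f: "cadlag f"
  shows "(\<lambda>r. f (max 0 r)) \<in> borel_measurable borel"
proof (rule borel_measurable_LIMSEQ_real)
  \<comment> \<open>Grid points to the right of \<open>r\<close> are used, because right-continuity
    then gives convergence for every \<open>r\<close>.\<close>
  define a where "a n r = (of_int (\<lfloor>max 0 r * real (Suc n)\<rfloor> + 1)) / real (Suc n)" for n r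
  fix r :: real
  have bounds: "max 0 r \<le> a n r" "a n r \<le> max 0 r + 1 / real (Suc n)" for n
  proof -
    define z where "z = max 0 r"
    have "max 0 r * real (Suc n) \<le> of_int (\<lfloor>max 0 r * real (Suc n)\<rfloor> + 1)"
         "of_int (\<lfloor>max 0 r * real (Suc n)\<rfloor> + 1) \<le> max 0 r * real (Suc n) + 1"
      by linarith+
    then show "max 0 r \<le> a n r" "a n r \<le> max 0 r + 1 / real (Suc n)"
      unfolding a_def z_def[symmetric] by (simp_all add: field_simps del: of_nat_Suc of_int_add)
  qed
  have lim: "(\<lambda>n. max 0 r + 1 / real (Suc n)) \<longlonglongrightarrow> max 0 r + 0"
    by (intro tendsto_intros LIMSEQ_Suc[OF lim_1_over_n])
  have "(\<lambda>n. a n r) \<longlonglongrightarrow> max 0 r"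
  proof (rule tendsto_sandwich)
    show "\<forall>\<^sub>F n in sequentially. max 0 r \<le> a n r" using bounds(1) by (intro always_eventually allI)
    show "\<forall>\<^sub>F n in sequentially. a n r \<le> max 0 r + 1 / real (Suc n)" using bounds(2) by (intro always_eventually allI)
    show "(\<lambda>n. max 0 r + 1 / real (Suc n)) \<longlonglongrightarrow> max 0 r" using lim by simp
  qed simp
  then show "(\<lambda>n. f (a n r)) \<longlonglongrightarrow> f (max 0 r)"
    using cadlag_right[OF f, of "max 0 r" "\<lambda>n. a n r"] bounds(1) by simp
next
  fix n
  have "(\<lambda>r. f (of_int (k + 1) / real (Suc n))) \<in> borel_measurable borel" for k by simp
  have "(\<lambda>r. \<lfloor>max 0 r * real (Suc n)\<rfloor>) \<in> measurable borel (count_space UNIV)"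
    by measurable
  then have "(\<lambda>k. f (of_int (k + 1) / real (Suc n))) \<circ> (\<lambda>r. \<lfloor>max 0 r * real (Suc n)\<rfloor>) \<in> borel_measurable borel"
    by (rule measurable_comp) simp
  then show "(\<lambda>r. f (of_int (\<lfloor>max 0 r * real (Suc n)\<rfloor> + 1) / real (Suc n))) \<in> borel_measurable borel"
    by (simp add: comp_def)
qed

section \<open>Subdivisions of a time interval and step functions on them\<close>

definition subdivision :: "real \<Rightarrow> nat \<Rightarrow> (nat \<Rightarrow> real) \<Rightarrow> bool" where
  "subdivision T N t \<longleftrightarrow> t 0 = 0 \<and> t N = T \<and> (\<forall>i<N. t i < t (Suc i))"

lemma subdivision_mono:
  assumes p: "subdivision T N t" and "i \<le> j" "j \<le> N"
  shows "t i \<le> t j"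
  using assms(2,3)
proof (induction j rule: dec_induct)
  case (step j)
  then have "t j < t (Suc j)" using p by (auto simp: subdivision_def)
  then show ?case using step by auto
qed simp

lemma subdivision_range: "subdivision T N t \<Longrightarrow> i \<le> N \<Longrightarrow> t i \<in> {0..T}"
  using subdivision_mono[of T N t 0 i] subdivision_mono[of T N t i N] by (auto simp: subdivision_def)

text \<open>The inequality is strict to match cells that are open on the left, as for predictable
  step integrands; \<open>insert 0\<close> keeps the maximum defined when no point lies below
  \<open>r\<close>.\<close>

definition subdivision_floor :: "nat \<Rightarrow> (nat \<Rightarrow> real) \<Rightarrow> real \<Rightarrow> real" where
  "subdivision_floor N t r = Max (insert 0 {t i | i. i \<le> N \<and> t i < r})"

definition subdivision_ceil :: "nat \<Rightarrow> (nat \<Rightarrow> real) \<Rightarrow> real \<Rightarrow> real" where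
  "subdivision_ceil N t r = Min {t i | i. i \<le> N \<and> r \<le> t i}"

lemma subdivision_floor_eq:
  assumes "subdivision T N t" "i < N" "t i < r" "r \<le> t (Suc i)"
  shows "subdivision_floor N t r = t i"
  unfolding subdivision_floor_def
proof (rule Max_eqI)
  fix y assume "y \<in> insert 0 {t i | i. i \<le> N \<and> t i < r}"
  then consider "y = 0" | j where "y = t j" "j \<le> N" "t j < r" by auto
  then show "y \<le> t i"
  proof cases
    case 1
    then show ?thesis using subdivision_range[OF assms(1), of i] assms by auto
  next
    case 2
    then have "\<not> Suc i \<le> j" using subdivision_mono[OF assms(1), of "Suc i" j] assms by auto
    then show ?thesis using 2 subdivision_mono[OF assms(1), of j i] assms by auto
  qed
qed (use assms in auto)

lemma subdivision_ceil_eq: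
  assumes "subdivision T N t" "i < N" "t i < r" "r \<le> t (Suc i)"
  shows "subdivision_ceil N t r = t (Suc i)"
  unfolding subdivision_ceil_def
proof (rule Min_eqI)
  fix y assume "y \<in> {t i | i. i \<le> N \<and> r \<le> t i}"
  then obtain j where j: "y = t j" "j \<le> N" "r \<le> t j" by auto
  then have "\<not> j \<le> i" using subdivision_mono[OF assms(1), of j i] assms by auto
  then show "t (Suc i) \<le> y" using j subdivision_mono[OF assms(1), of "Suc i" j] assms by auto
qed (use assms in auto)

lemma subdivision_cases:
  assumes "subdivision T N t" "0 < r" "r \<le> T"
  obtains i where "i < N" "t i < r" "r \<le> t (Suc i)"
proof -
  define k where "k = (LEAST k. r \<le> t k)"
  have N: "r \<le> t N" using assms by (auto simp: subdivision_def)
  have k: "r \<le> t k" "k \<le> N" unfolding k_def using N by (auto intro: LeastI Least_le)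
  have "k \<noteq> 0" using k assms by (auto simp: subdivision_def intro: ccontr)
  then obtain i where i: "k = Suc i" by (cases k) auto
  have "\<not> r \<le> t i" using not_less_Least[of i "\<lambda>k. r \<le> t k"] i by (simp add: k_def)
  then show thesis using that[of i] k i by auto
qed

lemma subdivision_Ioc_Un: "subdivision T N t \<Longrightarrow> {0<..T} = (\<Union>i<N. {t i<..t (Suc i)})"
proof (intro equalityI subsetI)
  fix r assume p: "subdivision T N t" and "r \<in> {0<..T}"
  then show "r \<in> (\<Union>i<N. {t i<..t (Suc i)})" by (auto elim: subdivision_cases[OF p])
next
  fix r assume p: "subdivision T N t" and "r \<in> (\<Union>i<N. {t i<..t (Suc i)})"
  then obtain i where "i < N" "t i < r" "r \<le> t (Suc i)" by auto
  then show "r \<in> {0<..T}" using subdivision_range[OF p, of i] subdivision_range[OF p, of "Suc i"] by auto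
qed

lemma subdivision_disjoint: "subdivision T N t \<Longrightarrow> disjoint_family_on (\<lambda>i. {t i<..t (Suc i)}) {..<N}"
  unfolding disjoint_family_on_def
proof safe
  fix i j r assume p: "subdivision T N t" and ij: "i < N" "j < N" "i \<noteq> j"
    and r: "r \<in> {t i<..t (Suc i)}" "r \<in> {t j<..t (Suc j)}"
  have "\<not> Suc i \<le> j" using subdivision_mono[OF p, of "Suc i" j] ij r by auto
  moreover have "\<not> Suc j \<le> i" using subdivision_mono[OF p, of "Suc j" i] ij r by auto
  ultimately show "r \<in> {}" using ij by auto
qed

lemma exists_subdivision:
  assumes S: "finite S" and T: "T > 0" and d: "d > 0"
  shows "\<exists>N t. subdivision T N t \<and> S \<inter> {0..T} \<subseteq> t ` {..N} \<and> (\<forall>i<N. t (Suc i) - t i \<le> d)"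
proof -
  obtain m :: nat where m: "T / d < real m" using reals_Archimedean2 by blast
  then have m0: "m > 0" using T d by (metis divide_pos_pos less_trans of_nat_0_less_iff)
  define P where "P = (S \<inter> {0..T}) \<union> (\<lambda>k. real k * T / real m) ` {..m}"
  have P: "finite P" "0 \<in> P" "T \<in> P" "P \<subseteq> {0..T}"
    using S m0 T by (auto simp: P_def image_iff field_simps intro!: bexI[of _ m])
  define L where "L = sorted_list_of_set P"
  define N where "N = length L - 1"
  define t where "t i = L ! i" for i
  have setL: "set L = P" and sL: "sorted L" "distinct L" using P by (auto simp: L_def)
  have lenL: "length L = Suc N" using setL P by (cases L) (auto simp: N_def)
  have step: "t i < t j" if "i < j" "j \<le> N" for i j
  proof -
    have "L ! i \<le> L ! j" using sL(1) that lenL by (intro sorted_nth_mono) auto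
    moreover have "L ! i \<noteq> L ! j" using sL(2) that lenL by (simp add: nth_eq_iff_index_eq)
    ultimately show ?thesis by (simp add: t_def)
  qed
  have idx: "\<exists>i\<le>N. t i = x" if "x \<in> P" for x
    using that setL lenL by (metis in_set_conv_nth less_Suc_eq_le t_def)
  have tP: "t i \<in> P" if "i \<le> N" for i
    using that setL lenL unfolding t_def by (metis less_Suc_eq_le nth_mem)
  have t0: "t 0 = 0"
  proof -
    obtain i where i: "i \<le> N" "t i = 0" using idx P by blast
    then have "t 0 \<le> 0" using step[of 0 i] by (cases "i = 0") auto
    then show ?thesis using tP[of 0] P by auto
  qed
  have tN: "t N = T"
  proof -
    obtain i where i: "i \<le> N" "t i = T" using idx P by blast
    then have "t N \<ge> T" using step[of i N] by (cases "i = N") auto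
    then show ?thesis using tP[of N] P by auto
  qed
  have part: "subdivision T N t" using t0 tN step by (auto simp: subdivision_def)
  moreover have "S \<inter> {0..T} \<subseteq> t ` {..N}" using idx by (force simp: P_def)
  moreover have "t (Suc i) - t i \<le> d" if i: "i < N" for i
  proof -
    \<comment> \<open>The next uniform grid point after \<open>t i\<close> belongs to
      \<open>P\<close>, so \<open>t (Suc i)\<close> cannot lie beyond it; the extra points from
      \<open>S\<close> only shorten the steps.\<close>
    define k where "k = nat \<lfloor>t i * m / T\<rfloor>"
    have "t i \<ge> 0" "t i < T" using tP[of i] P step[of i N] tN i by auto
    then have k: "real k \<le> t i * m / T" "t i * m / T < real k + 1"
      using T unfolding k_def by (auto intro: of_nat_floor)
    have k1: "real k * T \<le> t i * m" using k(1) by (simp only: pos_le_divide_eq[OF T])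
    have k2: "t i * m < real (Suc k) * T" using k(2) by (simp only: pos_divide_less_eq[OF T] of_nat_Suc ac_simps)
    have m1: "real m > 0" using m0 by simp
    have "t i * m < m * T" using \<open>t i < T\<close> m0 by (simp add: mult.commute)
    then have "real k * T < m * T" using k1 by linarith
    then have "k < m" using T by simp
    then have "real (Suc k) * T / real m \<in> P" unfolding P_def by (intro UnI2 image_eqI[of _ _ "Suc k"]) auto
    then obtain j where j: "j \<le> N" "t j = real (Suc k) * T / real m" using idx by meson
    have "t i < t j" using k2 unfolding j(2) by (simp only: pos_less_divide_eq[OF m1])
    then have "\<not> j \<le> i" using subdivision_mono[OF part, of j i] i by auto
    then have "t (Suc i) \<le> t j" using subdivision_mono[OF part, of "Suc i" j] j by auto
    also have "\<dots> = real k * T / real m + T / real m"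
      unfolding j(2) by (simp add: add_divide_distrib distrib_right)
    also have "real k * T / real m \<le> t i" using k1 by (simp only: pos_divide_le_eq[OF m1])
    also have "T / real m \<le> d" using m d m1 by (simp add: pos_divide_le_eq pos_divide_less_eq mult.commute)
    finally show ?thesis by simp
  qed
  ultimately show ?thesis by blast
qed

lemma set_integral_step:
  fixes \<phi> :: "real \<Rightarrow> 'b::{banach, second_countable_topology}"
  assumes p: "subdivision T N t" and \<phi>: "\<And>i r. i < N \<Longrightarrow> t i < r \<Longrightarrow> r \<le> t (Suc i) \<Longrightarrow> \<phi> r = f i"
  shows "set_integrable lborel {0<..T} \<phi>"
    and "(LINT r:{0<..T}|lborel. \<phi> r) = (\<Sum>i<N. (t (Suc i) - t i) *\<^sub>R f i)"
proof -
  have i1: "set_integrable lborel {t i<..t (Suc i)} \<phi>" and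
    i2: "(LINT r:{t i<..t (Suc i)}|lborel. \<phi> r) = (t (Suc i) - t i) *\<^sub>R f i" if "i < N" for i
  proof -
    have less: "t i \<le> t (Suc i)" using p that by (auto simp: subdivision_def less_imp_le)
    have eq: "indicator {t i<..t (Suc i)} r *\<^sub>R \<phi> r = indicator {t i<..t (Suc i)} r *\<^sub>R f i" for r
      using \<phi>[OF that] by (auto simp: indicator_def)
    show "set_integrable lborel {t i<..t (Suc i)} \<phi>"
      unfolding set_integrable_def eq using less by (intro integrable_scaleR_left integrable_real_indicator) auto
    show "(LINT r:{t i<..t (Suc i)}|lborel. \<phi> r) = (t (Suc i) - t i) *\<^sub>R f i"
      unfolding set_lebesgue_integral_def eq using less by simp
  qed
  show "set_integrable lborel {0<..T} \<phi>"
    unfolding subdivision_Ioc_Un[OF p] using i1 by (intro set_integrable_UN) auto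
  show "(LINT r:{0<..T}|lborel. \<phi> r) = (\<Sum>i<N. (t (Suc i) - t i) *\<^sub>R f i)"
    unfolding subdivision_Ioc_Un[OF p] using i1 i2 subdivision_disjoint[OF p]
    by (subst set_integral_finite_Union) auto
qed

context bm
begin

text \<open>Once the grid contains the breakpoints of the integrand, the integrand is constant on
  each cell with a value known at the left end point. Only a finite set \<open>S\<close> is
  prescribed and the subdivision is left free, so that one grid can serve two integrands in
  \<open>ito_approximation\<close>.\<close>

lemma elementary_integral_subdivision:
  assumes "elementary_integral M F W H J"
  shows "\<exists>S. finite S \<and> (\<forall>T N t. subdivision T N t \<longrightarrow> S \<inter> {0..T} \<subseteq> t ` {..N} \<longrightarrow>
     (\<forall>i<N. (\<lambda>\<omega>. H \<omega> (t (Suc i))) \<in> borel_measurable (F (t i)) \<and>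
        (\<forall>\<omega> r. t i < r \<and> r \<le> t (Suc i) \<longrightarrow> H \<omega> r = H \<omega> (t (Suc i)))) \<and>
     (\<forall>j\<le>N. \<forall>\<omega>. J \<omega> (t j) = (\<Sum>i<j. H \<omega> (t (Suc i)) * (W \<omega> (t (Suc i)) - W \<omega> (t i)))))"
proof -
  obtain n \<tau> \<xi> where \<tau>: "0 \<le> \<tau> 0" "mono \<tau>" and
     \<xi>: "\<And>i. i < n \<Longrightarrow> \<xi> i \<in> borel_measurable (F (\<tau> i))" and
     H: "H = (\<lambda>\<omega> r. \<Sum>i<n. \<xi> i \<omega> * indicator {\<tau> i<..\<tau> (Suc i)} r)" and
     J: "J = (\<lambda>\<omega> t. \<Sum>i<n. \<xi> i \<omega> * (W \<omega> (min t (\<tau> (Suc i))) - W \<omega> (min t (\<tau> i))))"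
    using assms by (auto simp: elementary_integral_def)
  have \<tau>0: "\<tau> l \<ge> 0" for l using \<tau> by (meson le0 monoD order_trans)
  have main: "(\<forall>i<N. (\<lambda>\<omega>. H \<omega> (t (Suc i))) \<in> borel_measurable (F (t i)) \<and>
        (\<forall>\<omega> r. t i < r \<and> r \<le> t (Suc i) \<longrightarrow> H \<omega> r = H \<omega> (t (Suc i)))) \<and>
     (\<forall>j\<le>N. \<forall>\<omega>. J \<omega> (t j) = (\<Sum>i<j. H \<omega> (t (Suc i)) * (W \<omega> (t (Suc i)) - W \<omega> (t i))))"
    if p: "subdivision T N t" and S: "\<tau> ` {..n} \<inter> {0..T} \<subseteq> t ` {..N}" for T N t
  proof -
    \<comment> \<open>Breakpoints up to \<open>T\<close> are grid points and later ones lie beyond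
      every cell, so no breakpoint is interior to a cell.\<close>
    have sep: "\<tau> l \<le> t i \<or> t (Suc i) \<le> \<tau> l" if "l \<le> n" "i < N" for l i
    proof (cases "\<tau> l \<le> T")
      case True
      then have "\<tau> l \<in> t ` {..N}" using S that \<tau>0[of l] by auto
      then obtain j where j: "j \<le> N" "\<tau> l = t j" by auto
      then show ?thesis using subdivision_mono[OF p, of j i] subdivision_mono[OF p, of "Suc i" j] that
        by (cases "j \<le> i") auto
    next
      case False
      then show ?thesis using subdivision_range[OF p, of "Suc i"] that by auto
    qed
    have ind: "indicator {\<tau> l<..\<tau> (Suc l)} r = (indicator {\<tau> l<..\<tau> (Suc l)} (t (Suc i)) :: real)"
      if "l < n" "i < N" "t i < r" "r \<le> t (Suc i)" for l i r
    proof -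
      have "\<tau> l \<le> t i \<or> t (Suc i) \<le> \<tau> l" by (rule sep) (use that in auto)
      moreover have "\<tau> (Suc l) \<le> t i \<or> t (Suc i) \<le> \<tau> (Suc l)" by (rule sep) (use that in auto)
      ultimately have "\<tau> l < r \<longleftrightarrow> \<tau> l < t (Suc i)" "r \<le> \<tau> (Suc l) \<longleftrightarrow> t (Suc i) \<le> \<tau> (Suc l)"
        using that(3,4) by linarith+
      then show ?thesis by (simp add: indicator_def)
    qed
    have const: "H \<omega> r = H \<omega> (t (Suc i))" if "i < N" "t i < r" "r \<le> t (Suc i)" for i \<omega> r
      unfolding H by (intro sum.cong refl arg_cong2[where f = "(*)"] ind) (use that in simp_all)
    have meas: "(\<lambda>\<omega>. H \<omega> (t (Suc i))) \<in> borel_measurable (F (t i))" if i: "i < N" for i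
      unfolding H
    proof (rule borel_measurable_sum)
      fix l assume l: "l \<in> {..<n}"
      show "(\<lambda>\<omega>. \<xi> l \<omega> * indicator {\<tau> l<..\<tau> (Suc l)} (t (Suc i))) \<in> borel_measurable (F (t i))"
      proof (cases "\<tau> l < t (Suc i)")
        case True
        then have "\<tau> l \<le> t i" using sep[of l i] l i by auto
        then have "\<xi> l \<in> borel_measurable (F (t i))" using \<xi>[of l] l by (auto intro: measurable_F_mono)
        then show ?thesis by measurable
      qed (auto simp: indicator_def)
    qed
    \<comment> \<open>The stopped path collects exactly the increments of the cells that end by
      \<open>\<tau> l\<close>. Differences of two such sums give the contribution of one step of the
      integrand.\<close>
    have tel: "W \<omega> (min (t j) (\<tau> l)) = W \<omega> 0 + (\<Sum>i<j. indicator {..\<tau> l} (t (Suc i)) * (W \<omega> (t (Suc i)) - W \<omega> (t i)))"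
      if "j \<le> N" "l \<le> n" for j l \<omega>
      using that(1)
    proof (induction j)
      case 0
      then show ?case using p \<tau>0[of l] by (simp add: subdivision_def)
    next
      case (Suc j)
      have "t j < t (Suc j)" using p Suc.prems by (auto simp: subdivision_def)
      then have "W \<omega> (min (t (Suc j)) (\<tau> l)) = W \<omega> (min (t j) (\<tau> l)) + indicator {..\<tau> l} (t (Suc j)) * (W \<omega> (t (Suc j)) - W \<omega> (t j))"
        using sep[of l j] that(2) Suc.prems by (auto simp: indicator_def min_def)
      then show ?case using Suc by simp
    qed
    have "J \<omega> (t j) = (\<Sum>i<j. H \<omega> (t (Suc i)) * (W \<omega> (t (Suc i)) - W \<omega> (t i)))" if "j \<le> N" for j \<omega>
    proof -
      have "W \<omega> (min (t j) (\<tau> (Suc l))) - W \<omega> (min (t j) (\<tau> l)) =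
         (\<Sum>i<j. indicator {\<tau> l<..\<tau> (Suc l)} (t (Suc i)) * (W \<omega> (t (Suc i)) - W \<omega> (t i)))" if l: "l < n" for l
      proof -
        have "\<tau> l \<le> \<tau> (Suc l)" using \<tau>(2) by (simp add: monoD)
        then have split: "(indicator {\<tau> l<..\<tau> (Suc l)} r :: real) = indicator {..\<tau> (Suc l)} r - indicator {..\<tau> l} r" for r
          by (auto simp: indicator_def)
        have "l \<le> n" "Suc l \<le> n" using l by auto
        note tel[OF \<open>j \<le> N\<close> this(1), of \<omega>] tel[OF \<open>j \<le> N\<close> this(2), of \<omega>]
        then show ?thesis unfolding split left_diff_distrib sum_subtractf by linarith
      qed
      then have "J \<omega> (t j) = (\<Sum>l<n. \<xi> l \<omega> * (\<Sum>i<j. indicator {\<tau> l<..\<tau> (Suc l)} (t (Suc i)) * (W \<omega> (t (Suc i)) - W \<omega> (t i))))"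
        by (simp add: J)
      also have "\<dots> = (\<Sum>l<n. \<Sum>i<j. \<xi> l \<omega> * (indicator {\<tau> l<..\<tau> (Suc l)} (t (Suc i)) * (W \<omega> (t (Suc i)) - W \<omega> (t i))))"
        by (simp only: sum_distrib_left)
      also have "\<dots> = (\<Sum>i<j. \<Sum>l<n. \<xi> l \<omega> * (indicator {\<tau> l<..\<tau> (Suc l)} (t (Suc i)) * (W \<omega> (t (Suc i)) - W \<omega> (t i))))"
        by (rule sum.swap)
      also have "\<dots> = (\<Sum>i<j. H \<omega> (t (Suc i)) * (W \<omega> (t (Suc i)) - W \<omega> (t i)))"
        unfolding H by (simp only: sum_distrib_right mult.assoc)
      finally show ?thesis .
    qed
    then show ?thesis using const meas by blast
  qed
  show ?thesis
    by (rule exI[of _ "\<tau> ` {..n}"], rule conjI, simp, intro allI impI, rule main)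
qed

lemma elementary_integral_borel:
  assumes "elementary_integral M F W H J"
  shows "H \<omega> \<in> borel_measurable borel"
proof -
  obtain n :: nat and \<tau> :: "nat \<Rightarrow> real" and \<xi> :: "nat \<Rightarrow> 'a \<Rightarrow> real" where
    H: "H = (\<lambda>\<omega> r. \<Sum>i<n. \<xi> i \<omega> * indicator {\<tau> i<..\<tau> (Suc i)} r)"
    using assms unfolding elementary_integral_def by blast
  show ?thesis unfolding H by measurable
qed

end

section \<open>The It\^o product formula by discretisation\<close>

lemma exp_minus_1_bounds:
  fixes x :: real
  shows "\<bar>exp x - 1\<bar> \<le> \<bar>x\<bar> * exp \<bar>x\<bar>" and "\<bar>exp x - 1 - x\<bar> \<le> x\<^sup>2 * exp \<bar>x\<bar>"
proof -
  have lo: "x \<le> exp x - 1" using exp_ge_add_one_self[of x] by linarith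
  have "1 - x \<le> exp (- x)" using exp_ge_add_one_self[of "- x"] by simp
  then have "(1 - x) * exp x \<le> exp (- x) * exp x" by (intro mult_right_mono) auto
  then have hi: "exp x - 1 \<le> x * exp x" by (simp add: exp_minus algebra_simps)
  show 1: "\<bar>exp x - 1\<bar> \<le> \<bar>x\<bar> * exp \<bar>x\<bar>"
  proof (cases "x \<ge> 0")
    case True
    then have "0 \<le> exp x - 1" using lo by linarith
    then show ?thesis using True hi by simp
  next
    case False
    then have "\<bar>exp x - 1\<bar> \<le> \<bar>x\<bar> * 1" using lo by simp
    also have "\<dots> \<le> \<bar>x\<bar> * exp \<bar>x\<bar>" by (intro mult_left_mono) auto
    finally show ?thesis .
  qed
  have "\<bar>exp x - 1 - x\<bar> \<le> x * (exp x - 1)"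
    using lo hi by (simp add: algebra_simps)
  also have "\<dots> \<le> \<bar>x\<bar> * \<bar>exp x - 1\<bar>" by (metis abs_ge_self abs_mult)
  also have "\<dots> \<le> \<bar>x\<bar> * (\<bar>x\<bar> * exp \<bar>x\<bar>)" using 1 by (intro mult_left_mono) auto
  finally show "\<bar>exp x - 1 - x\<bar> \<le> x\<^sup>2 * exp \<bar>x\<bar>" by (simp add: power2_eq_square)
qed

lemma norm_square_add_le:
  fixes x y :: "'b::real_normed_vector"
  shows "(norm (x + y))\<^sup>2 \<le> 2 * (norm x)\<^sup>2 + 2 * (norm y)\<^sup>2"
proof -
  have "(norm (x + y))\<^sup>2 \<le> (norm x + norm y)\<^sup>2"
    by (intro power_mono norm_triangle_ineq) auto
  also have "\<dots> \<le> 2 * (norm x)\<^sup>2 + 2 * (norm y)\<^sup>2"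
    using sum_squares_bound[of "norm x" "norm y"] by (simp add: power2_sum)
  finally show ?thesis .
qed

lemma norm_square_diff_le:
  fixes x y :: "'b::real_normed_vector"
  shows "(norm (x - y))\<^sup>2 \<le> 2 * (norm x)\<^sup>2 + 2 * (norm y)\<^sup>2"
  using norm_square_add_le[of x "- y"] by simp

text \<open>Over a step of length \<open>\<Delta>\<close> with increment \<open>w\<close>, the factor \<open>e\<^bsup>\<beta>t - ic W\<^esub>\<close> is multiplied by
  \<open>growth\<close>; \<open>drift\<close> is the second-order remainder which survives in the It\^o product formula.\<close>

definition growth :: "real \<Rightarrow> real \<Rightarrow> real \<Rightarrow> real \<Rightarrow> complex" where
  "growth \<beta> c \<Delta> w = complex_of_real (exp (\<beta> * \<Delta>)) * cis (- c * w)"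

definition drift :: "real \<Rightarrow> real \<Rightarrow> real \<Rightarrow> real \<Rightarrow> complex" where
  "drift \<beta> c \<Delta> w = growth \<beta> c \<Delta> w * (1 + \<i> * c * w) - 1"

lemma growth_measurable [measurable]: "growth \<beta> c \<Delta> \<in> borel_measurable borel"
  unfolding growth_def[abs_def] cis_conv_exp by measurable

lemma drift_measurable [measurable]: "drift \<beta> c \<Delta> \<in> borel_measurable borel"
  unfolding drift_def[abs_def] by measurable

lemma cis_bounds:
  fixes x :: real
  shows "norm (cis x - 1) \<le> \<bar>x\<bar>"
    and "norm (cis x - 1 - \<i> * x) \<le> x\<^sup>2 / 2"
    and "norm (cis x - 1 - \<i> * x + x\<^sup>2 / 2) \<le> \<bar>x\<bar> ^ 3 / 6"
proof -
  show "norm (cis x - 1) \<le> \<bar>x\<bar>" "norm (cis x - 1 - \<i> * x) \<le> x\<^sup>2 / 2"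
    using iexp_approx1[of x 0] iexp_approx1[of x 1]
    by (simp_all add: cis_conv_exp power2_eq_square fact_numeral diff_diff_eq)
  have "\<i> * x * (\<i> * x) = - (complex_of_real x * x)" by (simp add: complex_eq_iff)
  then have "(\<Sum>k\<le>2. (\<i> * x) ^ k / fact k) = 1 + \<i> * x - x\<^sup>2 / 2"
    by (simp add: numeral_2_eq_2 power2_eq_square)
  then have eq: "cis x - 1 - \<i> * x + x\<^sup>2 / 2 = iexp x - (\<Sum>k\<le>2. (\<i> * x) ^ k / fact k)"
    by (simp add: cis_conv_exp algebra_simps)
  have f: "\<bar>x\<bar> ^ 3 / 6 = \<bar>x\<bar> ^ Suc 2 / fact (Suc 2)" by (simp add: eval_nat_numeral)
  show "norm (cis x - 1 - \<i> * x + x\<^sup>2 / 2) \<le> \<bar>x\<bar> ^ 3 / 6"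
    unfolding eq f by (rule iexp_approx1)
qed

text \<open>With \<open>w\<close> of order \<open>sqrt \<Delta>\<close> these bounds give the orders
  needed below. The linear term of \<open>growth\<close> is centred, so compensating it leaves a
  mean of order \<open>\<Delta>\<close>. In \<open>drift\<close> the factor
  \<open>1 + \<i> * c * w\<close> cancels the linear term; the quadratic part
  \<open>c\<^sup>2 / 2 * w\<^sup>2\<close> is the Ito correction, and what is left is of third order
  in \<open>w\<close>.\<close>

lemma growth_drift_bounds:
  fixes \<beta> c \<Delta> w :: real
  defines "L \<equiv> exp \<bar>\<beta>\<bar>"
  assumes \<Delta>: "0 \<le> \<Delta>" "\<Delta> \<le> 1"
  shows "norm (growth \<beta> c \<Delta> w - 1) \<le> \<bar>\<beta>\<bar> * L * \<Delta> + L * \<bar>c\<bar> * \<bar>w\<bar>"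
    and "norm (growth \<beta> c \<Delta> w - 1 + complex_of_real (exp (\<beta> * \<Delta>)) * \<i> * c * w) \<le> \<bar>\<beta>\<bar> * L * \<Delta> + L * c\<^sup>2 * w\<^sup>2"
    and "norm (drift \<beta> c \<Delta> w) \<le> \<bar>\<beta>\<bar> * L * \<Delta> + 2 * L * c\<^sup>2 * w\<^sup>2"
    and "norm (drift \<beta> c \<Delta> w - (complex_of_real (exp (\<beta> * \<Delta>)) - 1) - complex_of_real (exp (\<beta> * \<Delta>)) * (c\<^sup>2 / 2) * w\<^sup>2) \<le> L * \<bar>c\<bar> ^ 3 * \<bar>w\<bar> ^ 3"
proof -
  define e where "e = exp (\<beta> * \<Delta>)"
  have bD: "\<bar>\<beta> * \<Delta>\<bar> \<le> \<bar>\<beta>\<bar>" using \<Delta> by (simp add: abs_mult mult_left_le)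
  have e: "e > 0" "e \<le> L" using bD by (auto simp: e_def L_def)
  have "\<bar>e - 1\<bar> \<le> \<bar>\<beta> * \<Delta>\<bar> * exp \<bar>\<beta> * \<Delta>\<bar>" unfolding e_def by (rule exp_minus_1_bounds)
  also have "\<dots> \<le> \<bar>\<beta> * \<Delta>\<bar> * L" using bD by (intro mult_left_mono) (auto simp: L_def)
  finally have e1: "\<bar>e - 1\<bar> \<le> \<bar>\<beta>\<bar> * L * \<Delta>" using \<Delta> by (simp add: abs_mult mult_ac)
  have scale: "norm (complex_of_real e * z) \<le> L * b" if "norm z \<le> b" for z b
    using that e norm_ge_zero[of z] by (auto simp: norm_mult intro!: mult_mono)
  have e1': "norm (complex_of_real e - 1) \<le> \<bar>\<beta>\<bar> * L * \<Delta>"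
    using e1 by (metis norm_of_real of_real_1 of_real_diff)
  let ?x = "- c * w"
  have g: "growth \<beta> c \<Delta> w = e * cis ?x" by (simp add: growth_def e_def)
  have "growth \<beta> c \<Delta> w - 1 = (e - 1) + e * (cis ?x - 1)"
    unfolding g by (simp add: algebra_simps)
  also have "norm \<dots> \<le> \<bar>\<beta>\<bar> * L * \<Delta> + L * \<bar>?x\<bar>"
    by (rule norm_triangle_le, rule add_mono, use e1' in simp, rule scale[OF cis_bounds(1)])
  finally show "norm (growth \<beta> c \<Delta> w - 1) \<le> \<bar>\<beta>\<bar> * L * \<Delta> + L * \<bar>c\<bar> * \<bar>w\<bar>"
    by (simp add: abs_mult mult_ac)
  have "growth \<beta> c \<Delta> w - 1 + complex_of_real (exp (\<beta> * \<Delta>)) * \<i> * c * w = (e - 1) + e * (cis ?x - 1 - \<i> * ?x)"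
    unfolding g e_def[symmetric] by (simp add: algebra_simps)
  also have "norm \<dots> \<le> \<bar>\<beta>\<bar> * L * \<Delta> + L * (?x\<^sup>2 / 2)"
    by (rule norm_triangle_le, rule add_mono, use e1' in simp, rule scale, rule cis_bounds(2))
  also have "\<dots> \<le> \<bar>\<beta>\<bar> * L * \<Delta> + L * ?x\<^sup>2" using e by simp
  finally show "norm (growth \<beta> c \<Delta> w - 1 + complex_of_real (exp (\<beta> * \<Delta>)) * \<i> * c * w) \<le> \<bar>\<beta>\<bar> * L * \<Delta> + L * c\<^sup>2 * w\<^sup>2"
    by (simp add: power_mult_distrib mult_ac)
  have p1: "norm (\<i> * ?x * (cis ?x - 1)) \<le> ?x\<^sup>2"
    using mult_left_mono[OF cis_bounds(1)[of ?x] abs_ge_zero[of ?x]] by (simp add: norm_mult power2_eq_square abs_mult mult_ac)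
  have p2: "norm (\<i> * ?x * (cis ?x - 1 - \<i> * ?x)) \<le> \<bar>?x\<bar> ^ 3 / 2"
  proof -
    have "norm (\<i> * ?x * (cis ?x - 1 - \<i> * ?x)) \<le> \<bar>?x\<bar> * (?x\<^sup>2 / 2)"
      unfolding norm_mult by (intro mult_mono cis_bounds) (auto simp: norm_mult)
    then show ?thesis by (simp add: power3_eq_cube power2_eq_square abs_mult mult_ac)
  qed
  have dr: "drift \<beta> c \<Delta> w = (e - 1) + e * ((cis ?x - 1 - \<i> * ?x) - \<i> * ?x * (cis ?x - 1))"
    unfolding drift_def g by (simp add: algebra_simps)
  show "norm (drift \<beta> c \<Delta> w) \<le> \<bar>\<beta>\<bar> * L * \<Delta> + 2 * L * c\<^sup>2 * w\<^sup>2"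
  proof -
    have "norm ((cis ?x - 1 - \<i> * ?x) - \<i> * ?x * (cis ?x - 1)) \<le> ?x\<^sup>2 / 2 + ?x\<^sup>2"
      by (rule order_trans[OF norm_triangle_ineq4], rule add_mono, rule cis_bounds(2), rule p1)
    also have "\<dots> \<le> 2 * ?x\<^sup>2" by simp
    finally have "norm (drift \<beta> c \<Delta> w) \<le> \<bar>\<beta>\<bar> * L * \<Delta> + L * (2 * ?x\<^sup>2)"
      unfolding dr by (intro norm_triangle_le add_mono scale) (use e1' in simp)
    then show ?thesis by (simp add: power_mult_distrib mult_ac)
  qed
  have "drift \<beta> c \<Delta> w - (complex_of_real (exp (\<beta> * \<Delta>)) - 1) - complex_of_real (exp (\<beta> * \<Delta>)) * (c\<^sup>2 / 2) * w\<^sup>2 =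
      e * ((cis ?x - 1 - \<i> * ?x + ?x\<^sup>2 / 2) - \<i> * ?x * (cis ?x - 1 - \<i> * ?x))"
    unfolding dr e_def[symmetric] by (simp add: algebra_simps power2_eq_square)
  also have "norm \<dots> \<le> L * (\<bar>?x\<bar> ^ 3)"
  proof (rule scale)
    have "norm ((cis ?x - 1 - \<i> * ?x + ?x\<^sup>2 / 2) - \<i> * ?x * (cis ?x - 1 - \<i> * ?x)) \<le> \<bar>?x\<bar> ^ 3 / 6 + \<bar>?x\<bar> ^ 3 / 2"
      by (rule order_trans[OF norm_triangle_ineq4], rule add_mono, rule cis_bounds(3), rule p2)
    also have "\<dots> \<le> \<bar>?x\<bar> ^ 3" using zero_le_power[of "\<bar>?x\<bar>" 3] by linarith
    finally show "norm ((cis ?x - 1 - \<i> * ?x + ?x\<^sup>2 / 2) - \<i> * ?x * (cis ?x - 1 - \<i> * ?x)) \<le> \<bar>?x\<bar> ^ 3" .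
  qed
  finally show "norm (drift \<beta> c \<Delta> w - (complex_of_real (exp (\<beta> * \<Delta>)) - 1) - complex_of_real (exp (\<beta> * \<Delta>)) * (c\<^sup>2 / 2) * w\<^sup>2) \<le> L * \<bar>c\<bar> ^ 3 * \<bar>w\<bar> ^ 3"
    by (simp add: abs_mult power_mult_distrib mult_ac)
qed

section \<open>Means and variances of the growth and drift factors\<close>

context bm
begin

definition growth_mean :: "real \<Rightarrow> real \<Rightarrow> real \<Rightarrow> real \<Rightarrow> complex" where
  "growth_mean \<beta> c a b = expectation (\<lambda>\<omega>. growth \<beta> c (b - a) (W \<omega> b - W \<omega> a) - 1)"

definition drift_mean :: "real \<Rightarrow> real \<Rightarrow> real \<Rightarrow> real \<Rightarrow> complex" where
  "drift_mean \<beta> c a b = expectation (\<lambda>\<omega>. drift \<beta> c (b - a) (W \<omega> b - W \<omega> a))"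

text \<open>The orders are what a sum over a grid tolerates. A variance of order
  \<open>b - a\<close> for \<open>growth\<close> is harmless against coefficients tending to 0 in
  mean square, a variance of order \<open>(b - a)\<^sup>2\<close> for \<open>drift\<close> against
  coefficients bounded in mean square, and the error of order \<open>(b - a) * sqrt (b - a)\<close>
  in the mean of \<open>drift\<close> disappears. The surviving rate
  \<open>\<beta> + c\<^sup>2 / 2\<close> is the one in the product formula.\<close>

lemma growth_drift_moments:
  fixes \<beta> c :: real
  shows "\<exists>K>0. \<forall>a b. 0 \<le> a \<and> a < b \<and> b - a \<le> 1 \<longrightarrow>
    has_bochner_integral M (\<lambda>\<omega>. growth \<beta> c (b - a) (W \<omega> b - W \<omega> a) - 1 - growth_mean \<beta> c a b) 0 \<and>
    integrable M (\<lambda>\<omega>. (norm (growth \<beta> c (b - a) (W \<omega> b - W \<omega> a) - 1 - growth_mean \<beta> c a b))\<^sup>2) \<and>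
    expectation (\<lambda>\<omega>. (norm (growth \<beta> c (b - a) (W \<omega> b - W \<omega> a) - 1 - growth_mean \<beta> c a b))\<^sup>2) \<le> K * (b - a) \<and>
    has_bochner_integral M (\<lambda>\<omega>. drift \<beta> c (b - a) (W \<omega> b - W \<omega> a) - drift_mean \<beta> c a b) 0 \<and>
    integrable M (\<lambda>\<omega>. (norm (drift \<beta> c (b - a) (W \<omega> b - W \<omega> a) - drift_mean \<beta> c a b))\<^sup>2) \<and>
    expectation (\<lambda>\<omega>. (norm (drift \<beta> c (b - a) (W \<omega> b - W \<omega> a) - drift_mean \<beta> c a b))\<^sup>2) \<le> K * (b - a)\<^sup>2 \<and>
    norm (growth_mean \<beta> c a b) \<le> K * (b - a) \<and>
    norm (drift_mean \<beta> c a b - (\<beta> + c\<^sup>2 / 2) * (b - a)) \<le> K * (b - a) * sqrt (b - a)"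
proof -
  define L where "L = exp \<bar>\<beta>\<bar>"
  define B where "B = \<bar>\<beta>\<bar> * L"
  \<comment> \<open>\<open>K1\<close> and \<open>K3\<close> bound the means of \<open>growth\<close>
    minus 1 and of \<open>drift\<close> per unit of time, \<open>K2\<close> and \<open>K4\<close>
    are for the variances, and \<open>K5\<close> is for the error in the mean of
    \<open>drift\<close>. The 48 in \<open>K4\<close> is 2 * 8 * 3, where 3 comes from the fourth
    normal moment.\<close>
  define K1 where "K1 = B + L * c\<^sup>2"
  define K2 where "K2 = 4 * B\<^sup>2 + 4 * L\<^sup>2 * c\<^sup>2 + 2 * K1\<^sup>2"
  define K3 where "K3 = B + 2 * L * c\<^sup>2"
  define K4 where "K4 = 4 * B\<^sup>2 + 48 * L\<^sup>2 * c ^ 4 + 2 * K3\<^sup>2"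
  define K5 where "K5 = 2 * L * \<bar>c\<bar> ^ 3 + \<beta>\<^sup>2 * L + B * c\<^sup>2"
  define K where "K = 1 + K1 + K2 + K4 + K5"
  have nn: "L > 0" "B \<ge> 0" "K1 \<ge> 0" "K2 \<ge> 0" "K3 \<ge> 0" "K4 \<ge> 0" "K5 \<ge> 0"
    by (auto simp: L_def B_def K1_def K2_def K3_def K4_def K5_def intro!: add_nonneg_nonneg mult_nonneg_nonneg)
  then have K: "K > 0" "K1 \<le> K" "K2 \<le> K" "K4 \<le> K" "K5 \<le> K" by (auto simp: K_def)
  show ?thesis
  proof (intro exI[of _ K] conjI[OF K(1)] allI impI, elim conjE)
    fix a b :: real assume ab: "0 \<le> a" "a < b" "b - a \<le> 1"
    define \<Delta> where "\<Delta> = b - a"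
    define D where "D \<omega> = W \<omega> b - W \<omega> a" for \<omega>
    define e where "e = exp (\<beta> * \<Delta>)"
    have \<Delta>: "0 < \<Delta>" "0 \<le> \<Delta>" "\<Delta> \<le> 1" using ab by (auto simp: \<Delta>_def)
    have Dm [measurable]: "D \<in> borel_measurable M"
      using ab unfolding D_def[abs_def] by (intro increment_measurable) auto
    note inc = increment_integral[OF ab(1,2), folded D_def \<Delta>_def]
    have D1: "integrable M D" "expectation D = 0" using inc(3) by (auto simp: has_bochner_integral_iff)
    have D2: "integrable M (\<lambda>\<omega>. (D \<omega>)\<^sup>2)" "expectation (\<lambda>\<omega>. (D \<omega>)\<^sup>2) = \<Delta>"
      using inc(1) by (auto simp: has_bochner_integral_iff)
    have D4: "integrable M (\<lambda>\<omega>. (D \<omega>) ^ 4)" "expectation (\<lambda>\<omega>. (D \<omega>) ^ 4) = 3 * \<Delta>\<^sup>2"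
      using inc(2) by (auto simp: has_bochner_integral_iff)
    note D3 = inc(4,5)
    note bnd = growth_drift_bounds[OF \<Delta>(2,3), where \<beta> = \<beta>, folded L_def, folded B_def]
    have eL: "0 < e" "e \<le> L"
    proof -
      have "\<beta> * \<Delta> \<le> \<bar>\<beta>\<bar>" using \<Delta> by (metis abs_ge_self abs_ge_zero abs_mult abs_of_nonneg mult_left_le order_trans)
      then show "0 < e" "e \<le> L" by (auto simp: e_def L_def)
    qed
    let ?u = "\<lambda>\<omega>. growth \<beta> c \<Delta> (D \<omega>) - 1" and ?m = "growth_mean \<beta> c a b"
    let ?g = "\<lambda>\<omega>. drift \<beta> c \<Delta> (D \<omega>)" and ?G = "drift_mean \<beta> c a b"
    have m: "?m = expectation ?u" and G: "?G = expectation ?g"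
      by (simp_all add: growth_mean_def drift_mean_def \<Delta>_def D_def)
    have um [measurable]: "?u \<in> borel_measurable M" and gm [measurable]: "?g \<in> borel_measurable M"
      by measurable
    have Dsq: "\<Delta>\<^sup>2 \<le> \<Delta>" using \<Delta> by (simp add: power2_eq_square mult_left_le)
    have intu2: "integrable M (\<lambda>\<omega>. 2 * B\<^sup>2 * \<Delta>\<^sup>2 + 2 * L\<^sup>2 * c\<^sup>2 * (D \<omega>)\<^sup>2)"
      using D2 by (intro Bochner_Integration.integrable_add integrable_mult_right) auto
    have u2: "(norm (?u \<omega>))\<^sup>2 \<le> 2 * B\<^sup>2 * \<Delta>\<^sup>2 + 2 * L\<^sup>2 * c\<^sup>2 * (D \<omega>)\<^sup>2" for \<omega>
    proof -
      have "(norm (?u \<omega>))\<^sup>2 \<le> (B * \<Delta> + L * \<bar>c\<bar> * \<bar>D \<omega>\<bar>)\<^sup>2"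
        using bnd(1) by (intro power_mono) auto
      also have "\<dots> \<le> 2 * (B * \<Delta>)\<^sup>2 + 2 * (L * \<bar>c\<bar> * \<bar>D \<omega>\<bar>)\<^sup>2"
        using norm_square_add_le[of "B * \<Delta>" "L * \<bar>c\<bar> * \<bar>D \<omega>\<bar>"] by (simp only: real_norm_def power2_abs)
      finally show ?thesis by (simp add: power_mult_distrib mult_ac)
    qed
    have intg2: "integrable M (\<lambda>\<omega>. 2 * B\<^sup>2 * \<Delta>\<^sup>2 + 8 * L\<^sup>2 * c ^ 4 * (D \<omega>) ^ 4)"
      using D4 by (intro Bochner_Integration.integrable_add integrable_mult_right) auto
    have g2: "(norm (?g \<omega>))\<^sup>2 \<le> 2 * B\<^sup>2 * \<Delta>\<^sup>2 + 8 * L\<^sup>2 * c ^ 4 * (D \<omega>) ^ 4" for \<omega>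
    proof -
      have "(norm (?g \<omega>))\<^sup>2 \<le> (B * \<Delta> + 2 * L * c\<^sup>2 * (D \<omega>)\<^sup>2)\<^sup>2"
        using bnd(3) by (intro power_mono) auto
      also have "\<dots> \<le> 2 * (B * \<Delta>)\<^sup>2 + 2 * (2 * L * c\<^sup>2 * (D \<omega>)\<^sup>2)\<^sup>2"
        using norm_square_add_le[of "B * \<Delta>" "2 * L * c\<^sup>2 * (D \<omega>)\<^sup>2"] by (simp only: real_norm_def power2_abs)
      finally show ?thesis by (simp add: power_mult_distrib mult_ac flip: power_mult)
    qed
    have int_sq: "integrable M h" if "integrable M (\<lambda>\<omega>. (norm (h \<omega>))\<^sup>2)" "h \<in> borel_measurable M" for h :: "'a \<Rightarrow> complex"
    proof (rule Bochner_Integration.integrable_bound)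
      show "integrable M (\<lambda>\<omega>. 1 + (norm (h \<omega>))\<^sup>2)" using that by simp
      have "x \<le> 1 + x\<^sup>2" if "x \<ge> 0" for x :: real
        using sum_squares_bound[of 1 x] that by (simp add: power2_eq_square)
      then show "AE \<omega> in M. norm (h \<omega>) \<le> norm (1 + (norm (h \<omega>))\<^sup>2)"
        by (intro AE_I2) (simp add: abs_of_nonneg)
    qed fact
    have iu2: "integrable M (\<lambda>\<omega>. (norm (?u \<omega>))\<^sup>2)"
      by (rule Bochner_Integration.integrable_bound[OF intu2]) (use u2 in \<open>auto intro!: AE_I2 simp: abs_le_iff intro: order_trans\<close>)
    have ig2: "integrable M (\<lambda>\<omega>. (norm (?g \<omega>))\<^sup>2)"
      by (rule Bochner_Integration.integrable_bound[OF intg2]) (use g2 in \<open>auto intro!: AE_I2 simp: abs_le_iff intro: order_trans\<close>)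
    have iu: "integrable M ?u" and ig: "integrable M ?g"
      using int_sq[OF iu2 um] int_sq[OF ig2 gm] .
    have Eu2: "expectation (\<lambda>\<omega>. (norm (?u \<omega>))\<^sup>2) \<le> 2 * B\<^sup>2 * \<Delta>\<^sup>2 + 2 * L\<^sup>2 * c\<^sup>2 * \<Delta>"
    proof -
      have "expectation (\<lambda>\<omega>. (norm (?u \<omega>))\<^sup>2) \<le> expectation (\<lambda>\<omega>. 2 * B\<^sup>2 * \<Delta>\<^sup>2 + 2 * L\<^sup>2 * c\<^sup>2 * (D \<omega>)\<^sup>2)"
        by (intro integral_mono iu2 intu2 u2)
      then show ?thesis using D2 by (simp add: prob_space)
    qed
    have Eg2: "expectation (\<lambda>\<omega>. (norm (?g \<omega>))\<^sup>2) \<le> 2 * B\<^sup>2 * \<Delta>\<^sup>2 + 24 * L\<^sup>2 * c ^ 4 * \<Delta>\<^sup>2"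
    proof -
      have "expectation (\<lambda>\<omega>. (norm (?g \<omega>))\<^sup>2) \<le> expectation (\<lambda>\<omega>. 2 * B\<^sup>2 * \<Delta>\<^sup>2 + 8 * L\<^sup>2 * c ^ 4 * (D \<omega>) ^ 4)"
        by (intro integral_mono ig2 intg2 g2)
      then show ?thesis using D4 by (simp add: prob_space)
    qed
    have centred: "integrable M (\<lambda>\<omega>. (norm (h \<omega> - y))\<^sup>2)"
      "expectation (\<lambda>\<omega>. (norm (h \<omega> - y))\<^sup>2) \<le> 2 * expectation (\<lambda>\<omega>. (norm (h \<omega>))\<^sup>2) + 2 * (norm y)\<^sup>2"
      if h: "integrable M (\<lambda>\<omega>. (norm (h \<omega>))\<^sup>2)" "h \<in> borel_measurable M" for h :: "'a \<Rightarrow> complex" and y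
    proof -
      have i: "integrable M (\<lambda>\<omega>. 2 * (norm (h \<omega>))\<^sup>2 + 2 * (norm y)\<^sup>2)" using h by simp
      show i2: "integrable M (\<lambda>\<omega>. (norm (h \<omega> - y))\<^sup>2)"
        by (rule Bochner_Integration.integrable_bound[OF i]) (use h norm_square_diff_le[of "h _" y] in \<open>auto intro!: AE_I2\<close>)
      have "expectation (\<lambda>\<omega>. (norm (h \<omega> - y))\<^sup>2) \<le> expectation (\<lambda>\<omega>. 2 * (norm (h \<omega>))\<^sup>2 + 2 * (norm y)\<^sup>2)"
        by (intro integral_mono i i2 norm_square_diff_le)
      then show "expectation (\<lambda>\<omega>. (norm (h \<omega> - y))\<^sup>2) \<le> 2 * expectation (\<lambda>\<omega>. (norm (h \<omega>))\<^sup>2) + 2 * (norm y)\<^sup>2"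
        using h by (simp add: prob_space)
    qed
    have m_le: "norm ?m \<le> K1 * \<Delta>"
    proof -
      have iD: "integrable M (\<lambda>\<omega>. complex_of_real e * \<i> * c * D \<omega>)"
        using D1 by (intro integrable_mult_right integrable_of_real)
      have "?m = expectation (\<lambda>\<omega>. ?u \<omega> + complex_of_real e * \<i> * c * D \<omega>)"
        using iu iD D1 by (subst Bochner_Integration.integral_add) (auto simp: m)
      also have "norm \<dots> \<le> expectation (\<lambda>\<omega>. B * \<Delta> + L * c\<^sup>2 * (D \<omega>)\<^sup>2)"
      proof (rule order_trans[OF integral_norm_bound], rule integral_mono)
        show "norm (?u \<omega> + complex_of_real e * \<i> * c * D \<omega>) \<le> B * \<Delta> + L * c\<^sup>2 * (D \<omega>)\<^sup>2" for \<omega>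
          using bnd(2)[of c "D \<omega>"] by (simp add: e_def)
      qed (use iu iD D2 in auto)
      also have "\<dots> = K1 * \<Delta>" using D2 by (simp add: prob_space K1_def algebra_simps)
      finally show ?thesis .
    qed
    have G_le: "norm ?G \<le> K3 * \<Delta>"
    proof -
      have "norm ?G \<le> expectation (\<lambda>\<omega>. B * \<Delta> + 2 * L * c\<^sup>2 * (D \<omega>)\<^sup>2)"
        unfolding G
      proof (rule order_trans[OF integral_norm_bound], rule integral_mono)
        show "norm (?g \<omega>) \<le> B * \<Delta> + 2 * L * c\<^sup>2 * (D \<omega>)\<^sup>2" for \<omega> by (rule bnd(3))
      qed (use ig D2 in auto)
      also have "\<dots> = K3 * \<Delta>" using D2 by (simp add: prob_space K3_def algebra_simps)
      finally show ?thesis .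
    qed
    have G_lim: "norm (?G - (\<beta> + c\<^sup>2 / 2) * \<Delta>) \<le> K5 * \<Delta> * sqrt \<Delta>"
    proof -
      have iD: "integrable M (\<lambda>\<omega>. complex_of_real (e * (c\<^sup>2 / 2) * (D \<omega>)\<^sup>2))"
        using D2 by (intro integrable_of_real integrable_mult_right)
      have "expectation (\<lambda>\<omega>. ?g \<omega> - complex_of_real (e - 1) - complex_of_real (e * (c\<^sup>2 / 2) * (D \<omega>)\<^sup>2)) =
          ?G - complex_of_real (e - 1) - complex_of_real (e * (c\<^sup>2 / 2) * \<Delta>)"
        using ig iD D2 by (simp add: G prob_space del: of_real_mult of_real_diff)
      moreover have "norm (expectation (\<lambda>\<omega>. ?g \<omega> - complex_of_real (e - 1) - complex_of_real (e * (c\<^sup>2 / 2) * (D \<omega>)\<^sup>2))) \<le>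
          expectation (\<lambda>\<omega>. L * \<bar>c\<bar> ^ 3 * \<bar>D \<omega>\<bar> ^ 3)"
      proof (rule order_trans[OF integral_norm_bound], rule integral_mono)
        show "norm (?g \<omega> - complex_of_real (e - 1) - complex_of_real (e * (c\<^sup>2 / 2) * (D \<omega>)\<^sup>2)) \<le> L * \<bar>c\<bar> ^ 3 * \<bar>D \<omega>\<bar> ^ 3" for \<omega>
          using bnd(4)[of c "D \<omega>"] by (simp add: e_def)
      qed (use ig iD D3 in auto)
      moreover have "expectation (\<lambda>\<omega>. L * \<bar>c\<bar> ^ 3 * \<bar>D \<omega>\<bar> ^ 3) \<le> L * \<bar>c\<bar> ^ 3 * (2 * sqrt \<Delta> * \<Delta>)"
        using D3 nn by (simp add: mult_left_mono)
      ultimately have 1: "norm (?G - complex_of_real (e - 1) - complex_of_real (e * (c\<^sup>2 / 2) * \<Delta>)) \<le> 2 * L * \<bar>c\<bar> ^ 3 * \<Delta> * sqrt \<Delta>"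
        by (simp add: mult_ac)
      have "\<bar>\<beta> * \<Delta>\<bar> \<le> \<bar>\<beta>\<bar>" using \<Delta> by (simp add: abs_mult mult_left_le)
      then have "(\<beta> * \<Delta>)\<^sup>2 * exp \<bar>\<beta> * \<Delta>\<bar> \<le> (\<beta> * \<Delta>)\<^sup>2 * L" "\<bar>\<beta> * \<Delta>\<bar> * exp \<bar>\<beta> * \<Delta>\<bar> \<le> \<bar>\<beta> * \<Delta>\<bar> * L"
        by (auto simp: L_def intro!: mult_left_mono)
      then have e1: "\<bar>e - 1 - \<beta> * \<Delta>\<bar> \<le> (\<beta> * \<Delta>)\<^sup>2 * L" and e2: "\<bar>e - 1\<bar> \<le> \<bar>\<beta> * \<Delta>\<bar> * L"
        using exp_minus_1_bounds[of "\<beta> * \<Delta>"] by (auto simp: e_def)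
      have "\<Delta> \<le> sqrt \<Delta>" using \<Delta> Dsq by (intro real_le_rsqrt)
      then have sq: "\<Delta>\<^sup>2 \<le> \<Delta> * sqrt \<Delta>" using \<Delta> by (simp add: power2_eq_square)
      have 2: "\<bar>(e - 1) + e * (c\<^sup>2 / 2) * \<Delta> - (\<beta> + c\<^sup>2 / 2) * \<Delta>\<bar> \<le> (\<beta>\<^sup>2 * L + B * c\<^sup>2) * (\<Delta> * sqrt \<Delta>)"
      proof -
        have "(e - 1) + e * (c\<^sup>2 / 2) * \<Delta> - (\<beta> + c\<^sup>2 / 2) * \<Delta> = (e - 1 - \<beta> * \<Delta>) + (e - 1) * (c\<^sup>2 / 2 * \<Delta>)"
          by (simp add: field_simps)
        also have "\<bar>\<dots>\<bar> \<le> (\<beta> * \<Delta>)\<^sup>2 * L + \<bar>\<beta> * \<Delta>\<bar> * L * (c\<^sup>2 / 2 * \<Delta>)"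
          using e1 e2 \<Delta> by (intro order_trans[OF abs_triangle_ineq] add_mono) (auto simp: abs_mult intro!: mult_right_mono)
        also have "\<dots> = (\<beta>\<^sup>2 * L + B * c\<^sup>2 / 2) * \<Delta>\<^sup>2"
          using \<Delta> by (simp add: B_def abs_mult power2_eq_square algebra_simps)
        also have "\<dots> \<le> (\<beta>\<^sup>2 * L + B * c\<^sup>2) * \<Delta>\<^sup>2" using nn by (intro mult_right_mono) auto
        also have "\<dots> \<le> (\<beta>\<^sup>2 * L + B * c\<^sup>2) * (\<Delta> * sqrt \<Delta>)" using nn sq by (intro mult_left_mono) auto
        finally show ?thesis .
      qed
      have "?G - (\<beta> + c\<^sup>2 / 2) * \<Delta> = (?G - complex_of_real (e - 1) - complex_of_real (e * (c\<^sup>2 / 2) * \<Delta>)) +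
          complex_of_real ((e - 1) + e * (c\<^sup>2 / 2) * \<Delta> - (\<beta> + c\<^sup>2 / 2) * \<Delta>)"
        by simp
      also have "norm \<dots> \<le> 2 * L * \<bar>c\<bar> ^ 3 * \<Delta> * sqrt \<Delta> + (\<beta>\<^sup>2 * L + B * c\<^sup>2) * (\<Delta> * sqrt \<Delta>)"
        by (rule norm_triangle_le, rule add_mono[OF 1]) (simp only: norm_of_real 2)
      also have "\<dots> = K5 * \<Delta> * sqrt \<Delta>" by (simp add: K5_def algebra_simps)
      finally show ?thesis .
    qed
    have a: "expectation (\<lambda>\<omega>. (norm (?u \<omega> - ?m))\<^sup>2) \<le> K * \<Delta>"
    proof -
      have "expectation (\<lambda>\<omega>. (norm (?u \<omega> - ?m))\<^sup>2) \<le> 2 * (2 * B\<^sup>2 * \<Delta>\<^sup>2 + 2 * L\<^sup>2 * c\<^sup>2 * \<Delta>) + 2 * (K1 * \<Delta>)\<^sup>2"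
        by (rule order_trans[OF centred(2)[OF iu2 um]]) (intro add_mono mult_left_mono Eu2 power_mono[OF m_le] norm_ge_zero, simp_all)
      also have "\<dots> = (4 * B\<^sup>2 + 2 * K1\<^sup>2) * \<Delta>\<^sup>2 + 4 * L\<^sup>2 * c\<^sup>2 * \<Delta>" by (simp add: power_mult_distrib algebra_simps)
      also have "\<dots> \<le> (4 * B\<^sup>2 + 2 * K1\<^sup>2) * \<Delta> + 4 * L\<^sup>2 * c\<^sup>2 * \<Delta>"
        using Dsq by (intro add_right_mono mult_left_mono) auto
      also have "\<dots> = K2 * \<Delta>" by (simp add: K2_def algebra_simps)
      also have "\<dots> \<le> K * \<Delta>" using K \<Delta> by (intro mult_right_mono) auto
      finally show ?thesis .
    qed
    have b: "expectation (\<lambda>\<omega>. (norm (?g \<omega> - ?G))\<^sup>2) \<le> K * \<Delta>\<^sup>2"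
    proof -
      have "expectation (\<lambda>\<omega>. (norm (?g \<omega> - ?G))\<^sup>2) \<le> 2 * (2 * B\<^sup>2 * \<Delta>\<^sup>2 + 24 * L\<^sup>2 * c ^ 4 * \<Delta>\<^sup>2) + 2 * (K3 * \<Delta>)\<^sup>2"
        by (rule order_trans[OF centred(2)[OF ig2 gm]]) (intro add_mono mult_left_mono Eg2 power_mono[OF G_le] norm_ge_zero, simp_all)
      also have "\<dots> = K4 * \<Delta>\<^sup>2" by (simp add: K4_def power_mult_distrib algebra_simps)
      also have "\<dots> \<le> K * \<Delta>\<^sup>2" using K by (intro mult_right_mono) auto
      finally show ?thesis .
    qed
    have c1: "norm ?m \<le> K * \<Delta>" using m_le mult_right_mono[OF K(2) \<Delta>(2)] by linarith
    have c2: "norm (?G - (\<beta> + c\<^sup>2 / 2) * \<Delta>) \<le> K * \<Delta> * sqrt \<Delta>"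
      by (rule order_trans[OF G_lim]) (intro mult_right_mono K, use \<Delta> in auto)
    have d1: "has_bochner_integral M (\<lambda>\<omega>. ?u \<omega> - ?m) 0" and d2: "has_bochner_integral M (\<lambda>\<omega>. ?g \<omega> - ?G) 0"
      using iu ig by (auto simp: has_bochner_integral_iff m G prob_space)
    from a b c1 c2 d1 d2 centred(1)[OF iu2 um, of ?m] centred(1)[OF ig2 gm, of ?G]
    show "has_bochner_integral M (\<lambda>\<omega>. growth \<beta> c (b - a) (W \<omega> b - W \<omega> a) - 1 - ?m) 0 \<and>
      integrable M (\<lambda>\<omega>. (norm (growth \<beta> c (b - a) (W \<omega> b - W \<omega> a) - 1 - ?m))\<^sup>2) \<and>
      expectation (\<lambda>\<omega>. (norm (growth \<beta> c (b - a) (W \<omega> b - W \<omega> a) - 1 - ?m))\<^sup>2) \<le> K * (b - a) \<and>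
      has_bochner_integral M (\<lambda>\<omega>. drift \<beta> c (b - a) (W \<omega> b - W \<omega> a) - ?G) 0 \<and>
      integrable M (\<lambda>\<omega>. (norm (drift \<beta> c (b - a) (W \<omega> b - W \<omega> a) - ?G))\<^sup>2) \<and>
      expectation (\<lambda>\<omega>. (norm (drift \<beta> c (b - a) (W \<omega> b - W \<omega> a) - ?G))\<^sup>2) \<le> K * (b - a)\<^sup>2 \<and>
      norm ?m \<le> K * (b - a) \<and> norm (?G - (\<beta> + c\<^sup>2 / 2) * (b - a)) \<le> K * (b - a) * sqrt (b - a)"
      unfolding \<Delta>_def[symmetric] D_def[symmetric] by (intro conjI)
  qed
qed

end

text \<open>Choosing \<open>\<eta>\<close> first makes the first term a prescribed
  \<open>e / 2\<close>, after which the second is eventually smaller than \<open>e / 2\<close>.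
  Together with \<open>le_interpolate\<close> this turns convergence in mean square into convergence
  in mean.\<close>

lemma tendsto_0_interpolate:
  fixes a b :: "nat \<Rightarrow> real"
  assumes le: "\<And>n \<eta>. \<eta> > 0 \<Longrightarrow> a n \<le> \<eta> * T + b n / \<eta>" and nonneg: "\<And>n. a n \<ge> 0"
    and b: "b \<longlonglongrightarrow> 0" and T: "T > 0"
  shows "a \<longlonglongrightarrow> 0"
proof (rule LIMSEQ_I)
  fix e :: real assume e: "e > 0"
  define \<eta> where "\<eta> = e / (2 * T)"
  have \<eta>: "\<eta> > 0" "\<eta> * T = e / 2" using e T by (auto simp: \<eta>_def)
  have "\<forall>\<^sub>F n in sequentially. b n < e / 2 * \<eta>"
    using b e \<eta> by (intro order_tendstoD(2)[OF b]) auto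
  then obtain n0 where n0: "\<And>n. n \<ge> n0 \<Longrightarrow> b n < e / 2 * \<eta>" by (auto simp: eventually_sequentially)
  have "norm (a n - 0) < e" if "n \<ge> n0" for n
  proof -
    have "b n / \<eta> < e / 2" using n0[OF that] \<eta> by (simp add: pos_divide_less_eq)
    then have "a n < e" using le[OF \<eta>(1), of n] \<eta>(2) by linarith
    then show ?thesis using nonneg[of n] by simp
  qed
  then show "\<exists>no. \<forall>n\<ge>no. norm (a n - 0) < e" by blast
qed

lemma le_interpolate:
  fixes x \<eta> :: real
  assumes "\<eta> > 0"
  shows "x \<le> \<eta> + x\<^sup>2 / \<eta>"
proof -
  have "x * \<eta> \<le> (x\<^sup>2 + \<eta>\<^sup>2)" using sum_squares_bound[of x \<eta>] zero_le_power2[of x] zero_le_power2[of \<eta>] by linarith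
  then show ?thesis using assms by (simp add: field_simps power2_eq_square)
qed

lemma subdivision_floor_tendsto:
  assumes sub: "\<And>n. subdivision T (N n) (t n)"
    and mesh: "\<And>n i. i < N n \<Longrightarrow> t n (Suc i) - t n i \<le> 1 / real (Suc n)" and r: "0 < r" "r \<le> T"
  shows "(\<lambda>n. subdivision_floor (N n) (t n) r) \<longlonglongrightarrow> r" "\<And>n. subdivision_floor (N n) (t n) r < r"
    "\<And>n. subdivision_floor (N n) (t n) r \<in> {0..T}"
    "(\<lambda>n. subdivision_ceil (N n) (t n) r) \<longlonglongrightarrow> r" "\<And>n. r \<le> subdivision_ceil (N n) (t n) r"
    "\<And>n. subdivision_ceil (N n) (t n) r \<in> {0..T}"
proof -
  have *: "subdivision_floor (N n) (t n) r < r \<and> r - 1 / real (Suc n) \<le> subdivision_floor (N n) (t n) r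
     \<and> subdivision_floor (N n) (t n) r \<in> {0..T} \<and> r \<le> subdivision_ceil (N n) (t n) r \<and>
     subdivision_ceil (N n) (t n) r \<le> r + 1 / real (Suc n) \<and> subdivision_ceil (N n) (t n) r \<in> {0..T}" for n
  proof -
    obtain i where i: "i < N n" "t n i < r" "r \<le> t n (Suc i)"
      using subdivision_cases[OF sub r] by metis
    show ?thesis
      unfolding subdivision_floor_eq[OF sub i] subdivision_ceil_eq[OF sub i]
      using mesh[OF i(1)] i subdivision_range[OF sub, of i n] subdivision_range[OF sub, of "Suc i" n] by auto
  qed
  show "\<And>n. subdivision_floor (N n) (t n) r < r" "\<And>n. subdivision_floor (N n) (t n) r \<in> {0..T}"
    "\<And>n. r \<le> subdivision_ceil (N n) (t n) r" "\<And>n. subdivision_ceil (N n) (t n) r \<in> {0..T}"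
    using * by blast+
  have lim: "(\<lambda>n. 1 / real (Suc n)) \<longlonglongrightarrow> 0" by (rule LIMSEQ_Suc[OF lim_1_over_n])
  have "(\<lambda>n. r - 1 / real (Suc n)) \<longlonglongrightarrow> r - 0" "(\<lambda>n. r + 1 / real (Suc n)) \<longlonglongrightarrow> r + 0"
    by (intro tendsto_intros lim)+
  then have l: "(\<lambda>n. r - 1 / real (Suc n)) \<longlonglongrightarrow> r" "(\<lambda>n. r + 1 / real (Suc n)) \<longlonglongrightarrow> r" by simp_all
  show "(\<lambda>n. subdivision_floor (N n) (t n) r) \<longlonglongrightarrow> r"
  proof (rule tendsto_sandwich[OF _ _ l(1) tendsto_const])
    show "\<forall>\<^sub>F n in sequentially. r - 1 / real (Suc n) \<le> subdivision_floor (N n) (t n) r"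
      using * by (intro always_eventually allI) blast
    show "\<forall>\<^sub>F n in sequentially. subdivision_floor (N n) (t n) r \<le> r"
      using * by (intro always_eventually allI) (meson less_imp_le)
  qed
  show "(\<lambda>n. subdivision_ceil (N n) (t n) r) \<longlonglongrightarrow> r"
  proof (rule tendsto_sandwich[OF _ _ tendsto_const l(2)])
    show "\<forall>\<^sub>F n in sequentially. r \<le> subdivision_ceil (N n) (t n) r"
      using * by (intro always_eventually allI) blast
    show "\<forall>\<^sub>F n in sequentially. subdivision_ceil (N n) (t n) r \<le> r + 1 / real (Suc n)"
      using * by (intro always_eventually allI) blast
  qed
qed

lemma complex_cadlag:
  fixes X :: "real \<Rightarrow> complex"
  assumes "cadlag (\<lambda>r. Re (X r))" "cadlag (\<lambda>r. Im (X r))"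
  shows "\<exists>B\<ge>0. \<forall>t\<in>{0..T}. norm (X t) \<le> B"
    and "(\<lambda>r. X (max 0 r)) \<in> borel_measurable borel"
    and "AE r in lborel. 0 < r \<longrightarrow> (X \<longlongrightarrow> X r) (at_left r)"
proof -
  obtain B1 B2 where B: "\<And>t. t \<in> {0..T} \<Longrightarrow> \<bar>Re (X t)\<bar> \<le> B1" "\<And>t. t \<in> {0..T} \<Longrightarrow> \<bar>Im (X t)\<bar> \<le> B2"
    using cadlag_bounded[OF assms(1), of T] cadlag_bounded[OF assms(2), of T] by blast
  then have "norm (X t) \<le> \<bar>B1\<bar> + \<bar>B2\<bar>" if "t \<in> {0..T}" for t
    using cmod_le[of "X t"] B[OF that] by linarith
  then show "\<exists>B\<ge>0. \<forall>t\<in>{0..T}. norm (X t) \<le> B"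
    by (intro exI[of _ "\<bar>B1\<bar> + \<bar>B2\<bar>"]) auto
  show "(\<lambda>r. X (max 0 r)) \<in> borel_measurable borel"
    using cadlag_borel[OF assms(1)] cadlag_borel[OF assms(2)] by (subst borel_measurable_complex_iff) auto
  show "AE r in lborel. 0 < r \<longrightarrow> (X \<longlongrightarrow> X r) (at_left r)"
    using cadlag_AE_left_continuous[OF assms(1)] cadlag_AE_left_continuous[OF assms(2)]
    by eventually_elim (auto simp: tendsto_complex_iff)
qed

lemma set_integrable_bounded:
  fixes f :: "real \<Rightarrow> 'b::{banach, second_countable_topology}"
  assumes "(\<lambda>r. f (max 0 r)) \<in> borel_measurable borel" "\<And>r. r \<in> {0..T} \<Longrightarrow> norm (f r) \<le> B" "A \<subseteq> {0..T}" "A \<in> sets borel"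
  shows "set_integrable lborel A f"
  unfolding set_integrable_def
proof (rule integrableI_bounded_set[where A = A and B = B])
  have "(\<lambda>r. indicator A r *\<^sub>R f r) = (\<lambda>r. indicator A r *\<^sub>R f (max 0 r))"
    using assms(3) by (auto simp: fun_eq_iff indicator_def max_def)
  then show "(\<lambda>r. indicator A r *\<^sub>R f r) \<in> borel_measurable lborel" using assms(1,4) by simp
  have "emeasure lborel A \<le> emeasure lborel {0..T}" using assms by (intro emeasure_mono) auto
  also have "\<dots> < \<infinity>" by (simp add: emeasure_lborel_Icc_eq)
  finally show "emeasure lborel A < \<infinity>" .
next
  show "AE r in lborel. r \<in> A \<longrightarrow> norm (indicator A r *\<^sub>R f r) \<le> B"
    using assms(2,3) by (intro AE_I2) auto
qed (use assms in \<open>auto simp: indicator_def\<close>)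

lemma set_integral_nonneg:
  fixes f :: "'b \<Rightarrow> real"
  shows "(\<And>x. x \<in> A \<Longrightarrow> 0 \<le> f x) \<Longrightarrow> 0 \<le> (LINT x:A|L. f x)"
  unfolding set_lebesgue_integral_def by (intro integral_nonneg_AE AE_I2) (auto simp: indicator_def)

section \<open>One path: limits of the terms in the discretised product formula\<close>

locale path_approximation =
  fixes T \<beta> c :: real and X J :: "real \<Rightarrow> complex" and w :: "real \<Rightarrow> real" and h Jn :: "nat \<Rightarrow> real \<Rightarrow> complex"
    and N :: "nat \<Rightarrow> nat" and t :: "nat \<Rightarrow> nat \<Rightarrow> real" and \<delta> :: "nat \<Rightarrow> real"
  assumes T: "T > 0"
    and X_cadlag: "cadlag (\<lambda>r. Re (X r))" "cadlag (\<lambda>r. Im (X r))"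
    and w: "continuous_on {0..} w"
    and sub: "\<And>n. subdivision T (N n) (t n)"
    and mesh: "\<And>n i. i < N n \<Longrightarrow> t n (Suc i) - t n i \<le> 1 / real (Suc n)"
    and h: "\<And>n i r. i < N n \<Longrightarrow> t n i < r \<Longrightarrow> r \<le> t n (Suc i) \<Longrightarrow> h n r = h n (t n (Suc i))"
    and h_lim: "(\<lambda>n. \<integral>\<^sup>+r\<in>{0<..T}. ennreal ((norm (h n r - X r))\<^sup>2) \<partial>lborel) \<longlonglongrightarrow> 0"
    and \<delta>: "\<delta> \<longlonglongrightarrow> 0" "\<And>n r. r \<in> {0..T} \<Longrightarrow> norm (Jn n r - J r) \<le> \<delta> n"
begin

definition E :: "real \<Rightarrow> complex" where "E r = complex_of_real (exp (\<beta> * r)) * cis (- c * w r)"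

text \<open>The stochastic part \<open>\<i> * c * J\<close> of \<open>X\<close> is exchanged for its
  elementary approximation, whose increment over a cell is an exact multiple of the increment of
  \<open>w\<close>. This is what makes \<open>Xn_telescope\<close> an identity.\<close>

definition Xn :: "nat \<Rightarrow> real \<Rightarrow> complex" where "Xn n r = X r + \<i> * c * (Jn n r - J r)"

abbreviation fl :: "nat \<Rightarrow> real \<Rightarrow> real" where "fl n \<equiv> subdivision_floor (N n) (t n)"

abbreviation step :: "nat \<Rightarrow> nat \<Rightarrow> real" where "step n i \<equiv> t n (Suc i) - t n i"

definition k :: "nat \<Rightarrow> nat \<Rightarrow> complex" where "k n i = h n (t n (Suc i))"

lemma h_eq_k: "i < N n \<Longrightarrow> t n i < r \<Longrightarrow> r \<le> t n (Suc i) \<Longrightarrow> h n r = k n i"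
  unfolding k_def by (rule h)

lemma step_pos: "i < N n \<Longrightarrow> 0 < step n i"
  using sub[of n] by (auto simp: subdivision_def)

lemma sum_step: "(\<Sum>i<N n. step n i) = T"
  using sum_lessThan_telescope[of "t n" "N n"] sub[of n] by (auto simp: subdivision_def)

lemma norm_E: "r \<in> {0..T} \<Longrightarrow> norm (E r) \<le> exp (\<bar>\<beta>\<bar> * T)"
proof -
  assume r: "r \<in> {0..T}"
  have "\<beta> * r \<le> \<bar>\<beta>\<bar> * T" using r by (intro mult_mono) auto
  then show ?thesis by (simp add: E_def norm_mult)
qed

lemma X_bounded: "\<exists>B\<ge>0. \<forall>r\<in>{0..T}. norm (X r) \<le> B"
  by (rule complex_cadlag[OF X_cadlag])

lemma X_integrable: "set_integrable lborel {0<..T} X" "set_integrable lborel {0<..T} (\<lambda>r. (norm (X r))\<^sup>2)"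
proof -
  obtain B where B: "B \<ge> 0" "\<And>r. r \<in> {0..T} \<Longrightarrow> norm (X r) \<le> B" using X_bounded by blast
  note [measurable] = complex_cadlag(2)[OF X_cadlag]
  show "set_integrable lborel {0<..T} X"
    using B by (intro set_integrable_bounded[where T = T and B = B]) auto
  show "set_integrable lborel {0<..T} (\<lambda>r. (norm (X r))\<^sup>2)"
    using B by (intro set_integrable_bounded[where T = T and B = "B\<^sup>2"]) (auto intro: power_mono)
qed

lemma step_integral:
  fixes f :: "nat \<Rightarrow> 'b::{banach, second_countable_topology}"
  assumes "\<And>i r. i < N n \<Longrightarrow> t n i < r \<Longrightarrow> r \<le> t n (Suc i) \<Longrightarrow> \<phi> r = f i"
  shows "set_integrable lborel {0<..T} \<phi>" "(LINT r:{0<..T}|lborel. \<phi> r) = (\<Sum>i<N n. step n i *\<^sub>R f i)"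
  using set_integral_step[OF sub[of n], of \<phi> f] assms by blast+

lemma h_X_integrable: "set_integrable lborel {0<..T} (\<lambda>r. h n r - X r)"
    "set_integrable lborel {0<..T} (\<lambda>r. (norm (h n r - X r))\<^sup>2)"
proof -
  have h1: "set_integrable lborel {0<..T} (h n)"
    by (rule step_integral[where f = "k n" and n = n]) (rule h_eq_k)
  show 1: "set_integrable lborel {0<..T} (\<lambda>r. h n r - X r)"
    by (intro set_integral_diff h1 X_integrable)
  have h2: "set_integrable lborel {0<..T} (\<lambda>r. (norm (h n r))\<^sup>2)"
    by (rule step_integral[where f = "\<lambda>i. (norm (k n i))\<^sup>2" and n = n]) (simp add: h_eq_k)
  have "set_integrable lborel {0<..T} (\<lambda>r. 2 * (norm (h n r))\<^sup>2 + 2 * (norm (X r))\<^sup>2)"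
    by (intro set_integral_add set_integrable_mult_right h2 X_integrable)
  moreover have "set_borel_measurable lborel {0<..T} (\<lambda>r. (norm (h n r - X r))\<^sup>2)"
  proof -
    have "(\<lambda>r. indicator {0<..T} r *\<^sub>R (h n r - X r)) \<in> borel_measurable lborel"
      using 1 by (auto simp: set_integrable_def)
    then have "(\<lambda>r. (norm (indicator {0<..T} r *\<^sub>R (h n r - X r)))\<^sup>2) \<in> borel_measurable lborel"
      by measurable
    moreover have "(norm (indicator {0<..T} r *\<^sub>R (h n r - X r)))\<^sup>2 = indicator {0<..T} r *\<^sub>R (norm (h n r - X r))\<^sup>2" for r
      by (simp add: indicator_def)
    ultimately show ?thesis by (simp add: set_borel_measurable_def)
  qed
  ultimately show "set_integrable lborel {0<..T} (\<lambda>r. (norm (h n r - X r))\<^sup>2)"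
    by (rule set_integrable_bound) (simp add: norm_square_diff_le)
qed

lemma h_lim': "(\<lambda>n. LINT r:{0<..T}|lborel. (norm (h n r - X r))\<^sup>2) \<longlonglongrightarrow> 0"
proof -
  have "(\<integral>\<^sup>+r\<in>{0<..T}. ennreal ((norm (h n r - X r))\<^sup>2) \<partial>lborel) =
      ennreal (LINT r:{0<..T}|lborel. (norm (h n r - X r))\<^sup>2)" for n
  proof -
    have "(\<integral>\<^sup>+r\<in>{0<..T}. ennreal ((norm (h n r - X r))\<^sup>2) \<partial>lborel) =
       (\<integral>\<^sup>+r. ennreal (indicator {0<..T} r *\<^sub>R (norm (h n r - X r))\<^sup>2) \<partial>lborel)"
      by (intro nn_integral_cong) (auto simp: indicator_def)
    also have "\<dots> = ennreal (LINT r:{0<..T}|lborel. (norm (h n r - X r))\<^sup>2)"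
      unfolding set_lebesgue_integral_def
      using h_X_integrable(2)[of n] by (intro nn_integral_eq_integral) (auto simp: set_integrable_def)
    finally show ?thesis .
  qed
  then have "(\<lambda>n. ennreal (LINT r:{0<..T}|lborel. (norm (h n r - X r))\<^sup>2)) \<longlonglongrightarrow> ennreal 0"
    using h_lim by simp
  then show ?thesis
    by (subst (asm) tendsto_ennreal_iff) (auto intro!: always_eventually set_integral_nonneg)
qed

lemma h_lim_L1: "(\<lambda>n. LINT r:{0<..T}|lborel. norm (h n r - X r)) \<longlonglongrightarrow> 0"
proof (rule tendsto_0_interpolate[OF _ _ h_lim' T])
  fix n and \<eta> :: real assume \<eta>: "\<eta> > 0"
  have "(LINT r:{0<..T}|lborel. norm (h n r - X r)) \<le> (LINT r:{0<..T}|lborel. \<eta> + (norm (h n r - X r))\<^sup>2 / \<eta>)"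
    using \<eta> h_X_integrable[of n] T
    by (intro set_integral_mono set_integral_add set_integrable_divide set_integrable_norm le_interpolate)
       (auto simp: set_integrable_def)
  also have "\<dots> = \<eta> * T + (LINT r:{0<..T}|lborel. (norm (h n r - X r))\<^sup>2) / \<eta>"
    using h_X_integrable[of n] T \<eta>
    by (subst set_integral_add) (auto simp: set_integrable_def set_lebesgue_integral_def mult.commute)
  finally show "(LINT r:{0<..T}|lborel. norm (h n r - X r)) \<le> \<eta> * T + (LINT r:{0<..T}|lborel. (norm (h n r - X r))\<^sup>2) / \<eta>" .
qed (auto intro!: set_integral_nonneg)

lemma X_floor_lim: "(\<lambda>n. LINT r:{0<..T}|lborel. (norm (X (fl n r) - X r))\<^sup>2) \<longlonglongrightarrow> 0"
proof -
  obtain B where B: "B \<ge> 0" "\<And>r. r \<in> {0..T} \<Longrightarrow> norm (X r) \<le> B" using X_bounded by blast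
  have meas: "(\<lambda>r. indicator {0<..T} r *\<^sub>R (norm (X (fl n r) - X r))\<^sup>2) \<in> borel_measurable lborel" for n
  proof -
    have "set_integrable lborel {0<..T} (\<lambda>r. X (fl n r))"
      by (rule step_integral[where f = "\<lambda>i. X (t n i)" and n = n]) (simp add: subdivision_floor_eq[OF sub])
    then have "set_integrable lborel {0<..T} (\<lambda>r. X (fl n r) - X r)"
      by (intro set_integral_diff X_integrable)
    then have m: "(\<lambda>r. indicator {0<..T} r *\<^sub>R (X (fl n r) - X r)) \<in> borel_measurable lborel"
      by (auto simp: set_integrable_def)
    have "(\<lambda>r. (norm (indicator {0<..T} r *\<^sub>R (X (fl n r) - X r)))\<^sup>2) \<in> borel_measurable lborel"
      by (rule measurable_compose[OF m]) measurable
    moreover have "(norm (indicator {0<..T} r *\<^sub>R (X (fl n r) - X r)))\<^sup>2 = indicator {0<..T} r *\<^sub>R (norm (X (fl n r) - X r))\<^sup>2" for r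
      by (simp add: indicator_def)
    ultimately show ?thesis by simp
  qed
  have wint: "integrable lborel (\<lambda>r. indicator {0<..T} r *\<^sub>R (4 * B\<^sup>2))"
    by (intro integrable_scaleR_left integrable_real_indicator) (use T in auto)
  have "(\<lambda>n. LINT r|lborel. indicator {0<..T} r *\<^sub>R (norm (X (fl n r) - X r))\<^sup>2) \<longlonglongrightarrow> (LINT (r::real)|lborel. (0::real))"
  proof (rule integral_dominated_convergence[OF _ _ wint])
    show "AE r in lborel. (\<lambda>n. indicator {0<..T} r *\<^sub>R (norm (X (fl n r) - X r))\<^sup>2) \<longlonglongrightarrow> 0"
      using complex_cadlag(3)[OF X_cadlag]
    proof eventually_elim
      case (elim r)
      show ?case
      proof (cases "r \<in> {0<..T}")
        case True
        then have r: "0 < r" "r \<le> T" by auto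
        have "(\<lambda>n. X (fl n r)) \<longlonglongrightarrow> X r"
          using elim r subdivision_floor_tendsto[OF sub mesh r] by (intro tendsto_at_left_sequence[of X]) auto
        then have "(\<lambda>n. (norm (X (fl n r) - X r))\<^sup>2) \<longlonglongrightarrow> (norm (X r - X r))\<^sup>2"
          by (intro tendsto_intros)
        then show ?thesis using True by simp
      qed auto
    qed
    fix n
    show "AE r in lborel. norm (indicator {0<..T} r *\<^sub>R (norm (X (fl n r) - X r))\<^sup>2) \<le> indicator {0<..T} r *\<^sub>R (4 * B\<^sup>2)"
    proof (rule AE_I2)
      fix r
      show "norm (indicator {0<..T} r *\<^sub>R (norm (X (fl n r) - X r))\<^sup>2) \<le> indicator {0<..T} r *\<^sub>R (4 * B\<^sup>2)"
      proof (cases "r \<in> {0<..T}")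
        case True
        then have r: "0 < r" "r \<le> T" by auto
        have "norm (X (fl n r) - X r) \<le> B + B"
          using r subdivision_floor_tendsto(3)[OF sub mesh r, of n]
          by (intro order_trans[OF norm_triangle_ineq4] add_mono B) auto
        then have "(norm (X (fl n r) - X r))\<^sup>2 \<le> (B + B)\<^sup>2" by (intro power_mono) auto
        then show ?thesis using True by (simp add: power2_eq_square algebra_simps)
      qed auto
    qed
  qed (use meas in auto)
  then show ?thesis by (simp add: set_lebesgue_integral_def)
qed

lemma X_floor_integrable: "set_integrable lborel {0<..T} (\<lambda>r. (norm (X (fl n r) - X r))\<^sup>2)"
proof -
  obtain B where B: "B \<ge> 0" "\<And>r. r \<in> {0..T} \<Longrightarrow> norm (X r) \<le> B" using X_bounded by blast
  have "set_integrable lborel {0<..T} (\<lambda>r. X (fl n r))"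
    by (rule step_integral[where f = "\<lambda>i. X (t n i)" and n = n]) (simp add: subdivision_floor_eq[OF sub])
  then have "set_integrable lborel {0<..T} (\<lambda>r. X (fl n r) - X r)"
    by (intro set_integral_diff X_integrable)
  then have m0: "(\<lambda>r. indicator {0<..T} r *\<^sub>R (X (fl n r) - X r)) \<in> borel_measurable lborel"
    by (auto simp: set_integrable_def)
  have m: "(\<lambda>r. (norm (indicator {0<..T} r *\<^sub>R (X (fl n r) - X r)))\<^sup>2) \<in> borel_measurable lborel"
    by (rule measurable_compose[OF m0]) measurable
  have eq: "(norm (indicator {0<..T} r *\<^sub>R (X (fl n r) - X r)))\<^sup>2 = indicator {0<..T} r *\<^sub>R (norm (X (fl n r) - X r))\<^sup>2" for r
    by (simp add: indicator_def)
  show ?thesis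
    unfolding set_integrable_def
  proof (rule integrableI_bounded_set[where A = "{0<..T}" and B = "(B + B)\<^sup>2"])
    show "AE r in lborel. r \<in> {0<..T} \<longrightarrow> norm (indicator {0<..T} r *\<^sub>R (norm (X (fl n r) - X r))\<^sup>2) \<le> (B + B)\<^sup>2"
    proof (rule AE_I2, rule impI)
      fix r assume "r \<in> {0<..T}"
      then have r: "0 < r" "r \<le> T" by auto
      have "norm (X (fl n r) - X r) \<le> B + B"
        using r subdivision_floor_tendsto(3)[OF sub mesh r, of n]
        by (intro order_trans[OF norm_triangle_ineq4] add_mono B) auto
      then have "(norm (X (fl n r) - X r))\<^sup>2 \<le> (B + B)\<^sup>2" by (intro power_mono) auto
      then show "norm (indicator {0<..T} r *\<^sub>R (norm (X (fl n r) - X r))\<^sup>2) \<le> (B + B)\<^sup>2" using r by simp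
    qed
  qed (use m[unfolded eq] T in auto)
qed

text \<open>Left end points are used in order to keep the coefficients adapted; a cadlag path has only countably
  many jumps, so this does not matter in the limit.\<close>

lemma error_sum_lim: "(\<lambda>n. \<Sum>i<N n. (norm (Xn n (t n i) - k n i))\<^sup>2 * step n i) \<longlonglongrightarrow> 0"
proof -
  define a where "a n = (LINT r:{0<..T}|lborel. (norm (X (fl n r) - X r))\<^sup>2)" for n
  define b where "b n = (LINT r:{0<..T}|lborel. (norm (h n r - X r))\<^sup>2)" for n
  \<comment> \<open>The error splits into the lag of the left end point, the approximation error of
    \<open>h\<close> and the exchanged stochastic part; using \<open>norm_square_add_le\<close> and
    \<open>norm_square_diff_le\<close> in turn gives the factors 2 and 4.\<close>
  have le: "(\<Sum>i<N n. (norm (Xn n (t n i) - k n i))\<^sup>2 * step n i) \<le> 4 * a n + 4 * b n + 2 * (c * \<delta> n)\<^sup>2 * T" for n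
  proof -
    have s: "set_integrable lborel {0<..T} (\<lambda>r. (norm (Xn n (fl n r) - h n r))\<^sup>2)"
        "(LINT r:{0<..T}|lborel. (norm (Xn n (fl n r) - h n r))\<^sup>2) = (\<Sum>i<N n. step n i *\<^sub>R (norm (Xn n (t n i) - k n i))\<^sup>2)"
      using step_integral[of n "\<lambda>r. (norm (Xn n (fl n r) - h n r))\<^sup>2" "\<lambda>i. (norm (Xn n (t n i) - k n i))\<^sup>2"]
      by (simp_all add: subdivision_floor_eq[OF sub] h_eq_k)
    have "(\<Sum>i<N n. (norm (Xn n (t n i) - k n i))\<^sup>2 * step n i) = (LINT r:{0<..T}|lborel. (norm (Xn n (fl n r) - h n r))\<^sup>2)"
      using s(2) by (simp add: mult.commute)
    also have "\<dots> \<le> (LINT r:{0<..T}|lborel. 4 * (norm (X (fl n r) - X r))\<^sup>2 + 4 * (norm (h n r - X r))\<^sup>2 + 2 * (c * \<delta> n)\<^sup>2)"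
    proof (rule set_integral_mono[OF s(1)])
      show "set_integrable lborel {0<..T} (\<lambda>r. 4 * (norm (X (fl n r) - X r))\<^sup>2 + 4 * (norm (h n r - X r))\<^sup>2 + 2 * (c * \<delta> n)\<^sup>2)"
        using X_floor_integrable h_X_integrable T
        by (intro set_integral_add set_integrable_mult_right) (auto simp: set_integrable_def)
      fix r assume "r \<in> {0<..T}"
      then have r: "0 < r" "r \<le> T" by auto
      have "(norm (Jn n (fl n r) - J (fl n r)))\<^sup>2 \<le> (\<delta> n)\<^sup>2"
        using \<delta>(2) subdivision_floor_tendsto(3)[OF sub mesh r] by (intro power_mono) auto
      then have 1: "(norm (\<i> * c * (Jn n (fl n r) - J (fl n r))))\<^sup>2 \<le> (c * \<delta> n)\<^sup>2"
        by (simp add: norm_mult power_mult_distrib mult_left_mono)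
      have "Xn n (fl n r) - h n r = ((X (fl n r) - X r) - (h n r - X r)) + \<i> * c * (Jn n (fl n r) - J (fl n r))"
        by (simp add: Xn_def)
      then have "(norm (Xn n (fl n r) - h n r))\<^sup>2 \<le> 2 * (norm ((X (fl n r) - X r) - (h n r - X r)))\<^sup>2 + 2 * (norm (\<i> * c * (Jn n (fl n r) - J (fl n r))))\<^sup>2"
        using norm_square_add_le by metis
      then show "(norm (Xn n (fl n r) - h n r))\<^sup>2 \<le> 4 * (norm (X (fl n r) - X r))\<^sup>2 + 4 * (norm (h n r - X r))\<^sup>2 + 2 * (c * \<delta> n)\<^sup>2"
        using norm_square_diff_le[of "X (fl n r) - X r" "h n r - X r"] 1 by linarith
    qed
    also have "\<dots> = 4 * a n + 4 * b n + 2 * (c * \<delta> n)\<^sup>2 * T"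
    proof -
      have const: "set_integrable lborel {0<..T} (\<lambda>r. 2 * (c * \<delta> n)\<^sup>2)"
        "(LINT r:{0<..T}|lborel. 2 * (c * \<delta> n)\<^sup>2) = 2 * (c * \<delta> n)\<^sup>2 * T"
        using T by (simp_all add: set_integrable_def set_lebesgue_integral_def)
      show ?thesis
        using X_floor_integrable[of n] h_X_integrable(2)[of n] const
        by (subst set_integral_add set_integral_mult_right | intro set_integral_add set_integrable_mult_right)+ (simp_all add: a_def b_def)
    qed
    finally show ?thesis .
  qed
  have "(\<lambda>n. 4 * a n + 4 * b n + 2 * (c * \<delta> n)\<^sup>2 * T) \<longlonglongrightarrow> 4 * 0 + 4 * 0 + 2 * (c * 0)\<^sup>2 * T"
    unfolding a_def b_def by (intro tendsto_intros X_floor_lim h_lim' \<delta>)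
  then have "(\<lambda>n. 4 * a n + 4 * b n + 2 * (c * \<delta> n)\<^sup>2 * T) \<longlonglongrightarrow> 0" by simp
  then show ?thesis
  proof (rule tendsto_sandwich[OF _ _ tendsto_const, rotated 2])
    show "\<forall>\<^sub>F n in sequentially. 0 \<le> (\<Sum>i<N n. (norm (Xn n (t n i) - k n i))\<^sup>2 * step n i)"
      using step_pos by (intro always_eventually allI sum_nonneg mult_nonneg_nonneg) (auto intro: less_imp_le)
  qed (use le in \<open>auto intro!: always_eventually\<close>)
qed

lemma h_square_bounded: "\<exists>B. \<forall>n. (\<Sum>i<N n. (norm (k n i))\<^sup>2 * step n i) \<le> B"
proof -
  define b where "b n = (LINT r:{0<..T}|lborel. (norm (h n r - X r))\<^sup>2)" for n
  obtain C where C: "\<And>n. b n \<le> C"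
  proof -
    have "Bseq b" unfolding b_def using h_lim' by (intro convergent_imp_Bseq convergentI)
    then obtain K where "\<And>n. norm (b n) \<le> K" by (auto simp: Bseq_def)
    then show thesis using that[of K] by (auto simp: abs_le_iff)
  qed
  have "(\<Sum>i<N n. (norm (k n i))\<^sup>2 * step n i) \<le> 2 * C + 2 * (LINT r:{0<..T}|lborel. (norm (X r))\<^sup>2)" for n
  proof -
    have s: "set_integrable lborel {0<..T} (\<lambda>r. (norm (h n r))\<^sup>2)"
        "(LINT r:{0<..T}|lborel. (norm (h n r))\<^sup>2) = (\<Sum>i<N n. step n i *\<^sub>R (norm (k n i))\<^sup>2)"
      using step_integral[of n "\<lambda>r. (norm (h n r))\<^sup>2" "\<lambda>i. (norm (k n i))\<^sup>2"] by (simp_all add: h_eq_k)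
    have "(\<Sum>i<N n. (norm (k n i))\<^sup>2 * step n i) = (LINT r:{0<..T}|lborel. (norm (h n r))\<^sup>2)"
      using s(2) by (simp add: mult.commute)
    also have "\<dots> \<le> (LINT r:{0<..T}|lborel. 2 * (norm (h n r - X r))\<^sup>2 + 2 * (norm (X r))\<^sup>2)"
    proof (intro set_integral_mono set_integral_add set_integrable_mult_right s(1) h_X_integrable X_integrable)
      fix r
      show "(norm (h n r))\<^sup>2 \<le> 2 * (norm (h n r - X r))\<^sup>2 + 2 * (norm (X r))\<^sup>2"
        using norm_square_add_le[of "h n r - X r" "X r"] by simp
    qed
    also have "\<dots> = 2 * b n + 2 * (LINT r:{0<..T}|lborel. (norm (X r))\<^sup>2)"
      using h_X_integrable[of n] X_integrable by (simp add: set_integral_add b_def)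
    finally show ?thesis using C[of n] by simp
  qed
  then show ?thesis by blast
qed

lemma E_continuous: "continuous_on {0..} E"
  unfolding E_def[abs_def] by (intro continuous_intros w)

text \<open>The difference to the limit is the integral of \<open>(E (fl n r) - E r) * X r\<close>,
  which vanishes by continuity of \<open>E\<close> and dominated convergence, plus that of
  \<open>E (fl n r) * (h n r - X r)\<close>, which vanishes because \<open>E\<close> is bounded and
  \<open>h\<close> converges in mean.\<close>

lemma drift_sum_lim: "(\<lambda>n. \<Sum>i<N n. E (t n i) * k n i * step n i) \<longlonglongrightarrow> (LINT r:{0<..T}|lborel. E r * X r)"
proof -
  define K where "K = exp (\<bar>\<beta>\<bar> * T)"
  obtain B where B: "B \<ge> 0" "\<And>r. r \<in> {0..T} \<Longrightarrow> norm (X r) \<le> B" using X_bounded by blast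
  have s: "set_integrable lborel {0<..T} (\<lambda>r. E (fl n r) * h n r)"
    "(LINT r:{0<..T}|lborel. E (fl n r) * h n r) = (\<Sum>i<N n. E (t n i) * k n i * step n i)" for n
    using step_integral[of n "\<lambda>r. E (fl n r) * h n r" "\<lambda>i. E (t n i) * k n i"]
    by (simp_all add: subdivision_floor_eq[OF sub] h_eq_k scaleR_conv_of_real mult_ac)
  have [measurable]: "(\<lambda>r. E (max 0 r)) \<in> borel_measurable borel"
    by (intro borel_measurable_continuous_onI continuous_on_compose2[OF E_continuous] continuous_intros) auto
  note [measurable] = complex_cadlag(2)[OF X_cadlag]
  have EX: "set_integrable lborel {0<..T} (\<lambda>r. E r * X r)"
    using B norm_E by (intro set_integrable_bounded[where T = T and B = "K * B"]) (auto simp: norm_mult K_def intro!: mult_mono)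
  have E_fl: "set_integrable lborel {0<..T} (\<lambda>r. E (fl n r))" for n
    using step_integral(1)[of n "\<lambda>r. E (fl n r)" "\<lambda>i. E (t n i)"] by (simp add: subdivision_floor_eq[OF sub])
  have meas: "(\<lambda>r. indicator {0<..T} r *\<^sub>R ((E (fl n r) - E r) * X r)) \<in> borel_measurable lborel" for n
  proof -
    have "(\<lambda>r. (indicator {0<..T} r *\<^sub>R E (fl n r) - indicator {0<..T} r *\<^sub>R E (max 0 r)) * X (max 0 r)) \<in> borel_measurable lborel"
      using E_fl[of n] by (auto simp: set_integrable_def)
    moreover have "(indicator {0<..T} r *\<^sub>R E (fl n r) - indicator {0<..T} r *\<^sub>R E (max 0 r)) * X (max 0 r) =
        indicator {0<..T} r *\<^sub>R ((E (fl n r) - E r) * X r)" for r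
      by (simp add: indicator_def max_def)
    ultimately show ?thesis by simp
  qed
  have bound: "norm (indicator {0<..T} r *\<^sub>R ((E (fl n r) - E r) * X r)) \<le> indicator {0<..T} r *\<^sub>R ((K + K) * B)" for n r
  proof (cases "r \<in> {0<..T}")
    case True
    then have r: "0 < r" "r \<le> T" by auto
    have "norm (E (fl n r) - E r) \<le> K + K"
      using norm_E r subdivision_floor_tendsto(3)[OF sub mesh r, of n] unfolding K_def
      by (intro order_trans[OF norm_triangle_ineq4] add_mono) auto
    then have "norm ((E (fl n r) - E r) * X r) \<le> (K + K) * B"
      using B r by (auto simp: norm_mult K_def intro!: mult_mono)
    then show ?thesis using True by simp
  qed auto
  have wint: "integrable lborel (\<lambda>r. indicator {0<..T} r *\<^sub>R ((K + K) * B))"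
    by (intro integrable_scaleR_left integrable_real_indicator) (use T in auto)
  have EE: "set_integrable lborel {0<..T} (\<lambda>r. (E (fl n r) - E r) * X r)" for n
    unfolding set_integrable_def
    by (rule Bochner_Integration.integrable_bound[OF wint meas], rule AE_I2)
      (metis bound order_trans real_norm_def abs_ge_self)
  have "(\<lambda>n. LINT r|lborel. indicator {0<..T} r *\<^sub>R ((E (fl n r) - E r) * X r)) \<longlonglongrightarrow> (LINT (r::real)|lborel. (0::complex))"
  proof (rule integral_dominated_convergence[OF _ _ wint])
    show "AE r in lborel. (\<lambda>n. indicator {0<..T} r *\<^sub>R ((E (fl n r) - E r) * X r)) \<longlonglongrightarrow> 0"
    proof (rule AE_I2)
      fix r
      show "(\<lambda>n. indicator {0<..T} r *\<^sub>R ((E (fl n r) - E r) * X r)) \<longlonglongrightarrow> 0"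
      proof (cases "r \<in> {0<..T}")
        case True
        then have r: "0 < r" "r \<le> T" by auto
        have "(\<lambda>n. E (fl n r)) \<longlonglongrightarrow> E r"
          using r subdivision_floor_tendsto[OF sub mesh r] by (intro continuous_on_tendsto_compose[OF E_continuous]) auto
        then have "(\<lambda>n. (E (fl n r) - E r) * X r) \<longlonglongrightarrow> (E r - E r) * X r" by (intro tendsto_intros)
        then show ?thesis using True by simp
      qed auto
    qed
  qed (use meas bound in auto)
  then have lim1: "(\<lambda>n. LINT r:{0<..T}|lborel. (E (fl n r) - E r) * X r) \<longlonglongrightarrow> 0"
    by (simp add: set_lebesgue_integral_def)
  have Eh: "set_integrable lborel {0<..T} (\<lambda>r. E (fl n r) * (h n r - X r))" for n
  proof -
    have "set_integrable lborel {0<..T} (\<lambda>r. E (fl n r) * h n r - ((E (fl n r) - E r) * X r + E r * X r))"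
      by (intro set_integral_diff set_integral_add s EE EX)
    then show ?thesis by (simp add: algebra_simps)
  qed
  have lim2: "(\<lambda>n. LINT r:{0<..T}|lborel. E (fl n r) * (h n r - X r)) \<longlonglongrightarrow> 0"
  proof (rule Lim_null_comparison)
    show "(\<lambda>n. K * (LINT r:{0<..T}|lborel. norm (h n r - X r))) \<longlonglongrightarrow> 0"
      using tendsto_mult_left[OF h_lim_L1, of K] by simp
    have "norm (LINT r:{0<..T}|lborel. E (fl n r) * (h n r - X r)) \<le> K * (LINT r:{0<..T}|lborel. norm (h n r - X r))" for n
    proof -
      have "norm (LINT r:{0<..T}|lborel. E (fl n r) * (h n r - X r)) \<le> (LINT r:{0<..T}|lborel. norm (E (fl n r) * (h n r - X r)))"
        by (rule set_integral_norm_bound[OF Eh])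
      also have "\<dots> \<le> (LINT r:{0<..T}|lborel. K * norm (h n r - X r))"
      proof (intro set_integral_mono set_integrable_norm Eh set_integrable_mult_right h_X_integrable)
        fix r assume "r \<in> {0<..T}"
        then have r: "0 < r" "r \<le> T" by auto
        show "norm (E (fl n r) * (h n r - X r)) \<le> K * norm (h n r - X r)"
          using norm_E subdivision_floor_tendsto(3)[OF sub mesh r, of n] unfolding norm_mult K_def
          by (intro mult_right_mono) auto
      qed
      finally show ?thesis by simp
    qed
    then show "\<forall>\<^sub>F n in sequentially. norm (LINT r:{0<..T}|lborel. E (fl n r) * (h n r - X r)) \<le> K * (LINT r:{0<..T}|lborel. norm (h n r - X r))"
      by (intro always_eventually allI)
  qed
  have "(\<Sum>i<N n. E (t n i) * k n i * step n i) = (LINT r:{0<..T}|lborel. (E (fl n r) - E r) * X r) +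
      (LINT r:{0<..T}|lborel. E (fl n r) * (h n r - X r)) + (LINT r:{0<..T}|lborel. E r * X r)" for n
  proof -
    have "(\<Sum>i<N n. E (t n i) * k n i * step n i) = (LINT r:{0<..T}|lborel. E (fl n r) * h n r)"
      by (simp only: s(2))
    also have "\<dots> = (LINT r:{0<..T}|lborel. ((E (fl n r) - E r) * X r + E (fl n r) * (h n r - X r)) + E r * X r)"
      by (rule arg_cong[where f = "set_lebesgue_integral lborel _"]) (simp add: fun_eq_iff algebra_simps)
    also have "\<dots> = (LINT r:{0<..T}|lborel. (E (fl n r) - E r) * X r) +
      (LINT r:{0<..T}|lborel. E (fl n r) * (h n r - X r)) + (LINT r:{0<..T}|lborel. E r * X r)"
      using EE Eh EX by (simp add: set_integral_add)
    finally show ?thesis .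
  qed
  then show ?thesis
    using tendsto_add[OF tendsto_add[OF lim1 lim2] tendsto_const[of "LINT r:{0<..T}|lborel. E r * X r"]] by simp
qed

lemma error_L1_lim: "(\<lambda>n. \<Sum>i<N n. norm (Xn n (t n i) - k n i) * step n i) \<longlonglongrightarrow> 0"
proof (rule tendsto_0_interpolate[OF _ _ error_sum_lim T])
  fix n and \<eta> :: real assume \<eta>: "\<eta> > 0"
  have "(\<Sum>i<N n. norm (Xn n (t n i) - k n i) * step n i) \<le> (\<Sum>i<N n. (\<eta> + (norm (Xn n (t n i) - k n i))\<^sup>2 / \<eta>) * step n i)"
    using step_pos by (intro sum_mono mult_right_mono le_interpolate \<eta>) (auto intro: less_imp_le)
  also have "\<dots> = \<eta> * (\<Sum>i<N n. step n i) + (\<Sum>i<N n. (norm (Xn n (t n i) - k n i))\<^sup>2 * step n i) / \<eta>"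
    unfolding sum_distrib_left sum_divide_distrib by (simp add: sum.distrib[symmetric] distrib_right del: sum.distrib)
  finally show "(\<Sum>i<N n. norm (Xn n (t n i) - k n i) * step n i) \<le>
      \<eta> * T + (\<Sum>i<N n. (norm (Xn n (t n i) - k n i))\<^sup>2 * step n i) / \<eta>"
    unfolding sum_step .
qed (intro sum_nonneg mult_nonneg_nonneg norm_ge_zero, use step_pos in \<open>auto intro: less_imp_le\<close>)

lemma t_range: "i \<le> N n \<Longrightarrow> t n i \<in> {0..T}"
  by (rule subdivision_range[OF sub])

lemma growth_mean_sum_lim:
  assumes m: "\<And>n i. i < N n \<Longrightarrow> norm (m n i) \<le> K * step n i" and K: "K \<ge> 0"
  shows "(\<lambda>n. \<Sum>i<N n. E (t n i) * (Xn n (t n i) - k n i) * m n i) \<longlonglongrightarrow> 0"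
proof (rule Lim_null_comparison)
  show "(\<lambda>n. exp (\<bar>\<beta>\<bar> * T) * K * (\<Sum>i<N n. norm (Xn n (t n i) - k n i) * step n i)) \<longlonglongrightarrow> 0"
    using tendsto_mult_left[OF error_L1_lim, of "exp (\<bar>\<beta>\<bar> * T) * K"] by simp
  have "norm (\<Sum>i<N n. E (t n i) * (Xn n (t n i) - k n i) * m n i) \<le>
      exp (\<bar>\<beta>\<bar> * T) * K * (\<Sum>i<N n. norm (Xn n (t n i) - k n i) * step n i)" for n
    unfolding sum_distrib_left
  proof (rule order_trans[OF norm_sum], rule sum_mono)
    fix i assume i: "i \<in> {..<N n}"
    have "norm (E (t n i)) \<le> exp (\<bar>\<beta>\<bar> * T)" using i by (intro norm_E t_range) auto
    moreover have "norm (m n i) \<le> K * step n i" using m i by auto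
    ultimately have "norm (E (t n i)) * norm (Xn n (t n i) - k n i) * norm (m n i) \<le>
        exp (\<bar>\<beta>\<bar> * T) * norm (Xn n (t n i) - k n i) * (K * step n i)"
      using K step_pos[of i n] i by (intro mult_mono) auto
    then show "norm (E (t n i) * (Xn n (t n i) - k n i) * m n i) \<le> exp (\<bar>\<beta>\<bar> * T) * K * (norm (Xn n (t n i) - k n i) * step n i)"
      by (simp add: norm_mult mult_ac)
  qed
  then show "\<forall>\<^sub>F n in sequentially. norm (\<Sum>i<N n. E (t n i) * (Xn n (t n i) - k n i) * m n i) \<le>
      exp (\<bar>\<beta>\<bar> * T) * K * (\<Sum>i<N n. norm (Xn n (t n i) - k n i) * step n i)"
    by (intro always_eventually allI)
qed

text \<open>The error in the mean carries a surplus factor \<open>sqrt (step n i)\<close>, uniformly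
  small with the mesh. The remaining sum stays bounded because \<open>norm (k n i)\<close> is at
  most one plus its square and the squares are controlled by
  \<open>h_square_bounded\<close>.\<close>

lemma drift_mean_sum_lim:
  assumes d: "\<And>n i. i < N n \<Longrightarrow> norm (d n i - complex_of_real \<gamma> * step n i) \<le> K * step n i * sqrt (step n i)" and K: "K \<ge> 0"
  shows "(\<lambda>n. \<Sum>i<N n. E (t n i) * k n i * d n i) \<longlonglongrightarrow> \<gamma> * (LINT r:{0<..T}|lborel. E r * X r)"
proof -
  obtain B where B: "\<And>n. (\<Sum>i<N n. (norm (k n i))\<^sup>2 * step n i) \<le> B" using h_square_bounded by blast
  have "(\<lambda>n. \<Sum>i<N n. E (t n i) * k n i * (d n i - complex_of_real \<gamma> * step n i)) \<longlonglongrightarrow> 0"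
  proof (rule Lim_null_comparison)
    have "(\<lambda>n. exp (\<bar>\<beta>\<bar> * T) * K * sqrt (1 / real (Suc n)) * (T + B)) \<longlonglongrightarrow> exp (\<bar>\<beta>\<bar> * T) * K * sqrt 0 * (T + B)"
      by (intro tendsto_intros LIMSEQ_Suc[OF lim_1_over_n])
    then show "(\<lambda>n. exp (\<bar>\<beta>\<bar> * T) * K * sqrt (1 / real (Suc n)) * (T + B)) \<longlonglongrightarrow> 0" by simp
    have "norm (\<Sum>i<N n. E (t n i) * k n i * (d n i - complex_of_real \<gamma> * step n i)) \<le>
        exp (\<bar>\<beta>\<bar> * T) * K * sqrt (1 / real (Suc n)) * (T + B)" for n
    proof -
      have "norm (\<Sum>i<N n. E (t n i) * k n i * (d n i - complex_of_real \<gamma> * step n i)) \<le>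
          (\<Sum>i<N n. exp (\<bar>\<beta>\<bar> * T) * K * sqrt (1 / real (Suc n)) * (step n i + (norm (k n i))\<^sup>2 * step n i))"
      proof (rule order_trans[OF norm_sum], rule sum_mono)
        fix i assume i: "i \<in> {..<N n}"
        have E: "norm (E (t n i)) \<le> exp (\<bar>\<beta>\<bar> * T)" using i by (intro norm_E t_range) auto
        have pos: "step n i > 0" using step_pos i by auto
        have "norm (d n i - complex_of_real \<gamma> * step n i) \<le> K * step n i * sqrt (step n i)" using d i by auto
        also have "\<dots> \<le> K * step n i * sqrt (1 / real (Suc n))"
          using mesh[of i n] i K pos by (intro mult_left_mono real_sqrt_le_mono) auto
        finally have 1: "norm (d n i - complex_of_real \<gamma> * step n i) \<le> K * step n i * sqrt (1 / real (Suc n))" .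
        have k: "norm (k n i) \<le> 1 + (norm (k n i))\<^sup>2" using le_interpolate[of 1 "norm (k n i)"] by simp
        have "norm (E (t n i)) * norm (k n i) * norm (d n i - complex_of_real \<gamma> * step n i) \<le>
            exp (\<bar>\<beta>\<bar> * T) * (1 + (norm (k n i))\<^sup>2) * (K * step n i * sqrt (1 / real (Suc n)))"
          by (intro mult_mono E k 1) auto
        then show "norm (E (t n i) * k n i * (d n i - complex_of_real \<gamma> * step n i)) \<le>
            exp (\<bar>\<beta>\<bar> * T) * K * sqrt (1 / real (Suc n)) * (step n i + (norm (k n i))\<^sup>2 * step n i)"
          by (simp only: norm_mult distrib_left distrib_right mult_1_right mult_1_left mult_ac)
      qed
      also have "\<dots> = exp (\<bar>\<beta>\<bar> * T) * K * sqrt (1 / real (Suc n)) * (T + (\<Sum>i<N n. (norm (k n i))\<^sup>2 * step n i))"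
        unfolding sum_distrib_left[symmetric] sum.distrib sum_step ..
      also have "\<dots> \<le> exp (\<bar>\<beta>\<bar> * T) * K * sqrt (1 / real (Suc n)) * (T + B)"
        using B[of n] K by (intro mult_left_mono add_left_mono) auto
      finally show ?thesis .
    qed
    then show "\<forall>\<^sub>F n in sequentially. norm (\<Sum>i<N n. E (t n i) * k n i * (d n i - complex_of_real \<gamma> * step n i)) \<le>
        exp (\<bar>\<beta>\<bar> * T) * K * sqrt (1 / real (Suc n)) * (T + B)"
      by (intro always_eventually allI)
  qed
  from tendsto_add[OF this tendsto_mult_left[OF drift_sum_lim, of "complex_of_real \<gamma>"]]
  have "(\<lambda>n. (\<Sum>i<N n. E (t n i) * k n i * (d n i - complex_of_real \<gamma> * step n i)) +
      complex_of_real \<gamma> * (\<Sum>i<N n. E (t n i) * k n i * step n i)) \<longlonglongrightarrow> \<gamma> * (LINT r:{0<..T}|lborel. E r * X r)"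
    by simp
  moreover have "(\<Sum>i<N n. E (t n i) * k n i * (d n i - complex_of_real \<gamma> * step n i)) +
      complex_of_real \<gamma> * (\<Sum>i<N n. E (t n i) * k n i * step n i) = (\<Sum>i<N n. E (t n i) * k n i * d n i)" for n
    unfolding sum_distrib_left sum.distrib[symmetric] by (rule sum.cong) (simp_all add: algebra_simps)
  ultimately show ?thesis by simp
qed

lemma growth_variation_lim:
  assumes K: "K \<ge> 0"
  shows "(\<lambda>n. \<Sum>i<N n. (norm (E (t n i) * (Xn n (t n i) - k n i)))\<^sup>2 * (K * step n i)) \<longlonglongrightarrow> 0"
proof (rule tendsto_sandwich[OF _ _ tendsto_const])
  show "(\<lambda>n. (exp (\<bar>\<beta>\<bar> * T))\<^sup>2 * K * (\<Sum>i<N n. (norm (Xn n (t n i) - k n i))\<^sup>2 * step n i)) \<longlonglongrightarrow> 0"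
    using tendsto_mult_left[OF error_sum_lim, of "(exp (\<bar>\<beta>\<bar> * T))\<^sup>2 * K"] by simp
  have "(\<Sum>i<N n. (norm (E (t n i) * (Xn n (t n i) - k n i)))\<^sup>2 * (K * step n i)) \<le>
      (exp (\<bar>\<beta>\<bar> * T))\<^sup>2 * K * (\<Sum>i<N n. (norm (Xn n (t n i) - k n i))\<^sup>2 * step n i)" for n
    unfolding sum_distrib_left
  proof (rule sum_mono)
    fix i assume i: "i \<in> {..<N n}"
    have "norm (E (t n i)) \<le> exp (\<bar>\<beta>\<bar> * T)" using i by (intro norm_E t_range) auto
    then have "(norm (E (t n i)))\<^sup>2 \<le> (exp (\<bar>\<beta>\<bar> * T))\<^sup>2" by (intro power_mono) auto
    then have "(norm (E (t n i)))\<^sup>2 * ((norm (Xn n (t n i) - k n i))\<^sup>2 * (K * step n i)) \<le>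
        (exp (\<bar>\<beta>\<bar> * T))\<^sup>2 * ((norm (Xn n (t n i) - k n i))\<^sup>2 * (K * step n i))"
      using K step_pos[of i n] i by (intro mult_right_mono) auto
    then show "(norm (E (t n i) * (Xn n (t n i) - k n i)))\<^sup>2 * (K * step n i) \<le>
        (exp (\<bar>\<beta>\<bar> * T))\<^sup>2 * K * ((norm (Xn n (t n i) - k n i))\<^sup>2 * step n i)"
      by (simp only: norm_mult power_mult_distrib mult_ac)
  qed
  then show "\<forall>\<^sub>F n in sequentially. (\<Sum>i<N n. (norm (E (t n i) * (Xn n (t n i) - k n i)))\<^sup>2 * (K * step n i)) \<le>
      (exp (\<bar>\<beta>\<bar> * T))\<^sup>2 * K * (\<Sum>i<N n. (norm (Xn n (t n i) - k n i))\<^sup>2 * step n i)"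
    by (intro always_eventually allI)
  show "\<forall>\<^sub>F n in sequentially. 0 \<le> (\<Sum>i<N n. (norm (E (t n i) * (Xn n (t n i) - k n i)))\<^sup>2 * (K * step n i))"
    using K step_pos by (intro always_eventually allI sum_nonneg mult_nonneg_nonneg) (auto intro: less_imp_le)
qed

lemma drift_variation_lim:
  assumes K: "K \<ge> 0"
  shows "(\<lambda>n. \<Sum>i<N n. (norm (E (t n i) * k n i))\<^sup>2 * (K * (step n i)\<^sup>2)) \<longlonglongrightarrow> 0"
proof -
  obtain B where B: "\<And>n. (\<Sum>i<N n. (norm (k n i))\<^sup>2 * step n i) \<le> B" using h_square_bounded by blast
  show ?thesis
  proof (rule tendsto_sandwich[OF _ _ tendsto_const])
    have "(\<lambda>n. (exp (\<bar>\<beta>\<bar> * T))\<^sup>2 * K * (1 / real (Suc n)) * B) \<longlonglongrightarrow> (exp (\<bar>\<beta>\<bar> * T))\<^sup>2 * K * 0 * B"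
      by (intro tendsto_intros LIMSEQ_Suc[OF lim_1_over_n])
    then show "(\<lambda>n. (exp (\<bar>\<beta>\<bar> * T))\<^sup>2 * K * (1 / real (Suc n)) * B) \<longlonglongrightarrow> 0" by simp
    have "(\<Sum>i<N n. (norm (E (t n i) * k n i))\<^sup>2 * (K * (step n i)\<^sup>2)) \<le> (exp (\<bar>\<beta>\<bar> * T))\<^sup>2 * K * (1 / real (Suc n)) * B" for n
    proof -
      have "(\<Sum>i<N n. (norm (E (t n i) * k n i))\<^sup>2 * (K * (step n i)\<^sup>2)) \<le>
          (exp (\<bar>\<beta>\<bar> * T))\<^sup>2 * K * (1 / real (Suc n)) * (\<Sum>i<N n. (norm (k n i))\<^sup>2 * step n i)"
        unfolding sum_distrib_left
      proof (rule sum_mono)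
        fix i assume i: "i \<in> {..<N n}"
        have pos: "step n i > 0" using step_pos i by auto
        have "norm (E (t n i)) \<le> exp (\<bar>\<beta>\<bar> * T)" using i by (intro norm_E t_range) auto
        then have 1: "(norm (E (t n i)))\<^sup>2 \<le> (exp (\<bar>\<beta>\<bar> * T))\<^sup>2" by (intro power_mono) auto
        have 2: "(step n i)\<^sup>2 \<le> 1 / real (Suc n) * step n i"
          unfolding power2_eq_square using mesh[of i n] i pos by (intro mult_right_mono) auto
        have "(norm (E (t n i)))\<^sup>2 * ((norm (k n i))\<^sup>2 * (K * (step n i)\<^sup>2)) \<le>
            (exp (\<bar>\<beta>\<bar> * T))\<^sup>2 * ((norm (k n i))\<^sup>2 * (K * (1 / real (Suc n) * step n i)))"
          using K by (intro mult_mono 1 mult_left_mono 2) auto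
        then show "(norm (E (t n i) * k n i))\<^sup>2 * (K * (step n i)\<^sup>2) \<le>
            (exp (\<bar>\<beta>\<bar> * T))\<^sup>2 * K * (1 / real (Suc n)) * ((norm (k n i))\<^sup>2 * step n i)"
          by (simp only: norm_mult power_mult_distrib mult_ac)
      qed
      also have "\<dots> \<le> (exp (\<bar>\<beta>\<bar> * T))\<^sup>2 * K * (1 / real (Suc n)) * B"
        using B[of n] K by (intro mult_left_mono) auto
      finally show ?thesis .
    qed
    then show "\<forall>\<^sub>F n in sequentially. (\<Sum>i<N n. (norm (E (t n i) * k n i))\<^sup>2 * (K * (step n i)\<^sup>2)) \<le> (exp (\<bar>\<beta>\<bar> * T))\<^sup>2 * K * (1 / real (Suc n)) * B"
      by (intro always_eventually allI)
    show "\<forall>\<^sub>F n in sequentially. 0 \<le> (\<Sum>i<N n. (norm (E (t n i) * k n i))\<^sup>2 * (K * (step n i)\<^sup>2))"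
      using K by (intro always_eventually allI sum_nonneg mult_nonneg_nonneg) auto
  qed
qed

lemma Xn_lim: "r \<in> {0..T} \<Longrightarrow> (\<lambda>n. Xn n r) \<longlonglongrightarrow> X r"
proof -
  assume r: "r \<in> {0..T}"
  have "(\<lambda>n. Jn n r - J r) \<longlonglongrightarrow> 0"
    by (rule Lim_null_comparison[OF _ \<delta>(1)]) (intro always_eventually allI \<delta>(2) r)
  then have "(\<lambda>n. X r + \<i> * c * (Jn n r - J r)) \<longlonglongrightarrow> X r + \<i> * c * 0" by (intro tendsto_intros)
  then show ?thesis by (simp add: Xn_def)
qed

text \<open>Discrete product rule. Let \<open>q\<close> be the growth factor of a cell and
  \<open>dw\<close> the increment of \<open>w\<close>. There \<open>Xn\<close> gains the increment
  of \<open>X - \<i> * c * J\<close> plus \<open>\<i> * c * k * dw\<close>; adding and subtracting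
  \<open>k\<close> produces \<open>(Xn - k) * (q - 1)\<close> and
  \<open>k * (q * (1 + \<i> * c * dw) - 1)\<close>, both times \<open>E\<close>. Centring the two
  factors by \<open>m\<close> and \<open>d\<close> separates the martingale transforms, which vanish
  in the limit, from sums of means.\<close>

lemma Xn_telescope:
  assumes Jn: "\<And>i. i < N n \<Longrightarrow> Jn n (t n (Suc i)) - Jn n (t n i) = k n i * (w (t n (Suc i)) - w (t n i))"
  shows "E T * Xn n T - E 0 * Xn n 0 =
    (\<Sum>i<N n. E (t n i) * (Xn n (t n i) - k n i) * (growth \<beta> c (step n i) (w (t n (Suc i)) - w (t n i)) - 1 - m i)) +
    (\<Sum>i<N n. E (t n i) * k n i * (drift \<beta> c (step n i) (w (t n (Suc i)) - w (t n i)) - d i)) +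
    (\<Sum>i<N n. E (t n i) * (Xn n (t n i) - k n i) * m i) +
    (\<Sum>i<N n. E (t n i) * k n i * d i) +
    (\<Sum>i<N n. E (t n (Suc i)) * ((X (t n (Suc i)) - \<i> * c * J (t n (Suc i))) - (X (t n i) - \<i> * c * J (t n i))))"
proof -
  have E_Suc: "E (t n (Suc i)) = E (t n i) * growth \<beta> c (step n i) (w (t n (Suc i)) - w (t n i))" for i
  proof -
    have "exp (\<beta> * t n (Suc i)) = exp (\<beta> * t n i) * exp (\<beta> * step n i)"
      by (simp add: exp_add[symmetric] algebra_simps)
    moreover have "cis (- c * w (t n (Suc i))) = cis (- c * w (t n i)) * cis (- c * (w (t n (Suc i)) - w (t n i)))"
      by (simp add: cis_mult algebra_simps)
    ultimately show ?thesis by (simp add: E_def growth_def)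
  qed
  have "E T * Xn n T - E 0 * Xn n 0 = (\<Sum>i<N n. E (t n (Suc i)) * Xn n (t n (Suc i)) - E (t n i) * Xn n (t n i))"
    using sum_lessThan_telescope[of "\<lambda>i. E (t n i) * Xn n (t n i)" "N n"] sub[of n] by (simp add: subdivision_def)
  also have "\<dots> = (\<Sum>i<N n. E (t n i) * (Xn n (t n i) - k n i) * (growth \<beta> c (step n i) (w (t n (Suc i)) - w (t n i)) - 1 - m i) +
      E (t n i) * k n i * (drift \<beta> c (step n i) (w (t n (Suc i)) - w (t n i)) - d i) +
      E (t n i) * (Xn n (t n i) - k n i) * m i + E (t n i) * k n i * d i +
      E (t n (Suc i)) * ((X (t n (Suc i)) - \<i> * c * J (t n (Suc i))) - (X (t n i) - \<i> * c * J (t n i))))"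
  proof (rule sum.cong)
    fix i assume i: "i \<in> {..<N n}"
    define dw where "dw = w (t n (Suc i)) - w (t n i)"
    define q where "q = growth \<beta> c (step n i) dw"
    define Vd where "Vd = (X (t n (Suc i)) - \<i> * c * J (t n (Suc i))) - (X (t n i) - \<i> * c * J (t n i))"
    have "Jn n (t n (Suc i)) = Jn n (t n i) + k n i * dw" using Jn[of i] i by (simp add: dw_def algebra_simps)
    then have X: "Xn n (t n (Suc i)) = Xn n (t n i) + Vd + \<i> * c * (k n i * dw)"
      by (simp add: Xn_def Vd_def algebra_simps)
    have E: "E (t n (Suc i)) = E (t n i) * q" unfolding E_Suc q_def dw_def ..
    have dr: "drift \<beta> c (step n i) dw = q * (1 + \<i> * c * dw) - 1" by (simp add: drift_def q_def)
    show "E (t n (Suc i)) * Xn n (t n (Suc i)) - E (t n i) * Xn n (t n i) =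
      E (t n i) * (Xn n (t n i) - k n i) * (growth \<beta> c (step n i) (w (t n (Suc i)) - w (t n i)) - 1 - m i) +
      E (t n i) * k n i * (drift \<beta> c (step n i) (w (t n (Suc i)) - w (t n i)) - d i) +
      E (t n i) * (Xn n (t n i) - k n i) * m i + E (t n i) * k n i * d i +
      E (t n (Suc i)) * ((X (t n (Suc i)) - \<i> * c * J (t n (Suc i))) - (X (t n i) - \<i> * c * J (t n i)))"
      unfolding dw_def[symmetric] Vd_def[symmetric] q_def[symmetric] dr E X by (simp add: algebra_simps)
  qed simp
  finally show ?thesis by (simp only: sum.distrib)
qed

end

section \<open>From single paths to processes: the product formula almost surely\<close>

context bm
begin

text \<open>Along the chosen indices the errors exceed \<open>(1/2) ^ k\<close> with summable
  probabilities, so Borel-Cantelli applies.\<close>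

lemma in_probability_subseq:
  assumes Z: "tends_to_0_in_probability M Z"
  shows "\<exists>r. strict_mono r \<and> (AE \<omega> in M. (\<lambda>n. Z (r n) \<omega>) \<longlonglongrightarrow> 0)"
proof -
  define P where "P k n \<longleftrightarrow> prob {\<omega>\<in>space M. Z n \<omega> > ennreal ((1/2) ^ k)} < (1/2) ^ k" for k n
  have [measurable]: "Z n \<in> borel_measurable M" for n
    using Z by (auto simp: tends_to_0_in_probability_def)
  have "\<forall>\<^sub>F n in sequentially. P k n" for k
  proof -
    have "(\<lambda>n. prob {\<omega>\<in>space M. Z n \<omega> > ennreal ((1/2) ^ k)}) \<longlonglongrightarrow> 0"
      using Z by (auto simp: tends_to_0_in_probability_def)
    then show ?thesis unfolding P_def by (rule order_tendstoD(2)) simp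
  qed
  then have ev: "\<exists>n>n0. P k n" for k n0
    by (metis (mono_tags, lifting) eventually_sequentially lessI less_imp_le linorder_not_le le_less_trans nat_le_linear)
  have "\<exists>r. \<forall>k. P k (r k) \<and> r k < r (Suc k)"
  proof (rule dependent_nat_choice)
    show "\<exists>x. P 0 x" using ev by blast
    show "\<exists>y. P (Suc n) y \<and> x < y" for x n using ev by blast
  qed
  then obtain r where r: "\<And>k. P k (r k)" "\<And>k. r k < r (Suc k)" by blast
  have "AE \<omega> in M. \<forall>\<^sub>F k in sequentially. \<omega> \<in> space M - {\<omega>\<in>space M. Z (r k) \<omega> > ennreal ((1/2) ^ k)}"
  proof (rule borel_cantelli_AE1)
    show "summable (\<lambda>k. prob {\<omega>\<in>space M. Z (r k) \<omega> > ennreal ((1/2) ^ k)})"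
      by (rule summable_comparison_test'[OF summable_geometric[of "1/2 :: real"], of 0])
         (use r(1) in \<open>auto simp: P_def intro: less_imp_le\<close>)
  qed (auto simp: less_top[symmetric])
  then have "AE \<omega> in M. (\<lambda>n. Z (r n) \<omega>) \<longlonglongrightarrow> 0"
  proof eventually_elim
    case (elim \<omega>)
    have "(\<lambda>k. ennreal ((1/2) ^ k)) \<longlonglongrightarrow> ennreal 0"
      by (intro tendsto_ennrealI LIMSEQ_power_zero) auto
    then have lim: "(\<lambda>k. ennreal ((1/2) ^ k)) \<longlonglongrightarrow> 0" by simp
    show ?case
    proof (rule tendsto_sandwich[OF _ _ tendsto_const lim])
      show "\<forall>\<^sub>F k in sequentially. Z (r k) \<omega> \<le> ennreal ((1/2) ^ k)"
        using elim by eventually_elim (auto simp: not_less)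
    qed simp
  qed
  then show ?thesis using r(2) strict_mono_Suc_iff by blast
qed

lemma in_probability_compose:
  "tends_to_0_in_probability M Z \<Longrightarrow> strict_mono r \<Longrightarrow> tends_to_0_in_probability M (\<lambda>n. Z (r n))"
  unfolding tends_to_0_in_probability_def
  using LIMSEQ_subseq_LIMSEQ[of "\<lambda>n. prob {\<omega>\<in>space M. ennreal _ < Z n \<omega>}" 0 r] by (auto simp: comp_def)

lemma AE_imp_prob_tendsto_0:
  fixes Z :: "nat \<Rightarrow> 'a \<Rightarrow> real"
  assumes [measurable]: "\<And>n. Z n \<in> borel_measurable M" and Z: "AE \<omega> in M. (\<lambda>n. Z n \<omega>) \<longlonglongrightarrow> 0" and \<delta>: "\<delta> > 0"
  shows "(\<lambda>n. prob {\<omega>\<in>space M. Z n \<omega> > \<delta>}) \<longlonglongrightarrow> 0"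
proof -
  have "(\<lambda>n. \<integral>\<omega>. indicator {\<omega>\<in>space M. Z n \<omega> > \<delta>} \<omega> \<partial>M) \<longlonglongrightarrow> (\<integral>\<omega>. 0 \<partial>M :: real)"
  proof (rule integral_dominated_convergence[where w = "\<lambda>_. 1"])
    show "AE \<omega> in M. (\<lambda>n. indicator {\<omega>\<in>space M. Z n \<omega> > \<delta>} \<omega> :: real) \<longlonglongrightarrow> 0"
      using Z
    proof eventually_elim
      case (elim \<omega>)
      then have "\<forall>\<^sub>F n in sequentially. Z n \<omega> < \<delta>" using \<delta> by (intro order_tendstoD(2)) auto
      then show ?case by (intro tendsto_eventually) (auto elim!: eventually_mono simp: indicator_def)
    qed
  qed (auto simp: indicator_def)
  then show ?thesis by simp
qed

text \<open>By \<open>transform_Lenglart\<close> it suffices that the accumulated variance is small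
  in probability, and almost sure convergence gives that. The value
  \<open>\<delta> = \<epsilon>\<^sup>2 * (\<eta> / 2)\<close> makes the first term there equal to
  \<open>\<eta> / 2\<close>.\<close>

lemma transform_in_probability:
  assumes tr: "\<And>n. martingale_transform M W (N n) (t n) (\<zeta> n) (f n) (C n)"
    and lim: "AE \<omega> in M. (\<lambda>n. \<Sum>i<N n. (norm (\<zeta> n i \<omega>))\<^sup>2 * C n i) \<longlonglongrightarrow> 0"
  shows "tends_to_0_in_probability M
    (\<lambda>n \<omega>. ennreal (norm (\<Sum>i<N n. \<zeta> n i \<omega> * f n i (W \<omega> (t n (Suc i)) - W \<omega> (t n i)))))"
proof -
  define S where "S n \<omega> = (\<Sum>i<N n. \<zeta> n i \<omega> * f n i (W \<omega> (t n (Suc i)) - W \<omega> (t n i)))" for n \<omega>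
  have Sm [measurable]: "S n \<in> borel_measurable M" for n
  proof -
    interpret martingale_transform M W "N n" "t n" "\<zeta> n" "f n" "C n" by (rule tr)
    show ?thesis
      unfolding S_def using measurable_F_imp[OF transform_measurable[OF order_refl \<zeta>]] by (simp add: D_def)
  qed
  have Vm: "(\<lambda>\<omega>. \<Sum>i<N n. (norm (\<zeta> n i \<omega>))\<^sup>2 * C n i) \<in> borel_measurable M" for n
  proof (rule borel_measurable_sum)
    fix i assume "i \<in> {..<N n}"
    interpret martingale_transform M W "N n" "t n" "\<zeta> n" "f n" "C n" by (rule tr)
    have [measurable]: "\<zeta> n i \<in> borel_measurable M" using \<zeta>[of i] \<open>i \<in> {..<N n}\<close> by (auto intro: measurable_F_imp)
    show "(\<lambda>\<omega>. (norm (\<zeta> n i \<omega>))\<^sup>2 * C n i) \<in> borel_measurable M" by measurable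
  qed
  have "(\<lambda>n. prob {\<omega>\<in>space M. norm (S n \<omega>) > \<epsilon>}) \<longlonglongrightarrow> 0" if \<epsilon>: "\<epsilon> > 0" for \<epsilon>
  proof (rule LIMSEQ_I)
    fix \<eta> :: real assume \<eta>: "\<eta> > 0"
    define \<delta> where "\<delta> = \<epsilon>\<^sup>2 * (\<eta> / 2)"
    have \<delta>: "\<delta> > 0" "\<delta> / \<epsilon>\<^sup>2 = \<eta> / 2" using \<epsilon> \<eta> by (auto simp: \<delta>_def)
    have "(\<lambda>n. prob {\<omega>\<in>space M. (\<Sum>i<N n. (norm (\<zeta> n i \<omega>))\<^sup>2 * C n i) > \<delta>}) \<longlonglongrightarrow> 0"
      by (rule AE_imp_prob_tendsto_0[OF Vm lim \<delta>(1)])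
    then have "\<forall>\<^sub>F n in sequentially. prob {\<omega>\<in>space M. (\<Sum>i<N n. (norm (\<zeta> n i \<omega>))\<^sup>2 * C n i) > \<delta>} < \<eta> / 2"
      using \<eta> by (intro order_tendstoD(2)) auto
    then obtain n0 where n0: "\<And>n. n \<ge> n0 \<Longrightarrow> prob {\<omega>\<in>space M. (\<Sum>i<N n. (norm (\<zeta> n i \<omega>))\<^sup>2 * C n i) > \<delta>} < \<eta> / 2"
      by (auto simp: eventually_sequentially)
    have "norm (prob {\<omega>\<in>space M. norm (S n \<omega>) > \<epsilon>} - 0) < \<eta>" if "n \<ge> n0" for n
    proof -
      interpret martingale_transform M W "N n" "t n" "\<zeta> n" "f n" "C n" by (rule tr)
      have "prob {\<omega>\<in>space M. norm (S n \<omega>) > \<epsilon>} \<le> \<delta> / \<epsilon>\<^sup>2 + prob {\<omega>\<in>space M. (\<Sum>i<N n. (norm (\<zeta> n i \<omega>))\<^sup>2 * C n i) > \<delta>}"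
        using transform_Lenglart[OF \<epsilon> less_imp_le[OF \<delta>(1)]] by (simp only: S_def D_def)
      then have "prob {\<omega>\<in>space M. norm (S n \<omega>) > \<epsilon>} < \<eta>" using n0[OF that] \<delta>(2) by linarith
      then show ?thesis by simp
    qed
    then show "\<exists>no. \<forall>n\<ge>no. norm (prob {\<omega>\<in>space M. norm (S n \<omega>) > \<epsilon>} - 0) < \<eta>" by blast
  qed
  then show ?thesis
    unfolding tends_to_0_in_probability_def S_def[symmetric]
    by (auto simp: ennreal_less_iff less_imp_le)
qed

text \<open>The path \<open>V\<close> is what remains of \<open>X\<close> after its stochastic part
  is removed. Its integral appears as an arbitrary limit \<open>A\<close> of sums along the given
  grids, so that the formula can be proved before anything is known about \<open>V\<close>;
  \<open>fourier_identity\<close> later identifies the limit. The grids are those on which the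
  elementary integrals are exact sums.\<close>

lemma exponential_expansion:
  fixes T \<beta> c :: real and X J :: "'a \<Rightarrow> real \<Rightarrow> complex" and Hn Jn :: "nat \<Rightarrow> 'a \<Rightarrow> real \<Rightarrow> complex"
    and N :: "nat \<Rightarrow> nat" and t :: "nat \<Rightarrow> nat \<Rightarrow> real"
  defines "E \<equiv> (\<lambda>\<omega> r. complex_of_real (exp (\<beta> * r)) * cis (- c * W \<omega> r))"
    and "V \<equiv> (\<lambda>\<omega> r. X \<omega> r - \<i> * c * J \<omega> r)"
  assumes T: "T > 0"
    and X_adapted: "\<And>r. 0 \<le> r \<Longrightarrow> (\<lambda>\<omega>. X \<omega> r) \<in> borel_measurable (F r)"
    and X_cadlag: "\<And>\<omega>. \<omega> \<in> space M \<Longrightarrow> cadlag (\<lambda>r. Re (X \<omega> r))" "\<And>\<omega>. \<omega> \<in> space M \<Longrightarrow> cadlag (\<lambda>r. Im (X \<omega> r))"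
    and J_adapted: "\<And>r. 0 \<le> r \<Longrightarrow> (\<lambda>\<omega>. J \<omega> r) \<in> borel_measurable (F r)"
    and sub: "\<And>n. subdivision T (N n) (t n)"
    and mesh: "\<And>n i. i < N n \<Longrightarrow> t n (Suc i) - t n i \<le> 1 / real (Suc n)"
    and H_adapted: "\<And>n i. i < N n \<Longrightarrow> (\<lambda>\<omega>. Hn n \<omega> (t n (Suc i))) \<in> borel_measurable (F (t n i))"
    and H_step: "\<And>n i \<omega> r. i < N n \<Longrightarrow> t n i < r \<Longrightarrow> r \<le> t n (Suc i) \<Longrightarrow> Hn n \<omega> r = Hn n \<omega> (t n (Suc i))"
    and J_sum: "\<And>n j \<omega>. j \<le> N n \<Longrightarrow>
      Jn n \<omega> (t n j) = (\<Sum>i<j. Hn n \<omega> (t n (Suc i)) * (W \<omega> (t n (Suc i)) - W \<omega> (t n i)))"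
    and H_lim: "AE \<omega> in M. (\<lambda>n. \<integral>\<^sup>+r\<in>{0<..T}. ennreal ((norm (Hn n \<omega> r - X \<omega> r))\<^sup>2) \<partial>lborel) \<longlonglongrightarrow> 0"
    and J_lim: "AE \<omega> in M. \<exists>\<delta>. \<delta> \<longlonglongrightarrow> 0 \<and> (\<forall>n. \<forall>r\<in>{0..T}. norm (Jn n \<omega> r - J \<omega> r) \<le> \<delta> n)"
  shows "AE \<omega> in M. \<forall>A. (\<lambda>n. \<Sum>i<N n. E \<omega> (t n (Suc i)) * (V \<omega> (t n (Suc i)) - V \<omega> (t n i))) \<longlonglongrightarrow> A \<longrightarrow>
    E \<omega> T * X \<omega> T - E \<omega> 0 * X \<omega> 0 = (\<beta> + c\<^sup>2 / 2) * (LINT r:{0<..T}|lborel. E \<omega> r * X \<omega> r) + A"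
proof -
  obtain K where K: "K > 0" and moments: "\<And>a b. 0 \<le> a \<Longrightarrow> a < b \<Longrightarrow> b - a \<le> 1 \<Longrightarrow>
    has_bochner_integral M (\<lambda>\<omega>. growth \<beta> c (b - a) (W \<omega> b - W \<omega> a) - 1 - growth_mean \<beta> c a b) 0 \<and>
    integrable M (\<lambda>\<omega>. (norm (growth \<beta> c (b - a) (W \<omega> b - W \<omega> a) - 1 - growth_mean \<beta> c a b))\<^sup>2) \<and>
    expectation (\<lambda>\<omega>. (norm (growth \<beta> c (b - a) (W \<omega> b - W \<omega> a) - 1 - growth_mean \<beta> c a b))\<^sup>2) \<le> K * (b - a) \<and>
    has_bochner_integral M (\<lambda>\<omega>. drift \<beta> c (b - a) (W \<omega> b - W \<omega> a) - drift_mean \<beta> c a b) 0 \<and>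
    integrable M (\<lambda>\<omega>. (norm (drift \<beta> c (b - a) (W \<omega> b - W \<omega> a) - drift_mean \<beta> c a b))\<^sup>2) \<and>
    expectation (\<lambda>\<omega>. (norm (drift \<beta> c (b - a) (W \<omega> b - W \<omega> a) - drift_mean \<beta> c a b))\<^sup>2) \<le> K * (b - a)\<^sup>2 \<and>
    norm (growth_mean \<beta> c a b) \<le> K * (b - a) \<and>
    norm (drift_mean \<beta> c a b - (\<beta> + c\<^sup>2 / 2) * (b - a)) \<le> K * (b - a) * sqrt (b - a)"
    using growth_drift_moments[of \<beta> c] by blast
  have t: "0 \<le> t n i" "t n i < t n (Suc i)" "t n (Suc i) - t n i \<le> 1" if "i < N n" for n i
  proof -
    have "1 / real (Suc n) \<le> 1" by simp
    then show "t n (Suc i) - t n i \<le> 1" using mesh[OF that] by linarith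
    show "0 \<le> t n i" "t n i < t n (Suc i)"
      using sub[of n] subdivision_range[OF sub, of i n] that by (auto simp: subdivision_def)
  qed
  note moment = moments[OF t]
  define m where "m n i = growth_mean \<beta> c (t n i) (t n (Suc i))" for n i
  define d where "d n i = drift_mean \<beta> c (t n i) (t n (Suc i))" for n i
  define \<Delta> where "\<Delta> n i = t n (Suc i) - t n i" for n i
  define k where "k n i \<omega> = Hn n \<omega> (t n (Suc i))" for n i \<omega>
  define Xn where "Xn n \<omega> r = X \<omega> r + \<i> * c * (Jn n \<omega> r - J \<omega> r)" for n \<omega> r
  define \<zeta> where "\<zeta> n i \<omega> = E \<omega> (t n i) * (Xn n \<omega> (t n i) - k n i \<omega>)" for n i \<omega>
  define \<zeta>' where "\<zeta>' n i \<omega> = E \<omega> (t n i) * k n i \<omega>" for n i \<omega>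
  define f where "f n i x = growth \<beta> c (\<Delta> n i) x - 1 - m n i" for n i x
  define f' where "f' n i x = drift \<beta> c (\<Delta> n i) x - d n i" for n i x
  have E_meas: "(\<lambda>\<omega>. E \<omega> r) \<in> borel_measurable (F r)" if "0 \<le> r" for r
  proof -
    have "(\<lambda>x. complex_of_real (exp (\<beta> * r)) * cis (- c * x)) \<in> borel_measurable borel"
      by (intro borel_measurable_continuous_onI continuous_intros)
    then show ?thesis
      unfolding E_def by (rule measurable_compose[OF W_measurable_F[OF that order_refl]])
  qed
  have k_meas: "k n i \<in> borel_measurable (F (t n i))" if "i < N n" for n i
    using H_adapted[OF that] by (simp add: k_def[abs_def])
  have Jn_meas: "(\<lambda>\<omega>. Jn n \<omega> (t n i)) \<in> borel_measurable (F (t n i))" if "i < N n" for n i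
  proof -
    have "(\<lambda>\<omega>. \<Sum>j<i. Hn n \<omega> (t n (Suc j)) * (W \<omega> (t n (Suc j)) - W \<omega> (t n j))) \<in> borel_measurable (F (t n i))"
    proof (rule borel_measurable_sum)
      fix j assume "j \<in> {..<i}"
      then have j: "j < N n" "t n j \<le> t n i" "t n (Suc j) \<le> t n i"
        using that subdivision_mono[OF sub, of j i n] subdivision_mono[OF sub, of "Suc j" i n] by auto
      have [measurable]: "(\<lambda>\<omega>. Hn n \<omega> (t n (Suc j))) \<in> borel_measurable (F (t n i))"
        using H_adapted[OF j(1)] j(2) by (rule measurable_F_mono[rotated])
      have [measurable]: "(\<lambda>\<omega>. W \<omega> (t n (Suc j))) \<in> borel_measurable (F (t n i))" "(\<lambda>\<omega>. W \<omega> (t n j)) \<in> borel_measurable (F (t n i))"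
        using t[OF j(1)] j by (auto intro!: W_measurable_F)
      show "(\<lambda>\<omega>. Hn n \<omega> (t n (Suc j)) * (W \<omega> (t n (Suc j)) - W \<omega> (t n j))) \<in> borel_measurable (F (t n i))"
        by measurable
    qed
    then show ?thesis using J_sum[of i n] that by simp
  qed
  have \<zeta>_meas: "\<zeta> n i \<in> borel_measurable (F (t n i))" "\<zeta>' n i \<in> borel_measurable (F (t n i))" if "i < N n" for n i
    unfolding \<zeta>_def[abs_def] \<zeta>'_def[abs_def] Xn_def
    by (intro borel_measurable_times borel_measurable_diff borel_measurable_add borel_measurable_const
        E_meas k_meas Jn_meas X_adapted J_adapted t that)+
  have tr: "martingale_transform M W (N n) (t n) (\<zeta> n) (f n) (\<lambda>i. K * \<Delta> n i)" for n
  proof (intro martingale_transform.intro bm_axioms martingale_transform_axioms.intro)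
    show "0 \<le> t n 0" using sub[of n] by (simp add: subdivision_def)
    fix i assume i: "i < N n"
    show "f n i \<in> borel_measurable borel" unfolding f_def[abs_def] by measurable
    show "0 < K * \<Delta> n i" using K t[OF i] by (simp add: \<Delta>_def)
  qed (use moment t \<zeta>_meas in \<open>simp_all add: f_def m_def \<Delta>_def\<close>)
  have tr': "martingale_transform M W (N n) (t n) (\<zeta>' n) (f' n) (\<lambda>i. K * (\<Delta> n i)\<^sup>2)" for n
  proof (intro martingale_transform.intro bm_axioms martingale_transform_axioms.intro)
    show "0 \<le> t n 0" using sub[of n] by (simp add: subdivision_def)
    fix i assume i: "i < N n"
    show "f' n i \<in> borel_measurable borel" unfolding f'_def[abs_def] by measurable
    show "0 < K * (\<Delta> n i)\<^sup>2" using K t[OF i] by (simp add: \<Delta>_def)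
  qed (use moment t \<zeta>_meas in \<open>simp_all add: f'_def d_def \<Delta>_def\<close>)
  define S where "S n \<omega> = (\<Sum>i<N n. \<zeta> n i \<omega> * f n i (W \<omega> (t n (Suc i)) - W \<omega> (t n i)))" for n \<omega>
  define S' where "S' n \<omega> = (\<Sum>i<N n. \<zeta>' n i \<omega> * f' n i (W \<omega> (t n (Suc i)) - W \<omega> (t n i)))" for n \<omega>
  have path: "AE \<omega> in M. \<exists>\<delta>. path_approximation T (X \<omega>) (J \<omega>) (W \<omega>) (\<lambda>n. Hn n \<omega>) (\<lambda>n. Jn n \<omega>) N t \<delta>"
    using H_lim J_lim W_continuous AE_space
  proof eventually_elim
    case (elim \<omega>)
    then obtain \<delta> where \<delta>: "\<delta> \<longlonglongrightarrow> 0" "\<forall>n. \<forall>r\<in>{0..T}. norm (Jn n \<omega> r - J \<omega> r) \<le> \<delta> n" by blast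
    show ?case
      by (intro exI[of _ \<delta>] path_approximation.intro T X_cadlag elim sub mesh H_step \<delta>(1) \<delta>(2)[rule_format])
  qed
  have "AE \<omega> in M. (\<lambda>n. \<Sum>i<N n. (norm (\<zeta> n i \<omega>))\<^sup>2 * (K * \<Delta> n i)) \<longlonglongrightarrow> 0"
    using path
  proof eventually_elim
    case (elim \<omega>)
    then obtain \<delta> where "path_approximation T (X \<omega>) (J \<omega>) (W \<omega>) (\<lambda>n. Hn n \<omega>) (\<lambda>n. Jn n \<omega>) N t \<delta>" by blast
    then interpret P: path_approximation T \<beta> c "X \<omega>" "J \<omega>" "W \<omega>" "\<lambda>n. Hn n \<omega>" "\<lambda>n. Jn n \<omega>" N t \<delta> .
    show ?case
      using P.growth_variation_lim[OF less_imp_le[OF K]]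
      by (simp add: \<zeta>_def E_def P.E_def Xn_def P.Xn_def k_def P.k_def \<Delta>_def)
  qed
  note prob1 = transform_in_probability[OF tr this, folded S_def]
  have "AE \<omega> in M. (\<lambda>n. \<Sum>i<N n. (norm (\<zeta>' n i \<omega>))\<^sup>2 * (K * (\<Delta> n i)\<^sup>2)) \<longlonglongrightarrow> 0"
    using path
  proof eventually_elim
    case (elim \<omega>)
    then obtain \<delta> where "path_approximation T (X \<omega>) (J \<omega>) (W \<omega>) (\<lambda>n. Hn n \<omega>) (\<lambda>n. Jn n \<omega>) N t \<delta>" by blast
    then interpret P: path_approximation T \<beta> c "X \<omega>" "J \<omega>" "W \<omega>" "\<lambda>n. Hn n \<omega>" "\<lambda>n. Jn n \<omega>" N t \<delta> .
    show ?case
      using P.drift_variation_lim[OF less_imp_le[OF K]]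
      by (simp add: \<zeta>'_def E_def P.E_def k_def P.k_def \<Delta>_def)
  qed
  note prob2 = transform_in_probability[OF tr' this, folded S'_def]
  \<comment> \<open>Subsequences serve to obtain almost sure convergence of the two martingale
    terms; all other terms converge along the whole sequence.\<close>
  obtain r1 where r1: "strict_mono r1" "AE \<omega> in M. (\<lambda>n. ennreal (norm (S (r1 n) \<omega>))) \<longlonglongrightarrow> 0"
    using in_probability_subseq[OF prob1] by blast
  obtain r2 where r2: "strict_mono r2" "AE \<omega> in M. (\<lambda>n. ennreal (norm (S' (r1 (r2 n)) \<omega>))) \<longlonglongrightarrow> 0"
    using in_probability_subseq[OF in_probability_compose[OF prob2 r1(1)]] by blast
  define r where "r = r1 \<circ> r2"
  have r: "strict_mono r" unfolding r_def using r1 r2 by (intro strict_mono_o)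
  show ?thesis
    using path r1(2) r2(2)
  proof eventually_elim
    case (elim \<omega>)
    then obtain \<delta> where "path_approximation T (X \<omega>) (J \<omega>) (W \<omega>) (\<lambda>n. Hn n \<omega>) (\<lambda>n. Jn n \<omega>) N t \<delta>" by blast
    then interpret P: path_approximation T \<beta> c "X \<omega>" "J \<omega>" "W \<omega>" "\<lambda>n. Hn n \<omega>" "\<lambda>n. Jn n \<omega>" N t \<delta> .
    have E: "P.E = E \<omega>" by (simp add: fun_eq_iff E_def P.E_def)
    have PX: "P.Xn n = Xn n \<omega>" for n by (simp add: fun_eq_iff Xn_def P.Xn_def)
    have Pk: "P.k n i = k n i \<omega>" for n i by (simp add: k_def P.k_def)
    have norm0: "(\<lambda>n. z n) \<longlonglongrightarrow> 0" if "(\<lambda>n. ennreal (norm (z n))) \<longlonglongrightarrow> 0" for z :: "nat \<Rightarrow> complex"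
    proof -
      have "(\<lambda>n. ennreal (norm (z n))) \<longlonglongrightarrow> ennreal 0" using that by simp
      then have "(\<lambda>n. norm (z n)) \<longlonglongrightarrow> 0" by (subst (asm) tendsto_ennreal_iff) auto
      then show ?thesis by (rule tendsto_norm_zero_cancel)
    qed
    have S: "(\<lambda>n. S (r n) \<omega>) \<longlonglongrightarrow> 0"
      using LIMSEQ_subseq_LIMSEQ[OF norm0[OF elim(2)] r2(1)] by (simp add: r_def comp_def)
    have S': "(\<lambda>n. S' (r n) \<omega>) \<longlonglongrightarrow> 0"
      using norm0[OF elim(3)] by (simp add: r_def)
    show ?case
    proof (intro allI impI)
      fix A assume A: "(\<lambda>n. \<Sum>i<N n. E \<omega> (t n (Suc i)) * (V \<omega> (t n (Suc i)) - V \<omega> (t n i))) \<longlonglongrightarrow> A"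
      have D: "(\<lambda>n. \<Sum>i<N n. E \<omega> (t n i) * (Xn n \<omega> (t n i) - k n i \<omega>) * m n i) \<longlonglongrightarrow> 0"
        unfolding E[symmetric] PX[symmetric] Pk[symmetric]
        by (rule P.growth_mean_sum_lim[where K = K]) (use moment K in \<open>auto simp: m_def\<close>)
      have D': "(\<lambda>n. \<Sum>i<N n. E \<omega> (t n i) * k n i \<omega> * d n i) \<longlonglongrightarrow> complex_of_real (\<beta> + c\<^sup>2 / 2) * (LINT r:{0<..T}|lborel. E \<omega> r * X \<omega> r)"
        unfolding E[symmetric] Pk[symmetric]
        by (rule P.drift_mean_sum_lim[where K = K]) (use moment K in \<open>auto simp: d_def\<close>)
      have lhs: "(\<lambda>n. E \<omega> T * Xn n \<omega> T - E \<omega> 0 * Xn n \<omega> 0) \<longlonglongrightarrow> E \<omega> T * X \<omega> T - E \<omega> 0 * X \<omega> 0"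
        unfolding PX[symmetric] using T by (intro tendsto_intros P.Xn_lim) auto
      have eq: "E \<omega> T * Xn n \<omega> T - E \<omega> 0 * Xn n \<omega> 0 = S n \<omega> + S' n \<omega> +
         (\<Sum>i<N n. E \<omega> (t n i) * (Xn n \<omega> (t n i) - k n i \<omega>) * m n i) +
         (\<Sum>i<N n. E \<omega> (t n i) * k n i \<omega> * d n i) +
         (\<Sum>i<N n. E \<omega> (t n (Suc i)) * (V \<omega> (t n (Suc i)) - V \<omega> (t n i)))" for n
      proof -
        have "Jn n \<omega> (t n (Suc i)) - Jn n \<omega> (t n i) = k n i \<omega> * (W \<omega> (t n (Suc i)) - W \<omega> (t n i))" if "i < N n" for i
          using J_sum[of "Suc i" n \<omega>] J_sum[of i n \<omega>] that by (simp add: k_def)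
        from P.Xn_telescope[of n "m n" "d n", unfolded Pk, OF this]
        show ?thesis
          unfolding E PX Pk S_def S'_def \<zeta>_def \<zeta>'_def f_def f'_def \<Delta>_def V_def .
      qed
      have "(\<lambda>n. E \<omega> T * Xn (r n) \<omega> T - E \<omega> 0 * Xn (r n) \<omega> 0) \<longlonglongrightarrow>
          0 + 0 + 0 + complex_of_real (\<beta> + c\<^sup>2 / 2) * (LINT r:{0<..T}|lborel. E \<omega> r * X \<omega> r) + A"
        unfolding eq
        using LIMSEQ_subseq_LIMSEQ[OF D r] LIMSEQ_subseq_LIMSEQ[OF D' r] LIMSEQ_subseq_LIMSEQ[OF A r]
        by (intro tendsto_add S S') (simp_all add: comp_def)
      from LIMSEQ_unique[OF LIMSEQ_subseq_LIMSEQ[OF lhs r, unfolded comp_def] this]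
      show "E \<omega> T * X \<omega> T - E \<omega> 0 * X \<omega> 0 = (\<beta> + c\<^sup>2 / 2) * (LINT r:{0<..T}|lborel. E \<omega> r * X \<omega> r) + A"
        by simp
    qed
  qed
qed

section \<open>Joint approximation of two Ito integrals and the resulting expansion\<close>

lemma common_subseq:
  assumes "\<And>i. i < (m::nat) \<Longrightarrow> tends_to_0_in_probability M (Z i)"
  shows "\<exists>r. strict_mono r \<and> (AE \<omega> in M. \<forall>i<m. (\<lambda>n. Z i (r n) \<omega>) \<longlonglongrightarrow> 0)"
  using assms
proof (induction m)
  case 0
  then show ?case by (intro exI[of _ id]) (auto simp: strict_mono_id)
next
  case (Suc m)
  then obtain r where r: "strict_mono r" "AE \<omega> in M. \<forall>i<m. (\<lambda>n. Z i (r n) \<omega>) \<longlonglongrightarrow> 0" by auto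
  obtain r' where r': "strict_mono r'" "AE \<omega> in M. (\<lambda>n. Z m (r (r' n)) \<omega>) \<longlonglongrightarrow> 0"
    using in_probability_subseq[OF in_probability_compose[OF Suc.prems[of m] r(1)]] by auto
  have "AE \<omega> in M. \<forall>i<Suc m. (\<lambda>n. Z i ((r \<circ> r') n) \<omega>) \<longlonglongrightarrow> 0"
    using r(2) r'(2)
  proof eventually_elim
    case (elim \<omega>)
    show ?case
    proof (intro allI impI)
      fix i assume "i < Suc m"
      then consider "i < m" | "i = m" by linarith
      then show "(\<lambda>n. Z i ((r \<circ> r') n) \<omega>) \<longlonglongrightarrow> 0"
      proof cases
        case 1
        then have "(\<lambda>n. Z i (r n) \<omega>) \<longlonglongrightarrow> 0" using elim(1) by blast
        from LIMSEQ_subseq_LIMSEQ[OF this r'(1)] show ?thesis by (simp add: comp_def)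
      qed (use elim(2) in simp)
    qed
  qed
  then show ?case using strict_mono_o[OF r(1) r'(1)] by blast
qed

lemma elementary_integral_continuous:
  assumes "elementary_integral M F W H J" "continuous_on {0..} (W \<omega>)"
  shows "continuous_on {0..} (J \<omega>)" and "J \<omega> 0 = 0"
proof -
  obtain n :: nat and \<tau> :: "nat \<Rightarrow> real" and \<xi> where \<tau>: "0 \<le> \<tau> 0" "mono \<tau>" and
     J: "J = (\<lambda>\<omega> t. \<Sum>i<n. \<xi> i \<omega> * (W \<omega> (min t (\<tau> (Suc i))) - W \<omega> (min t (\<tau> i))))"
    using assms(1) unfolding elementary_integral_def by blast
  have \<tau>0: "0 \<le> \<tau> l" for l using \<tau>(1) monoD[OF \<tau>(2), of 0 l] by linarith
  have "continuous_on {0..} (\<lambda>t. W \<omega> (min t (\<tau> l)))" for l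
    by (rule continuous_on_compose2[OF assms(2)]) (use \<tau>0[of l] in \<open>auto intro!: continuous_intros\<close>)
  then show "continuous_on {0..} (J \<omega>)"
    unfolding J by (intro continuous_intros)
  show "J \<omega> 0 = 0" unfolding J using \<tau>0 by (simp add: min_absorb1)
qed

text \<open>Continuity on a compact interval makes every supremum finite, so its real value serves
  as the uniform error bound that \<open>path_approximation\<close> asks for.\<close>

lemma SUP_bound_sequence:
  fixes T :: real and Jn :: "nat \<Rightarrow> real \<Rightarrow> real"
  assumes fin: "\<And>n. continuous_on {0..T} (\<lambda>r. Jn n r - I r)" 
    and lim: "(\<lambda>n. SUP r\<in>{0..T}. ennreal \<bar>Jn n r - I r\<bar>) \<longlonglongrightarrow> 0"
  shows "\<exists>\<delta>. \<delta> \<longlonglongrightarrow> 0 \<and> (\<forall>n. \<forall>r\<in>{0..T}. \<bar>Jn n r - I r\<bar> \<le> \<delta> n)"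
proof -
  define Z where "Z n = (SUP r\<in>{0..T}. ennreal \<bar>Jn n r - I r\<bar>)" for n
  have Zfin: "Z n < \<infinity>" for n
  proof -
    have "bounded ((\<lambda>r. Jn n r - I r) ` {0..T})"
      by (intro compact_imp_bounded compact_continuous_image fin) auto
    then obtain B where "\<forall>r\<in>{0..T}. \<bar>Jn n r - I r\<bar> \<le> B" by (auto simp: bounded_iff)
    then have "Z n \<le> ennreal B" unfolding Z_def by (intro SUP_least ennreal_leI) auto
    then show ?thesis by (rule order.strict_trans1) simp
  qed
  have "(\<lambda>n. enn2real (Z n)) \<longlonglongrightarrow> enn2real 0"
    using lim unfolding Z_def[symmetric] by (intro tendsto_enn2real) auto
  then have "(\<lambda>n. enn2real (Z n)) \<longlonglongrightarrow> 0" by simp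
  moreover have "\<bar>Jn n r - I r\<bar> \<le> enn2real (Z n)" if "r \<in> {0..T}" for n r
  proof -
    have "ennreal \<bar>Jn n r - I r\<bar> \<le> Z n" unfolding Z_def using that by (rule SUP_upper)
    also have "Z n = ennreal (enn2real (Z n))" using Zfin[of n] by simp
    finally show ?thesis by (simp add: ennreal_le_iff)
  qed
  ultimately show ?thesis by blast
qed

lemma ito_integral_0:
  assumes "has_ito_integral M F W H I"
  shows "AE \<omega> in M. I \<omega> 0 = 0"
proof -
  obtain Hn Jn where el: "\<And>n. elementary_integral M F W (Hn n) (Jn n)" and
    pr: "tends_to_0_in_probability M (\<lambda>n \<omega>. SUP t\<in>{0..1}. ennreal \<bar>Jn n \<omega> t - I \<omega> t\<bar>)"
    using assms zero_less_one unfolding has_ito_integral_def by blast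
  obtain r where r: "AE \<omega> in M. (\<lambda>n. SUP t\<in>{0..1}. ennreal \<bar>Jn (r n) \<omega> t - I \<omega> t\<bar>) \<longlonglongrightarrow> 0"
    using in_probability_subseq[OF pr] by blast
  show ?thesis
    using r W_continuous
  proof eventually_elim
    case (elim \<omega>)
    have "ennreal \<bar>I \<omega> 0\<bar> \<le> (SUP t\<in>{0..1}. ennreal \<bar>Jn (r n) \<omega> t - I \<omega> t\<bar>)" for n
      using elementary_integral_continuous(2)[OF el elim(2), of "r n"] by (intro SUP_upper2[of 0]) auto
    then have "ennreal \<bar>I \<omega> 0\<bar> \<le> 0"
      by (intro LIMSEQ_le_const[OF elim(1)]) blast
    then show ?case by simp
  qed
qed

text \<open>Progressive measurability is used for its sections: for a fixed path the integrand is
  measurable in time on \<open>{0..T}\<close>. This permits splitting the integral of a sum in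
  \<open>ito_approximation\<close>.\<close>

lemma path_square_measurable:
  assumes ito: "has_ito_integral M F W H I" and el: "elementary_integral M F W H' J" and \<omega>: "\<omega> \<in> space M" and T: "0 \<le> T"
  shows "(\<lambda>r. ennreal ((H' \<omega> r - H \<omega> r)\<^sup>2) * indicator {0..T} r) \<in> borel_measurable lborel"
proof -
  have "(\<lambda>(r, \<omega>). H \<omega> r) \<in> borel_measurable (restrict_space borel {0..T} \<Otimes>\<^sub>M F T)"
    using ito T by (auto simp: has_ito_integral_def progressive_def)
  from measurable_compose[OF measurable_Pair2'[of \<omega> "F T"] this]
  have "(\<lambda>r. H \<omega> r) \<in> borel_measurable (restrict_space borel {0..T})" using \<omega> by simp
  then have [measurable]: "(\<lambda>r. indicator {0..T} r *\<^sub>R H \<omega> r) \<in> borel_measurable borel"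
    by (subst (asm) borel_measurable_restrict_space_iff) auto
  note [measurable] = elementary_integral_borel[OF el, of \<omega>]
  have "(\<lambda>r. ennreal ((H' \<omega> r - indicator {0..T} r *\<^sub>R H \<omega> r)\<^sup>2) * indicator {0..T} r) \<in> borel_measurable lborel"
    by measurable
  moreover have "ennreal ((H' \<omega> r - indicator {0..T} r *\<^sub>R H \<omega> r)\<^sup>2) * indicator {0..T} r =
      ennreal ((H' \<omega> r - H \<omega> r)\<^sup>2) * indicator {0..T} r" for r
    by (simp add: indicator_def)
  ultimately show ?thesis by simp
qed

text \<open>Real and imaginary part come with unrelated approximations. A common subsequence makes
  all four errors converge almost surely, and grids containing the breakpoints of both integrands
  merge them into one complex step process.\<close>

lemma ito_approximation:
  assumes ito: "has_ito_integral M F W H1 I1" "has_ito_integral M F W H2 I2" and T: "T > 0"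
  shows "\<exists>Hn Jn N t. (\<forall>n. subdivision T (N n) (t n)) \<and>
    (\<forall>n i. i < N n \<longrightarrow> t n (Suc i) - t n i \<le> 1 / real (Suc n)) \<and>
    (\<forall>n i. i < N n \<longrightarrow> (\<lambda>\<omega>. Hn n \<omega> (t n (Suc i)) :: complex) \<in> borel_measurable (F (t n i))) \<and>
    (\<forall>n i \<omega> r. i < N n \<longrightarrow> t n i < r \<longrightarrow> r \<le> t n (Suc i) \<longrightarrow> Hn n \<omega> r = Hn n \<omega> (t n (Suc i))) \<and>
    (\<forall>n j \<omega>. j \<le> N n \<longrightarrow>
      Jn n \<omega> (t n j) = (\<Sum>i<j. Hn n \<omega> (t n (Suc i)) * (W \<omega> (t n (Suc i)) - W \<omega> (t n i)))) \<and>
    (AE \<omega> in M. (\<lambda>n. \<integral>\<^sup>+r\<in>{0<..T}. ennreal ((norm (Hn n \<omega> r - Complex (H1 \<omega> r) (H2 \<omega> r)))\<^sup>2) \<partial>lborel) \<longlonglongrightarrow> 0) \<and>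
    (AE \<omega> in M. \<exists>\<delta>. \<delta> \<longlonglongrightarrow> 0 \<and> (\<forall>n. \<forall>r\<in>{0..T}. norm (Jn n \<omega> r - Complex (I1 \<omega> r) (I2 \<omega> r)) \<le> \<delta> n))"
proof -
  obtain Hn1 Jn1 where el1: "\<And>n. elementary_integral M F W (Hn1 n) (Jn1 n)" and
    pr1: "tends_to_0_in_probability M (\<lambda>n \<omega>. \<integral>\<^sup>+r\<in>{0..T}. ennreal ((Hn1 n \<omega> r - H1 \<omega> r)\<^sup>2) \<partial>lebesgue)"
      "tends_to_0_in_probability M (\<lambda>n \<omega>. SUP t\<in>{0..T}. ennreal \<bar>Jn1 n \<omega> t - I1 \<omega> t\<bar>)"
    using ito(1) T unfolding has_ito_integral_def by blast
  obtain Hn2 Jn2 where el2: "\<And>n. elementary_integral M F W (Hn2 n) (Jn2 n)" and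
    pr2: "tends_to_0_in_probability M (\<lambda>n \<omega>. \<integral>\<^sup>+r\<in>{0..T}. ennreal ((Hn2 n \<omega> r - H2 \<omega> r)\<^sup>2) \<partial>lebesgue)"
      "tends_to_0_in_probability M (\<lambda>n \<omega>. SUP t\<in>{0..T}. ennreal \<bar>Jn2 n \<omega> t - I2 \<omega> t\<bar>)"
    using ito(2) T unfolding has_ito_integral_def by blast
  have I_cont: "AE \<omega> in M. continuous_on {0..} (I1 \<omega>)" "AE \<omega> in M. continuous_on {0..} (I2 \<omega>)"
    using ito unfolding has_ito_integral_def by blast+
  define Z where "Z i = [\<lambda>n \<omega>. \<integral>\<^sup>+r\<in>{0..T}. ennreal ((Hn1 n \<omega> r - H1 \<omega> r)\<^sup>2) \<partial>lebesgue,
     \<lambda>n \<omega>. SUP t\<in>{0..T}. ennreal \<bar>Jn1 n \<omega> t - I1 \<omega> t\<bar>,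
     \<lambda>n \<omega>. \<integral>\<^sup>+r\<in>{0..T}. ennreal ((Hn2 n \<omega> r - H2 \<omega> r)\<^sup>2) \<partial>lebesgue,
     \<lambda>n \<omega>. SUP t\<in>{0..T}. ennreal \<bar>Jn2 n \<omega> t - I2 \<omega> t\<bar>] ! i" for i
  have "tends_to_0_in_probability M (Z i)" if "i < 4" for i
  proof -
    have "i \<in> {0, 1, 2, 3}" using that by (auto simp: less_Suc_eq numeral_eq_Suc)
    then show ?thesis using pr1 pr2 by (auto simp: Z_def)
  qed
  then obtain \<rho> where "strict_mono \<rho>" and \<rho>: "AE \<omega> in M. \<forall>i<4. (\<lambda>n. Z i (\<rho> n) \<omega>) \<longlonglongrightarrow> 0"
    using common_subseq[of 4 Z] by blast
  define Hn where "Hn n \<omega> r = Complex (Hn1 (\<rho> n) \<omega> r) (Hn2 (\<rho> n) \<omega> r)" for n \<omega> r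
  define Jn where "Jn n \<omega> r = Complex (Jn1 (\<rho> n) \<omega> r) (Jn2 (\<rho> n) \<omega> r)" for n \<omega> r
  define Q where "Q n N t \<longleftrightarrow> subdivision T N t \<and> (\<forall>i<N. t (Suc i) - t i \<le> 1 / real (Suc n)) \<and>
     (\<forall>i<N. (\<lambda>\<omega>. Hn n \<omega> (t (Suc i))) \<in> borel_measurable (F (t i)) \<and>
        (\<forall>\<omega> r. t i < r \<longrightarrow> r \<le> t (Suc i) \<longrightarrow> Hn n \<omega> r = Hn n \<omega> (t (Suc i)))) \<and>
     (\<forall>j\<le>N. \<forall>\<omega>. Jn n \<omega> (t j) = (\<Sum>i<j. Hn n \<omega> (t (Suc i)) * (W \<omega> (t (Suc i)) - W \<omega> (t i))))" for n N t
  have Q: "\<exists>N t. Q n N t" for n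
  proof -
    obtain S1 where S1: "finite S1" "\<And>T N t. subdivision T N t \<Longrightarrow> S1 \<inter> {0..T} \<subseteq> t ` {..N} \<Longrightarrow>
     (\<forall>i<N. (\<lambda>\<omega>. Hn1 (\<rho> n) \<omega> (t (Suc i))) \<in> borel_measurable (F (t i)) \<and>
        (\<forall>\<omega> r. t i < r \<and> r \<le> t (Suc i) \<longrightarrow> Hn1 (\<rho> n) \<omega> r = Hn1 (\<rho> n) \<omega> (t (Suc i)))) \<and>
     (\<forall>j\<le>N. \<forall>\<omega>. Jn1 (\<rho> n) \<omega> (t j) = (\<Sum>i<j. Hn1 (\<rho> n) \<omega> (t (Suc i)) * (W \<omega> (t (Suc i)) - W \<omega> (t i))))"
      using elementary_integral_subdivision[OF el1[of "\<rho> n"]] by blast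
    obtain S2 where S2: "finite S2" "\<And>T N t. subdivision T N t \<Longrightarrow> S2 \<inter> {0..T} \<subseteq> t ` {..N} \<Longrightarrow>
     (\<forall>i<N. (\<lambda>\<omega>. Hn2 (\<rho> n) \<omega> (t (Suc i))) \<in> borel_measurable (F (t i)) \<and>
        (\<forall>\<omega> r. t i < r \<and> r \<le> t (Suc i) \<longrightarrow> Hn2 (\<rho> n) \<omega> r = Hn2 (\<rho> n) \<omega> (t (Suc i)))) \<and>
     (\<forall>j\<le>N. \<forall>\<omega>. Jn2 (\<rho> n) \<omega> (t j) = (\<Sum>i<j. Hn2 (\<rho> n) \<omega> (t (Suc i)) * (W \<omega> (t (Suc i)) - W \<omega> (t i))))"
      using elementary_integral_subdivision[OF el2[of "\<rho> n"]] by blast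
    obtain N t where sub: "subdivision T N t" "(S1 \<union> S2) \<inter> {0..T} \<subseteq> t ` {..N}" "\<forall>i<N. t (Suc i) - t i \<le> 1 / real (Suc n)"
      using exists_subdivision[of "S1 \<union> S2" T "1 / real (Suc n)"] S1(1) S2(1) T by auto
    have sub1: "S1 \<inter> {0..T} \<subseteq> t ` {..N}" and sub2: "S2 \<inter> {0..T} \<subseteq> t ` {..N}" using sub(2) by auto
    note 1 = S1(2)[OF sub(1) sub1] and 2 = S2(2)[OF sub(1) sub2]
    show ?thesis
      unfolding Q_def
    proof (rule exI[of _ N], rule exI[of _ t], intro conjI sub(1,3) allI impI)
      fix i assume i: "i < N"
      have "(\<lambda>\<omega>. Hn1 (\<rho> n) \<omega> (t (Suc i))) \<in> borel_measurable (F (t i))"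
        "(\<lambda>\<omega>. Hn2 (\<rho> n) \<omega> (t (Suc i))) \<in> borel_measurable (F (t i))"
        using 1 2 i by blast+
      then show "(\<lambda>\<omega>. Hn n \<omega> (t (Suc i))) \<in> borel_measurable (F (t i))"
        by (subst borel_measurable_complex_iff) (simp add: Hn_def)
      fix \<omega> r assume "t i < r" "r \<le> t (Suc i)"
      then have "Hn1 (\<rho> n) \<omega> r = Hn1 (\<rho> n) \<omega> (t (Suc i))" "Hn2 (\<rho> n) \<omega> r = Hn2 (\<rho> n) \<omega> (t (Suc i))"
        using 1 2 i by blast+
      then show "Hn n \<omega> r = Hn n \<omega> (t (Suc i))" by (simp add: Hn_def)
    next
      fix j \<omega> assume "j \<le> N"
      then have "Jn1 (\<rho> n) \<omega> (t j) = (\<Sum>i<j. Hn1 (\<rho> n) \<omega> (t (Suc i)) * (W \<omega> (t (Suc i)) - W \<omega> (t i)))"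
        "Jn2 (\<rho> n) \<omega> (t j) = (\<Sum>i<j. Hn2 (\<rho> n) \<omega> (t (Suc i)) * (W \<omega> (t (Suc i)) - W \<omega> (t i)))"
        using 1 2 by blast+
      then show "Jn n \<omega> (t j) = (\<Sum>i<j. Hn n \<omega> (t (Suc i)) * (W \<omega> (t (Suc i)) - W \<omega> (t i)))"
        by (intro complex_eqI) (simp_all add: Jn_def Hn_def)
    qed
  qed
  obtain N where "\<And>n. \<exists>t. Q n (N n) t" using Q by metis
  then obtain t where Nt: "\<And>n. Q n (N n) (t n)" by metis
  note Nt = Nt[unfolded Q_def]
  have Hlim: "AE \<omega> in M. (\<lambda>n. \<integral>\<^sup>+r\<in>{0<..T}. ennreal ((norm (Hn n \<omega> r - Complex (H1 \<omega> r) (H2 \<omega> r)))\<^sup>2) \<partial>lborel) \<longlonglongrightarrow> 0"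
    using \<rho> AE_space
  proof eventually_elim
    case (elim \<omega>)
    have "(\<lambda>n. Z 0 (\<rho> n) \<omega>) \<longlonglongrightarrow> 0" "(\<lambda>n. Z 2 (\<rho> n) \<omega>) \<longlonglongrightarrow> 0" using elim(1) by simp_all
    from tendsto_add[OF this] have lim: "(\<lambda>n. Z 0 (\<rho> n) \<omega> + Z 2 (\<rho> n) \<omega>) \<longlonglongrightarrow> 0" by simp
    have le: "(\<integral>\<^sup>+r\<in>{0<..T}. ennreal ((norm (Hn n \<omega> r - Complex (H1 \<omega> r) (H2 \<omega> r)))\<^sup>2) \<partial>lborel) \<le> Z 0 (\<rho> n) \<omega> + Z 2 (\<rho> n) \<omega>" for n
    proof -
      define a where "a r = ennreal ((Hn1 (\<rho> n) \<omega> r - H1 \<omega> r)\<^sup>2) * indicator {0..T} r" for r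
      define b where "b r = ennreal ((Hn2 (\<rho> n) \<omega> r - H2 \<omega> r)\<^sup>2) * indicator {0..T} r" for r
      have ab [measurable]: "a \<in> borel_measurable lborel" "b \<in> borel_measurable lborel"
        unfolding a_def[abs_def] b_def[abs_def]
        using path_square_measurable[OF ito(1) el1 elim(2)] path_square_measurable[OF ito(2) el2 elim(2)] T by auto
      have "(\<integral>\<^sup>+r\<in>{0<..T}. ennreal ((norm (Hn n \<omega> r - Complex (H1 \<omega> r) (H2 \<omega> r)))\<^sup>2) \<partial>lborel) \<le> (\<integral>\<^sup>+r. a r + b r \<partial>lborel)"
        by (rule nn_integral_mono) (auto simp: a_def b_def Hn_def cmod_power2 indicator_def)
      also have "\<dots> = (\<integral>\<^sup>+r. a r \<partial>lborel) + (\<integral>\<^sup>+r. b r \<partial>lborel)"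
        by (rule nn_integral_add) simp_all
      also have "\<dots> = Z 0 (\<rho> n) \<omega> + Z 2 (\<rho> n) \<omega>"
        by (simp add: Z_def a_def b_def nn_integral_completion numeral_2_eq_2)
      finally show ?thesis .
    qed
    show ?case
      by (rule tendsto_sandwich[OF _ _ tendsto_const lim]) (use le in simp_all)
  qed
  have Jlim: "AE \<omega> in M. \<exists>\<delta>. \<delta> \<longlonglongrightarrow> 0 \<and> (\<forall>n. \<forall>r\<in>{0..T}. norm (Jn n \<omega> r - Complex (I1 \<omega> r) (I2 \<omega> r)) \<le> \<delta> n)"
    using \<rho> I_cont W_continuous
  proof eventually_elim
    case (elim \<omega>)
    have "(\<lambda>n. Z 1 (\<rho> n) \<omega>) \<longlonglongrightarrow> 0" "(\<lambda>n. Z 3 (\<rho> n) \<omega>) \<longlonglongrightarrow> 0" using elim(1) by simp_all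
    then have lim: "(\<lambda>n. SUP t\<in>{0..T}. ennreal \<bar>Jn1 (\<rho> n) \<omega> t - I1 \<omega> t\<bar>) \<longlonglongrightarrow> 0"
        "(\<lambda>n. SUP t\<in>{0..T}. ennreal \<bar>Jn2 (\<rho> n) \<omega> t - I2 \<omega> t\<bar>) \<longlonglongrightarrow> 0"
      by (simp_all add: Z_def numeral_3_eq_3)
    have sub: "{0..T} \<subseteq> {0..}" by auto
    have cont: "continuous_on {0..T} (\<lambda>r. Jn1 (\<rho> n) \<omega> r - I1 \<omega> r)" "continuous_on {0..T} (\<lambda>r. Jn2 (\<rho> n) \<omega> r - I2 \<omega> r)" for n
      using elim elementary_integral_continuous(1)[OF el1 elim(4)] elementary_integral_continuous(1)[OF el2 elim(4)]
      by (auto intro!: continuous_on_diff continuous_on_subset[OF _ sub])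
    obtain \<delta>1 where \<delta>1: "\<delta>1 \<longlonglongrightarrow> 0" "\<forall>n. \<forall>r\<in>{0..T}. \<bar>Jn1 (\<rho> n) \<omega> r - I1 \<omega> r\<bar> \<le> \<delta>1 n"
      using SUP_bound_sequence[OF cont(1) lim(1)] by blast
    obtain \<delta>2 where \<delta>2: "\<delta>2 \<longlonglongrightarrow> 0" "\<forall>n. \<forall>r\<in>{0..T}. \<bar>Jn2 (\<rho> n) \<omega> r - I2 \<omega> r\<bar> \<le> \<delta>2 n"
      using SUP_bound_sequence[OF cont(2) lim(2)] by blast
    have "norm (Jn n \<omega> r - Complex (I1 \<omega> r) (I2 \<omega> r)) \<le> \<delta>1 n + \<delta>2 n" if "r \<in> {0..T}" for n r
    proof -
      have "norm (Jn n \<omega> r - Complex (I1 \<omega> r) (I2 \<omega> r)) \<le> \<bar>Jn1 (\<rho> n) \<omega> r - I1 \<omega> r\<bar> + \<bar>Jn2 (\<rho> n) \<omega> r - I2 \<omega> r\<bar>"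
        using cmod_le[of "Jn n \<omega> r - Complex (I1 \<omega> r) (I2 \<omega> r)"] by (simp add: Jn_def)
      also have "\<dots> \<le> \<delta>1 n + \<delta>2 n" using \<delta>1(2) \<delta>2(2) that by (intro add_mono) auto
      finally show ?thesis .
    qed
    moreover have "(\<lambda>n. \<delta>1 n + \<delta>2 n) \<longlonglongrightarrow> 0" using tendsto_add[OF \<delta>1(1) \<delta>2(1)] by simp
    ultimately show ?case by (intro exI[of _ "\<lambda>n. \<delta>1 n + \<delta>2 n"]) blast
  qed
  show ?thesis
    by (rule exI[of _ Hn], rule exI[of _ Jn], rule exI[of _ N], rule exI[of _ t], intro conjI Hlim Jlim) (use Nt in blast)+
qed

text \<open>For a trigonometric test function the integrand is \<open>\<i> * \<xi> * X\<close>.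
  Multiplying its approximations by \<open>y\<close>, the inverse of \<open>\<i> * \<xi>\<close>,
  gives approximations of \<open>X\<close> itself, as \<open>exponential_expansion\<close> requires
  with \<open>c = \<xi> * \<theta>\<close>; then \<open>\<i> * c * J\<close> is again
  \<open>\<theta>\<close> times the original stochastic integral.\<close>

lemma ito_expansion:
  fixes T \<beta> \<xi> \<theta> :: real and X :: "'a \<Rightarrow> real \<Rightarrow> complex"
    and H1 H2 I1 I2 :: "'a \<Rightarrow> real \<Rightarrow> real"
  defines "E \<equiv> (\<lambda>\<omega> r. complex_of_real (exp (\<beta> * r)) * cis (- (\<xi> * \<theta>) * W \<omega> r))"
    and "V \<equiv> (\<lambda>\<omega> r. X \<omega> r - \<theta> * Complex (I1 \<omega> r) (I2 \<omega> r))"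
  assumes T: "T > 0" and \<xi>: "\<xi> \<noteq> 0"
    and X_adapted: "\<And>r. 0 \<le> r \<Longrightarrow> (\<lambda>\<omega>. X \<omega> r) \<in> borel_measurable (F r)"
    and X_cadlag: "\<And>\<omega>. \<omega> \<in> space M \<Longrightarrow> cadlag (\<lambda>r. Re (X \<omega> r))" "\<And>\<omega>. \<omega> \<in> space M \<Longrightarrow> cadlag (\<lambda>r. Im (X \<omega> r))"
    and ito: "has_ito_integral M F W H1 I1" "has_ito_integral M F W H2 I2"
    and H: "\<And>\<omega> r. \<omega> \<in> space M \<Longrightarrow> 0 \<le> r \<Longrightarrow> Complex (H1 \<omega> r) (H2 \<omega> r) = \<i> * \<xi> * X \<omega> r"
  shows "\<exists>N t. (\<forall>n. subdivision T (N n) (t n)) \<and>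
    (\<forall>n i. i < N n \<longrightarrow> t n (Suc i) - t n i \<le> 1 / real (Suc n)) \<and>
    (AE \<omega> in M. \<forall>A. (\<lambda>n. \<Sum>i<N n. E \<omega> (t n (Suc i)) * (V \<omega> (t n (Suc i)) - V \<omega> (t n i))) \<longlonglongrightarrow> A \<longrightarrow>
      E \<omega> T * X \<omega> T - E \<omega> 0 * X \<omega> 0 = (\<beta> + (\<xi> * \<theta>)\<^sup>2 / 2) * (LINT r:{0<..T}|lborel. E \<omega> r * X \<omega> r) + A)"
proof -
  obtain Hn Jn N t where sub: "\<And>n. subdivision T (N n) (t n)" and
    mesh: "\<And>n i. i < N n \<Longrightarrow> t n (Suc i) - t n i \<le> 1 / real (Suc n)" and
    Hm: "\<And>n i. i < N n \<Longrightarrow> (\<lambda>\<omega>. Hn n \<omega> (t n (Suc i)) :: complex) \<in> borel_measurable (F (t n i))" and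
    Hs: "\<And>n i \<omega> r. i < N n \<Longrightarrow> t n i < r \<Longrightarrow> r \<le> t n (Suc i) \<Longrightarrow> Hn n \<omega> r = Hn n \<omega> (t n (Suc i))" and
    Js: "\<And>n j \<omega>. j \<le> N n \<Longrightarrow>
      Jn n \<omega> (t n j) = (\<Sum>i<j. Hn n \<omega> (t n (Suc i)) * (W \<omega> (t n (Suc i)) - W \<omega> (t n i)))" and
    Hl: "AE \<omega> in M. (\<lambda>n. \<integral>\<^sup>+r\<in>{0<..T}. ennreal ((norm (Hn n \<omega> r - Complex (H1 \<omega> r) (H2 \<omega> r)))\<^sup>2) \<partial>lborel) \<longlonglongrightarrow> 0" and
    Jl: "AE \<omega> in M. \<exists>\<delta>. \<delta> \<longlonglongrightarrow> 0 \<and> (\<forall>n. \<forall>r\<in>{0..T}. norm (Jn n \<omega> r - Complex (I1 \<omega> r) (I2 \<omega> r)) \<le> \<delta> n)"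
    using ito_approximation[OF ito T] by blast
  define y where "y = inverse (\<i> * complex_of_real \<xi>)"
  have y: "y * (\<i> * \<xi>) = 1" unfolding y_def by (rule left_inverse) (use \<xi> in simp)
  define J where "J \<omega> r = y * Complex (I1 \<omega> r) (I2 \<omega> r)" for \<omega> r
  have "AE \<omega> in M. \<forall>A. (\<lambda>n. \<Sum>i<N n. E \<omega> (t n (Suc i)) *
      ((X \<omega> (t n (Suc i)) - \<i> * complex_of_real (\<xi> * \<theta>) * J \<omega> (t n (Suc i))) - (X \<omega> (t n i) - \<i> * complex_of_real (\<xi> * \<theta>) * J \<omega> (t n i)))) \<longlonglongrightarrow> A \<longrightarrow>
      E \<omega> T * X \<omega> T - E \<omega> 0 * X \<omega> 0 = (\<beta> + (\<xi> * \<theta>)\<^sup>2 / 2) * (LINT r:{0<..T}|lborel. E \<omega> r * X \<omega> r) + A"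
    unfolding E_def
  proof (rule exponential_expansion[OF T X_adapted X_cadlag _ sub mesh, where Hn = "\<lambda>n \<omega> r. y * Hn n \<omega> r" and Jn = "\<lambda>n \<omega> r. y * Jn n \<omega> r"])
    fix r :: real assume r: "0 \<le> r"
    have "(\<lambda>\<omega>. I1 \<omega> r) \<in> borel_measurable (F r)" "(\<lambda>\<omega>. I2 \<omega> r) \<in> borel_measurable (F r)"
      using ito r by (auto simp: has_ito_integral_def adapted_def)
    then have "(\<lambda>\<omega>. Complex (I1 \<omega> r) (I2 \<omega> r)) \<in> borel_measurable (F r)"
      by (subst borel_measurable_complex_iff) simp
    then show "(\<lambda>\<omega>. J \<omega> r) \<in> borel_measurable (F r)" unfolding J_def by measurable
  next
    fix n i assume "i < N n"
    from Hm[OF this] show "(\<lambda>\<omega>. y * Hn n \<omega> (t n (Suc i))) \<in> borel_measurable (F (t n i))" by measurable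
  next
    fix n i \<omega> r assume "i < N n" "t n i < r" "r \<le> t n (Suc i)"
    from Hs[OF this] show "y * Hn n \<omega> r = y * Hn n \<omega> (t n (Suc i))" by metis
  next
    fix n j \<omega> assume "j \<le> N n"
    from Js[OF this] show "y * Jn n \<omega> (t n j) = (\<Sum>i<j. y * Hn n \<omega> (t n (Suc i)) * (W \<omega> (t n (Suc i)) - W \<omega> (t n i)))"
      by (simp add: sum_distrib_left mult.assoc)
  next
    show "AE \<omega> in M. (\<lambda>n. \<integral>\<^sup>+r\<in>{0<..T}. ennreal ((norm (y * Hn n \<omega> r - X \<omega> r))\<^sup>2) \<partial>lborel) \<longlonglongrightarrow> 0"
      using Hl AE_space
    proof eventually_elim
      case (elim \<omega>)
      have "(\<integral>\<^sup>+r\<in>{0<..T}. ennreal ((norm (y * Hn n \<omega> r - X \<omega> r))\<^sup>2) \<partial>lborel) =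
         (\<integral>\<^sup>+r. ennreal ((norm y)\<^sup>2) * (ennreal ((norm (Hn n \<omega> r - Complex (H1 \<omega> r) (H2 \<omega> r)))\<^sup>2) * indicator {0<..T} r) \<partial>lborel)" for n
      proof (rule nn_integral_cong)
        fix r :: real
        show "ennreal ((norm (y * Hn n \<omega> r - X \<omega> r))\<^sup>2) * indicator {0<..T} r =
          ennreal ((norm y)\<^sup>2) * (ennreal ((norm (Hn n \<omega> r - Complex (H1 \<omega> r) (H2 \<omega> r)))\<^sup>2) * indicator {0<..T} r)"
        proof (cases "r \<in> {0<..T}")
          case True
          then have "Complex (H1 \<omega> r) (H2 \<omega> r) = \<i> * \<xi> * X \<omega> r" using H[of \<omega> r] elim by auto
          then have "y * Complex (H1 \<omega> r) (H2 \<omega> r) = X \<omega> r" using y by (metis mult.assoc mult_1)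
          then have "y * Hn n \<omega> r - X \<omega> r = y * (Hn n \<omega> r - Complex (H1 \<omega> r) (H2 \<omega> r))" by (simp add: algebra_simps)
          then show ?thesis using True by (simp add: norm_mult power_mult_distrib ennreal_mult)
        qed simp
      qed
      moreover have meas: "(\<lambda>r. ennreal ((norm (Hn n \<omega> r - Complex (H1 \<omega> r) (H2 \<omega> r)))\<^sup>2) * indicator {0<..T} r) \<in> borel_measurable lborel" for n
      proof -
        have h: "set_integrable lborel {0<..T} (Hn n \<omega>)"
          using set_integral_step(1)[OF sub, where f = "\<lambda>i. Hn n \<omega> (t n (Suc i))"] Hs by metis
        have "(\<lambda>r. X \<omega> (max 0 r)) \<in> borel_measurable borel" using complex_cadlag(2)[OF X_cadlag] elim by auto
        then have m: "(\<lambda>r. indicator {0<..T} r *\<^sub>R Hn n \<omega> r - indicator {0<..T} r *\<^sub>R (\<i> * \<xi> * X \<omega> (max 0 r))) \<in> borel_measurable lborel"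
          using h by (auto simp: set_integrable_def)
        have "(\<lambda>r. ennreal ((norm (indicator {0<..T} r *\<^sub>R Hn n \<omega> r - indicator {0<..T} r *\<^sub>R (\<i> * \<xi> * X \<omega> (max 0 r))))\<^sup>2)) \<in> borel_measurable lborel"
          by (rule measurable_compose[OF m]) measurable
        moreover have "ennreal ((norm (indicator {0<..T} r *\<^sub>R Hn n \<omega> r - indicator {0<..T} r *\<^sub>R (\<i> * \<xi> * X \<omega> (max 0 r))))\<^sup>2) =
            ennreal ((norm (Hn n \<omega> r - Complex (H1 \<omega> r) (H2 \<omega> r)))\<^sup>2) * indicator {0<..T} r" for r
          using H[of \<omega> r] elim by (auto simp: indicator_def max_def)
        ultimately show ?thesis by simp
      qed
      ultimately have "(\<lambda>n. \<integral>\<^sup>+r\<in>{0<..T}. ennreal ((norm (y * Hn n \<omega> r - X \<omega> r))\<^sup>2) \<partial>lborel) =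
          (\<lambda>n. ennreal ((norm y)\<^sup>2) * (\<integral>\<^sup>+r\<in>{0<..T}. ennreal ((norm (Hn n \<omega> r - Complex (H1 \<omega> r) (H2 \<omega> r)))\<^sup>2) \<partial>lborel))"
        using nn_integral_cmult[OF meas] by simp
      moreover have "(\<lambda>n. ennreal ((norm y)\<^sup>2) * (\<integral>\<^sup>+r\<in>{0<..T}. ennreal ((norm (Hn n \<omega> r - Complex (H1 \<omega> r) (H2 \<omega> r)))\<^sup>2) \<partial>lborel))
          \<longlonglongrightarrow> ennreal ((norm y)\<^sup>2) * 0"
        by (rule ennreal_tendsto_cmult[OF _ elim(1)]) simp
      ultimately show ?case by simp
    qed
  next
    show "AE \<omega> in M. \<exists>\<delta>. \<delta> \<longlonglongrightarrow> 0 \<and> (\<forall>n. \<forall>r\<in>{0..T}. norm (y * Jn n \<omega> r - J \<omega> r) \<le> \<delta> n)"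
      using Jl
    proof eventually_elim
      case (elim \<omega>)
      then obtain \<delta> where \<delta>: "\<delta> \<longlonglongrightarrow> 0" "\<forall>n. \<forall>r\<in>{0..T}. norm (Jn n \<omega> r - Complex (I1 \<omega> r) (I2 \<omega> r)) \<le> \<delta> n" by blast
      have "norm (y * Jn n \<omega> r - J \<omega> r) \<le> norm y * \<delta> n" if "r \<in> {0..T}" for n r
      proof -
        have "y * Jn n \<omega> r - J \<omega> r = y * (Jn n \<omega> r - Complex (I1 \<omega> r) (I2 \<omega> r))" by (simp add: J_def algebra_simps)
        then show ?thesis using \<delta>(2) that by (auto simp: norm_mult intro!: mult_left_mono)
      qed
      moreover have "(\<lambda>n. norm y * \<delta> n) \<longlonglongrightarrow> 0" using tendsto_mult_left[OF \<delta>(1), of "norm y"] by simp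
      ultimately show ?case by blast
    qed
  qed
  moreover have "X \<omega> r - \<i> * complex_of_real (\<xi> * \<theta>) * J \<omega> r = V \<omega> r" for \<omega> r
  proof -
    have "\<i> * complex_of_real (\<xi> * \<theta>) * J \<omega> r = (y * (\<i> * \<xi>)) * (\<theta> * Complex (I1 \<omega> r) (I2 \<omega> r))"
      by (simp add: J_def mult_ac)
    then show ?thesis unfolding y by (simp add: V_def)
  qed
  ultimately show ?thesis using sub mesh by (intro exI[of _ N] exI[of _ t]) simp
qed

end

section \<open>The weak formulation in Fourier variables\<close>

text \<open>Lindelof reduces the union of all open sets on which \<open>f\<close> vanishes almost
  everywhere to a countable one, whose exceptional sets together are null.\<close>

lemma ess_supp_AE: "AE x in lebesgue. x \<notin> ess_supp f \<longrightarrow> f x = 0"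
proof -
  define \<U> where "\<U> = {U. open U \<and> (AE x in lebesgue. x \<in> U \<longrightarrow> f x = (0::real))}"
  obtain \<V> where \<V>: "\<V> \<subseteq> \<U>" "countable \<V>" "\<Union>\<V> = \<Union>\<U>"
    using Lindelof[of \<U>] by (auto simp: \<U>_def)
  have "AE x in lebesgue. \<forall>U\<in>\<V>. x \<in> U \<longrightarrow> f x = 0"
    using \<V> by (subst AE_ball_countable) (auto simp: \<U>_def)
  then show ?thesis
  proof eventually_elim
    case (elim x)
    then show ?case using \<V>(3) by (auto simp: ess_supp_def \<U>_def[symmetric])
  qed
qed

lemma bcontfunI: "continuous_on UNIV g \<Longrightarrow> (\<And>x. \<bar>g x :: real\<bar> \<le> B) \<Longrightarrow> g \<in> bcontfun"
  unfolding bcontfun_def by (auto simp: bounded_iff)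

lemma bcontfunD:
  assumes "g \<in> (bcontfun :: (real \<Rightarrow> real) set)"
  shows "continuous_on UNIV g" "\<exists>B. \<forall>x. \<bar>g x\<bar> \<le> B" "g \<in> borel_measurable borel"
  using assms unfolding bcontfun_def by (auto simp: bounded_iff intro: borel_measurable_continuous_onI)

lemma integrable_mult_bcontfun:
  fixes f g :: "real \<Rightarrow> real"
  assumes f: "integrable lebesgue f" and g: "g \<in> bcontfun"
  shows "integrable lebesgue (\<lambda>x. f x * g x)"
proof -
  obtain B where B: "\<And>x. \<bar>g x\<bar> \<le> B" using bcontfunD(2)[OF g] by blast
  have "g \<in> borel_measurable lebesgue" using bcontfunD(3)[OF g] by (simp add: measurable_completion)
  then show ?thesis
    using f B by (intro Bochner_Integration.integrable_bound[OF integrable_mult_right[OF f, of B]])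
      (auto intro!: AE_I2 simp: abs_mult mult.commute[of "\<bar>f _\<bar>"] intro!: mult_right_mono order_trans[OF B abs_ge_self])
qed

lemma set_integral_eq_pairing:
  fixes f g :: "real \<Rightarrow> real"
  assumes f: "integrable lebesgue f" "AE x in lebesgue. x < a \<longrightarrow> f x = 0" and g: "g \<in> bcontfun"
  shows "(LINT x:{a..}|lebesgue. f x * g x) = pairing f g"
  unfolding pairing_def set_lebesgue_integral_def
proof (rule integral_cong_AE)
  show "(\<lambda>x. f x * g x) \<in> borel_measurable lebesgue"
    using integrable_mult_bcontfun[OF f(1) g] by auto
  then show "(\<lambda>x. indicator {a..} x *\<^sub>R (f x * g x)) \<in> borel_measurable lebesgue"
    by (intro borel_measurable_scaleR) (auto intro!: measurable_completion)
  show "AE x in lebesgue. indicator {a..} x *\<^sub>R (f x * g x) = f x * g x"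
    using f(2) by eventually_elim (auto simp: indicator_def)
qed

lemma C12b_const_time:
  fixes g g' g'' :: "real \<Rightarrow> real"
  assumes D1: "\<And>x. (g has_real_derivative g' x) (at x)" and D2: "\<And>x. (g' has_real_derivative g'' x) (at x)"
    and bc: "g \<in> bcontfun" "g' \<in> bcontfun" "g'' \<in> bcontfun"
  shows "(\<lambda>r. g) \<in> C12b" and "d_x (\<lambda>r. g) = (\<lambda>r. g')" and "d_xx (\<lambda>r. g) = (\<lambda>r. g'')"
    and "0 \<le> r \<Longrightarrow> d_t (\<lambda>r. g) r x = 0"
proof -
  have dg: "deriv g = g'" and dg': "deriv g' = g''"
    using D1 D2 by (auto simp: fun_eq_iff intro!: DERIV_imp_deriv)
  show dx: "d_x (\<lambda>r. g) = (\<lambda>r. g')" and dxx: "d_xx (\<lambda>r. g) = (\<lambda>r. g'')"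
    by (simp_all add: fun_eq_iff d_x_def d_xx_def dg dg')
  show dt: "d_t (\<lambda>r. g) r x = 0" if "0 \<le> r" for r x
  proof -
    \<comment> \<open>At time 0 the derivative is one-sided. The right neighbourhood shows that the
      point is not isolated in \<open>{0..}\<close>, which makes the vector derivative
      unique.\<close>
    have "at_right r \<le> at r within {0..}" using that by (intro at_le) auto
    then have "at r within {0..} \<noteq> bot" using trivial_limit_at_right_real[of r] bot.extremum_uniqueI by metis
    then show ?thesis unfolding d_t_def by (rule vector_derivative_within) simp
  qed
  have *: "continuous_on ({0..} \<times> UNIV) (\<lambda>(t::real, x). h x) \<and> bounded ((\<lambda>(t::real, x). h x) ` ({0..} \<times> UNIV))"
    if h: "h \<in> bcontfun" for h :: "real \<Rightarrow> real"
  proof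
    show "continuous_on ({0..} \<times> UNIV) (\<lambda>(t::real, x). h x)"
      unfolding split_beta by (intro continuous_on_compose2[OF bcontfunD(1)[OF h]] continuous_intros) auto
    show "bounded ((\<lambda>(t::real, x). h x) ` ({0..} \<times> UNIV))"
      using bcontfunD(2)[OF h] by (auto simp: bounded_iff)
  qed
  have **: "continuous_on ({0..} \<times> UNIV) (\<lambda>(t, x). d_t (\<lambda>r. g) t x) \<and> bounded ((\<lambda>(t, x). d_t (\<lambda>r. g) t x) ` ({0..} \<times> UNIV))"
  proof
    show "continuous_on ({0..} \<times> UNIV) (\<lambda>(t, x). d_t (\<lambda>r. g) t x)"
      by (rule continuous_on_eq[OF continuous_on_const[of _ 0]]) (auto simp: dt)
    show "bounded ((\<lambda>(t, x). d_t (\<lambda>r. g) t x) ` ({0..} \<times> UNIV))"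
      by (auto simp: bounded_iff dt)
  qed
  show "(\<lambda>r. g) \<in> C12b"
    unfolding C12b_def
  proof (intro CollectI conjI allI impI ballI)
    fix t x :: real
    show "(\<lambda>r. g x) differentiable at t within {0..}" by simp
    show "g differentiable at x" using D1 real_differentiable_def by blast
    show "deriv g differentiable at x" unfolding dg using D2 real_differentiable_def by blast
  next
    fix \<psi> assume "\<psi> \<in> {\<lambda>r. g, d_t (\<lambda>r. g), d_x (\<lambda>r. g), d_xx (\<lambda>r. g)}"
    then consider "\<psi> = (\<lambda>r. g)" | "\<psi> = d_t (\<lambda>r. g)" | "\<psi> = (\<lambda>r. g')" | "\<psi> = (\<lambda>r. g'')"
      unfolding dx dxx by blast
    then have "continuous_on ({0..} \<times> UNIV) (\<lambda>(t, x). \<psi> t x) \<and> bounded ((\<lambda>(t, x). \<psi> t x) ` ({0..} \<times> UNIV))"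
      by cases (use *[OF bc(1)] *[OF bc(2)] *[OF bc(3)] ** in simp_all)
    then show "continuous_on ({0..} \<times> UNIV) (\<lambda>(t, x). \<psi> t x)" "bounded ((\<lambda>(t, x). \<psi> t x) ` ({0..} \<times> UNIV))"
      by blast+
  qed
qed

lemma trig_bcontfun:
  fixes a \<xi> :: real
  shows "(\<lambda>x. a * cos (\<xi> * x)) \<in> bcontfun" "(\<lambda>x. a * sin (\<xi> * x)) \<in> bcontfun"
  by (rule bcontfunI[where B = "\<bar>a\<bar>"], intro continuous_intros, simp add: abs_mult mult_left_le)+

lemma trig_test_functions:
  fixes \<xi> :: real
  defines "C \<equiv> \<lambda>r::real. \<lambda>x. cos (\<xi> * x)" and "S \<equiv> \<lambda>r::real. \<lambda>x. sin (\<xi> * x)"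
  shows "C \<in> C12b" "d_x C = (\<lambda>r x. (- \<xi>) * sin (\<xi> * x))" "d_xx C = (\<lambda>r x. (- (\<xi>\<^sup>2)) * cos (\<xi> * x))"
    "S \<in> C12b" "d_x S = (\<lambda>r x. \<xi> * cos (\<xi> * x))" "d_xx S = (\<lambda>r x. (- (\<xi>\<^sup>2)) * sin (\<xi> * x))"
    "0 \<le> r \<Longrightarrow> d_t C r x = 0" "0 \<le> r \<Longrightarrow> d_t S r x = 0"
proof -
  have c: "((\<lambda>x. cos (\<xi> * x)) has_real_derivative (- \<xi>) * sin (\<xi> * x)) (at x)"
    "((\<lambda>x. (- \<xi>) * sin (\<xi> * x)) has_real_derivative (- (\<xi>\<^sup>2)) * cos (\<xi> * x)) (at x)"
    "((\<lambda>x. sin (\<xi> * x)) has_real_derivative \<xi> * cos (\<xi> * x)) (at x)"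
    "((\<lambda>x. \<xi> * cos (\<xi> * x)) has_real_derivative (- (\<xi>\<^sup>2)) * sin (\<xi> * x)) (at x)" for x
    by (auto intro!: derivative_eq_intros simp: power2_eq_square)
  have b: "(\<lambda>x. cos (\<xi> * x)) \<in> bcontfun" "(\<lambda>x. sin (\<xi> * x)) \<in> bcontfun"
    using trig_bcontfun[of 1 \<xi>] by simp_all
  note 1 = C12b_const_time[OF c(1,2) b(1) trig_bcontfun(2) trig_bcontfun(1)]
  note 2 = C12b_const_time[OF c(3,4) b(2) trig_bcontfun(1) trig_bcontfun(2)]
  show "C \<in> C12b" "d_x C = (\<lambda>r x. (- \<xi>) * sin (\<xi> * x))" "d_xx C = (\<lambda>r x. (- (\<xi>\<^sup>2)) * cos (\<xi> * x))"
    "S \<in> C12b" "d_x S = (\<lambda>r x. \<xi> * cos (\<xi> * x))" "d_xx S = (\<lambda>r x. (- (\<xi>\<^sup>2)) * sin (\<xi> * x))"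
    "0 \<le> r \<Longrightarrow> d_t C r x = 0" "0 \<le> r \<Longrightarrow> d_t S r x = 0"
    unfolding C_def S_def using 1 2 by simp_all
qed

text \<open>Sampling \<open>E\<close> at right end points amounts to integrating with the step
  function \<open>E (ce n r)\<close>, which converges to \<open>E r\<close> by continuity and is
  bounded on the compact interval. The measure is general because the lemma serves both Lebesgue
  measure in time and the Stieltjes measure of the front.\<close>

lemma stieltjes_sum_lim:
  fixes E u :: "real \<Rightarrow> complex"
  assumes sets: "sets \<mu> = sets borel"
    and u: "set_integrable \<mu> {0<..T} u" and E: "continuous_on {0..} E"
    and sub: "\<And>n. subdivision T (N n) (t n)"
    and mesh: "\<And>n i. i < N n \<Longrightarrow> t n (Suc i) - t n i \<le> 1 / real (Suc n)"
  shows "(\<lambda>n. \<Sum>i<N n. E (t n (Suc i)) * (LINT r:{t n i<..t n (Suc i)}|\<mu>. u r)) \<longlonglongrightarrow> (LINT r:{0<..T}|\<mu>. E r * u r)"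
proof -
  note [measurable_cong] = sets
  have "compact (E ` {0..T})"
    by (intro compact_continuous_image continuous_on_subset[OF E]) auto
  then obtain B where B: "\<And>r. r \<in> {0..T} \<Longrightarrow> norm (E r) \<le> B"
    using compact_imp_bounded by (force simp: bounded_iff)
  define ce where "ce n = subdivision_ceil (N n) (t n)" for n
  have u_meas: "(\<lambda>r. indicator {0<..T} r *\<^sub>R u r) \<in> borel_measurable \<mu>"
    using u by (auto simp: set_integrable_def)
  have term_eq: "E (ce n r) * u r = E (t n (Suc i)) * u r" if "i < N n" "r \<in> {t n i<..t n (Suc i)}" for n i r
    using subdivision_ceil_eq[OF sub that(1)] that(2) by (simp add: ce_def)
  have piece: "set_integrable \<mu> {t n i<..t n (Suc i)} u" if "i < N n" for n i
    by (rule set_integrable_subset[OF u]) (use sets subdivision_Ioc_Un[OF sub, of n] that in auto)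
  have piece': "set_integrable \<mu> {t n i<..t n (Suc i)} (\<lambda>r. E (ce n r) * u r)" if "i < N n" for n i
  proof -
    have "set_integrable \<mu> {t n i<..t n (Suc i)} (\<lambda>r. E (t n (Suc i)) * u r)"
      by (rule set_integrable_mult_right) (rule piece[OF that])
    moreover have "set_integrable \<mu> {t n i<..t n (Suc i)} (\<lambda>r. E (ce n r) * u r) \<longleftrightarrow>
       set_integrable \<mu> {t n i<..t n (Suc i)} (\<lambda>r. E (t n (Suc i)) * u r)"
      by (rule set_integrable_cong[OF refl refl]) (rule term_eq[OF that])
    ultimately show ?thesis by simp
  qed
  have whole: "set_integrable \<mu> {0<..T} (\<lambda>r. E (ce n r) * u r)" for n
    unfolding subdivision_Ioc_Un[OF sub[of n]] using piece' sets by (intro set_integrable_UN) auto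
  have sum_eq: "(\<Sum>i<N n. E (t n (Suc i)) * (LINT r:{t n i<..t n (Suc i)}|\<mu>. u r)) = (LINT r:{0<..T}|\<mu>. E (ce n r) * u r)" for n
  proof -
    have "(LINT r:{0<..T}|\<mu>. E (ce n r) * u r) = (\<Sum>i<N n. LINT r:{t n i<..t n (Suc i)}|\<mu>. E (ce n r) * u r)"
      unfolding subdivision_Ioc_Un[OF sub[of n]]
      using piece' subdivision_disjoint[OF sub] sets by (intro set_integral_finite_Union) auto
    also have "\<dots> = (\<Sum>i<N n. E (t n (Suc i)) * (LINT r:{t n i<..t n (Suc i)}|\<mu>. u r))"
    proof (rule sum.cong)
      fix i assume i: "i \<in> {..<N n}"
      have "(LINT r:{t n i<..t n (Suc i)}|\<mu>. E (ce n r) * u r) = (LINT r:{t n i<..t n (Suc i)}|\<mu>. E (t n (Suc i)) * u r)"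
        using term_eq i sets by (intro set_lebesgue_integral_cong) auto
      then show "(LINT r:{t n i<..t n (Suc i)}|\<mu>. E (ce n r) * u r) = E (t n (Suc i)) * (LINT r:{t n i<..t n (Suc i)}|\<mu>. u r)"
        by simp
    qed simp
    finally show ?thesis by simp
  qed
  have wint: "integrable \<mu> (\<lambda>r. B * norm (indicator {0<..T} r *\<^sub>R u r))"
    by (intro integrable_mult_right integrable_norm) (rule u[unfolded set_integrable_def])
  have [measurable]: "(\<lambda>r. indicator {0<..T} r *\<^sub>R E r) \<in> borel_measurable borel"
    by (rule borel_measurable_continuous_on_indicator) (auto intro: continuous_on_subset[OF E])
  have "(\<lambda>n. LINT r|\<mu>. indicator {0<..T} r *\<^sub>R (E (ce n r) * u r)) \<longlonglongrightarrow> (LINT r|\<mu>. indicator {0<..T} r *\<^sub>R (E r * u r))"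
  proof (rule integral_dominated_convergence[OF _ _ wint])
    have "(\<lambda>r. (indicator {0<..T} r *\<^sub>R E r) * (indicator {0<..T} r *\<^sub>R u r)) \<in> borel_measurable \<mu>"
      using u_meas by (intro borel_measurable_times) (auto simp: measurable_cong_sets[OF sets refl])
    moreover have "(\<lambda>r. (indicator {0<..T} r *\<^sub>R E r) * (indicator {0<..T} r *\<^sub>R u r)) = (\<lambda>r. indicator {0<..T} r *\<^sub>R (E r * u r))"
      by (auto simp: indicator_def fun_eq_iff)
    ultimately show "(\<lambda>r. indicator {0<..T} r *\<^sub>R (E r * u r)) \<in> borel_measurable \<mu>" by (simp only:)
    show "(\<lambda>r. indicator {0<..T} r *\<^sub>R (E (ce n r) * u r)) \<in> borel_measurable \<mu>" for n
      using whole[of n] by (auto simp: set_integrable_def)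
    show "AE r in \<mu>. (\<lambda>n. indicator {0<..T} r *\<^sub>R (E (ce n r) * u r)) \<longlonglongrightarrow> indicator {0<..T} r *\<^sub>R (E r * u r)"
    proof (rule AE_I2)
      fix r
      show "(\<lambda>n. indicator {0<..T} r *\<^sub>R (E (ce n r) * u r)) \<longlonglongrightarrow> indicator {0<..T} r *\<^sub>R (E r * u r)"
      proof (cases "r \<in> {0<..T}")
        case True
        then have r: "0 < r" "r \<le> T" by auto
        have "(\<lambda>n. E (ce n r)) \<longlonglongrightarrow> E r"
          using r subdivision_floor_tendsto[OF sub mesh r] unfolding ce_def by (intro continuous_on_tendsto_compose[OF E]) auto
        then show ?thesis by (intro tendsto_intros)
      qed auto
    qed
    show "AE r in \<mu>. norm (indicator {0<..T} r *\<^sub>R (E (ce n r) * u r)) \<le> B * norm (indicator {0<..T} r *\<^sub>R u r)" for n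
    proof (rule AE_I2)
      fix r
      show "norm (indicator {0<..T} r *\<^sub>R (E (ce n r) * u r)) \<le> B * norm (indicator {0<..T} r *\<^sub>R u r)"
      proof (cases "r \<in> {0<..T}")
        case True
        then have r: "0 < r" "r \<le> T" by auto
        then show ?thesis using True B subdivision_floor_tendsto(6)[OF sub mesh r, of n]
          by (auto simp: ce_def norm_mult intro!: mult_right_mono)
      qed auto
    qed
  qed
  then show ?thesis unfolding sum_eq by (simp add: set_lebesgue_integral_def)
qed

section \<open>A weak solution tested with sine and cosine\<close>

locale stefan = bm +
  fixes \<kappa> \<theta> l s0 :: real and v0 :: "real \<Rightarrow> real" and v :: "'a \<Rightarrow> real \<Rightarrow> real \<Rightarrow> real" and s :: "'a \<Rightarrow> real \<Rightarrow> real"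
    and I :: "(real \<Rightarrow> real \<Rightarrow> real) \<Rightarrow> 'a \<Rightarrow> real \<Rightarrow> real"
  assumes \<kappa>: "\<kappa> > 0" and l: "l > 0" and \<theta>: "\<theta>\<^sup>2 < 2 * \<kappa>"
    and v0_integrable: "integrable lebesgue v0" and v0_Linf: "Linf_norm v0 < \<infinity>" and v0_supp: "ess_supp v0 \<subseteq> {s0..}"
    and v0_nonpos: "AE x in lebesgue. v0 x \<le> 0"
    and proc: "(v, s) \<in> D_processes M F v0 s0"
    and ito: "\<And>\<phi>. \<phi> \<in> C12b \<Longrightarrow> has_ito_integral M F W
       (\<lambda>\<omega> r. LINT x:{s \<omega> r..}|lebesgue. v \<omega> r x * d_x \<phi> r x) (I \<phi>)"
    and identity: "AE \<omega> in M. \<forall>\<phi>\<in>C12b. \<forall>t>0. weak_identity \<kappa> \<theta> l v0 s0 (v \<omega>) (s \<omega>) \<phi> (I \<phi> \<omega> t) t"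
begin

lemma paths:
  assumes "\<omega> \<in> space M"
  shows v_integrable: "0 \<le> t \<Longrightarrow> integrable lebesgue (v \<omega> t)"
    and v_cadlag: "\<phi> \<in> bcontfun \<Longrightarrow> cadlag (\<lambda>t. pairing (v \<omega> t) \<phi>)"
    and s_cadlag: "cadlag (s \<omega>)" and s_mono: "0 \<le> r \<Longrightarrow> r \<le> t \<Longrightarrow> s \<omega> r \<le> s \<omega> t"
    and s_0: "s \<omega> 0 = s0" and v_0: "AE x in lebesgue. v \<omega> 0 x = v0 x"
    and v_supp: "0 \<le> t \<Longrightarrow> AE x in lebesgue. x < s \<omega> t \<longrightarrow> v \<omega> t x = 0"
    and v_Linf: "0 \<le> t \<Longrightarrow> Linf_norm (v \<omega> t) \<le> Linf_norm v0"
proof -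
  have p: "(v \<omega>, s \<omega>) \<in> D_paths v0 s0" using proc assms by (auto simp: D_processes_def)
  then show "0 \<le> t \<Longrightarrow> integrable lebesgue (v \<omega> t)" "\<phi> \<in> bcontfun \<Longrightarrow> cadlag (\<lambda>t. pairing (v \<omega> t) \<phi>)"
    "cadlag (s \<omega>)" "s \<omega> 0 = s0" "AE x in lebesgue. v \<omega> 0 x = v0 x" "0 \<le> t \<Longrightarrow> Linf_norm (v \<omega> t) \<le> Linf_norm v0"
    by (auto simp: D_paths_def D_L1_def D_up_H_def)
  show "s \<omega> r \<le> s \<omega> t" if "0 \<le> r" "r \<le> t"
    using p that by (auto simp: D_paths_def D_up_H_def intro: mono_onD)
  show "AE x in lebesgue. x < s \<omega> t \<longrightarrow> v \<omega> t x = 0" if "0 \<le> t"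
  proof -
    have "ess_supp (v \<omega> t) \<subseteq> {s \<omega> t..}" using p that by (auto simp: D_paths_def)
    with ess_supp_AE[of "v \<omega> t"] show ?thesis by (auto elim!: eventually_mono)
  qed
qed

lemma v0_support: "AE x in lebesgue. x < s0 \<longrightarrow> v0 x = 0"
  using ess_supp_AE[of v0] v0_supp by (auto elim!: eventually_mono)

lemma v_bounded: "\<exists>C\<ge>0. (AE x in lebesgue. \<bar>v0 x\<bar> \<le> C) \<and> (\<forall>\<omega>\<in>space M. \<forall>t\<ge>0. AE x in lebesgue. \<bar>v \<omega> t x\<bar> \<le> C)"
proof -
  obtain C where C: "C \<ge> 0" "Linf_norm v0 \<le> ereal C"
  proof (cases "Linf_norm v0")
    case (real r)
    then show ?thesis using that[of "max 0 r"] by simp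
  next
    case MInf
    then show ?thesis using that[of 0] by simp
  qed (use v0_Linf in auto)
  have AE: "AE x in lebesgue. \<bar>f x\<bar> \<le> C" if "Linf_norm f \<le> Linf_norm v0" for f
  proof -
    have "AE x in lebesgue. ereal \<bar>f x\<bar> \<le> Linf_norm f" unfolding Linf_norm_def by (rule esssup_AE)
    then show ?thesis
    proof eventually_elim
      case (elim x)
      then have "ereal \<bar>f x\<bar> \<le> ereal C" using that C(2) by (meson order_trans)
      then show ?case by simp
    qed
  qed
  then show ?thesis using C(1) v_Linf by blast
qed

lemma adapted_pairing: "\<phi> \<in> bcontfun \<Longrightarrow> 0 \<le> t \<Longrightarrow> (\<lambda>\<omega>. pairing (v \<omega> t) \<phi>) \<in> borel_measurable (F t)"
  and adapted_s: "0 \<le> t \<Longrightarrow> (\<lambda>\<omega>. s \<omega> t) \<in> borel_measurable (F t)"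
  using proc by (auto simp: D_processes_def adapted_def)

lemma stieltjes_props:
  assumes "\<omega> \<in> space M"
  shows "sets (stieltjes (s \<omega>)) = sets borel" "0 \<le> a \<Longrightarrow> a \<le> b \<Longrightarrow> emeasure (stieltjes (s \<omega>)) {a<..b} = ennreal (s \<omega> b - s \<omega> a)"
    "sigma_finite_measure (stieltjes (s \<omega>))"
proof -
  show "sets (stieltjes (s \<omega>)) = sets borel" by (simp add: stieltjes_def)
  have mono: "s \<omega> (max 0 x) \<le> s \<omega> (max 0 y)" if "x \<le> y" for x y
    using that assms by (intro s_mono) auto
  have cont: "continuous (at_right a) (\<lambda>r. s \<omega> (max 0 r))" for a
  proof (cases "a \<ge> 0")
    case True
    have "(s \<omega> \<longlongrightarrow> s \<omega> a) (at_right a)"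
      using s_cadlag[OF assms] True by (auto simp: cadlag_def continuous_within)
    then have "((\<lambda>r. s \<omega> (max 0 r)) \<longlongrightarrow> s \<omega> a) (at_right a)"
      by (rule Lim_transform_eventually) (use True in \<open>auto simp: eventually_at_right_field intro!: exI[of _ "a + 1"]\<close>)
    then show ?thesis using True by (simp add: continuous_within)
  next
    case False
    have "((\<lambda>r. s \<omega> (max 0 r)) \<longlongrightarrow> s \<omega> 0) (at_right a)"
      by (rule Lim_transform_eventually[OF tendsto_const])
         (use False in \<open>auto simp: eventually_at_right_field intro!: exI[of _ 0]\<close>)
    then show ?thesis using False by (simp add: continuous_within)
  qed
  show "emeasure (stieltjes (s \<omega>)) {a<..b} = ennreal (s \<omega> b - s \<omega> a)" if "0 \<le> a" "a \<le> b"
    unfolding stieltjes_def using that mono cont by (subst emeasure_interval_measure_Ioc) auto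
  show "sigma_finite_measure (stieltjes (s \<omega>))"
    unfolding stieltjes_def using mono cont by (rule sigma_finite_interval_measure)
qed

lemma pairing_integral:
  assumes \<omega>: "\<omega> \<in> space M" and g: "g \<in> bcontfun" and t: "0 \<le> t"
  shows "set_integrable lborel {0<..t} (\<lambda>r. pairing (v \<omega> r) g)"
    and "(LINT r:{0..t}|lebesgue. pairing (v \<omega> r) g) = (LINT r:{0<..t}|lborel. pairing (v \<omega> r) g)"
proof -
  note c = v_cadlag[OF \<omega> g]
  obtain B where "\<forall>r\<in>{0..t}. \<bar>pairing (v \<omega> r) g\<bar> \<le> B" using cadlag_bounded[OF c, of t] by blast
  then show "set_integrable lborel {0<..t} (\<lambda>r. pairing (v \<omega> r) g)"
    using cadlag_borel[OF c] by (intro set_integrable_bounded[where T = t and B = B]) auto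
  have m: "(\<lambda>r. indicator A r *\<^sub>R pairing (v \<omega> r) g) \<in> borel_measurable lborel" if "A \<subseteq> {0..t}" "A \<in> sets borel" for A
  proof -
    have "(\<lambda>r. indicator A r *\<^sub>R pairing (v \<omega> (max 0 r)) g) \<in> borel_measurable lborel"
      using cadlag_borel[OF c] that by simp
    moreover have "(\<lambda>r. indicator A r *\<^sub>R pairing (v \<omega> (max 0 r)) g) = (\<lambda>r. indicator A r *\<^sub>R pairing (v \<omega> r) g)"
      using that by (auto simp: indicator_def max_def fun_eq_iff)
    ultimately show ?thesis by (simp only:)
  qed
  have "(LINT r:{0..t}|lebesgue. pairing (v \<omega> r) g) = (LINT r:{0..t}|lborel. pairing (v \<omega> r) g)"
    unfolding set_lebesgue_integral_def by (rule integral_completion) (rule m, auto)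
  also have "\<dots> = (LINT r:{0<..t}|lborel. pairing (v \<omega> r) g)"
    unfolding set_lebesgue_integral_def
  proof (rule integral_cong_AE)
    show "AE r in lborel. indicator {0..t} r *\<^sub>R pairing (v \<omega> r) g = indicator {0<..t} r *\<^sub>R pairing (v \<omega> r) g"
      using AE_lborel_singleton[of 0] by eventually_elim (auto simp: indicator_def)
    show "(\<lambda>r. indicator {0..t} r *\<^sub>R pairing (v \<omega> r) g) \<in> borel_measurable lborel"
      "(\<lambda>r. indicator {0<..t} r *\<^sub>R pairing (v \<omega> r) g) \<in> borel_measurable lborel"
      by (rule m; auto)+
  qed
  finally show "(LINT r:{0..t}|lebesgue. pairing (v \<omega> r) g) = (LINT r:{0<..t}|lborel. pairing (v \<omega> r) g)" .
qed

text \<open>Jumps are still allowed here: \<open>s_jump_imp_v_jump\<close> applies this with a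
  constant test function, for which every term of the jump sum vanishes.\<close>

lemma weak_identity_pairing:
  assumes \<omega>: "\<omega> \<in> space M" and t: "0 < t"
    and g: "g \<in> bcontfun" "g'' \<in> bcontfun" and d: "d_xx (\<lambda>r. g) = (\<lambda>r. g'')" "\<And>r x. 0 \<le> r \<Longrightarrow> d_t (\<lambda>r. g) r x = 0"
    and wi: "weak_identity \<kappa> \<theta> l v0 s0 (v \<omega>) (s \<omega>) (\<lambda>r. g) J t"
  shows "pairing (v \<omega> t) g = pairing v0 g + \<kappa> * (LINT r:{0<..t}|lborel. pairing (v \<omega> r) g'') + \<theta> * J +
     l * \<kappa> * (LINT r:{0<..t}|stieltjes (s \<omega>). g (left_lim (s \<omega>) r)) +
     (\<Sum>\<^sub>\<infinity>r\<in>{0<..t}. LINT x:{left_lim (s \<omega>) r..s \<omega> r}|lebesgue. left_lim_L1 (v \<omega>) r x * (g (left_lim (s \<omega>) r) - g x))"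
proof -
  have 1: "(LINT x:{s \<omega> t..}|lebesgue. v \<omega> t x * g x) = pairing (v \<omega> t) g"
    using t \<omega> g by (intro set_integral_eq_pairing v_integrable v_supp) auto
  have 2: "(LINT x:{s0..}|lebesgue. v0 x * g x) = pairing v0 g"
    using g by (intro set_integral_eq_pairing v0_integrable v0_support)
  have 3: "(LINT r:{0..t}|lebesgue. LINT x:{s \<omega> r..}|lebesgue. v \<omega> r x * d_t (\<lambda>r. g) r x) = 0"
    unfolding set_lebesgue_integral_def using d(2) by (intro integral_eq_zero_AE AE_I2) (auto simp: indicator_def)
  have "(LINT r:{0..t}|lebesgue. LINT x:{s \<omega> r..}|lebesgue. v \<omega> r x * d_xx (\<lambda>r. g) r x) =
     (LINT r:{0..t}|lebesgue. pairing (v \<omega> r) g'')"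
    unfolding d(1) using \<omega> g
    by (intro set_lebesgue_integral_cong) (auto intro!: set_integral_eq_pairing v_integrable v_supp)
  also have "\<dots> = (LINT r:{0<..t}|lborel. pairing (v \<omega> r) g'')"
    using \<omega> g t by (intro pairing_integral) auto
  finally have 4: "(LINT r:{0..t}|lebesgue. LINT x:{s \<omega> r..}|lebesgue. v \<omega> r x * d_xx (\<lambda>r. g) r x) =
     (LINT r:{0<..t}|lborel. pairing (v \<omega> r) g'')" .
  have arith: "a = b + c + d + e + f" if "a - b = 0 + c + d + e + f" for a b c d e f :: real
    using that by linarith
  show ?thesis
    by (rule arith) (use wi[unfolded weak_identity_def 1 2 3 4] in simp)
qed

text \<open>Without a jump the left limit at \<open>r\<close> is \<open>s \<omega> r\<close> itself,
  and each term of the jump sum integrates over a single point.\<close>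

lemma weak_identity_no_jump:
  assumes \<omega>: "\<omega> \<in> space M" and t: "0 < t" and nj: "\<And>r. 0 < r \<Longrightarrow> r \<le> t \<Longrightarrow> left_lim (s \<omega>) r = s \<omega> r"
    and g: "g \<in> bcontfun" "g'' \<in> bcontfun" and d: "d_xx (\<lambda>r. g) = (\<lambda>r. g'')" "\<And>r x. 0 \<le> r \<Longrightarrow> d_t (\<lambda>r. g) r x = 0"
    and wi: "weak_identity \<kappa> \<theta> l v0 s0 (v \<omega>) (s \<omega>) (\<lambda>r. g) J t"
  shows "pairing (v \<omega> t) g = pairing v0 g + \<kappa> * (LINT r:{0<..t}|lborel. pairing (v \<omega> r) g'') + \<theta> * J +
     l * \<kappa> * (LINT r:{0<..t}|stieltjes (s \<omega>). g (s \<omega> r))"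
proof -
  have 1: "(LINT r:{0<..t}|stieltjes (s \<omega>). g (left_lim (s \<omega>) r)) = (LINT r:{0<..t}|stieltjes (s \<omega>). g (s \<omega> r))"
    using nj by (intro set_lebesgue_integral_cong) (auto simp: stieltjes_props(1)[OF \<omega>])
  have "(LINT x:{left_lim (s \<omega>) r..s \<omega> r}|lebesgue. left_lim_L1 (v \<omega>) r x * (g (left_lim (s \<omega>) r) - g x)) = 0"
    if "r \<in> {0<..t}" for r
  proof -
    have "left_lim (s \<omega>) r = s \<omega> r" using nj that by auto
    moreover have "AE x in lebesgue. x \<noteq> s \<omega> r"
      using AE_lborel_singleton[of "s \<omega> r"] by (rule AE_completion)
    ultimately show ?thesis
      unfolding set_lebesgue_integral_def by (intro integral_eq_zero_AE) (auto elim!: eventually_mono simp: indicator_def)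
  qed
  then have 2: "(\<Sum>\<^sub>\<infinity>r\<in>{0<..t}. LINT x:{left_lim (s \<omega>) r..s \<omega> r}|lebesgue. left_lim_L1 (v \<omega>) r x * (g (left_lim (s \<omega>) r) - g x)) = 0"
    by (rule infsum_0)
  show ?thesis
    using weak_identity_pairing[OF \<omega> t g d wi] unfolding 1 2 by simp
qed

definition X :: "real \<Rightarrow> 'a \<Rightarrow> real \<Rightarrow> complex" where
  "X \<xi> \<omega> r = Complex (pairing (v \<omega> r) (\<lambda>x. cos (\<xi> * x))) (pairing (v \<omega> r) (\<lambda>x. sin (\<xi> * x)))"

definition X0 :: "real \<Rightarrow> complex" where
  "X0 \<xi> = Complex (pairing v0 (\<lambda>x. cos (\<xi> * x))) (pairing v0 (\<lambda>x. sin (\<xi> * x)))"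

lemma trig_bcontfun': "(\<lambda>x. cos (\<xi> * x :: real)) \<in> bcontfun" "(\<lambda>x. sin (\<xi> * x :: real)) \<in> bcontfun"
  using trig_bcontfun[of 1 \<xi>] by simp_all

lemma pairing_cmult: "pairing f (\<lambda>x. a * g x) = a * pairing f g"
  unfolding pairing_def by (simp add: mult.left_commute[of _ a])

lemma pairing_v_0: "\<omega> \<in> space M \<Longrightarrow> \<phi> \<in> bcontfun \<Longrightarrow> pairing (v \<omega> 0) \<phi> = pairing v0 \<phi>"
  unfolding pairing_def
  by (intro integral_cong_AE borel_measurable_integrable integrable_mult_bcontfun v_integrable v0_integrable)
     (use v_0[of \<omega>] in \<open>auto elim!: eventually_mono\<close>)

text \<open>The factor \<open>E\<close> passes to the frame moving with \<open>\<theta>W\<close>, where the stochastic integrals cancel,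
  and its exponential part compensates the decay with the remaining diffusivity \<open>\<kappa> - \<theta>\<^sup>2 / 2\<close>.\<close>

lemma fourier_identity:
  assumes \<xi>: "\<xi> \<noteq> 0" and T: "T > 0"
  defines "E \<equiv> (\<lambda>\<omega> r. complex_of_real (exp ((\<kappa> - \<theta>\<^sup>2 / 2) * \<xi>\<^sup>2 * r)) * cis (- (\<xi> * \<theta>) * W \<omega> r))"
  shows "AE \<omega> in M. (\<forall>r. 0 < r \<and> r \<le> T \<longrightarrow> left_lim (s \<omega>) r = s \<omega> r) \<longrightarrow>
     E \<omega> T * X \<xi> \<omega> T = X0 \<xi> + l * \<kappa> * (LINT r:{0<..T}|stieltjes (s \<omega>). E \<omega> r * cis (\<xi> * s \<omega> r))"
proof -
  let ?c = "\<lambda>r::real. \<lambda>x. cos (\<xi> * x)" and ?s = "\<lambda>r::real. \<lambda>x. sin (\<xi> * x)"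
  define \<beta> where "\<beta> = (\<kappa> - \<theta>\<^sup>2 / 2) * \<xi>\<^sup>2"
  define V where "V \<omega> r = X \<xi> \<omega> r - \<theta> * Complex (I ?c \<omega> r) (I ?s \<omega> r)" for \<omega> r
  have adapted: "(\<lambda>\<omega>. X \<xi> \<omega> r) \<in> borel_measurable (F r)" if "0 \<le> r" for r
    using adapted_pairing[OF trig_bcontfun'(1) that] adapted_pairing[OF trig_bcontfun'(2) that]
    by (subst borel_measurable_complex_iff) (simp add: X_def)
  have cadlag: "cadlag (\<lambda>r. Re (X \<xi> \<omega> r))" "cadlag (\<lambda>r. Im (X \<xi> \<omega> r))" if "\<omega> \<in> space M" for \<omega>
    using v_cadlag[OF that trig_bcontfun'(1)] v_cadlag[OF that trig_bcontfun'(2)] by (simp_all add: X_def)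
  have H: "Complex (LINT x:{s \<omega> r..}|lebesgue. v \<omega> r x * d_x ?c r x) (LINT x:{s \<omega> r..}|lebesgue. v \<omega> r x * d_x ?s r x) = \<i> * \<xi> * X \<xi> \<omega> r"
    if "\<omega> \<in> space M" "0 \<le> r" for \<omega> r
  proof -
    have "(LINT x:{s \<omega> r..}|lebesgue. v \<omega> r x * ((- \<xi>) * sin (\<xi> * x))) = (- \<xi>) * pairing (v \<omega> r) (\<lambda>x. sin (\<xi> * x))"
      unfolding pairing_cmult[symmetric] using that
      by (intro set_integral_eq_pairing v_integrable v_supp trig_bcontfun) auto
    moreover have "(LINT x:{s \<omega> r..}|lebesgue. v \<omega> r x * (\<xi> * cos (\<xi> * x))) = \<xi> * pairing (v \<omega> r) (\<lambda>x. cos (\<xi> * x))"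
      unfolding pairing_cmult[symmetric] using that
      by (intro set_integral_eq_pairing v_integrable v_supp trig_bcontfun) auto
    ultimately show ?thesis
      unfolding trig_test_functions by (intro complex_eqI) (simp_all add: X_def)
  qed
  obtain N t where sub: "\<And>n. subdivision T (N n) (t n)" and
    mesh: "\<And>n i. i < N n \<Longrightarrow> t n (Suc i) - t n i \<le> 1 / real (Suc n)" and
    expansion: "AE \<omega> in M. \<forall>A. (\<lambda>n. \<Sum>i<N n. E \<omega> (t n (Suc i)) * (V \<omega> (t n (Suc i)) - V \<omega> (t n i))) \<longlonglongrightarrow> A \<longrightarrow>
      E \<omega> T * X \<xi> \<omega> T - E \<omega> 0 * X \<xi> \<omega> 0 = (\<beta> + (\<xi> * \<theta>)\<^sup>2 / 2) * (LINT r:{0<..T}|lborel. E \<omega> r * X \<xi> \<omega> r) + A"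
    using ito_expansion[OF T \<xi> adapted cadlag ito[OF trig_test_functions(1)] ito[OF trig_test_functions(4)] H, where \<beta> = \<beta> and \<theta> = \<theta>]
    unfolding V_def E_def \<beta>_def[symmetric] by blast
  have I0: "AE \<omega> in M. I ?c \<omega> 0 = 0" "AE \<omega> in M. I ?s \<omega> 0 = 0"
    using ito_integral_0[OF ito[OF trig_test_functions(1)]] ito_integral_0[OF ito[OF trig_test_functions(4)]] by simp_all
  show ?thesis
    using expansion identity I0 W_0 W_continuous AE_space
  proof eventually_elim
    case (elim \<omega>)
    note \<omega> = \<open>\<omega> \<in> space M\<close>
    let ?S = "stieltjes (s \<omega>)"
    show ?case
    proof
      assume nj: "\<forall>r. 0 < r \<and> r \<le> T \<longrightarrow> left_lim (s \<omega>) r = s \<omega> r"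
      define u where "u r = cis (\<xi> * s \<omega> r)" for r
      have intX: "set_integrable lborel {0<..r} (X \<xi> \<omega>)" if "0 \<le> r" for r
      proof -
        have "integrable lborel (\<lambda>r'. complex_of_real (indicator {0<..r} r' *\<^sub>R pairing (v \<omega> r') (\<lambda>x. cos (\<xi> * x))) +
            \<i> * complex_of_real (indicator {0<..r} r' *\<^sub>R pairing (v \<omega> r') (\<lambda>x. sin (\<xi> * x))))"
          using pairing_integral(1)[OF \<omega> trig_bcontfun'(1) that] pairing_integral(1)[OF \<omega> trig_bcontfun'(2) that]
          unfolding set_integrable_def
          by (intro Bochner_Integration.integrable_add integrable_mult_right integrable_of_real)
        moreover have "complex_of_real (indicator {0<..r} r' *\<^sub>R pairing (v \<omega> r') (\<lambda>x. cos (\<xi> * x))) +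
            \<i> * complex_of_real (indicator {0<..r} r' *\<^sub>R pairing (v \<omega> r') (\<lambda>x. sin (\<xi> * x))) =
            indicator {0<..r} r' *\<^sub>R X \<xi> \<omega> r'" for r'
          by (simp add: X_def complex_eq_iff)
        ultimately show ?thesis unfolding set_integrable_def by simp
      qed
      have intu: "set_integrable ?S {0<..r} u" if "0 \<le> r" for r
        unfolding set_integrable_def
      proof (rule integrableI_bounded_set[where A = "{0<..r}" and B = 1])
        have [measurable]: "(\<lambda>r. s \<omega> (max 0 r)) \<in> borel_measurable borel" by (rule cadlag_borel[OF s_cadlag[OF \<omega>]])
        have [measurable]: "(\<lambda>r. cis (\<xi> * s \<omega> (max 0 r))) \<in> borel_measurable borel"
          unfolding cis_conv_exp by measurable
        have "(\<lambda>r'. indicator {0<..r} r' *\<^sub>R cis (\<xi> * s \<omega> (max 0 r'))) \<in> borel_measurable borel" by measurable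
        moreover have "indicator {0<..r} r' *\<^sub>R cis (\<xi> * s \<omega> (max 0 r')) = indicator {0<..r} r' *\<^sub>R u r'" for r'
          by (simp add: u_def indicator_def max_def)
        ultimately show "(\<lambda>r'. indicator {0<..r} r' *\<^sub>R u r') \<in> borel_measurable ?S"
          by (simp add: measurable_cong_sets[OF stieltjes_props(1)[OF \<omega>] refl])
        show "{0<..r} \<in> sets ?S" by (simp add: stieltjes_props(1)[OF \<omega>])
        show "emeasure ?S {0<..r} < \<infinity>" using that by (simp add: stieltjes_props(2)[OF \<omega>])
      qed (auto simp: u_def indicator_def)
      \<comment> \<open>The weak identities for cosine and sine are combined: the second derivative
        contributes the factor \<open>- (\<xi>\<^sup>2)\<close>, and subtracting the Ito integrals
        leaves a path built from ordinary integrals, to which \<open>stieltjes_sum_lim\<close>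
        applies.\<close>
      have V: "V \<omega> r = X0 \<xi> + (- (\<kappa> * \<xi>\<^sup>2)) * (LINT r':{0<..r}|lborel. X \<xi> \<omega> r') + l * \<kappa> * (LINT r':{0<..r}|?S. u r')"
        if r: "0 \<le> r" "r \<le> T" for r
      proof (cases "r = 0")
        \<comment> \<open>The weak identity speaks of positive times; at time 0 the Ito integrals
          vanish almost surely by \<open>ito_integral_0\<close>.\<close>
        case True
        then show ?thesis
          using elim(3,4) pairing_v_0[OF \<omega> trig_bcontfun'(1)] pairing_v_0[OF \<omega> trig_bcontfun'(2)]
          by (simp add: V_def X_def X0_def complex_eq_iff set_lebesgue_integral_def)
      next
        case False
        then have r0: "0 < r" using r by simp
        have nj': "\<And>r'. 0 < r' \<Longrightarrow> r' \<le> r \<Longrightarrow> left_lim (s \<omega>) r' = s \<omega> r'" using nj r by auto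
        define XI where "XI = (LINT r':{0<..r}|lborel. X \<xi> \<omega> r')"
        define uI where "uI = (LINT r':{0<..r}|?S. u r')"
        have X_parts: "Re XI = (LINT r':{0<..r}|lborel. pairing (v \<omega> r') (\<lambda>x. cos (\<xi> * x)))"
          "Im XI = (LINT r':{0<..r}|lborel. pairing (v \<omega> r') (\<lambda>x. sin (\<xi> * x)))"
          using intX[OF r(1)] unfolding XI_def set_lebesgue_integral_def set_integrable_def
          by (simp_all add: integral_Re[symmetric] integral_Im[symmetric] X_def del: integral_Re integral_Im)
        have u_parts: "Re uI = (LINT r':{0<..r}|?S. cos (\<xi> * s \<omega> r'))"
          "Im uI = (LINT r':{0<..r}|?S. sin (\<xi> * s \<omega> r'))"
          using intu[OF r(1)] unfolding uI_def set_lebesgue_integral_def set_integrable_def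
          by (simp_all add: integral_Re[symmetric] integral_Im[symmetric] u_def del: integral_Re integral_Im)
        have pull: "(LINT r':{0<..r}|lborel. pairing (v \<omega> r') (\<lambda>x. a * g x)) = a * (LINT r':{0<..r}|lborel. pairing (v \<omega> r') g)" for a g
          unfolding pairing_cmult by simp
        have c: "pairing (v \<omega> r) (\<lambda>x. cos (\<xi> * x)) = pairing v0 (\<lambda>x. cos (\<xi> * x)) +
            \<kappa> * (LINT r':{0<..r}|lborel. pairing (v \<omega> r') (\<lambda>x. (- (\<xi>\<^sup>2)) * cos (\<xi> * x))) + \<theta> * I ?c \<omega> r +
            l * \<kappa> * (LINT r':{0<..r}|?S. cos (\<xi> * s \<omega> r'))"
          using elim(2) r0 trig_test_functions(1)
          by (intro weak_identity_no_jump[OF \<omega> r0 nj' trig_bcontfun'(1) trig_bcontfun(1) trig_test_functions(3,7)]) auto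
        have s: "pairing (v \<omega> r) (\<lambda>x. sin (\<xi> * x)) = pairing v0 (\<lambda>x. sin (\<xi> * x)) +
            \<kappa> * (LINT r':{0<..r}|lborel. pairing (v \<omega> r') (\<lambda>x. (- (\<xi>\<^sup>2)) * sin (\<xi> * x))) + \<theta> * I ?s \<omega> r +
            l * \<kappa> * (LINT r':{0<..r}|?S. sin (\<xi> * s \<omega> r'))"
          using elim(2) r0 trig_test_functions(4)
          by (intro weak_identity_no_jump[OF \<omega> r0 nj' trig_bcontfun'(2) trig_bcontfun(2) trig_test_functions(6,8)]) auto
        show ?thesis
          unfolding complex_eq_iff XI_def[symmetric] uI_def[symmetric]
          using c s X_parts u_parts unfolding pull by (simp add: V_def X_def X0_def)
      qed
      have E_cont: "continuous_on {0..} (E \<omega>)"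
        unfolding E_def by (intro continuous_intros elim(6))
      have sumV: "(\<Sum>i<N n. E \<omega> (t n (Suc i)) * (V \<omega> (t n (Suc i)) - V \<omega> (t n i))) =
         (- (\<kappa> * \<xi>\<^sup>2)) * (\<Sum>i<N n. E \<omega> (t n (Suc i)) * (LINT r:{t n i<..t n (Suc i)}|lborel. X \<xi> \<omega> r)) +
         l * \<kappa> * (\<Sum>i<N n. E \<omega> (t n (Suc i)) * (LINT r:{t n i<..t n (Suc i)}|?S. u r))" for n
        unfolding sum_distrib_left sum.distrib[symmetric]
      proof (rule sum.cong)
        fix i assume i: "i \<in> {..<N n}"
        have ti: "0 \<le> t n i" "t n i \<le> t n (Suc i)" "t n (Suc i) \<le> T"
          using subdivision_range[OF sub, of i n] subdivision_range[OF sub, of "Suc i" n] sub[of n] i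
          by (auto simp: subdivision_def less_imp_le)
        have un: "{0<..t n (Suc i)} = {0<..t n i} \<union> {t n i<..t n (Suc i)}" using ti by auto
        have dX: "(LINT r:{0<..t n (Suc i)}|lborel. X \<xi> \<omega> r) = (LINT r:{0<..t n i}|lborel. X \<xi> \<omega> r) + (LINT r:{t n i<..t n (Suc i)}|lborel. X \<xi> \<omega> r)"
          unfolding un using ti
          by (intro set_integral_Un intX set_integrable_subset[OF intX[of "t n (Suc i)"]]) auto
        have du: "(LINT r:{0<..t n (Suc i)}|?S. u r) = (LINT r:{0<..t n i}|?S. u r) + (LINT r:{t n i<..t n (Suc i)}|?S. u r)"
          unfolding un using ti
          by (intro set_integral_Un intu set_integrable_subset[OF intu[of "t n (Suc i)"]]) (auto simp: stieltjes_props(1)[OF \<omega>])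
        show "E \<omega> (t n (Suc i)) * (V \<omega> (t n (Suc i)) - V \<omega> (t n i)) =
           (- (\<kappa> * \<xi>\<^sup>2)) * (E \<omega> (t n (Suc i)) * (LINT r:{t n i<..t n (Suc i)}|lborel. X \<xi> \<omega> r)) +
           l * \<kappa> * (E \<omega> (t n (Suc i)) * (LINT r:{t n i<..t n (Suc i)}|?S. u r))"
        proof -
          have "V \<omega> (t n (Suc i)) - V \<omega> (t n i) = (- (\<kappa> * \<xi>\<^sup>2)) * (LINT r:{t n i<..t n (Suc i)}|lborel. X \<xi> \<omega> r) +
              l * \<kappa> * (LINT r:{t n i<..t n (Suc i)}|?S. u r)"
            using V[of "t n i"] V[of "t n (Suc i)"] ti unfolding dX du by (simp add: distrib_left)
          then show ?thesis by (simp only: distrib_left mult_ac)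
        qed
      qed simp
      define EXint where "EXint = (LINT r:{0<..T}|lborel. E \<omega> r * X \<xi> \<omega> r)"
      define Eu where "Eu = (LINT r:{0<..T}|?S. E \<omega> r * u r)"
      have "(\<lambda>n. \<Sum>i<N n. E \<omega> (t n (Suc i)) * (V \<omega> (t n (Suc i)) - V \<omega> (t n i))) \<longlonglongrightarrow>
          (- (\<kappa> * \<xi>\<^sup>2)) * EXint + l * \<kappa> * Eu"
        unfolding sumV EXint_def Eu_def
        using T by (intro tendsto_intros stieltjes_sum_lim[OF _ _ E_cont sub mesh] intX intu) (auto simp: stieltjes_props(1)[OF \<omega>])
      then have "E \<omega> T * X \<xi> \<omega> T - E \<omega> 0 * X \<xi> \<omega> 0 = (\<beta> + (\<xi> * \<theta>)\<^sup>2 / 2) * EXint + ((- (\<kappa> * \<xi>\<^sup>2)) * EXint + l * \<kappa> * Eu)"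
        using elim(1) unfolding EXint_def by blast
      also have "\<dots> = l * \<kappa> * Eu"
      proof -
        \<comment> \<open>This is the origin of \<open>\<beta>\<close>: the rate
          \<open>\<beta> + (\<xi> * \<theta>)\<^sup>2 / 2\<close> has to equal
          \<open>\<kappa> * \<xi>\<^sup>2\<close> for the diffusion term to cancel.\<close>
        have "\<beta> + (\<xi> * \<theta>)\<^sup>2 / 2 + (- (\<kappa> * \<xi>\<^sup>2)) = 0" by (simp add: \<beta>_def power_mult_distrib field_simps)
        then have "complex_of_real (\<beta> + (\<xi> * \<theta>)\<^sup>2 / 2) + (- (\<kappa> * \<xi>\<^sup>2)) = 0" by (metis of_real_0 of_real_add)
        then show ?thesis by (metis add.assoc add_0 distrib_right mult_zero_left)
      qed
      finally have "E \<omega> T * X \<xi> \<omega> T = E \<omega> 0 * X \<xi> \<omega> 0 + l * \<kappa> * Eu" by (simp add: algebra_simps)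
      moreover have "E \<omega> 0 = 1" using elim(5) by (simp add: E_def)
      moreover have "X \<xi> \<omega> 0 = X0 \<xi>"
        using pairing_v_0[OF \<omega> trig_bcontfun'(1)] pairing_v_0[OF \<omega> trig_bcontfun'(2)] by (simp add: X_def X0_def)
      ultimately show "E \<omega> T * X \<xi> \<omega> T = X0 \<xi> + l * \<kappa> * (LINT r:{0<..T}|?S. E \<omega> r * cis (\<xi> * s \<omega> r))"
        by (simp add: Eu_def u_def)
    qed
  qed
qed

end

section \<open>The heat kernel representation\<close>

lemma measurable_sets_borel: "sets \<mu> = sets borel \<Longrightarrow> f \<in> measurable borel N \<Longrightarrow> f \<in> measurable \<mu> N"
  using measurable_cong_sets[of \<mu> borel N N] by simp

definition sum_measure :: "real measure \<Rightarrow> real measure \<Rightarrow> real measure" where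
  "sum_measure \<mu> \<nu> = measure_of UNIV (sets borel) (\<lambda>A. emeasure \<mu> A + emeasure \<nu> A)"

lemma sets_sum_measure [simp, measurable_cong]: "sets (sum_measure \<mu> \<nu>) = sets borel"
  unfolding sum_measure_def using sets.sigma_sets_eq[of "borel :: real measure"] by (simp add: sets_measure_of_conv)

lemma space_sum_measure [simp]: "space (sum_measure \<mu> \<nu>) = UNIV"
  by (simp add: sum_measure_def space_measure_of_conv)

lemma emeasure_sum_measure:
  assumes s: "sets \<mu> = sets borel" "sets \<nu> = sets borel" and A: "A \<in> sets borel"
  shows "emeasure (sum_measure \<mu> \<nu>) A = emeasure \<mu> A + emeasure \<nu> A"
  unfolding sum_measure_def
proof (rule emeasure_measure_of_sigma[OF _ _ _ A])
  show "sigma_algebra UNIV (sets (borel :: real measure))"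
    using sets.sigma_algebra_axioms[of "borel :: real measure"] by simp
  show "countably_additive (sets borel) (\<lambda>A. emeasure \<mu> A + emeasure \<nu> A)"
  proof (rule countably_additiveI)
    fix A :: "nat \<Rightarrow> real set"
    assume A: "range A \<subseteq> sets borel" "disjoint_family A"
    have "(\<Sum>i. emeasure \<mu> (A i) + emeasure \<nu> (A i)) = (\<Sum>i. emeasure \<mu> (A i)) + (\<Sum>i. emeasure \<nu> (A i))"
      by (rule suminf_add[symmetric]) auto
    then show "(\<Sum>i. emeasure \<mu> (A i) + emeasure \<nu> (A i)) = emeasure \<mu> (\<Union> (range A)) + emeasure \<nu> (\<Union> (range A))"
      using A s suminf_emeasure[of A \<mu>] suminf_emeasure[of A \<nu>] by simp
  qed
qed (simp add: positive_def)

lemma nn_integral_sum_measure: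
  assumes s: "sets \<mu> = sets borel" "sets \<nu> = sets borel" and f: "f \<in> borel_measurable borel"
  shows "(\<integral>\<^sup>+x. f x \<partial>sum_measure \<mu> \<nu>) = (\<integral>\<^sup>+x. f x \<partial>\<mu>) + (\<integral>\<^sup>+x. f x \<partial>\<nu>)"
  using f
proof (induction rule: borel_measurable_induct)
  case (cong f g)
  then have "f = g" by (simp add: fun_eq_iff)
  then show ?case using cong by simp
next
  case (set A)
  then show ?case using s by (simp add: emeasure_sum_measure)
next
  case (mult u c)
  then have "u \<in> borel_measurable \<mu>" "u \<in> borel_measurable \<nu>" "u \<in> borel_measurable (sum_measure \<mu> \<nu>)"
    using s by (auto intro: measurable_sets_borel)
  then show ?case using mult by (simp add: nn_integral_cmult distrib_left)
next
  case (add u v)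
  then have "u \<in> borel_measurable \<mu>" "u \<in> borel_measurable \<nu>" "u \<in> borel_measurable (sum_measure \<mu> \<nu>)"
    "v \<in> borel_measurable \<mu>" "v \<in> borel_measurable \<nu>" "v \<in> borel_measurable (sum_measure \<mu> \<nu>)"
    using s by (auto intro: measurable_sets_borel)
  then show ?case using add by (simp add: nn_integral_add ac_simps)
next
  case (seq U)
  then have m: "U i \<in> borel_measurable \<mu>" "U i \<in> borel_measurable \<nu>" "U i \<in> borel_measurable (sum_measure \<mu> \<nu>)" for i
    using s by (auto intro: measurable_sets_borel)
  have i: "incseq (\<lambda>i. \<integral>\<^sup>+x. U i x \<partial>\<mu>)" "incseq (\<lambda>i. \<integral>\<^sup>+x. U i x \<partial>\<nu>)"
    using seq(3) by (auto simp: incseq_def le_fun_def intro!: nn_integral_mono)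
  have "(\<integral>\<^sup>+x. (SUP i. U i) x \<partial>sum_measure \<mu> \<nu>) = (SUP i. \<integral>\<^sup>+x. U i x \<partial>sum_measure \<mu> \<nu>)"
    using seq m by (simp add: nn_integral_monotone_convergence_SUP image_comp)
  also have "\<dots> = (SUP i. (\<integral>\<^sup>+x. U i x \<partial>\<mu>) + (\<integral>\<^sup>+x. U i x \<partial>\<nu>))" using seq by simp
  also have "\<dots> = (SUP i. \<integral>\<^sup>+x. U i x \<partial>\<mu>) + (SUP i. \<integral>\<^sup>+x. U i x \<partial>\<nu>)"
    using i by (rule ennreal_SUP_add)
  also have "\<dots> = (\<integral>\<^sup>+x. (SUP i. U i) x \<partial>\<mu>) + (\<integral>\<^sup>+x. (SUP i. U i) x \<partial>\<nu>)"
    using seq m by (simp add: nn_integral_monotone_convergence_SUP image_comp)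
  finally show ?case .
qed

lemma finite_measure_sum_measure:
  assumes s: "sets \<mu> = sets borel" "sets \<nu> = sets borel" and f: "finite_measure \<mu>" "finite_measure \<nu>"
  shows "finite_measure (sum_measure \<mu> \<nu>)"
proof (rule finite_measureI)
  have "emeasure \<mu> UNIV < \<infinity>" "emeasure \<nu> UNIV < \<infinity>"
    using finite_measure.emeasure_finite[OF f(1), of UNIV] finite_measure.emeasure_finite[OF f(2), of UNIV]
    by (auto simp: less_top)
  then show "emeasure (sum_measure \<mu> \<nu>) (space (sum_measure \<mu> \<nu>)) \<noteq> \<infinity>"
    using s by (simp add: emeasure_sum_measure less_top)
qed

lemma integrable_bounded_borel:
  fixes f :: "real \<Rightarrow> 'b::{banach, second_countable_topology}"
  assumes "finite_measure \<mu>" "sets \<mu> = sets borel" "f \<in> borel_measurable borel" "\<And>x. norm (f x) \<le> B"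
  shows "integrable \<mu> f"
  using assms by (intro finite_measure.integrable_const_bound[where B = B]) (auto intro: measurable_sets_borel)

lemma integral_sum_measure_real:
  fixes f :: "real \<Rightarrow> real"
  assumes s: "sets \<mu> = sets borel" "sets \<nu> = sets borel" and fin: "finite_measure \<mu>" "finite_measure \<nu>"
    and f: "f \<in> borel_measurable borel" "\<And>x. \<bar>f x\<bar> \<le> B"
  shows "(\<integral>x. f x \<partial>sum_measure \<mu> \<nu>) = (\<integral>x. f x \<partial>\<mu>) + (\<integral>x. f x \<partial>\<nu>)"
proof -
  let ?\<sigma> = "sum_measure \<mu> \<nu>"
  have fs: "finite_measure ?\<sigma>" using s fin by (rule finite_measure_sum_measure)
  have nonneg: "(\<integral>x. g x \<partial>?\<sigma>) = (\<integral>x. g x \<partial>\<mu>) + (\<integral>x. g x \<partial>\<nu>)"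
    if g: "g \<in> borel_measurable borel" "\<And>x. 0 \<le> g x" "\<And>x. g x \<le> K" for g and K :: real
  proof -
    have int: "integrable \<rho> g" if "finite_measure \<rho>" "sets \<rho> = sets borel" for \<rho>
      using that g by (intro integrable_bounded_borel[where B = K]) auto
    have "ennreal (\<integral>x. g x \<partial>?\<sigma>) = (\<integral>\<^sup>+x. g x \<partial>?\<sigma>)"
      using int[OF fs] g by (intro nn_integral_eq_integral[symmetric]) auto
    also have "\<dots> = (\<integral>\<^sup>+x. g x \<partial>\<mu>) + (\<integral>\<^sup>+x. g x \<partial>\<nu>)"
      using s g by (intro nn_integral_sum_measure) auto
    also have "\<dots> = ennreal (\<integral>x. g x \<partial>\<mu>) + ennreal (\<integral>x. g x \<partial>\<nu>)"
      using int[OF fin(1) s(1)] int[OF fin(2) s(2)] g by (simp add: nn_integral_eq_integral)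
    also have "\<dots> = ennreal ((\<integral>x. g x \<partial>\<mu>) + (\<integral>x. g x \<partial>\<nu>))"
      using g by (intro ennreal_plus[symmetric] integral_nonneg_AE) auto
    finally show ?thesis using g by (subst (asm) ennreal_inj) (auto intro!: add_nonneg_nonneg integral_nonneg_AE)
  qed
  have B: "B \<ge> 0" using f(2)[of 0] by simp
  have int: "integrable \<rho> f" if "finite_measure \<rho>" "sets \<rho> = sets borel" for \<rho>
    using that f by (intro integrable_bounded_borel[where B = B]) auto
  have cint: "integrable \<rho> (\<lambda>_. B)" if "finite_measure \<rho>" for \<rho> :: "real measure"
    using that by (rule finite_measure.integrable_const)
  have bnd: "0 \<le> f x + B" "f x + B \<le> 2 * B" for x using f(2)[of x] by (auto simp: abs_le_iff)
  \<comment> \<open>Adding the constant \<open>B\<close> reduces to nonnegative functions; the same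
    statement for the constant itself is then subtracted.\<close>
  have "(\<integral>x. f x + B \<partial>?\<sigma>) = (\<integral>x. f x + B \<partial>\<mu>) + (\<integral>x. f x + B \<partial>\<nu>)"
    using f bnd by (intro nonneg[where K = "2 * B"]) auto
  moreover have "(\<integral>x. B \<partial>?\<sigma>) = (\<integral>x. B \<partial>\<mu>) + (\<integral>x. B \<partial>\<nu>)"
    using B by (intro nonneg[where K = B]) auto
  moreover have "(\<integral>x. f x + B \<partial>\<rho>) = (\<integral>x. f x \<partial>\<rho>) + (\<integral>x. B \<partial>\<rho>)" if "finite_measure \<rho>" "sets \<rho> = sets borel" for \<rho>
    using int[OF that] cint[OF that(1)] by (rule Bochner_Integration.integral_add)
  ultimately show ?thesis using fs fin s by simp
qed

lemma integral_sum_measure_complex: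
  fixes f :: "real \<Rightarrow> complex"
  assumes s: "sets \<mu> = sets borel" "sets \<nu> = sets borel" and fin: "finite_measure \<mu>" "finite_measure \<nu>"
    and f: "f \<in> borel_measurable borel" "\<And>x. norm (f x) \<le> B"
  shows "(\<integral>x. f x \<partial>sum_measure \<mu> \<nu>) = (\<integral>x. f x \<partial>\<mu>) + (\<integral>x. f x \<partial>\<nu>)"
proof -
  have fs: "finite_measure (sum_measure \<mu> \<nu>)" using s fin by (rule finite_measure_sum_measure)
  have int: "integrable \<rho> f" if "finite_measure \<rho>" "sets \<rho> = sets borel" for \<rho>
    using that f by (intro integrable_bounded_borel[where B = B]) auto
  note i = int[OF fs sets_sum_measure] int[OF fin(1) s(1)] int[OF fin(2) s(2)]
  have "(\<integral>x. Re (f x) \<partial>sum_measure \<mu> \<nu>) = (\<integral>x. Re (f x) \<partial>\<mu>) + (\<integral>x. Re (f x) \<partial>\<nu>)"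
    using f by (intro integral_sum_measure_real[OF s fin, where B = B]) (auto intro: order_trans[OF abs_Re_le_cmod])
  moreover have "(\<integral>x. Im (f x) \<partial>sum_measure \<mu> \<nu>) = (\<integral>x. Im (f x) \<partial>\<mu>) + (\<integral>x. Im (f x) \<partial>\<nu>)"
    using f by (intro integral_sum_measure_real[OF s fin, where B = B]) (auto intro: order_trans[OF abs_Im_le_cmod])
  ultimately show ?thesis using i by (intro complex_eqI) simp_all
qed

text \<open>Frequency 0 shows that the total masses agree. If they are positive, normalising by them
  reduces to Levy's uniqueness theorem for probability measures; mass 0 is treated
  separately.\<close>

lemma finite_measure_fourier_unique:
  assumes fin: "finite_measure \<mu>" "finite_measure \<nu>" and s: "sets \<mu> = sets borel" "sets \<nu> = sets borel"
    and eq: "\<And>\<xi>::real. (\<integral>x. cis (\<xi> * x) \<partial>\<mu>) = (\<integral>x. cis (\<xi> * x) \<partial>\<nu>)"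
  shows "\<mu> = \<nu>"
proof -
  interpret m: finite_measure \<mu> by fact
  interpret n: finite_measure \<nu> by fact
  have sp: "space \<mu> = UNIV" "space \<nu> = UNIV" using s sets_eq_imp_space_eq[of _ "borel :: real measure"] by auto
  have tot: "measure \<mu> UNIV = measure \<nu> UNIV"
  proof -
    have "(\<integral>x. cis (0 * x) \<partial>\<mu>) = (\<integral>x. cis (0 * x) \<partial>\<nu>)" by (rule eq)
    then show ?thesis using sp by simp
  qed
  show ?thesis
  proof (cases "measure \<mu> UNIV = 0")
    case True
    have "emeasure \<mu> A = emeasure \<nu> A" if "A \<in> sets \<mu>" for A
    proof -
      have "emeasure \<mu> A \<le> emeasure \<mu> UNIV" "emeasure \<nu> A \<le> emeasure \<nu> UNIV"
        using s by (auto intro!: emeasure_mono)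
      then show ?thesis using True tot by (simp add: m.emeasure_eq_measure n.emeasure_eq_measure measure_le_0_iff)
    qed
    then show ?thesis using s by (intro measure_eqI) auto
  next
    case False
    define c where "c = measure \<mu> UNIV"
    have c: "c > 0" using False by (simp add: c_def zero_less_measure_iff)
    define P where "P \<rho> = density \<rho> (\<lambda>_. ennreal (1 / c))" for \<rho> :: "real measure"
    have P: "real_distribution (P \<rho>)" if "finite_measure \<rho>" "sets \<rho> = sets borel" "measure \<rho> UNIV = c" for \<rho>
    proof -
      interpret f: finite_measure \<rho> by fact
      have sp: "space \<rho> = UNIV" using that sets_eq_imp_space_eq[of \<rho> "borel :: real measure"] by auto
      have "emeasure (P \<rho>) (space (P \<rho>)) = ennreal (1 / c) * ennreal c"
        using that sp by (simp add: P_def emeasure_density nn_integral_cmult f.emeasure_eq_measure)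
      also have "\<dots> = 1" using c by (simp add: ennreal_mult[symmetric])
      finally show ?thesis using that sp
        by (intro real_distribution.intro prob_spaceI real_distribution_axioms.intro) (auto simp: P_def)
    qed
    have PA: "emeasure (P \<rho>) A = ennreal (1 / c) * emeasure \<rho> A" if "A \<in> sets \<rho>" for \<rho> A
      using that by (simp add: P_def emeasure_density nn_integral_cmult_indicator)
    have char_P: "char (P \<rho>) \<xi> = (1 / c) *\<^sub>R (\<integral>x. cis (\<xi> * x) \<partial>\<rho>)" if "sets \<rho> = sets borel" for \<rho> \<xi>
    proof -
      have m: "(\<lambda>x. cis (\<xi> * x)) \<in> borel_measurable \<rho>"
        by (rule measurable_sets_borel[OF that]) (intro borel_measurable_continuous_onI continuous_intros)
      have "char (P \<rho>) \<xi> = (\<integral>x. cis (\<xi> * x) \<partial>density \<rho> (\<lambda>_. ennreal (1 / c)))"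
        unfolding char_def P_def cis_conv_exp ..
      also have "\<dots> = (\<integral>x. (1 / c) *\<^sub>R cis (\<xi> * x) \<partial>\<rho>)"
        using c by (intro integral_density m) auto
      also have "\<dots> = (1 / c) *\<^sub>R (\<integral>x. cis (\<xi> * x) \<partial>\<rho>)" by (rule integral_scaleR_right)
      finally show ?thesis .
    qed
    have "P \<mu> = P \<nu>"
      using P[OF fin(1) s(1)] P[OF fin(2) s(2)] tot
      by (intro Levy_uniqueness) (auto simp: fun_eq_iff char_P[OF s(1)] char_P[OF s(2)] eq c_def)
    have "emeasure \<mu> A = emeasure \<nu> A" if "A \<in> sets \<mu>" for A
    proof -
      have "ennreal (1 / c) * emeasure \<mu> A = ennreal (1 / c) * emeasure \<nu> A"
        using PA[of A \<mu>] PA[of A \<nu>] that s \<open>P \<mu> = P \<nu>\<close> by simp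
      then show ?thesis using c by (simp add: ennreal_mult_cancel_left)
    qed
    then show ?thesis using s by (intro measure_eqI) auto
  qed
qed

text \<open>This is uniqueness for the signed measure \<open>\<mu>1 - \<nu>1 = \<nu>2 - \<mu>2\<close>, with all terms moved to the
  side on which they are positive.\<close>

lemma signed_fourier_unique:
  fixes \<phi> :: "real \<Rightarrow> real"
  assumes fin: "finite_measure \<mu>1" "finite_measure \<mu>2" "finite_measure \<nu>1" "finite_measure \<nu>2"
    and s: "sets \<mu>1 = sets borel" "sets \<mu>2 = sets borel" "sets \<nu>1 = sets borel" "sets \<nu>2 = sets borel"
    and eq: "\<And>\<xi>::real. \<xi> \<in> \<rat> - {0} \<Longrightarrow> (\<integral>x. cis (\<xi> * x) \<partial>\<mu>1) + (\<integral>x. cis (\<xi> * x) \<partial>\<mu>2) =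
      (\<integral>x. cis (\<xi> * x) \<partial>\<nu>1) + (\<integral>x. cis (\<xi> * x) \<partial>\<nu>2)"
    and \<phi>: "\<phi> \<in> borel_measurable borel" "\<And>x. \<bar>\<phi> x\<bar> \<le> B"
  shows "(\<integral>x. \<phi> x \<partial>\<mu>1) + (\<integral>x. \<phi> x \<partial>\<mu>2) = (\<integral>x. \<phi> x \<partial>\<nu>1) + (\<integral>x. \<phi> x \<partial>\<nu>2)"
proof -
  have cism: "(\<lambda>x. cis (\<xi> * x)) \<in> borel_measurable borel" for \<xi> :: real
    by (intro borel_measurable_continuous_onI continuous_intros)
  have lim: "(\<lambda>n. \<integral>x. cis (q n * x) \<partial>\<rho>) \<longlonglongrightarrow> (\<integral>x. cis (\<xi> * x) \<partial>\<rho>)"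
    if "q \<longlonglongrightarrow> \<xi>" "finite_measure \<rho>" "sets \<rho> = sets borel" for q :: "nat \<Rightarrow> real" and \<xi> \<rho>
  proof (rule integral_dominated_convergence[where w = "\<lambda>_. 1"])
    show "integrable \<rho> (\<lambda>_. 1 :: real)" using that by (simp add: finite_measure.integrable_const)
    have "continuous_on UNIV cis" by (intro continuous_intros)
    then have "(\<lambda>n. cis (q n * x)) \<longlonglongrightarrow> cis (\<xi> * x)" for x
      by (rule continuous_on_tendsto_compose) (auto intro!: tendsto_intros that)
    then show "AE x in \<rho>. (\<lambda>n. cis (q n * x)) \<longlonglongrightarrow> cis (\<xi> * x)" by simp
  qed (use cism that(3) in \<open>auto intro: measurable_sets_borel\<close>)
  have all: "(\<integral>x. cis (\<xi> * x) \<partial>\<mu>1) + (\<integral>x. cis (\<xi> * x) \<partial>\<mu>2) = (\<integral>x. cis (\<xi> * x) \<partial>\<nu>1) + (\<integral>x. cis (\<xi> * x) \<partial>\<nu>2)" for \<xi> :: real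
  proof -
    \<comment> \<open>The cap at 0 for negative \<open>\<xi>\<close> keeps \<open>q\<close> away
      from 0. Frequency 0 itself, about which the hypothesis says nothing, is reached as a
      limit.\<close>
    have "\<exists>q\<in>\<rat> - {0}. \<xi> \<le> q \<and> q \<le> \<xi> + 1 / real (Suc n)" for n
    proof -
      have "\<xi> < (if \<xi> < 0 then min 0 (\<xi> + 1 / real (Suc n)) else \<xi> + 1 / real (Suc n))" by simp
      then obtain q where "q \<in> \<rat>" "\<xi> < q" "q < (if \<xi> < 0 then min 0 (\<xi> + 1 / real (Suc n)) else \<xi> + 1 / real (Suc n))"
        using Rats_dense_in_real by blast
      then show ?thesis by (intro bexI[of _ q]) (auto split: if_splits)
    qed
    then obtain q where q: "\<And>n. q n \<in> \<rat> - {0}" "\<And>n. \<xi> \<le> q n" "\<And>n. q n \<le> \<xi> + 1 / real (Suc n)" by metis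
    have u: "(\<lambda>n. \<xi> + 1 / real (Suc n)) \<longlonglongrightarrow> \<xi>"
      using tendsto_add[OF tendsto_const[of \<xi>] LIMSEQ_Suc[OF lim_1_over_n]] by simp
    have ql: "q \<longlonglongrightarrow> \<xi>"
      by (rule tendsto_sandwich[OF _ _ tendsto_const u]) (use q in simp_all)
    have "(\<lambda>n. (\<integral>x. cis (q n * x) \<partial>\<mu>1) + (\<integral>x. cis (q n * x) \<partial>\<mu>2)) \<longlonglongrightarrow> (\<integral>x. cis (\<xi> * x) \<partial>\<mu>1) + (\<integral>x. cis (\<xi> * x) \<partial>\<mu>2)"
      by (intro tendsto_add lim ql fin s)
    moreover have "(\<lambda>n. (\<integral>x. cis (q n * x) \<partial>\<nu>1) + (\<integral>x. cis (q n * x) \<partial>\<nu>2)) \<longlonglongrightarrow> (\<integral>x. cis (\<xi> * x) \<partial>\<nu>1) + (\<integral>x. cis (\<xi> * x) \<partial>\<nu>2)"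
      by (intro tendsto_add lim ql fin s)
    ultimately show ?thesis unfolding eq[OF q(1)] by (rule LIMSEQ_unique)
  qed
  have "sum_measure \<mu>1 \<mu>2 = sum_measure \<nu>1 \<nu>2"
  proof (rule finite_measure_fourier_unique)
    show "(\<integral>x. cis (\<xi> * x) \<partial>sum_measure \<mu>1 \<mu>2) = (\<integral>x. cis (\<xi> * x) \<partial>sum_measure \<nu>1 \<nu>2)" for \<xi>
      using all[of \<xi>] integral_sum_measure_complex[OF s(1,2) fin(1,2) cism[of \<xi>], where B = 1]
        integral_sum_measure_complex[OF s(3,4) fin(3,4) cism[of \<xi>], where B = 1] by simp
  qed (auto intro!: finite_measure_sum_measure fin s)
  then show ?thesis
    using integral_sum_measure_real[OF s(1,2) fin(1,2) \<phi>] integral_sum_measure_real[OF s(3,4) fin(3,4) \<phi>] by simp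
qed

text \<open>Time is the variance: this is the semigroup of half the Laplacian.\<close>

definition heat :: "real \<Rightarrow> (real \<Rightarrow> real) \<Rightarrow> real \<Rightarrow> real" where
  "heat t \<phi> x = (\<integral>z. \<phi> (x + sqrt t * z) \<partial>std_normal_distribution)"

text \<open>The mass at \<open>x\<close> is spread over the normal law with mean \<open>g x\<close>
  and standard deviation \<open>\<bar>h x\<bar>\<close>. With \<open>h\<close> constant this is the
  heat flow of an initial value, with \<open>h\<close> depending on the point it describes mass
  released at different times, and with \<open>h = 0\<close> it is an image measure.\<close>

definition smear :: "'b measure \<Rightarrow> ('b \<Rightarrow> real) \<Rightarrow> ('b \<Rightarrow> real) \<Rightarrow> real measure" where
  "smear \<mu> g h = distr (\<mu> \<Otimes>\<^sub>M std_normal_distribution) borel (\<lambda>(x, z). g x + h x * z)"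

lemma smear:
  assumes fin: "finite_measure \<mu>" and g: "g \<in> borel_measurable \<mu>" and h: "h \<in> borel_measurable \<mu>"
  shows sets_smear: "sets (smear \<mu> g h) = sets borel" and finite_smear: "finite_measure (smear \<mu> g h)"
    and integral_smear: "\<And>f. f \<in> borel_measurable borel \<Longrightarrow> (\<And>x. norm (f x :: 'c::{banach, second_countable_topology}) \<le> B) \<Longrightarrow>
      (\<integral>x. f x \<partial>smear \<mu> g h) = (\<integral>x. (\<integral>z. f (g x + h x * z) \<partial>std_normal_distribution) \<partial>\<mu>)"
proof -
  interpret m: finite_measure \<mu> by fact
  interpret n: real_distribution std_normal_distribution by (rule real_dist_normal_dist)
  interpret p: pair_sigma_finite \<mu> std_normal_distribution ..
  have fp: "finite_measure (\<mu> \<Otimes>\<^sub>M std_normal_distribution)"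
    by (rule finite_measure_pair_measure) unfold_locales
  note [measurable] = g h
  have meas [measurable]: "(\<lambda>(x, z). g x + h x * z) \<in> borel_measurable (\<mu> \<Otimes>\<^sub>M std_normal_distribution)"
    by measurable
  show "sets (smear \<mu> g h) = sets borel" by (simp add: smear_def)
  show "finite_measure (smear \<mu> g h)"
    unfolding smear_def by (rule finite_measure.finite_measure_distr[OF fp meas])
  fix f :: "real \<Rightarrow> 'c" assume f [measurable]: "f \<in> borel_measurable borel" and B: "\<And>x. norm (f x) \<le> B"
  have int: "integrable (\<mu> \<Otimes>\<^sub>M std_normal_distribution) (\<lambda>w. f (case w of (x, z) \<Rightarrow> g x + h x * z))"
    using B by (intro finite_measure.integrable_const_bound[OF fp, where B = B]) auto
  have "(\<integral>x. f x \<partial>smear \<mu> g h) = (\<integral>w. f (case w of (x, z) \<Rightarrow> g x + h x * z) \<partial>(\<mu> \<Otimes>\<^sub>M std_normal_distribution))"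
    unfolding smear_def by (rule integral_distr[OF meas f])
  also have "\<dots> = (\<integral>x. (\<integral>z. f (g x + h x * z) \<partial>std_normal_distribution) \<partial>\<mu>)"
    using p.integral_fst'[OF int] by simp
  finally show "(\<integral>x. f x \<partial>smear \<mu> g h) = (\<integral>x. (\<integral>z. f (g x + h x * z) \<partial>std_normal_distribution) \<partial>\<mu>)" .
qed

lemma integral_cis_normal:
  "(\<integral>z. cis (\<xi> * (a + b * z)) \<partial>std_normal_distribution) = cis (\<xi> * a) * complex_of_real (exp (- (\<xi> * b)\<^sup>2 / 2))"
proof -
  have "(\<integral>z. cis (\<xi> * (a + b * z)) \<partial>std_normal_distribution) = (\<integral>z. cis (\<xi> * a) * iexp ((\<xi> * b) * z) \<partial>std_normal_distribution)"
    by (rule Bochner_Integration.integral_cong) (simp_all add: cis_conv_exp exp_add[symmetric] algebra_simps)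
  also have "\<dots> = cis (\<xi> * a) * char std_normal_distribution (\<xi> * b)"
    by (simp add: char_def)
  finally show ?thesis by (simp add: char_std_normal_distribution)
qed

lemma fourier_smear:
  assumes fin: "finite_measure \<mu>" and g: "g \<in> borel_measurable \<mu>" and h: "h \<in> borel_measurable \<mu>"
  shows "(\<integral>x. cis (\<xi> * x) \<partial>smear \<mu> g h) = (\<integral>x. cis (\<xi> * g x) * complex_of_real (exp (- (\<xi> * h x)\<^sup>2 / 2)) \<partial>\<mu>)"
proof -
  have "(\<lambda>x. cis (\<xi> * x)) \<in> borel_measurable borel"
    by (intro borel_measurable_continuous_onI continuous_intros)
  from integral_smear[OF fin g h this, of 1] show ?thesis by (simp add: integral_cis_normal)
qed

text \<open>As \<open>ennreal\<close> sends negative reals to 0, this is the measure with density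
  the positive part of \<open>f\<close>. The image under the identity moves it from the Lebesgue
  sets to the Borel sets, on which the uniqueness theorem is stated.\<close>

definition lebesgue_part :: "(real \<Rightarrow> real) \<Rightarrow> real measure" where
  "lebesgue_part f = distr (density lebesgue (\<lambda>x. ennreal (f x))) borel (\<lambda>x. x)"

lemma lebesgue_part:
  assumes f: "integrable lebesgue f"
  shows sets_lebesgue_part: "sets (lebesgue_part f) = sets borel" and finite_lebesgue_part: "finite_measure (lebesgue_part f)"
    and integral_lebesgue_part: "\<And>g. g \<in> borel_measurable borel \<Longrightarrow>
      (\<integral>x. (g x :: 'c::{banach, second_countable_topology}) \<partial>lebesgue_part f) = (\<integral>x. max 0 (f x) *\<^sub>R g x \<partial>lebesgue)"
proof -
  have fm [measurable]: "f \<in> borel_measurable lebesgue" using f by auto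
  have id: "(\<lambda>x. x) \<in> measurable (density lebesgue (\<lambda>x. ennreal (f x))) borel"
    by (simp add: measurable_completion)
  show "sets (lebesgue_part f) = sets borel" by (simp add: lebesgue_part_def)
  show "finite_measure (lebesgue_part f)"
  proof (rule finite_measureI)
    have "emeasure (lebesgue_part f) (space (lebesgue_part f)) = (\<integral>\<^sup>+x. ennreal (f x) \<partial>lebesgue)"
      unfolding lebesgue_part_def using id by (simp add: emeasure_distr emeasure_density)
    also have "\<dots> \<le> (\<integral>\<^sup>+x. ennreal (norm (f x)) \<partial>lebesgue)" by (intro nn_integral_mono ennreal_leI) auto
    also have "\<dots> < \<infinity>" using f by (simp add: integrable_iff_bounded)
    finally show "emeasure (lebesgue_part f) (space (lebesgue_part f)) \<noteq> \<infinity>" by simp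
  qed
  fix g :: "real \<Rightarrow> 'c" assume g: "g \<in> borel_measurable borel"
  have "(\<lambda>x. ennreal (f x)) = (\<lambda>x. ennreal (max 0 (f x)))" by (simp add: fun_eq_iff max_def ennreal_neg)
  then have "(\<integral>x. g x \<partial>lebesgue_part f) = (\<integral>x. g x \<partial>density lebesgue (\<lambda>x. ennreal (max 0 (f x))))"
    unfolding lebesgue_part_def using integral_distr[OF id g] by simp
  also have "\<dots> = (\<integral>x. max 0 (f x) *\<^sub>R g x \<partial>lebesgue)"
    using g by (intro integral_density) (auto intro: measurable_completion)
  finally show "(\<integral>x. g x \<partial>lebesgue_part f) = (\<integral>x. max 0 (f x) *\<^sub>R g x \<partial>lebesgue)" .
qed

lemma lebesgue_part_diff:
  fixes g :: "real \<Rightarrow> 'c::{banach, second_countable_topology}"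
  assumes f: "integrable lebesgue f" and g: "g \<in> borel_measurable borel" "\<And>x. norm (g x) \<le> B"
  shows "(\<integral>x. g x \<partial>lebesgue_part f) - (\<integral>x. g x \<partial>lebesgue_part (\<lambda>x. - f x)) = (\<integral>x. f x *\<^sub>R g x \<partial>lebesgue)"
proof -
  have f': "integrable lebesgue (\<lambda>x. - f x)" using f by simp
  have gm: "g \<in> borel_measurable lebesgue" using g by (simp add: measurable_completion)
  have int: "integrable lebesgue (\<lambda>x. max 0 (h x) *\<^sub>R g x)" if h: "integrable lebesgue h" for h :: "real \<Rightarrow> real"
  proof (rule Bochner_Integration.integrable_bound)
    show "integrable lebesgue (\<lambda>x. B *\<^sub>R h x)" using h by simp
    show "(\<lambda>x. max 0 (h x) *\<^sub>R g x) \<in> borel_measurable lebesgue"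
      using h gm by (intro borel_measurable_scaleR borel_measurable_max) auto
    have "norm (max 0 (h x) *\<^sub>R g x) \<le> norm (B *\<^sub>R h x)" for x
    proof -
      have "norm (max 0 (h x) *\<^sub>R g x) \<le> \<bar>h x\<bar> * B" using g(2)[of x] by (auto intro!: mult_mono)
      also have "\<dots> \<le> norm (B *\<^sub>R h x)" by (simp add: abs_mult mult.commute mult_right_mono)
      finally show ?thesis .
    qed
    then show "AE x in lebesgue. norm (max 0 (h x) *\<^sub>R g x) \<le> norm (B *\<^sub>R h x)" by simp
  qed
  have "(\<integral>x. f x *\<^sub>R g x \<partial>lebesgue) = (\<integral>x. max 0 (f x) *\<^sub>R g x - max 0 (- f x) *\<^sub>R g x \<partial>lebesgue)"
    by (rule Bochner_Integration.integral_cong) (simp_all add: scaleR_diff_left[symmetric] max_def)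
  also have "\<dots> = (\<integral>x. max 0 (f x) *\<^sub>R g x \<partial>lebesgue) - (\<integral>x. max 0 (- f x) *\<^sub>R g x \<partial>lebesgue)"
    by (rule Bochner_Integration.integral_diff[OF int[OF f] int[OF f']])
  finally show ?thesis
    unfolding integral_lebesgue_part[OF f g(1)] integral_lebesgue_part[OF f' g(1)] by simp
qed

text \<open>Dominated convergence under the normal law. Negative times are included, since
  \<open>sqrt\<close> is continuous on all reals; \<open>heat_solution_tendsto\<close> meets them at
  points \<open>r\<close> beyond the current time, where an indicator removes them.\<close>

lemma heat_tendsto:
  assumes \<phi>: "\<phi> \<in> bcontfun" and lim: "t \<longlonglongrightarrow> t'" "x \<longlonglongrightarrow> x'"
  shows "(\<lambda>n. heat (t n) \<phi> (x n)) \<longlonglongrightarrow> heat t' \<phi> x'"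
proof -
  interpret n: real_distribution std_normal_distribution by (rule real_dist_normal_dist)
  obtain B where B: "\<And>x. \<bar>\<phi> x\<bar> \<le> B" using bcontfunD(2)[OF \<phi>] by blast
  note [measurable] = bcontfunD(3)[OF \<phi>]
  show ?thesis
    unfolding heat_def
  proof (rule integral_dominated_convergence[where w = "\<lambda>_. B"])
    show "AE z in std_normal_distribution. (\<lambda>n. \<phi> (x n + sqrt (t n) * z)) \<longlonglongrightarrow> \<phi> (x' + sqrt t' * z)"
      by (intro AE_I2 continuous_on_tendsto_compose[OF bcontfunD(1)[OF \<phi>]] tendsto_intros lim) auto
  qed (use B in auto)
qed

lemma heat_bound:
  assumes \<phi>: "\<phi> \<in> bcontfun" and B: "\<And>x. \<bar>\<phi> x\<bar> \<le> B"
  shows "\<bar>heat t \<phi> x\<bar> \<le> B"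
proof -
  interpret n: real_distribution std_normal_distribution by (rule real_dist_normal_dist)
  have B0: "0 \<le> B" using B[of 0] by linarith
  note [measurable] = bcontfunD(3)[OF \<phi>]
  have "integrable std_normal_distribution (\<lambda>z. \<phi> (x + sqrt t * z))"
    using B by (intro n.integrable_const_bound[where B = B]) auto
  then have "\<bar>heat t \<phi> x\<bar> \<le> (\<integral>z. \<bar>\<phi> (x + sqrt t * z)\<bar> \<partial>std_normal_distribution)"
    unfolding heat_def using integral_norm_bound[of std_normal_distribution "\<lambda>z. \<phi> (x + sqrt t * z)"] by simp
  also have "\<dots> \<le> (\<integral>z. B \<partial>std_normal_distribution)"
    using B B0 by (intro integral_mono n.integrable_const_bound[where B = B]) auto
  finally show ?thesis using n.prob_space by simp
qed

lemma heat_continuous: "\<phi> \<in> bcontfun \<Longrightarrow> continuous_on UNIV (\<lambda>p. heat (fst p) \<phi> (snd p))"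
  unfolding continuous_on_sequentially comp_def
  by (intro ballI allI impI, elim conjE) (auto intro!: heat_tendsto tendsto_fst tendsto_snd)

lemma heat_measurable:
  assumes "\<phi> \<in> bcontfun" "f \<in> borel_measurable L" "g \<in> borel_measurable L"
  shows "(\<lambda>r. heat (f r) \<phi> (g r)) \<in> borel_measurable L"
proof -
  have "(\<lambda>r. (f r, g r)) \<in> borel_measurable L" using assms by measurable
  from measurable_compose[OF this borel_measurable_continuous_onI[OF heat_continuous[OF assms(1)]]]
  show ?thesis by simp
qed

section \<open>The heat representation of a jump-free solution\<close>

context stefan
begin

abbreviation no_jump :: "'a \<Rightarrow> real \<Rightarrow> bool" where
  "no_jump \<omega> T \<equiv> \<forall>r. 0 < r \<and> r \<le> T \<longrightarrow> left_lim (s \<omega>) r = s \<omega> r"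

lemma X_eq_integral:
  assumes "integrable lebesgue f"
  shows "(\<integral>x. f x *\<^sub>R cis (\<xi> * x) \<partial>lebesgue) = Complex (pairing f (\<lambda>x. cos (\<xi> * x))) (pairing f (\<lambda>x. sin (\<xi> * x)))"
proof -
  have "integrable lebesgue (\<lambda>x. complex_of_real (f x * cos (\<xi> * x)) + \<i> * complex_of_real (f x * sin (\<xi> * x)))"
    using integrable_mult_bcontfun[OF assms trig_bcontfun'(1)] integrable_mult_bcontfun[OF assms trig_bcontfun'(2)]
    by (intro Bochner_Integration.integrable_add integrable_mult_right integrable_of_real)
  moreover have "complex_of_real (f x * cos (\<xi> * x)) + \<i> * complex_of_real (f x * sin (\<xi> * x)) = f x *\<^sub>R cis (\<xi> * x)" for x
    by (simp add: complex_eq_iff)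
  ultimately have int: "integrable lebesgue (\<lambda>x. f x *\<^sub>R cis (\<xi> * x))" by simp
  show ?thesis
    using integral_Re[OF int] integral_Im[OF int] by (intro complex_eqI) (simp_all add: pairing_def)
qed

text \<open>Multiplying \<open>fourier_identity\<close> by
  \<open>exp (- (d / 2) * \<xi>\<^sup>2 * T)\<close>, with
  \<open>d = 2 * \<kappa> - \<theta>\<^sup>2\<close>, turns each exponential into a Gaussian
  characteristic function: of variance \<open>d * T\<close> for the initial value and
  \<open>d * (T - r)\<close> for the source released at time \<open>r\<close>. Inversion is by
  \<open>signed_fourier_unique\<close>. Countably many \<open>\<xi>\<close> and \<open>T\<close>
  leave a single null set.\<close>

lemma representation_rational:
  "AE \<omega> in M. \<forall>T\<in>\<rat> \<inter> {0<..}. no_jump \<omega> T \<longrightarrow> (\<forall>\<phi>\<in>bcontfun.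
     pairing (v \<omega> T) (\<lambda>x. \<phi> (x - \<theta> * W \<omega> T)) = (\<integral>x. v0 x * heat ((2 * \<kappa> - \<theta>\<^sup>2) * T) \<phi> x \<partial>lebesgue) +
       l * \<kappa> * (LINT r:{0<..T}|stieltjes (s \<omega>). heat ((2 * \<kappa> - \<theta>\<^sup>2) * (T - r)) \<phi> (s \<omega> r - \<theta> * W \<omega> r)))"
proof -
  define d where "d = 2 * \<kappa> - \<theta>\<^sup>2"
  have d: "d > 0" using \<theta> by (simp add: d_def)
  define E where "E \<xi> \<omega> r = complex_of_real (exp ((\<kappa> - \<theta>\<^sup>2 / 2) * \<xi>\<^sup>2 * r)) * cis (- (\<xi> * \<theta>) * W \<omega> r)" for \<xi> \<omega> r
  have "AE \<omega> in M. \<forall>\<xi>\<in>\<rat> - {0}. \<forall>T\<in>\<rat> \<inter> {0<..}. no_jump \<omega> T \<longrightarrow>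
     E \<xi> \<omega> T * X \<xi> \<omega> T = X0 \<xi> + l * \<kappa> * (LINT r:{0<..T}|stieltjes (s \<omega>). E \<xi> \<omega> r * cis (\<xi> * s \<omega> r))"
    using fourier_identity unfolding E_def
    by (subst AE_ball_countable AE_ball_countable, force intro: countable_rat)+ auto
  with W_continuous AE_space show ?thesis
  proof eventually_elim
    case (elim \<omega>)
    note \<omega> = elim(2)
    let ?S = "stieltjes (s \<omega>)"
    have W_borel: "(\<lambda>r. W \<omega> (max 0 r)) \<in> borel_measurable borel"
      by (intro borel_measurable_continuous_onI continuous_on_compose2[OF elim(1)] continuous_intros) auto
    note s_borel = cadlag_borel[OF s_cadlag[OF \<omega>]]
    show ?case
    proof (intro ballI impI)
      fix T \<phi> assume T: "T \<in> \<rat> \<inter> {0<..}" and nj: "no_jump \<omega> T" and \<phi>: "\<phi> \<in> (bcontfun :: (real \<Rightarrow> real) set)"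
      have T0: "0 < T" using T by simp
      define A where "A = (\<lambda>x. x - \<theta> * W \<omega> T)"
      define a where "a r = s \<omega> (max 0 r) - \<theta> * W \<omega> (max 0 r)" for r
      define S' where "S' = density ?S (\<lambda>r. ennreal (l * \<kappa> * indicator {0<..T} r))"
      have S'_sets: "sets S' = sets borel" by (simp add: S'_def stieltjes_props(1)[OF \<omega>])
      have lk: "l * \<kappa> > 0" using l \<kappa> by simp
      have ind_m: "(\<lambda>r. l * \<kappa> * indicator {0<..T} r) \<in> borel_measurable ?S"
        by (rule measurable_sets_borel[OF stieltjes_props(1)[OF \<omega>]]) measurable
      have S'_int: "(\<integral>r. g r \<partial>S') = l * \<kappa> * (LINT r:{0<..T}|?S. g r)" if g: "g \<in> borel_measurable borel" for g :: "real \<Rightarrow> complex"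
      proof -
        have "(\<integral>r. g r \<partial>S') = (\<integral>r. (l * \<kappa> * indicator {0<..T} r) *\<^sub>R g r \<partial>?S)"
          unfolding S'_def using lk ind_m by (intro integral_density measurable_sets_borel[OF stieltjes_props(1)[OF \<omega>] g]) auto
        also have "\<dots> = (\<integral>r. (l * \<kappa>) *\<^sub>R (indicator {0<..T} r *\<^sub>R g r) \<partial>?S)" by simp
        finally show ?thesis
          unfolding set_lebesgue_integral_def integral_scaleR_right by (simp only: scaleR_conv_of_real of_real_mult)
      qed
      have S'_int_real: "(\<integral>r. g r \<partial>S') = l * \<kappa> * (LINT r:{0<..T}|?S. g r)" if g: "g \<in> borel_measurable borel" for g :: "real \<Rightarrow> real"
      proof -
        have "(\<integral>r. g r \<partial>S') = (\<integral>r. (l * \<kappa> * indicator {0<..T} r) *\<^sub>R g r \<partial>?S)"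
          unfolding S'_def using lk ind_m by (intro integral_density measurable_sets_borel[OF stieltjes_props(1)[OF \<omega>] g]) auto
        also have "\<dots> = (\<integral>r. (l * \<kappa>) *\<^sub>R (indicator {0<..T} r *\<^sub>R g r) \<partial>?S)" by (intro Bochner_Integration.integral_cong refl) (simp add: mult.assoc)
        finally show ?thesis
          unfolding set_lebesgue_integral_def integral_scaleR_right by (simp only: real_scaleR_def)
      qed
      have S'_fin: "finite_measure S'"
      proof (rule finite_measureI)
        have "emeasure S' (space S') = (\<integral>\<^sup>+r. ennreal (l * \<kappa> * indicator {0<..T} r) \<partial>?S)"
          unfolding S'_def using ind_m by (simp add: emeasure_density)
        also have "\<dots> = (\<integral>\<^sup>+r. ennreal (l * \<kappa>) * indicator {0<..T} r \<partial>?S)"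
          by (rule nn_integral_cong) (simp add: indicator_def)
        also have "\<dots> = ennreal (l * \<kappa>) * emeasure ?S {0<..T}"
          by (rule nn_integral_cmult_indicator) (simp add: stieltjes_props(1)[OF \<omega>])
        also have "\<dots> < \<infinity>" using T0 by (simp add: stieltjes_props(2)[OF \<omega>] ennreal_mult_less_top)
        finally show "emeasure S' (space S') \<noteq> \<infinity>" by simp
      qed
      have vT: "integrable lebesgue (v \<omega> T)" and vT': "integrable lebesgue (\<lambda>x. - v \<omega> T x)" and v0': "integrable lebesgue (\<lambda>x. - v0 x)"
        using v_integrable[OF \<omega>, of T] T0 v0_integrable by auto
      have part_m: "f \<in> measurable borel N \<Longrightarrow> integrable lebesgue h \<Longrightarrow> f \<in> measurable (lebesgue_part h) N" for f :: "real \<Rightarrow> 'x" and N h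
        using measurable_sets_borel[OF sets_lebesgue_part] by blast
      have a_m: "a \<in> borel_measurable borel" unfolding a_def[abs_def] using s_borel W_borel by measurable
      define H where "H r = sqrt (d * (T - r))" for r
      have H_m: "H \<in> borel_measurable borel" unfolding H_def[abs_def] by measurable
      have A_m: "A \<in> borel_measurable borel" by (simp add: A_def)
      \<comment> \<open>The intended identity, \<open>v\<close> equals the heat flow of
        \<open>v0\<close> plus the source, is arranged as: positive part of \<open>v\<close> plus
        heat flow of \<open>- v0\<close> equals negative part of \<open>v\<close> plus source. All
        four are positive measures; the sign of \<open>v\<close> itself is not known here.\<close>
      define \<mu>1 where "\<mu>1 = smear (lebesgue_part (v \<omega> T)) A (\<lambda>_. 0)"
      define \<nu>1 where "\<nu>1 = smear (lebesgue_part (\<lambda>x. - v \<omega> T x)) A (\<lambda>_. 0)"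
      define \<mu>2 where "\<mu>2 = smear (lebesgue_part (\<lambda>x. - v0 x)) (\<lambda>x. x) (\<lambda>_. sqrt (d * T))"
      define \<nu>2 where "\<nu>2 = smear S' a H"
      note prem1 = finite_lebesgue_part[OF vT] part_m[OF A_m vT] part_m[OF borel_measurable_const[of 0] vT]
      note prem2 = finite_lebesgue_part[OF vT'] part_m[OF A_m vT'] part_m[OF borel_measurable_const[of 0] vT']
      note prem3 = finite_lebesgue_part[OF v0'] part_m[OF measurable_ident v0', unfolded id_def] part_m[OF borel_measurable_const[of "sqrt (d * T)"] v0']
      note prem4 = S'_fin measurable_sets_borel[OF S'_sets a_m] measurable_sets_borel[OF S'_sets H_m]
      have v0_part: "(\<integral>x. g x \<partial>lebesgue_part (\<lambda>x. - v0 x)) = - (\<integral>x. v0 x *\<^sub>R g x \<partial>lebesgue)"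
        if g: "g \<in> borel_measurable borel" for g :: "real \<Rightarrow> 'y::{banach, second_countable_topology}"
      proof -
        have gm: "g \<in> borel_measurable lebesgue" using g by (simp add: measurable_completion)
        have vm: "v0 \<in> borel_measurable lebesgue" using v0_integrable by auto
        have "(\<integral>x. max 0 (- v0 x) *\<^sub>R g x \<partial>lebesgue) = (\<integral>x. - (v0 x *\<^sub>R g x) \<partial>lebesgue)"
        proof (rule integral_cong_AE)
          show "(\<lambda>x. max 0 (- v0 x) *\<^sub>R g x) \<in> borel_measurable lebesgue" "(\<lambda>x. - (v0 x *\<^sub>R g x)) \<in> borel_measurable lebesgue"
            by (intro borel_measurable_scaleR borel_measurable_max borel_measurable_uminus borel_measurable_const gm vm)+
          show "AE x in lebesgue. max 0 (- v0 x) *\<^sub>R g x = - (v0 x *\<^sub>R g x)"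
            using v0_nonpos by eventually_elim (simp add: max_def)
        qed
        then show ?thesis unfolding integral_lebesgue_part[OF v0' g] by simp
      qed
      have "(\<integral>x. \<phi> x \<partial>\<mu>1) + (\<integral>x. \<phi> x \<partial>\<mu>2) = (\<integral>x. \<phi> x \<partial>\<nu>1) + (\<integral>x. \<phi> x \<partial>\<nu>2)"
      proof -
        obtain B where B: "\<And>x. \<bar>\<phi> x\<bar> \<le> B" using bcontfunD(2)[OF \<phi>] by blast
        show ?thesis
        proof (rule signed_fourier_unique[OF _ _ _ _ _ _ _ _ _ bcontfunD(3)[OF \<phi>] B])
          show "finite_measure \<mu>1" "finite_measure \<mu>2" "finite_measure \<nu>1" "finite_measure \<nu>2"
            unfolding \<mu>1_def \<mu>2_def \<nu>1_def \<nu>2_def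
            by (rule finite_smear[OF prem1] finite_smear[OF prem2] finite_smear[OF prem3] finite_smear[OF prem4])+
          show "sets \<mu>1 = sets borel" "sets \<mu>2 = sets borel" "sets \<nu>1 = sets borel" "sets \<nu>2 = sets borel"
            unfolding \<mu>1_def \<mu>2_def \<nu>1_def \<nu>2_def
            by (rule sets_smear[OF prem1] sets_smear[OF prem2] sets_smear[OF prem3] sets_smear[OF prem4])+
          fix \<xi> :: real assume \<xi>: "\<xi> \<in> \<rat> - {0}"
          have cm: "(\<lambda>x. cis (\<xi> * x)) \<in> borel_measurable borel"
            by (intro borel_measurable_continuous_onI continuous_intros)
          have cA: "(\<lambda>x. cis (\<xi> * A x)) \<in> borel_measurable borel"
            unfolding A_def by (intro borel_measurable_continuous_onI continuous_intros)
          have 1: "(\<integral>x. cis (\<xi> * x) \<partial>\<mu>1) - (\<integral>x. cis (\<xi> * x) \<partial>\<nu>1) = cis (- (\<xi> * \<theta>) * W \<omega> T) * X \<xi> \<omega> T"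
          proof -
            have "(\<integral>x. cis (\<xi> * x) \<partial>\<mu>1) - (\<integral>x. cis (\<xi> * x) \<partial>\<nu>1) = (\<integral>x. v \<omega> T x *\<^sub>R cis (\<xi> * A x) \<partial>lebesgue)"
              unfolding \<mu>1_def \<nu>1_def fourier_smear[OF prem1] fourier_smear[OF prem2]
              using lebesgue_part_diff[OF vT cA, of 1] by simp
            also have "\<dots> = (\<integral>x. cis (- (\<xi> * \<theta>) * W \<omega> T) * (v \<omega> T x *\<^sub>R cis (\<xi> * x)) \<partial>lebesgue)"
              by (rule Bochner_Integration.integral_cong) (simp_all add: A_def cis_mult algebra_simps)
            also have "\<dots> = cis (- (\<xi> * \<theta>) * W \<omega> T) * (\<integral>x. v \<omega> T x *\<^sub>R cis (\<xi> * x) \<partial>lebesgue)"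
              by (rule integral_mult_right_zero)
            finally show ?thesis unfolding X_eq_integral[OF vT] X_def .
          qed
          have 2: "(\<integral>x. cis (\<xi> * x) \<partial>\<mu>2) = - (X0 \<xi> * complex_of_real (exp (- (d / 2) * \<xi>\<^sup>2 * T)))"
          proof -
            have "(\<integral>x. cis (\<xi> * x) \<partial>\<mu>2) = (\<integral>x. cis (\<xi> * x) * complex_of_real (exp (- (\<xi> * sqrt (d * T))\<^sup>2 / 2)) \<partial>lebesgue_part (\<lambda>x. - v0 x))"
              unfolding \<mu>2_def by (rule fourier_smear[OF prem3])
            also have "- (\<xi> * sqrt (d * T))\<^sup>2 / 2 = - (d / 2) * \<xi>\<^sup>2 * T"
              using d T0 by (simp add: power_mult_distrib)
            also have "(\<integral>x. cis (\<xi> * x) * complex_of_real (exp (- (d / 2) * \<xi>\<^sup>2 * T)) \<partial>lebesgue_part (\<lambda>x. - v0 x)) =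
               - (\<integral>x. v0 x *\<^sub>R cis (\<xi> * x) \<partial>lebesgue) * complex_of_real (exp (- (d / 2) * \<xi>\<^sup>2 * T))"
              using v0_part[OF cm] by simp
            finally show ?thesis by (simp add: X_eq_integral[OF v0_integrable] X0_def)
          qed
          have 3: "(\<integral>x. cis (\<xi> * x) \<partial>\<nu>2) = l * \<kappa> * (LINT r:{0<..T}|?S. complex_of_real (exp (- (d / 2) * \<xi>\<^sup>2 * T)) * (E \<xi> \<omega> r * cis (\<xi> * s \<omega> r)))"
          proof -
            have m: "(\<lambda>r. cis (\<xi> * a r) * complex_of_real (exp (- (\<xi> * H r)\<^sup>2 / 2))) \<in> borel_measurable borel"
              using measurable_compose[OF a_m cm] H_m by measurable
            have "(\<integral>x. cis (\<xi> * x) \<partial>\<nu>2) = l * \<kappa> * (LINT r:{0<..T}|?S. cis (\<xi> * a r) * complex_of_real (exp (- (\<xi> * H r)\<^sup>2 / 2)))"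
              unfolding \<nu>2_def fourier_smear[OF prem4] by (rule S'_int[OF m])
            also have "(LINT r:{0<..T}|?S. cis (\<xi> * a r) * complex_of_real (exp (- (\<xi> * H r)\<^sup>2 / 2))) =
               (LINT r:{0<..T}|?S. complex_of_real (exp (- (d / 2) * \<xi>\<^sup>2 * T)) * (E \<xi> \<omega> r * cis (\<xi> * s \<omega> r)))"
            proof (rule set_lebesgue_integral_cong, simp add: stieltjes_props(1)[OF \<omega>], intro allI impI)
              fix r assume r: "r \<in> {0<..T}"
              have "- (\<xi> * H r)\<^sup>2 / 2 = - (d / 2) * \<xi>\<^sup>2 * T + (\<kappa> - \<theta>\<^sup>2 / 2) * \<xi>\<^sup>2 * r"
              proof -
                have Hr: "(H r)\<^sup>2 = d * (T - r)" using d r by (simp add: H_def)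
                show ?thesis unfolding power_mult_distrib Hr unfolding d_def by (simp add: field_simps)
              qed
              moreover have "cis (\<xi> * a r) = cis (- (\<xi> * \<theta>) * W \<omega> r) * cis (\<xi> * s \<omega> r)"
                using r by (simp add: a_def cis_mult algebra_simps)
              ultimately show "cis (\<xi> * a r) * complex_of_real (exp (- (\<xi> * H r)\<^sup>2 / 2)) =
                 complex_of_real (exp (- (d / 2) * \<xi>\<^sup>2 * T)) * (E \<xi> \<omega> r * cis (\<xi> * s \<omega> r))"
                by (simp only: E_def exp_add of_real_mult mult_ac)
            qed
            finally show ?thesis .
          qed
          have ET: "complex_of_real (exp (- (d / 2) * \<xi>\<^sup>2 * T)) * E \<xi> \<omega> T = cis (- (\<xi> * \<theta>) * W \<omega> T)"
          proof -
            have "- (d / 2) * \<xi>\<^sup>2 * T + (\<kappa> - \<theta>\<^sup>2 / 2) * \<xi>\<^sup>2 * T = 0" by (simp add: d_def field_simps)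
            then have "exp (- (d / 2) * \<xi>\<^sup>2 * T) * exp ((\<kappa> - \<theta>\<^sup>2 / 2) * \<xi>\<^sup>2 * T) = 1"
              by (simp only: exp_add[symmetric] exp_zero)
            then show ?thesis unfolding E_def by (metis mult.assoc mult_1 of_real_1 of_real_mult)
          qed
          have id: "E \<xi> \<omega> T * X \<xi> \<omega> T = X0 \<xi> + l * \<kappa> * (LINT r:{0<..T}|?S. E \<xi> \<omega> r * cis (\<xi> * s \<omega> r))"
            using elim(3) \<xi> T nj by blast
          have "cis (- (\<xi> * \<theta>) * W \<omega> T) * X \<xi> \<omega> T =
              complex_of_real (exp (- (d / 2) * \<xi>\<^sup>2 * T)) * (E \<xi> \<omega> T * X \<xi> \<omega> T)"
            unfolding ET[symmetric] by (simp only: mult.assoc)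
          also have "\<dots> = X0 \<xi> * complex_of_real (exp (- (d / 2) * \<xi>\<^sup>2 * T)) + (\<integral>x. cis (\<xi> * x) \<partial>\<nu>2)"
            unfolding id 3 set_integral_mult_right by (simp only: distrib_left mult_ac)
          finally show "(\<integral>x. cis (\<xi> * x) \<partial>\<mu>1) + (\<integral>x. cis (\<xi> * x) \<partial>\<mu>2) = (\<integral>x. cis (\<xi> * x) \<partial>\<nu>1) + (\<integral>x. cis (\<xi> * x) \<partial>\<nu>2)"
            using 1 2 by (simp add: algebra_simps)
        qed
      qed
      moreover have "(\<integral>x. \<phi> x \<partial>\<mu>1) - (\<integral>x. \<phi> x \<partial>\<nu>1) = pairing (v \<omega> T) (\<lambda>x. \<phi> (x - \<theta> * W \<omega> T))"
      proof -
        interpret n: real_distribution std_normal_distribution by (rule real_dist_normal_dist)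
        obtain B where B: "\<And>x. norm (\<phi> x) \<le> B" using bcontfunD(2)[OF \<phi>] by auto
        have m: "(\<lambda>x. \<phi> (A x)) \<in> borel_measurable borel" using measurable_compose[OF A_m bcontfunD(3)[OF \<phi>]] .
        show ?thesis
          unfolding \<mu>1_def \<nu>1_def integral_smear[OF prem1 bcontfunD(3)[OF \<phi>] B] integral_smear[OF prem2 bcontfunD(3)[OF \<phi>] B]
          using lebesgue_part_diff[OF vT m, of B] B n.prob_space by (simp add: A_def pairing_def)
      qed
      moreover have "(\<integral>x. \<phi> x \<partial>\<mu>2) = - (\<integral>x. v0 x * heat (d * T) \<phi> x \<partial>lebesgue)"
      proof -
        obtain B where B: "\<And>x. norm (\<phi> x) \<le> B" using bcontfunD(2)[OF \<phi>] by auto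
        have "(\<lambda>x. heat (d * T) \<phi> x) \<in> borel_measurable borel"
          by (rule heat_measurable[OF \<phi>]) auto
        from v0_part[OF this] show ?thesis
          unfolding \<mu>2_def integral_smear[OF prem3 bcontfunD(3)[OF \<phi>] B] by (simp add: heat_def)
      qed
      moreover have "(\<integral>x. \<phi> x \<partial>\<nu>2) = l * \<kappa> * (LINT r:{0<..T}|?S. heat (d * (T - r)) \<phi> (s \<omega> r - \<theta> * W \<omega> r))"
      proof -
        obtain B where B: "\<And>x. norm (\<phi> x) \<le> B" using bcontfunD(2)[OF \<phi>] by auto
        have m: "(\<lambda>r. heat (d * (T - r)) \<phi> (a r)) \<in> borel_measurable borel"
          by (rule heat_measurable[OF \<phi> _ a_m]) measurable
        have "(\<integral>x. \<phi> x \<partial>\<nu>2) = l * \<kappa> * (LINT r:{0<..T}|?S. heat (d * (T - r)) \<phi> (a r))"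
          unfolding \<nu>2_def integral_smear[OF prem4 bcontfunD(3)[OF \<phi>] B]
          using S'_int_real[OF m] by (simp add: heat_def H_def)
        also have "(LINT r:{0<..T}|?S. heat (d * (T - r)) \<phi> (a r)) = (LINT r:{0<..T}|?S. heat (d * (T - r)) \<phi> (s \<omega> r - \<theta> * W \<omega> r))"
          by (rule set_lebesgue_integral_cong) (auto simp: stieltjes_props(1)[OF \<omega>] a_def)
        finally show ?thesis .
      qed
      ultimately show "pairing (v \<omega> T) (\<lambda>x. \<phi> (x - \<theta> * W \<omega> T)) = (\<integral>x. v0 x * heat ((2 * \<kappa> - \<theta>\<^sup>2) * T) \<phi> x \<partial>lebesgue) +
         l * \<kappa> * (LINT r:{0<..T}|?S. heat ((2 * \<kappa> - \<theta>\<^sup>2) * (T - r)) \<phi> (s \<omega> r - \<theta> * W \<omega> r))"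
        unfolding d_def by linarith
    qed
  qed
qed

end

section \<open>Jumps of the front and of the temperature\<close>

lemma left_lim_tendsto: "cadlag f \<Longrightarrow> 0 < t \<Longrightarrow> (f \<longlongrightarrow> left_lim f t) (at_left t)"
  by (auto simp: cadlag_def left_lim_def tendsto_Lim)

lemma first_jump_s_finite_iff: "first_jump_s f < \<infinity> \<longleftrightarrow> (\<exists>t>0. f t \<noteq> left_lim f t)"
  unfolding first_jump_s_def Inf_less_iff by auto

lemma of_rat_inverse_Suc: "(of_rat (1 / of_nat (Suc k)) :: real) = 1 / real (Suc k)"
  by (simp add: of_rat_divide of_rat_add)

context stefan
begin

text \<open>The representation carried back to the fixed frame: testing with \<open>\<psi>\<close>
  there is testing with \<open>\<psi>\<close> shifted by \<open>\<theta> * W \<omega> t\<close> in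
  the moving one.\<close>

definition heat_solution :: "'a \<Rightarrow> (real \<Rightarrow> real) \<Rightarrow> real \<Rightarrow> real" where
  "heat_solution \<omega> \<psi> t = (\<integral>x. v0 x * heat ((2 * \<kappa> - \<theta>\<^sup>2) * t) \<psi> (x + \<theta> * W \<omega> t) \<partial>lebesgue) +
     l * \<kappa> * (LINT r:{0<..t}|stieltjes (s \<omega>). heat ((2 * \<kappa> - \<theta>\<^sup>2) * (t - r)) \<psi> (s \<omega> r - \<theta> * W \<omega> r + \<theta> * W \<omega> t))"

text \<open>An atom at \<open>t\<close> is at most the mass
  \<open>s \<omega> t - s \<omega> (u n)\<close> of \<open>{u n<..t}\<close>, and this tends to 0
  when the left limit of the front is its value.\<close>

lemma stieltjes_no_atom:
  assumes \<omega>: "\<omega> \<in> space M" and t: "0 < t" "left_lim (s \<omega>) t = s \<omega> t"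
  shows "AE r in stieltjes (s \<omega>). r \<noteq> t"
proof -
  define u where "u n = t - t / real (n + 2)" for n
  have u: "0 \<le> u n" "u n < t" for n using t by (simp_all add: u_def field_simps)
  have "u \<longlonglongrightarrow> t - 0"
    unfolding u_def[abs_def] by (intro tendsto_diff tendsto_const LIMSEQ_ignore_initial_segment[OF lim_const_over_n])
  then have "(\<lambda>n. s \<omega> (u n)) \<longlonglongrightarrow> s \<omega> t"
    using left_lim_tendsto[OF s_cadlag[OF \<omega>] t(1)] t(2) u(2)
    by (intro tendsto_at_left_sequence[of "s \<omega>" "s \<omega> t" t]) auto
  then have "(\<lambda>n. s \<omega> t - s \<omega> (u n)) \<longlonglongrightarrow> s \<omega> t - s \<omega> t" by (intro tendsto_diff tendsto_const)
  then have lim: "(\<lambda>n. ennreal (s \<omega> t - s \<omega> (u n))) \<longlonglongrightarrow> ennreal 0" by (intro tendsto_ennrealI) simp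
  have "emeasure (stieltjes (s \<omega>)) {t} \<le> ennreal (s \<omega> t - s \<omega> (u n))" for n
  proof -
    have "emeasure (stieltjes (s \<omega>)) {t} \<le> emeasure (stieltjes (s \<omega>)) {u n<..t}"
      using u by (intro emeasure_mono) (auto simp: stieltjes_props(1)[OF \<omega>])
    then show ?thesis using u[of n] by (simp add: stieltjes_props(2)[OF \<omega>])
  qed
  then have "emeasure (stieltjes (s \<omega>)) {t} \<le> ennreal 0" by (intro LIMSEQ_le_const[OF lim]) auto
  then have "{t} \<in> null_sets (stieltjes (s \<omega>))" by (auto simp: null_sets_def stieltjes_props(1)[OF \<omega>])
  from AE_not_in[OF this] show ?thesis by simp
qed

lemma path_borel:
  assumes \<omega>: "\<omega> \<in> space M" and W: "continuous_on {0..} (W \<omega>)"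
  shows "(\<lambda>r. s \<omega> (max 0 r) - \<theta> * W \<omega> (max 0 r)) \<in> borel_measurable borel"
proof -
  have "(\<lambda>r. W \<omega> (max 0 r)) \<in> borel_measurable borel"
    by (intro borel_measurable_continuous_onI continuous_on_compose2[OF W] continuous_intros) auto
  then show ?thesis using cadlag_borel[OF s_cadlag[OF \<omega>]] by measurable
qed

text \<open>Dominated convergence. The indicators of \<open>{0<..t n}\<close> may fail to converge
  only at \<open>r = t'\<close>, and since the front does not jump there,
  \<open>stieltjes_no_atom\<close> makes that point negligible.\<close>

lemma heat_solution_tendsto:
  assumes \<omega>: "\<omega> \<in> space M" and W: "continuous_on {0..} (W \<omega>)" and nj: "no_jump \<omega> T"
    and t: "\<And>n. 0 < t n" "\<And>n. t n \<le> T" "t \<longlonglongrightarrow> t'" "0 < t'" "t' \<le> T" and \<psi>: "\<psi> \<in> bcontfun"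
  shows "(\<lambda>n. heat_solution \<omega> \<psi> (t n)) \<longlonglongrightarrow> heat_solution \<omega> \<psi> t'"
proof -
  define d where "d = 2 * \<kappa> - \<theta>\<^sup>2"
  define a where "a r = s \<omega> (max 0 r) - \<theta> * W \<omega> (max 0 r)" for r
  define h where "h r u = heat (d * (u - r)) \<psi> (a r + \<theta> * W \<omega> u)" for r u
  let ?S = "stieltjes (s \<omega>)"
  obtain B where B: "\<And>x. \<bar>\<psi> x\<bar> \<le> B" using bcontfunD(2)[OF \<psi>] by blast
  have B0: "0 \<le> B" using B[of 0] by linarith
  have Wt: "(\<lambda>n. W \<omega> (t n)) \<longlonglongrightarrow> W \<omega> t'"
    using t by (intro continuous_on_tendsto_compose[OF W]) (auto intro!: always_eventually less_imp_le)
  have S_meas: "f \<in> borel_measurable borel \<Longrightarrow> f \<in> borel_measurable ?S" for f :: "real \<Rightarrow> real"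
    by (rule measurable_sets_borel[OF stieltjes_props(1)[OF \<omega>]])
  have a_m: "a \<in> borel_measurable borel" unfolding a_def[abs_def] by (rule path_borel[OF \<omega> W])
  have h_m: "(\<lambda>r. h r u) \<in> borel_measurable borel" for u
    unfolding h_def by (rule heat_measurable[OF \<psi>]) (use a_m in measurable)
  have rep: "heat_solution \<omega> \<psi> u = (\<integral>x. v0 x * heat (d * u) \<psi> (x + \<theta> * W \<omega> u) \<partial>lebesgue) +
      l * \<kappa> * (\<integral>r. indicator {0<..u} r *\<^sub>R h r u \<partial>?S)" for u
  proof -
    have "(LINT r:{0<..u}|?S. heat (d * (u - r)) \<psi> (s \<omega> r - \<theta> * W \<omega> r + \<theta> * W \<omega> u)) = (LINT r:{0<..u}|?S. h r u)"
      by (rule set_lebesgue_integral_cong) (auto simp: stieltjes_props(1)[OF \<omega>] h_def a_def)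
    then show ?thesis unfolding heat_solution_def d_def[symmetric] set_lebesgue_integral_def by simp
  qed
  have 1: "(\<lambda>n. \<integral>x. v0 x * heat (d * t n) \<psi> (x + \<theta> * W \<omega> (t n)) \<partial>lebesgue) \<longlonglongrightarrow>
     (\<integral>x. v0 x * heat (d * t') \<psi> (x + \<theta> * W \<omega> t') \<partial>lebesgue)"
  proof (rule integral_dominated_convergence[where w = "\<lambda>x. \<bar>v0 x\<bar> * B"])
    have vm: "v0 \<in> borel_measurable lebesgue" using v0_integrable by auto
    have hm: "(\<lambda>x. heat (d * u) \<psi> (x + \<theta> * W \<omega> u)) \<in> borel_measurable lebesgue" for u
      by (rule measurable_completion, simp, rule heat_measurable[OF \<psi>]) measurable
    show "(\<lambda>x. v0 x * heat (d * t') \<psi> (x + \<theta> * W \<omega> t')) \<in> borel_measurable lebesgue"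
      "\<And>n. (\<lambda>x. v0 x * heat (d * t n) \<psi> (x + \<theta> * W \<omega> (t n))) \<in> borel_measurable lebesgue"
      by (intro borel_measurable_times vm hm)+
    show "integrable lebesgue (\<lambda>x. \<bar>v0 x\<bar> * B)" using v0_integrable by simp
    show "AE x in lebesgue. (\<lambda>n. v0 x * heat (d * t n) \<psi> (x + \<theta> * W \<omega> (t n))) \<longlonglongrightarrow> v0 x * heat (d * t') \<psi> (x + \<theta> * W \<omega> t')"
      by (intro AE_I2 tendsto_mult heat_tendsto[OF \<psi>] tendsto_add tendsto_const t Wt)
    show "AE x in lebesgue. norm (v0 x * heat (d * t n) \<psi> (x + \<theta> * W \<omega> (t n))) \<le> \<bar>v0 x\<bar> * B" for n
      using heat_bound[OF \<psi> B] by (intro AE_I2) (simp add: abs_mult mult_left_mono)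
  qed
  have 2: "(\<lambda>n. \<integral>r. indicator {0<..t n} r *\<^sub>R h r (t n) \<partial>?S) \<longlonglongrightarrow> (\<integral>r. indicator {0<..t'} r *\<^sub>R h r t' \<partial>?S)"
  proof (rule integral_dominated_convergence[where w = "\<lambda>r. B * indicator {0<..T} r"])
    have im: "(\<lambda>r. indicator {0<..u} r *\<^sub>R h r u) \<in> borel_measurable ?S" for u
      by (rule S_meas, intro borel_measurable_scaleR h_m) simp
    show "(\<lambda>r. indicator {0<..t'} r *\<^sub>R h r t') \<in> borel_measurable ?S"
      "\<And>n. (\<lambda>r. indicator {0<..t n} r *\<^sub>R h r (t n)) \<in> borel_measurable ?S"
      by (rule im)+
    have "emeasure ?S {0<..T} < \<infinity>" using t(4,5) by (simp add: stieltjes_props(2)[OF \<omega>])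
    then show "integrable ?S (\<lambda>r. B * indicator {0<..T} r)"
      by (intro integrable_mult_right integrable_real_indicator) (auto simp: stieltjes_props(1)[OF \<omega>])
    have "AE r in ?S. r \<noteq> t'" using t(4,5) nj by (intro stieltjes_no_atom[OF \<omega>]) auto
    then show "AE r in ?S. (\<lambda>n. indicator {0<..t n} r *\<^sub>R h r (t n)) \<longlonglongrightarrow> indicator {0<..t'} r *\<^sub>R h r t'"
    proof eventually_elim
      case (elim r)
      have "eventually (\<lambda>n. indicator {0<..t n} r = (indicator {0<..t'} r :: real)) sequentially"
      proof (cases "r < t'")
        case True
        then show ?thesis using order_tendstoD(1)[OF t(3), of r] by (auto elim!: eventually_mono simp: indicator_def)
      next
        case False
        then have "t' < r" using elim by simp
        then show ?thesis using order_tendstoD(2)[OF t(3), of r] by (auto elim!: eventually_mono simp: indicator_def)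
      qed
      then have "(\<lambda>n. indicator {0<..t n} r :: real) \<longlonglongrightarrow> indicator {0<..t'} r" by (rule tendsto_eventually)
      moreover have "(\<lambda>n. h r (t n)) \<longlonglongrightarrow> h r t'"
        unfolding h_def by (intro heat_tendsto[OF \<psi>] tendsto_add tendsto_mult tendsto_diff tendsto_const t Wt)
      ultimately show ?case by (rule tendsto_scaleR)
    qed
    have "norm (indicator {0<..t n} r *\<^sub>R h r (t n)) \<le> B * indicator {0<..T} r" for n r
      using heat_bound[OF \<psi> B, of "d * (t n - r)" "a r + \<theta> * W \<omega> (t n)"] t(2)[of n] B0
      by (auto simp: indicator_def h_def)
    then show "AE r in ?S. norm (indicator {0<..t n} r *\<^sub>R h r (t n)) \<le> B * indicator {0<..T} r" for n
      by (intro AE_I2)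
  qed
  show ?thesis unfolding rep by (intro tendsto_add tendsto_mult tendsto_const 1 2)
qed

text \<open>Rational times approximate \<open>t\<close> from the right, along which the pairings
  converge because they are cadlag and the heat solution because it is continuous. Requiring
  \<open>t < T\<close> leaves room for rational times within the jump-free range.\<close>

lemma representation:
  "AE \<omega> in M. \<forall>T t. no_jump \<omega> T \<longrightarrow> 0 < t \<longrightarrow> t < T \<longrightarrow> (\<forall>\<psi>\<in>bcontfun. pairing (v \<omega> t) \<psi> = heat_solution \<omega> \<psi> t)"
  using representation_rational W_continuous AE_space
proof eventually_elim
  case (elim \<omega>)
  note \<omega> = elim(3)
  have rat: "pairing (v \<omega> q) \<psi> = heat_solution \<omega> \<psi> q" if q: "q \<in> \<rat>" "0 < q" "no_jump \<omega> q" and \<psi>: "\<psi> \<in> bcontfun" for q \<psi>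
  proof -
    obtain B where B: "\<And>x. \<bar>\<psi> x\<bar> \<le> B" using bcontfunD(2)[OF \<psi>] by blast
    have "(\<lambda>x. \<psi> (x + \<theta> * W \<omega> q)) \<in> bcontfun"
      using B by (intro bcontfunI continuous_on_compose2[OF bcontfunD(1)[OF \<psi>]] continuous_intros) auto
    moreover have "heat t (\<lambda>x. \<psi> (x + \<theta> * W \<omega> q)) x = heat t \<psi> (x + \<theta> * W \<omega> q)" for t x
      by (simp add: heat_def algebra_simps)
    ultimately show ?thesis using elim(1) q unfolding heat_solution_def by fastforce
  qed
  show ?case
  proof (intro allI impI ballI)
    fix T t and \<psi> :: "real \<Rightarrow> real" assume nj: "no_jump \<omega> T" and t: "0 < t" "t < T" and \<psi>: "\<psi> \<in> bcontfun"
    have "\<exists>q\<in>\<rat>. t < q \<and> q < min T (t + 1 / real (Suc n))" for n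
      using t by (intro Rats_dense_in_real) simp
    then obtain q where q: "\<And>n. q n \<in> \<rat>" "\<And>n. t < q n" "\<And>n. q n < min T (t + 1 / real (Suc n))" by metis
    have ql: "q \<longlonglongrightarrow> t"
    proof (rule tendsto_sandwich)
      show "(\<lambda>n. t) \<longlonglongrightarrow> t" by simp
      show "(\<lambda>n. t + 1 / real (Suc n)) \<longlonglongrightarrow> t"
        using tendsto_add[OF tendsto_const[of t] LIMSEQ_Suc[OF lim_1_over_n]] by simp
      show "\<forall>\<^sub>F n in sequentially. t \<le> q n" "\<forall>\<^sub>F n in sequentially. q n \<le> t + 1 / real (Suc n)"
        using q(2,3) by (auto intro!: always_eventually less_imp_le)
    qed
    have 1: "(\<lambda>n. pairing (v \<omega> (q n)) \<psi>) \<longlonglongrightarrow> pairing (v \<omega> t) \<psi>"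
      by (rule cadlag_right[OF v_cadlag[OF \<omega> \<psi>] _ ql]) (use t q(2) in \<open>auto intro: less_imp_le\<close>)
    have qT: "0 < q n" "q n \<le> T" for n using q(2,3)[of n] t by auto
    have 2: "(\<lambda>n. heat_solution \<omega> \<psi> (q n)) \<longlonglongrightarrow> heat_solution \<omega> \<psi> t"
      by (rule heat_solution_tendsto[OF \<omega> elim(2) nj qT ql _ _ \<psi>]) (use t in auto)
    have "pairing (v \<omega> (q n)) \<psi> = heat_solution \<omega> \<psi> (q n)" for n
      using nj qT[of n] by (intro rat q \<psi>) auto
    then show "pairing (v \<omega> t) \<psi> = heat_solution \<omega> \<psi> t" using 1 2 LIMSEQ_unique by simp
  qed
qed

text \<open>The constant test function gives the balance of total mass, in which the diffusion term
  and the jump sum vanish. The stochastic integral is continuous, so a jump of the front forces the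
  mass to jump by \<open>l * \<kappa>\<close> times as much.\<close>

lemma s_jump_imp_v_jump:
  "AE \<omega> in M. \<forall>t>0. is_left_lim_L1 (v \<omega>) t (v \<omega> t) \<longrightarrow> left_lim (s \<omega>) t = s \<omega> t"
proof -
  have one: "(\<lambda>x. 1 :: real) \<in> bcontfun" and zero: "(\<lambda>x. 0 :: real) \<in> bcontfun" by (auto intro!: bcontfunI[of _ 1])
  have "((\<lambda>x. 1) has_real_derivative 0) (at x)" "((\<lambda>x. 0) has_real_derivative 0) (at x)" for x :: real by auto
  note C = C12b_const_time[OF this one zero zero]
  have "AE \<omega> in M. continuous_on {0..} (I (\<lambda>r x. 1) \<omega>)"
    using ito[OF C(1)] by (auto simp: has_ito_integral_def)
  with identity AE_space show ?thesis
  proof eventually_elim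
    case (elim \<omega>)
    note \<omega> = elim(2)
    let ?I = "I (\<lambda>r x. 1) \<omega>" and ?m = "\<lambda>r. pairing (v \<omega> r) (\<lambda>x. 1)"
    have m: "?m t = pairing v0 (\<lambda>x. 1) + \<theta> * ?I t + l * \<kappa> * (s \<omega> t - s0)" if t: "t > 0" for t
    proof -
      have "(LINT r:{0<..t}|stieltjes (s \<omega>). (1::real)) = s \<omega> t - s0"
        using s_mono[OF \<omega>, of 0 t] t
        by (simp add: set_lebesgue_integral_def measure_def stieltjes_props(2)[OF \<omega>] stieltjes_props(1)[OF \<omega>] s_0[OF \<omega>])
      then show ?thesis
        using weak_identity_pairing[OF \<omega> t one zero C(3) C(4), of "?I t"] elim(1) C(1) t by (simp add: pairing_def)
    qed
    show ?case
    proof (intro allI impI)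
      fix t :: real assume t: "0 < t" and ll: "is_left_lim_L1 (v \<omega>) t (v \<omega> t)"
      have mlim: "(?m \<longlongrightarrow> ?m t) (at_left t)" using ll one by (auto simp: is_left_lim_L1_def)
      have Ilim: "(?I \<longlongrightarrow> ?I t) (at_left t)"
      proof -
        have "isCont ?I t" using elim(3) t by (auto simp: continuous_on_interior)
        then show ?thesis by (auto simp: isCont_def filterlim_at_split)
      qed
      have lk: "l * \<kappa> \<noteq> 0" using l \<kappa> by simp
      have eq: "s \<omega> r = s0 + (?m r - pairing v0 (\<lambda>x. 1) - \<theta> * ?I r) / (l * \<kappa>)" if "r > 0" for r
        using m[OF that] lk by (simp add: field_simps)
      have "((\<lambda>r. s0 + (?m r - pairing v0 (\<lambda>x. 1) - \<theta> * ?I r) / (l * \<kappa>)) \<longlongrightarrow> s \<omega> t) (at_left t)"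
        unfolding eq[OF t] by (intro tendsto_intros mlim Ilim lk)
      then have "(s \<omega> \<longlongrightarrow> s \<omega> t) (at_left t)"
        by (rule Lim_transform_eventually) (use t eq in \<open>auto simp: eventually_at_left_field intro!: exI[of _ 0]\<close>)
      then show "left_lim (s \<omega>) t = s \<omega> t" unfolding left_lim_def by (intro tendsto_Lim) auto
    qed
  qed
qed

text \<open>One inequality comes from \<open>s_jump_imp_v_jump\<close>. For the other, before the
  first jump of the front \<open>v\<close> is given by the heat solution, whose continuity rules out
  a jump of \<open>v\<close>.\<close>

lemma first_jumps_eq: "AE \<omega> in M. first_jump_v (v \<omega>) = first_jump_s (s \<omega>)"
  using representation s_jump_imp_v_jump W_continuous AE_space
proof eventually_elim
  case (elim \<omega>)
  note \<omega> = elim(4)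
  have "first_jump_v (v \<omega>) \<le> first_jump_s (s \<omega>)"
    unfolding first_jump_v_def first_jump_s_def using elim(2) by (intro Inf_superset_mono image_mono) auto
  moreover have "first_jump_s (s \<omega>) \<le> ereal t" if t: "t > 0" "\<not> is_left_lim_L1 (v \<omega>) t (v \<omega> t)" for t
  proof (rule ccontr)
    assume "\<not> ?thesis"
    then have "ereal t < first_jump_s (s \<omega>)" by simp
    \<comment> \<open>A time \<open>T\<close> strictly between leaves the margin beyond
      \<open>t\<close> that \<open>representation\<close> requires.\<close>
    then obtain T where T: "ereal t < ereal T" "ereal T < first_jump_s (s \<omega>)" using ereal_dense2 by blast
    have nj: "no_jump \<omega> T"
    proof (intro allI impI, rule ccontr)
      fix r assume r: "0 < r \<and> r \<le> T" "left_lim (s \<omega>) r \<noteq> s \<omega> r"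
      then have "first_jump_s (s \<omega>) \<le> ereal r" unfolding first_jump_s_def by (intro Inf_lower) force
      then have "first_jump_s (s \<omega>) \<le> ereal T" using r(1) by (meson ereal_less_eq(3) order_trans)
      then show False using T(2) by simp
    qed
    have "((\<lambda>r. pairing (v \<omega> r) \<psi>) \<longlongrightarrow> pairing (v \<omega> t) \<psi>) (at_left t)" if \<psi>: "\<psi> \<in> bcontfun" for \<psi>
    proof (rule tendsto_at_left_sequentially[of 0])
      show "0 < t" by fact
      fix S assume S: "\<And>n. S n < t" "\<And>n. 0 < S n" "S \<longlonglongrightarrow> t"
      have ST: "S n \<le> T" for n using S(1)[of n] T(1) by simp
      have "(\<lambda>n. heat_solution \<omega> \<psi> (S n)) \<longlonglongrightarrow> heat_solution \<omega> \<psi> t"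
        by (rule heat_solution_tendsto[OF \<omega> elim(3) nj S(2) ST S(3) t(1) _ \<psi>]) (use T(1) in simp)
      moreover have "pairing (v \<omega> r) \<psi> = heat_solution \<omega> \<psi> r" if "0 < r" "r \<le> t" for r
        using elim(1) nj that T(1) \<psi> by (meson ereal_less_eq(3) ereal_less(2) le_less_trans less_ereal.simps(1))
      ultimately show "(\<lambda>n. pairing (v \<omega> (S n)) \<psi>) \<longlonglongrightarrow> pairing (v \<omega> t) \<psi>"
        using S(1,2) t(1) by (simp add: less_imp_le)
    qed
    then have "is_left_lim_L1 (v \<omega>) t (v \<omega> t)"
      using v_integrable[OF \<omega>, of t] t(1) by (simp add: is_left_lim_L1_def)
    then show False using t(2) by simp
  qed
  then have "first_jump_s (s \<omega>) \<le> first_jump_v (v \<omega>)"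
    unfolding first_jump_v_def by (intro Inf_greatest) auto
  ultimately show ?case by (rule antisym)
qed

section \<open>Measurability of the jump event\<close>

lemma s_measurable: "0 \<le> t \<Longrightarrow> (\<lambda>\<omega>. s \<omega> t) \<in> borel_measurable M"
  by (rule measurable_F_imp[OF adapted_s])

lemma continuous_of_no_jump:
  assumes \<omega>: "\<omega> \<in> space M" and T: "0 \<le> T"
  shows "no_jump \<omega> T \<Longrightarrow> continuous_on {0..T} (s \<omega>)"
proof -
  assume nj: "no_jump \<omega> T"
  have right: "(s \<omega> \<longlongrightarrow> s \<omega> t) (at_right t)" if "0 \<le> t" for t
    using s_cadlag[OF \<omega>] that by (auto simp: cadlag_def continuous_within)
  have left: "(s \<omega> \<longlongrightarrow> s \<omega> t) (at_left t)" if "0 < t" "t \<le> T" for t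
    using left_lim_tendsto[OF s_cadlag[OF \<omega>] that(1)] nj that by auto
  show ?thesis
    unfolding continuous_on_def
  proof
    fix t assume t: "t \<in> {0..T}"
    show "(s \<omega> \<longlongrightarrow> s \<omega> t) (at t within {0..T})"
    proof (cases "t = 0")
      case True
      have "(s \<omega> \<longlongrightarrow> s \<omega> t) (at t within {0<..})" using right[of t] t True by simp
      moreover have "at t within {0..T} \<le> at t within {0<..}"
        unfolding at_within_def using True by (intro inf_mono order_refl) auto
      ultimately show ?thesis using tendsto_mono by blast
    next
      case False
      then have "(s \<omega> \<longlongrightarrow> s \<omega> t) (at t)" using left[of t] right[of t] t by (simp add: filterlim_at_split)
      then show ?thesis by (rule tendsto_within_subset) simp
    qed
  qed
qed

text \<open>This replaces the uncountable search for a jump time by countable quantifiers.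
  Monotonicity hands the size of a jump on to every interval around it; conversely, uniform
  continuity on \<open>{0..real n}\<close> forbids a fixed increment over arbitrarily short
  intervals. The \<open>max 0\<close> keeps the times at which \<open>s\<close> is evaluated
  nonnegative, as \<open>s_measurable\<close> requires.\<close>

lemma jump_iff:
  assumes \<omega>: "\<omega> \<in> space M"
  shows "first_jump_s (s \<omega>) < \<infinity> \<longleftrightarrow>
    (\<exists>m n::nat. \<forall>k::nat. \<exists>p q::rat. 0 \<le> p \<and> p < q \<and> q \<le> of_nat n \<and> q - p < 1 / of_nat (Suc k) \<and>
       s \<omega> (max 0 (of_rat q)) - s \<omega> (max 0 (of_rat p)) > 1 / real (Suc m))" (is "?L \<longleftrightarrow> ?R")
proof
  assume ?L
  then obtain t where t: "t > 0" "left_lim (s \<omega>) t \<noteq> s \<omega> t"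
    unfolding first_jump_s_finite_iff by auto
  have below: "s \<omega> r \<le> left_lim (s \<omega>) t" if r: "0 \<le> r" "r < t" for r
  proof (rule tendsto_lowerbound[OF left_lim_tendsto[OF s_cadlag[OF \<omega>] t(1)]])
    show "\<forall>\<^sub>F x in at_left t. s \<omega> r \<le> s \<omega> x"
      using s_mono[OF \<omega>, of r] r by (auto simp: eventually_at_left_field intro!: exI[of _ r])
  qed simp
  have "left_lim (s \<omega>) t \<le> s \<omega> t"
  proof (rule tendsto_upperbound[OF left_lim_tendsto[OF s_cadlag[OF \<omega>] t(1)]])
    show "\<forall>\<^sub>F x in at_left t. s \<omega> x \<le> s \<omega> t"
      using s_mono[OF \<omega>, of _ t] t by (auto simp: eventually_at_left_field intro!: exI[of _ 0])
  qed simp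
  with t have "0 < s \<omega> t - left_lim (s \<omega>) t" by simp
  then obtain m where m: "1 / real (Suc m) < s \<omega> t - left_lim (s \<omega>) t" using nat_approx_posE by blast
  obtain n :: nat where n: "t + 1 < real n" using reals_Archimedean2 by blast
  have "\<exists>p q::rat. 0 \<le> p \<and> p < q \<and> q \<le> of_nat n \<and> q - p < 1 / of_nat (Suc k) \<and>
       s \<omega> (max 0 (of_rat q)) - s \<omega> (max 0 (of_rat p)) > 1 / real (Suc m)" for k
  proof -
    define e where "e = 1 / real (Suc k) / 2"
    have e: "e > 0" "e \<le> 1" by (simp_all add: e_def)
    obtain p where p: "max 0 (t - e) < of_rat p" "of_rat p < t" using of_rat_dense[of "max 0 (t - e)" t] t e by auto
    obtain q where q: "t < of_rat q" "of_rat q < t + e" using of_rat_dense[of t "t + e"] e by auto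
    have "of_rat (q - p) < (of_rat (1 / of_nat (Suc k)) :: real)"
    proof -
      have "of_rat q - of_rat p < 2 * e" using p q by simp
      also have "2 * e = e + e" by simp
      also have "e + e = 1 / real (Suc k)" unfolding e_def by (rule field_sum_of_halves)
      finally show ?thesis by (simp only: of_rat_diff of_rat_inverse_Suc)
    qed
    then have 1: "q - p < 1 / of_nat (Suc k)" by (simp only: of_rat_less)
    have "(of_rat q :: real) \<le> of_rat (of_nat n)" using q n e by simp
    then have 2: "q \<le> of_nat n" by (simp only: of_rat_less_eq)
    have "(of_rat p :: real) < of_rat q" using p q by linarith
    then have 3: "p < q" by (simp only: of_rat_less)
    have "(0 :: real) < of_rat p" using p by simp
    then have 4: "0 \<le> p" by (simp add: zero_less_of_rat_iff)
    have "s \<omega> t \<le> s \<omega> (of_rat q)" using s_mono[OF \<omega>, of t "of_rat q"] t q by simp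
    moreover have "s \<omega> (of_rat p) \<le> left_lim (s \<omega>) t" using below p by simp
    ultimately have "s \<omega> t - left_lim (s \<omega>) t \<le> s \<omega> (of_rat q) - s \<omega> (of_rat p)" by linarith
    have "s \<omega> (max 0 (of_rat q)) - s \<omega> (max 0 (of_rat p)) > 1 / real (Suc m)"
    proof -
      have "max 0 (of_rat q) = (of_rat q :: real)" "max 0 (of_rat p) = (of_rat p :: real)"
        using p q t by (auto simp: max.absorb2)
      then show ?thesis
        using m \<open>s \<omega> t - left_lim (s \<omega>) t \<le> s \<omega> (of_rat q) - s \<omega> (of_rat p)\<close> by simp
    qed
    then show ?thesis using 1 2 3 4 by blast
  qed
  then show ?R by blast
next
  assume ?R
  then obtain m n :: nat where mn: "\<And>k::nat. \<exists>p q::rat. 0 \<le> p \<and> p < q \<and> q \<le> of_nat n \<and> q - p < 1 / of_nat (Suc k) \<and>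
       s \<omega> (max 0 (of_rat q)) - s \<omega> (max 0 (of_rat p)) > 1 / real (Suc m)" by blast
  show ?L
  proof (rule ccontr)
    assume "\<not> ?L"
    then have nj: "left_lim (s \<omega>) r = s \<omega> r" if "r > 0" for r
      unfolding first_jump_s_finite_iff using that by auto
    have "continuous_on {0..real n} (s \<omega>)" using nj by (intro continuous_of_no_jump[OF \<omega>]) auto
    then have "uniformly_continuous_on {0..real n} (s \<omega>)" by (rule compact_uniformly_continuous) simp
    moreover have "1 / real (Suc m) > 0" by simp
    ultimately obtain e where e: "e > 0" "\<And>x x'. x \<in> {0..real n} \<Longrightarrow> x' \<in> {0..real n} \<Longrightarrow> dist x' x < e \<Longrightarrow>
       dist (s \<omega> x') (s \<omega> x) < 1 / real (Suc m)" unfolding uniformly_continuous_on_def by metis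
    obtain k where k: "1 / real (Suc k) < e" using e(1) nat_approx_posE by blast
    obtain p q :: rat where pq: "0 \<le> p" "p < q" "q \<le> of_nat n" "q - p < 1 / of_nat (Suc k)"
       "s \<omega> (max 0 (of_rat q)) - s \<omega> (max 0 (of_rat p)) > 1 / real (Suc m)" using mn[of k] by blast
    have 1: "0 \<le> (of_rat p :: real)" "(of_rat p :: real) < of_rat q" "(of_rat q :: real) \<le> real n"
      using pq(1,2) pq(3)[folded of_rat_less_eq[where 'a = real]] by (simp_all add: of_rat_less)
    have "of_rat q - of_rat p < 1 / real (Suc k)"
      using pq(4)[folded of_rat_less[where 'a = real]] by (simp only: of_rat_diff of_rat_inverse_Suc)
    then have "dist (s \<omega> (of_rat q)) (s \<omega> (of_rat p)) < 1 / real (Suc m)"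
      using 1 k order.trans[OF pq(1) less_imp_le[OF pq(2)]] by (intro e(2)) (auto simp: dist_real_def)
    moreover have "max 0 (of_rat q) = (of_rat q :: real)" "max 0 (of_rat p) = (of_rat p :: real)"
      using 1 by linarith+
    ultimately show False using pq(5) by (simp add: dist_real_def)
  qed
qed

lemma jump_set_measurable: "{\<omega> \<in> space M. first_jump_s (s \<omega>) < \<infinity>} \<in> sets M"
proof -
  have [measurable]: "(\<lambda>\<omega>. s \<omega> (max 0 r)) \<in> borel_measurable M" for r by (rule s_measurable) simp
  have "{\<omega> \<in> space M. \<exists>m n::nat. \<forall>k::nat. \<exists>p q::rat. 0 \<le> p \<and> p < q \<and> q \<le> of_nat n \<and> q - p < 1 / of_nat (Suc k) \<and>
       s \<omega> (max 0 (of_rat q)) - s \<omega> (max 0 (of_rat p)) > 1 / real (Suc m)} \<in> sets M"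
    by measurable
  also have "?this \<longleftrightarrow> ?thesis"
    by (rule arg_cong[where f = "\<lambda>A. A \<in> sets M"], rule Collect_cong) (use jump_iff in blast)
  finally show ?thesis .
qed

text \<open>Measurability of the event for \<open>v\<close> comes from completeness of
  \<open>M\<close>: it differs from the event for \<open>s\<close> by a null set.\<close>

lemma measure_first_jumps_eq:
  "measure M {\<omega> \<in> space M. first_jump_v (v \<omega>) < \<infinity>} = measure M {\<omega> \<in> space M. first_jump_s (s \<omega>) < \<infinity>}"
proof -
  interpret c: complete_measure M by (rule complete_M)
  have ae: "AE \<omega> in M. \<omega> \<in> {\<omega> \<in> space M. first_jump_s (s \<omega>) < \<infinity>} \<longleftrightarrow> \<omega> \<in> {\<omega> \<in> space M. first_jump_v (v \<omega>) < \<infinity>}"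
    using first_jumps_eq by eventually_elim auto
  then have "{\<omega> \<in> space M. first_jump_v (v \<omega>) < \<infinity>} \<in> sets M"
    using jump_set_measurable by (rule c.in_sets_AE) auto
  then show ?thesis using ae jump_set_measurable by (intro measure_eq_AE) auto
qed

end

section \<open>The front sweeping past a supercooled interval\<close>

text \<open>The times with \<open>a\<close> at least \<open>y\<close> form a compact set, so there
  is a smallest one; the intermediate value theorem shows that the value there is exactly
  \<open>y\<close>.\<close>

lemma exists_first_hit:
  fixes a :: "real \<Rightarrow> real"
  assumes a: "continuous_on {0..\<epsilon>} a" and \<epsilon>: "0 \<le> \<epsilon>" "a 0 < y" "y \<le> a \<epsilon>"
  shows "\<exists>\<tau>\<in>{0<..\<epsilon>}. a \<tau> = y \<and> (\<forall>r\<in>{0..\<tau>}. a r \<le> y)"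
proof -
  define S where "S = {0..\<epsilon>} \<inter> a -` {y..}"
  have "closed S" unfolding S_def using a by (intro continuous_closed_preimage) auto
  then have "compact S" using bounded_subset[of "{0..\<epsilon>}" S] by (auto simp: compact_eq_bounded_closed S_def)
  moreover have "S \<noteq> {}" using \<epsilon> by (auto simp: S_def)
  ultimately have "\<exists>\<tau>\<in>S. \<forall>t\<in>S. \<tau> \<le> t" by (rule compact_attains_inf)
  then obtain \<tau> where \<tau>: "\<tau> \<in> S" "\<And>t. t \<in> S \<Longrightarrow> \<tau> \<le> t" by auto
  have \<tau>': "0 \<le> \<tau>" "\<tau> \<le> \<epsilon>" "y \<le> a \<tau>" using \<tau>(1) by (auto simp: S_def)
  obtain c where c: "0 \<le> c" "c \<le> \<tau>" "a c = y"
    using IVT'[of a 0 y \<tau>] \<tau>' \<epsilon> continuous_on_subset[OF a, of "{0..\<tau>}"] by auto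
  then have "c \<in> S" using \<tau>' by (auto simp: S_def)
  then have "c = \<tau>" using \<tau>(2) c(2) by (auto intro: antisym)
  then have 1: "a \<tau> = y" using c by simp
  have "a r \<le> y" if "r \<in> {0..\<tau>}" for r
  proof (rule ccontr)
    assume *: "\<not> a r \<le> y"
    then have "r \<in> S" using that \<tau>' by (auto simp: S_def)
    then show False using \<tau>(2)[of r] that 1 * by (auto dest: antisym)
  qed
  moreover have "\<tau> \<noteq> 0" using 1 \<epsilon>(2) by auto
  ultimately show ?thesis using 1 \<tau>' by (intro bexI[of _ \<tau>]) auto
qed

section \<open>Ramp test functions and heat flow at small times\<close>

definition ramp :: "real \<Rightarrow> real \<Rightarrow> real \<Rightarrow> real" where
  "ramp p q x = max 0 (min 1 ((x - p) / (q - p)))"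

lemma ramp:
  assumes "p < q"
  shows "ramp p q \<in> bcontfun" "0 \<le> ramp p q x" "ramp p q x \<le> 1" "x \<le> p \<Longrightarrow> ramp p q x = 0" "q \<le> x \<Longrightarrow> ramp p q x = 1"
proof -
  show *: "0 \<le> ramp p q x" "ramp p q x \<le> 1" for x by (auto simp: ramp_def)
  have "continuous_on UNIV (ramp p q)" unfolding ramp_def[abs_def] using assms by (intro continuous_intros) auto
  then show "ramp p q \<in> bcontfun" using * by (intro bcontfunI[of _ 1]) auto
  show "x \<le> p \<Longrightarrow> ramp p q x = 0" using assms divide_nonpos_pos[of "x - p" "q - p"] by (simp add: ramp_def)
  show "q \<le> x \<Longrightarrow> ramp p q x = 1" using assms by (simp add: ramp_def)
qed

lemma heat_nonneg: "(\<And>x. 0 \<le> \<phi> x) \<Longrightarrow> 0 \<le> heat t \<phi> x"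
  unfolding heat_def by (intro integral_nonneg_AE AE_I2) auto

lemma heat_0: "heat 0 \<phi> x = \<phi> x"
proof -
  interpret n: real_distribution std_normal_distribution by (rule real_dist_normal_dist)
  show ?thesis using n.prob_space by (simp add: heat_def)
qed

lemma heat_const: "heat t (\<lambda>x. c) x = c"
proof -
  interpret n: real_distribution std_normal_distribution by (rule real_dist_normal_dist)
  show ?thesis using n.prob_space by (simp add: heat_def)
qed

lemma heat_shift: "heat t (\<lambda>x. \<phi> (x - c)) x = heat t \<phi> (x - c)"
  by (simp add: heat_def algebra_simps)

text \<open>A Chebyshev bound: the ramp vanishes unless \<open>sqrt t * z\<close> exceeds
  \<open>\<eta>\<close>, and then \<open>t / \<eta>\<^sup>2 * z\<^sup>2\<close> is at least 1. The
  second moment of the standard normal law is 1.\<close>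

lemma heat_ramp_le:
  assumes \<eta>: "\<eta> > 0" and t: "0 \<le> t" and a: "a \<le> y"
  shows "heat t (ramp (y + \<eta>) (y + 2 * \<eta>)) a \<le> t / \<eta>\<^sup>2"
proof -
  have m: "(LINT z|std_normal_distribution. z\<^sup>2) = 1" "integrable std_normal_distribution (\<lambda>z. z\<^sup>2)"
    using std_normal_distribution_even_moments[of 1] by auto
  have r: "y + \<eta> < y + 2 * \<eta>" using \<eta> by simp
  have "heat t (ramp (y + \<eta>) (y + 2 * \<eta>)) a \<le> (LINT z|std_normal_distribution. t / \<eta>\<^sup>2 * z\<^sup>2)"
    unfolding heat_def
  proof (rule integral_mono')
    show "integrable std_normal_distribution (\<lambda>z. t / \<eta>\<^sup>2 * z\<^sup>2)" using m by simp
    fix z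
    show "0 \<le> t / \<eta>\<^sup>2 * z\<^sup>2" using t by simp
    show "ramp (y + \<eta>) (y + 2 * \<eta>) (a + sqrt t * z) \<le> t / \<eta>\<^sup>2 * z\<^sup>2"
    proof (cases "sqrt t * z \<le> \<eta>")
      case True
      then show ?thesis using ramp(4)[OF r, of "a + sqrt t * z"] a t by simp
    next
      case False
      then have "\<eta>\<^sup>2 \<le> (sqrt t * z)\<^sup>2" using \<eta> by (intro power_mono) auto
      also have "\<dots> = t * z\<^sup>2" using t by (simp add: power_mult_distrib)
      finally have "1 \<le> t * z\<^sup>2 / \<eta>\<^sup>2" using \<eta> by simp
      then show ?thesis using ramp(3)[OF r, of "a + sqrt t * z"] by simp
    qed
  qed
  then show ?thesis using m by simp
qed

lemma heat_pairing_continuous: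
  assumes f: "integrable lebesgue f" and \<psi>: "\<psi> \<in> bcontfun"
  shows "continuous_on UNIV (\<lambda>t. \<integral>x. f x * heat t \<psi> x \<partial>lebesgue)"
  unfolding continuous_on_sequentially comp_def
proof (intro ballI allI impI, elim conjE)
  fix t' :: real and t assume t: "t \<longlonglongrightarrow> t'"
  obtain B where B: "\<And>x. \<bar>\<psi> x\<bar> \<le> B" using bcontfunD(2)[OF \<psi>] by blast
  have fm: "f \<in> borel_measurable lebesgue" using f by auto
  have hm: "(\<lambda>x. heat u \<psi> x) \<in> borel_measurable lebesgue" for u
    by (rule measurable_completion, simp, rule heat_measurable[OF \<psi>]) measurable
  show "(\<lambda>n. \<integral>x. f x * heat (t n) \<psi> x \<partial>lebesgue) \<longlonglongrightarrow> (\<integral>x. f x * heat t' \<psi> x \<partial>lebesgue)"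
  proof (rule integral_dominated_convergence[where w = "\<lambda>x. \<bar>f x\<bar> * B"])
    show "(\<lambda>x. f x * heat t' \<psi> x) \<in> borel_measurable lebesgue" "\<And>n. (\<lambda>x. f x * heat (t n) \<psi> x) \<in> borel_measurable lebesgue"
      by (intro borel_measurable_times fm hm)+
    show "integrable lebesgue (\<lambda>x. \<bar>f x\<bar> * B)" using f by simp
    show "AE x in lebesgue. (\<lambda>n. f x * heat (t n) \<psi> x) \<longlonglongrightarrow> f x * heat t' \<psi> x"
      by (intro AE_I2 tendsto_mult heat_tendsto[OF \<psi>] tendsto_const t)
    show "AE x in lebesgue. norm (f x * heat (t n) \<psi> x) \<le> \<bar>f x\<bar> * B" for n
      using heat_bound[OF \<psi> B] by (intro AE_I2) (simp add: abs_mult mult_left_mono)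
  qed
qed

lemma heat_pairing_near_0:
  assumes f: "integrable lebesgue f" and \<psi>: "\<psi> \<in> bcontfun" and \<gamma>: "\<gamma> > 0"
  shows "\<exists>\<delta>>0. \<forall>t\<in>{0..\<delta>}. \<bar>(\<integral>x. f x * heat t \<psi> x \<partial>lebesgue) - pairing f \<psi>\<bar> \<le> \<gamma>"
proof -
  have "isCont (\<lambda>t. \<integral>x. f x * heat t \<psi> x \<partial>lebesgue) 0"
    using heat_pairing_continuous[OF f \<psi>] by (simp add: continuous_on_eq_continuous_at)
  then obtain e where e: "e > 0" "\<And>t. \<bar>t\<bar> < e \<Longrightarrow> \<bar>(\<integral>x. f x * heat t \<psi> x \<partial>lebesgue) - pairing f \<psi>\<bar> < \<gamma>"
    using \<gamma> unfolding continuous_at_eps_delta by (force simp: heat_0 pairing_def dist_real_def)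
  show ?thesis using e by (intro exI[of _ "e / 2"]) (auto intro!: less_imp_le)
qed

section \<open>The mass balance of the sweep and the contradiction\<close>

context stefan
begin

lemma stieltjes_length:
  assumes \<omega>: "\<omega> \<in> space M" and t: "0 \<le> t"
  shows "(LINT r|stieltjes (s \<omega>). indicator {0<..t} r) = s \<omega> t - s0"
    and "integrable (stieltjes (s \<omega>)) (indicat_real {0<..t})"
  using s_mono[OF \<omega>, of 0 t] t
  by (simp_all add: measure_def stieltjes_props(2)[OF \<omega>] stieltjes_props(1)[OF \<omega>] s_0[OF \<omega>])

lemma heat_solution_shift:
  assumes "\<omega> \<in> space M"
  shows "heat_solution \<omega> (\<lambda>x. \<phi> (x - \<theta> * W \<omega> t)) t = (\<integral>x. v0 x * heat ((2 * \<kappa> - \<theta>\<^sup>2) * t) \<phi> x \<partial>lebesgue) +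
     l * \<kappa> * (LINT r:{0<..t}|stieltjes (s \<omega>). heat ((2 * \<kappa> - \<theta>\<^sup>2) * (t - r)) \<phi> (s \<omega> r - \<theta> * W \<omega> r))"
  by (simp add: heat_solution_def heat_shift)

text \<open>Between the first time \<open>\<tau>1\<close> at which the front in the moving frame reaches \<open>y\<close> and a later time
  \<open>\<tau>2\<close> at which it reaches \<open>y + \<delta>\<close>, the front absorbs nearly all the mass which \<open>v0\<close> carries on
  \<open>[y, y + \<delta>]\<close>, since there is hardly time for diffusion. Continuity allows it to absorb only
  \<open>l * \<kappa>\<close> per unit of its own displacement, which is at most \<open>\<delta> + 2 * x\<close>. The slack terms come from
  the ramps of width \<open>\<eta>\<close>, from the diffusion of \<open>v0\<close> and from the source term near \<open>y\<close>.\<close>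

lemma sweep:
  assumes \<omega>: "\<omega> \<in> space M" and W0: "W \<omega> 0 = 0" and W: "continuous_on {0..} (W \<omega>)"
    and nj: "\<And>r. 0 < r \<Longrightarrow> left_lim (s \<omega>) r = s \<omega> r"
    and rep: "\<And>t \<psi>. 0 < t \<Longrightarrow> \<psi> \<in> bcontfun \<Longrightarrow> pairing (v \<omega> t) \<psi> = heat_solution \<omega> \<psi> t"
    and C: "0 \<le> C" "\<And>t. 0 \<le> t \<Longrightarrow> AE x in lebesgue. \<bar>v \<omega> t x\<bar> \<le> C"
    and y: "s0 < y" and \<eta>: "0 < \<eta>" "3 * \<eta> \<le> \<delta>" and \<epsilon>: "0 < \<epsilon>"
    and v0: "\<And>x. y \<le> x \<Longrightarrow> x \<le> y + \<delta> \<Longrightarrow> v0 x \<le> - K" and K: "0 \<le> K"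
    and climb: "y + \<delta> - s0 \<le> - \<theta> * W \<omega> \<epsilon>"
      "\<And>r t. 0 \<le> r \<Longrightarrow> r \<le> t \<Longrightarrow> t \<le> \<epsilon> \<Longrightarrow> - 2 * x \<le> - \<theta> * W \<omega> t - (- \<theta>) * W \<omega> r"
    and near: "\<And>\<phi> t. \<phi> \<in> {ramp (y + \<eta>) (y + 2 * \<eta>), ramp (y + \<delta> - \<eta>) (y + \<delta>)} \<Longrightarrow> 0 \<le> t \<Longrightarrow> t \<le> \<epsilon> \<Longrightarrow>
       \<bar>(\<integral>x. v0 x * heat ((2 * \<kappa> - \<theta>\<^sup>2) * t) \<phi> x \<partial>lebesgue) - pairing v0 \<phi>\<bar> \<le> \<gamma>"
  shows "K * (\<delta> - 3 * \<eta>) \<le> l * \<kappa> * (\<delta> + 2 * x) + 2 * \<gamma> + 2 * C * \<eta> +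
     l * \<kappa> * (y - s0 + 2 * x) * ((2 * \<kappa> - \<theta>\<^sup>2) * \<epsilon> / \<eta>\<^sup>2)"
proof -
  define d where "d = 2 * \<kappa> - \<theta>\<^sup>2"
  have d: "d > 0" using \<theta> by (simp add: d_def)
  have lk: "l * \<kappa> > 0" using l \<kappa> by simp
  define a where "a t = s \<omega> t - \<theta> * W \<omega> t" for t
  \<comment> \<open>\<open>Y\<close> starts a distance \<open>\<eta>\<close> beyond
    \<open>y\<close>, so the source released up to time \<open>\<tau>1\<close> at front positions
    not above \<open>y\<close> hardly reaches it. \<open>Z\<close> attains 1 at
    \<open>y + \<delta>\<close>, so at time \<open>\<tau>2\<close> it sees all the mass ahead of the
    front.\<close>
  define Y where "Y = ramp (y + \<eta>) (y + 2 * \<eta>)"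
  define Z where "Z = ramp (y + \<delta> - \<eta>) (y + \<delta>)"
  have "y + \<eta> < y + 2 * \<eta>" "y + \<delta> - \<eta> < y + \<delta>" using \<eta> by auto
  note Y = ramp[OF this(1), folded Y_def] and Z = ramp[OF this(2), folded Z_def]
  let ?S = "stieltjes (s \<omega>)" and ?m = "\<lambda>t. pairing (v \<omega> t) (\<lambda>x. 1)"
  have a_cont: "continuous_on {0..\<epsilon>} a"
    unfolding a_def[abs_def] using \<epsilon> nj
    by (intro continuous_intros continuous_on_subset[OF W] continuous_of_no_jump[OF \<omega>]) auto
  have a0: "a 0 < y" using W0 y by (simp add: a_def s_0[OF \<omega>])
  have a\<epsilon>: "y + \<delta> \<le> a \<epsilon>" using climb(1) s_mono[OF \<omega>, of 0 \<epsilon>] \<epsilon> by (simp add: a_def s_0[OF \<omega>])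
  obtain \<tau>1 where \<tau>1: "0 < \<tau>1" "\<tau>1 \<le> \<epsilon>" "a \<tau>1 = y" "\<And>r. 0 \<le> r \<Longrightarrow> r \<le> \<tau>1 \<Longrightarrow> a r \<le> y"
    using exists_first_hit[OF a_cont _ a0] a\<epsilon> \<epsilon> \<eta> by force
  obtain \<tau>2 where \<tau>2: "\<tau>1 \<le> \<tau>2" "\<tau>2 \<le> \<epsilon>" "a \<tau>2 = y + \<delta>"
    using IVT'[of a \<tau>1 "y + \<delta>" \<epsilon>] continuous_on_subset[OF a_cont, of "{\<tau>1..\<epsilon>}"] \<tau>1 a\<epsilon> \<eta> by auto
  have \<tau>2_pos: "0 < \<tau>2" using \<tau>1 \<tau>2 by simp
  have one: "(\<lambda>x. 1 :: real) \<in> bcontfun" by (intro bcontfunI[of _ 1]) auto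
  have shift: "(\<lambda>x. \<phi> (x - \<theta> * W \<omega> t)) \<in> bcontfun" if \<phi>: "\<phi> \<in> bcontfun" for \<phi> :: "real \<Rightarrow> real" and t
  proof -
    obtain B where B: "\<And>x. \<bar>\<phi> x\<bar> \<le> B" using bcontfunD(2)[OF \<phi>] by blast
    then show ?thesis
      by (intro bcontfunI continuous_on_compose2[OF bcontfunD(1)[OF \<phi>]] continuous_intros) auto
  qed
  \<comment> \<open>The balance of total mass, read off from the heat representation with the
    constant test function, which the heat flow preserves.\<close>
  have m: "?m t = pairing v0 (\<lambda>x. 1) + l * \<kappa> * (s \<omega> t - s0)" if "0 < t" for t
    using rep[OF that one] stieltjes_length(1)[OF \<omega>, of t] that
    by (simp add: heat_solution_def heat_const pairing_def set_lebesgue_integral_def)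
  \<comment> \<open>Ahead of the front \<open>Z\<close> is 1, so the tested mass is the whole mass,
    and the nonnegative source term is dropped. What remains is \<open>v0\<close> tested with
    \<open>Z\<close>, up to \<open>\<gamma>\<close>.\<close>
  have lower: "pairing v0 Z - \<gamma> \<le> ?m \<tau>2"
  proof -
    have "?m \<tau>2 = pairing (v \<omega> \<tau>2) (\<lambda>x. Z (x - \<theta> * W \<omega> \<tau>2))"
      unfolding pairing_def
    proof (rule integral_cong_AE)
      show "(\<lambda>x. v \<omega> \<tau>2 x * 1) \<in> borel_measurable lebesgue" "(\<lambda>x. v \<omega> \<tau>2 x * Z (x - \<theta> * W \<omega> \<tau>2)) \<in> borel_measurable lebesgue"
        using integrable_mult_bcontfun[OF v_integrable[OF \<omega>] one, of \<tau>2]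
          integrable_mult_bcontfun[OF v_integrable[OF \<omega>] shift[OF Z(1)], of \<tau>2] \<tau>2_pos
        by (auto dest: borel_measurable_integrable)
      show "AE x in lebesgue. v \<omega> \<tau>2 x * 1 = v \<omega> \<tau>2 x * Z (x - \<theta> * W \<omega> \<tau>2)"
        using v_supp[OF \<omega>, of \<tau>2] \<tau>2_pos \<tau>2(3) by (auto elim!: eventually_mono simp: a_def Z(5) not_less)
    qed
    also have "\<dots> = (\<integral>x. v0 x * heat (d * \<tau>2) Z x \<partial>lebesgue) +
        l * \<kappa> * (LINT r:{0<..\<tau>2}|?S. heat (d * (\<tau>2 - r)) Z (s \<omega> r - \<theta> * W \<omega> r))"
      using rep[OF \<tau>2_pos shift[OF Z(1)]] heat_solution_shift[OF \<omega>] by (simp add: d_def)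
    also have "\<dots> \<ge> (\<integral>x. v0 x * heat (d * \<tau>2) Z x \<partial>lebesgue)"
      using \<kappa> l by (auto intro!: mult_nonneg_nonneg set_integral_nonneg heat_nonneg Z(2))
    moreover have "pairing v0 Z - \<gamma> \<le> (\<integral>x. v0 x * heat (d * \<tau>2) Z x \<partial>lebesgue)"
      using near[of Z \<tau>2] \<tau>2 \<tau>2_pos by (auto simp: Z_def d_def abs_le_iff)
    ultimately show ?thesis by linarith
  qed
  \<comment> \<open>At time \<open>\<tau>1\<close> the front in the moving frame is at
    \<open>y\<close>, so \<open>s\<close> equals \<open>y + \<theta> * W\<close>, and the drawdown
    bound from time 0 says that \<open>\<theta> * W\<close> is at most \<open>2 * x\<close>. The
    next bound is the same argument between the two hitting times.\<close>
  have gain: "s \<omega> \<tau>1 - s0 \<le> y - s0 + 2 * x"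
    using climb(2)[of 0 \<tau>1] \<tau>1 W0 by (simp add: a_def)
  have advance: "s \<omega> \<tau>2 - s \<omega> \<tau>1 \<le> \<delta> + 2 * x"
    using climb(2)[of \<tau>1 \<tau>2] \<tau>1 \<tau>2 by (simp add: a_def)
  \<comment> \<open>The mass that \<open>Y\<close> misses sits in a strip of width
    \<open>2 * \<eta>\<close> ahead of the front, where \<open>v\<close> is bounded by
    \<open>C\<close>. The source reaches \<open>Y\<close> only by diffusion:
    \<open>heat_ramp_le\<close> bounds the fraction and \<open>gain\<close> the amount
    released.\<close>
  have upper: "?m \<tau>1 \<le> pairing v0 Y + \<gamma> + 2 * C * \<eta> + l * \<kappa> * (y - s0 + 2 * x) * (d * \<epsilon> / \<eta>\<^sup>2)"
  proof -
    let ?f = "\<lambda>x. Y (x - \<theta> * W \<omega> \<tau>1)"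
    have "?m \<tau>1 - pairing (v \<omega> \<tau>1) ?f \<le> 2 * C * \<eta>"
    proof -
      have i: "integrable lebesgue (\<lambda>x. v \<omega> \<tau>1 x * 1)" "integrable lebesgue (\<lambda>x. v \<omega> \<tau>1 x * ?f x)"
        using integrable_mult_bcontfun[OF v_integrable[OF \<omega>] one, of \<tau>1]
          integrable_mult_bcontfun[OF v_integrable[OF \<omega>] shift[OF Y(1)], of \<tau>1] \<tau>1 by auto
      have "?m \<tau>1 - pairing (v \<omega> \<tau>1) ?f = (\<integral>x. v \<omega> \<tau>1 x * 1 - v \<omega> \<tau>1 x * ?f x \<partial>lebesgue)"
        unfolding pairing_def using i by (rule Bochner_Integration.integral_diff[symmetric])
      also have "\<dots> \<le> (\<integral>x. C * indicator {s \<omega> \<tau>1..s \<omega> \<tau>1 + 2 * \<eta>} x \<partial>lebesgue)"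
      proof (rule integral_mono_AE)
        show "integrable lebesgue (\<lambda>x. v \<omega> \<tau>1 x * 1 - v \<omega> \<tau>1 x * ?f x)"
          using i by (rule Bochner_Integration.integrable_diff)
        show "integrable lebesgue (\<lambda>x. C * indicator {s \<omega> \<tau>1..s \<omega> \<tau>1 + 2 * \<eta>} x)"
          by (intro integrable_mult_right integrable_real_indicator) (auto simp: emeasure_lborel_Icc_eq)
        have "0 \<le> \<tau>1" using \<tau>1 by simp
        from v_supp[OF \<omega> this] C(2)[OF this]
        show "AE x in lebesgue. v \<omega> \<tau>1 x * 1 - v \<omega> \<tau>1 x * ?f x \<le> C * indicator {s \<omega> \<tau>1..s \<omega> \<tau>1 + 2 * \<eta>} x"
        proof eventually_elim
          case (elim x)
          have eq: "v \<omega> \<tau>1 x * 1 - v \<omega> \<tau>1 x * ?f x = v \<omega> \<tau>1 x * (1 - ?f x)" by (simp add: algebra_simps)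
          consider "x < s \<omega> \<tau>1" | "s \<omega> \<tau>1 + 2 * \<eta> \<le> x" | "s \<omega> \<tau>1 \<le> x" "x \<le> s \<omega> \<tau>1 + 2 * \<eta>" by linarith
          then show ?case
          proof cases
            case 1
            then show ?thesis using elim(1) by simp
          next
            case 2
            then have "?f x = 1" using \<tau>1(3) by (intro Y(5)) (simp add: a_def)
            then show ?thesis using C(1) by (simp add: indicator_def)
          next
            case 3
            have "v \<omega> \<tau>1 x * (1 - ?f x) \<le> \<bar>v \<omega> \<tau>1 x\<bar> * (1 - ?f x)"
              using Y(3) by (intro mult_right_mono) auto
            also have "\<dots> \<le> C * 1" using elim(2) Y(2,3) C(1) by (intro mult_mono) auto
            finally show ?thesis unfolding eq using 3 by simp
          qed
        qed
      qed
      also have "\<dots> = 2 * C * \<eta>" using \<eta>(1) by (simp add: measure_completion)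
      finally show ?thesis .
    qed
    moreover have "pairing (v \<omega> \<tau>1) ?f = (\<integral>x. v0 x * heat (d * \<tau>1) Y x \<partial>lebesgue) +
        l * \<kappa> * (LINT r:{0<..\<tau>1}|?S. heat (d * (\<tau>1 - r)) Y (a r))"
      using rep[OF \<tau>1(1) shift[OF Y(1)]] heat_solution_shift[OF \<omega>] by (simp add: d_def a_def)
    moreover have "(\<integral>x. v0 x * heat (d * \<tau>1) Y x \<partial>lebesgue) \<le> pairing v0 Y + \<gamma>"
      using near[of Y \<tau>1] \<tau>1 by (auto simp: Y_def d_def abs_le_iff)
    moreover have "l * \<kappa> * (LINT r:{0<..\<tau>1}|?S. heat (d * (\<tau>1 - r)) Y (a r)) \<le> l * \<kappa> * (y - s0 + 2 * x) * (d * \<epsilon> / \<eta>\<^sup>2)"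
    proof -
      define q where "q = d * \<epsilon> / \<eta>\<^sup>2"
      have q: "0 \<le> q" using d \<epsilon> by (simp add: q_def)
      have "(LINT r:{0<..\<tau>1}|?S. heat (d * (\<tau>1 - r)) Y (a r)) \<le> (\<integral>r. q * indicator {0<..\<tau>1} r \<partial>?S)"
        unfolding set_lebesgue_integral_def
      proof (rule integral_mono')
        show "integrable ?S (\<lambda>r. q * indicator {0<..\<tau>1} r)"
          using stieltjes_length(2)[OF \<omega>, of \<tau>1] \<tau>1 by simp
        fix r
        show "0 \<le> q * indicator {0<..\<tau>1} r" using q by simp
        have "heat (d * (\<tau>1 - r)) Y (a r) \<le> q" if "r \<in> {0<..\<tau>1}"
        proof -
          have "heat (d * (\<tau>1 - r)) Y (a r) \<le> d * (\<tau>1 - r) / \<eta>\<^sup>2"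
            unfolding Y_def using that d \<tau>1 \<eta> by (intro heat_ramp_le) auto
          also have "\<dots> \<le> q" unfolding q_def using that d \<tau>1 by (intro divide_right_mono mult_left_mono) auto
          finally show ?thesis .
        qed
        then show "indicator {0<..\<tau>1} r *\<^sub>R heat (d * (\<tau>1 - r)) Y (a r) \<le> q * indicator {0<..\<tau>1} r"
          by (simp add: indicator_def)
      qed
      also have "\<dots> = q * (s \<omega> \<tau>1 - s0)" using stieltjes_length(1)[OF \<omega>, of \<tau>1] \<tau>1 by simp
      also have "\<dots> \<le> q * (y - s0 + 2 * x)" using gain q by (rule mult_left_mono)
      finally have "l * \<kappa> * (LINT r:{0<..\<tau>1}|?S. heat (d * (\<tau>1 - r)) Y (a r)) \<le> l * \<kappa> * (q * (y - s0 + 2 * x))"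
        using lk by (intro mult_left_mono) auto
      then show ?thesis by (simp add: q_def mult_ac)
    qed
    ultimately show ?thesis by linarith
  qed
  \<comment> \<open>\<open>Y - Z\<close> is 1 on an interval of length
    \<open>\<delta> - 3 * \<eta>\<close>, where \<open>v0\<close> is at most \<open>- K\<close>, and
    nonnegative elsewhere, where \<open>v0 \<le> 0\<close> gives the sign.\<close>
  have gap: "K * (\<delta> - 3 * \<eta>) \<le> pairing v0 Z - pairing v0 Y"
  proof -
    note i = integrable_mult_bcontfun[OF v0_integrable Z(1)] integrable_mult_bcontfun[OF v0_integrable Y(1)]
    have "K * (\<delta> - 3 * \<eta>) = (\<integral>x. K * indicator {y + 2 * \<eta>..y + \<delta> - \<eta>} x \<partial>lebesgue)"
      using \<eta> by (simp add: measure_completion)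
    also have "\<dots> \<le> (\<integral>x. v0 x * Z x - v0 x * Y x \<partial>lebesgue)"
    proof (rule integral_mono_AE)
      show "integrable lebesgue (\<lambda>x. v0 x * Z x - v0 x * Y x)" using i by (rule Bochner_Integration.integrable_diff)
      show "integrable lebesgue (\<lambda>x. K * indicator {y + 2 * \<eta>..y + \<delta> - \<eta>} x)"
        by (intro integrable_mult_right integrable_real_indicator) (auto simp: emeasure_lborel_Icc_eq)
      show "AE x in lebesgue. K * indicator {y + 2 * \<eta>..y + \<delta> - \<eta>} x \<le> v0 x * Z x - v0 x * Y x"
        using v0_nonpos
      proof eventually_elim
        case (elim x)
        have eq: "v0 x * Z x - v0 x * Y x = - v0 x * (Y x - Z x)" by (simp add: algebra_simps)
        have ZY: "Z x \<le> Y x"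
        proof (cases "x \<le> y + \<delta> - \<eta>")
          case True
          then show ?thesis using Y(2) Z(4) by simp
        next
          case False
          then show ?thesis using \<eta> Y(5)[of x] Z(3)[of x] by simp
        qed
        show ?case
        proof (cases "x \<in> {y + 2 * \<eta>..y + \<delta> - \<eta>}")
          case True
          then have "Y x - Z x = 1" using Y(5)[of x] Z(4)[of x] by simp
          then show ?thesis unfolding eq using True v0[of x] \<eta> by simp
        next
          case False
          then show ?thesis unfolding eq using ZY elim by (simp add: mult_nonpos_nonneg)
        qed
      qed
    qed
    also have "\<dots> = pairing v0 Z - pairing v0 Y"
      unfolding pairing_def using i by (rule Bochner_Integration.integral_diff)
    finally show ?thesis .
  qed
  have "l * \<kappa> * (s \<omega> \<tau>2 - s \<omega> \<tau>1) \<le> l * \<kappa> * (\<delta> + 2 * x)"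
    using advance lk by (intro mult_left_mono) auto
  moreover have "?m \<tau>2 - ?m \<tau>1 = l * \<kappa> * (s \<omega> \<tau>2 - s \<omega> \<tau>1)"
    unfolding m[OF \<tau>1(1)] m[OF \<tau>2_pos] by (simp add: algebra_simps)
  ultimately show ?thesis using lower upper gap unfolding d_def by linarith
qed

text \<open>If jumps had probability 0, \<open>sweep\<close> would apply almost surely on a climbing
  event of positive probability. The constants are chosen in the order \<open>\<delta>\<close>,
  \<open>x\<close>, \<open>\<eta>\<close>, \<open>\<epsilon>\<close>: the bound on the diffusing
  source has \<open>\<eta>\<^sup>2\<close> in the denominator, so the horizon comes last, and
  \<open>brownian_climb\<close> accepts any positive horizon.\<close>

lemma jump_probability_pos:
  assumes \<theta>0: "\<theta> \<noteq> 0" and y: "s0 < y" and v0y: "v0 y < - l * \<kappa>" and v0_right: "continuous (at_right y) v0"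
  shows "measure M {\<omega> \<in> space M. first_jump_s (s \<omega>) < \<infinity>} > 0"
proof (rule ccontr)
  assume "\<not> ?thesis"
  then have "prob {\<omega> \<in> space M. first_jump_s (s \<omega>) < \<infinity>} = 0" by (simp add: measure_le_0_iff not_less)
  then have "AE \<omega> in M. \<omega> \<notin> {\<omega> \<in> space M. first_jump_s (s \<omega>) < \<infinity>}" using prob_eq_0[OF jump_set_measurable] by simp
  then have nj: "AE \<omega> in M. \<forall>r>0. left_lim (s \<omega>) r = s \<omega> r"
    using AE_space by eventually_elim (auto simp: first_jump_s_finite_iff simp del: ereal_infty_less)
  define K where "K = l * \<kappa>"
  have K: "K > 0" using l \<kappa> by (simp add: K_def)
  define d where "d = 2 * \<kappa> - \<theta>\<^sup>2"
  have d: "d > 0" using \<theta> by (simp add: d_def)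
  \<comment> \<open>Half of the excess of \<open>- v0 y\<close> over \<open>l * \<kappa>\<close>;
    the other half is left for right-continuity to consume on an interval beyond
    \<open>y\<close>.\<close>
  define \<rho> where "\<rho> = (- K - v0 y) / 2"
  have \<rho>: "\<rho> > 0" using v0y by (simp add: \<rho>_def K_def)
  have "(v0 \<longlongrightarrow> v0 y) (at_right y)" using v0_right by (simp add: continuous_within)
  moreover have "v0 y < - (K + \<rho>)" using v0y by (simp add: \<rho>_def K_def field_simps)
  ultimately have "\<forall>\<^sub>F x in at_right y. v0 x < - (K + \<rho>)" by (rule order_tendstoD)
  then obtain b where b: "b > y" "\<And>x. y < x \<Longrightarrow> x < b \<Longrightarrow> v0 x < - (K + \<rho>)" by (auto simp: eventually_at_right_field)
  define \<delta> where "\<delta> = (b - y) / 2"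
  have \<delta>: "\<delta> > 0" "y + \<delta> < b" using b by (simp_all add: \<delta>_def field_simps)
  have v0K: "v0 x \<le> - (K + \<rho>)" if "y \<le> x" "x \<le> y + \<delta>" for x
    using that b(2)[of x] \<delta> \<open>v0 y < - (K + \<rho>)\<close> by (cases "x = y") auto
  obtain C where C: "C \<ge> 0" "\<And>\<omega> t. \<omega> \<in> space M \<Longrightarrow> 0 \<le> t \<Longrightarrow> AE x in lebesgue. \<bar>v \<omega> t x\<bar> \<le> C"
    using v_bounded by blast
  \<comment> \<open>\<open>A\<close> is the surplus mass of the interval over what an advance by
    \<open>\<delta>\<close> explains. Four slack terms oppose it: from the drawdown
    \<open>x\<close>, the ramps, the diffusion of \<open>v0\<close> and the diffusing source. Each
    is made at most \<open>A / 6\<close>, so together they stay below \<open>A\<close>.\<close>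
  define A where "A = \<rho> * \<delta>"
  have A: "A > 0" using \<rho> \<delta> by (simp add: A_def)
  define x where "x = A / (12 * K)"
  have x: "x > 0" "2 * K * x = A / 6" using A K by (simp_all add: x_def)
  \<comment> \<open>The total coefficient of \<open>\<eta>\<close>: \<open>3 * (K + \<rho>)\<close>
    is lost where the ramps shorten the interval, and \<open>2 * C\<close> comes from the mass that
    the first ramp misses.\<close>
  define c where "c = 3 * (K + \<rho>) + 2 * C"
  have c: "c > 0" using K \<rho> C(1) by (simp add: c_def)
  define \<eta> where "\<eta> = min (\<delta> / 3) (A / (6 * c))"
  have \<eta>: "0 < \<eta>" "3 * \<eta> \<le> \<delta>" "c * \<eta> \<le> A / 6"
  proof -
    show "0 < \<eta>" "3 * \<eta> \<le> \<delta>" using \<delta> A c by (simp_all add: \<eta>_def)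
    have "c * \<eta> \<le> c * (A / (6 * c))" using c by (intro mult_left_mono) (simp_all add: \<eta>_def)
    also have "\<dots> = A / 6" using c by simp
    finally show "c * \<eta> \<le> A / 6" .
  qed
  have ramps: "ramp (y + \<eta>) (y + 2 * \<eta>) \<in> bcontfun" "ramp (y + \<delta> - \<eta>) (y + \<delta>) \<in> bcontfun"
    using \<eta> by (simp_all add: ramp(1))
  have A12: "A / 12 > 0" using A by simp
  obtain e1 where e1: "e1 > 0" "\<And>t. t \<in> {0..e1} \<Longrightarrow> \<bar>(\<integral>x. v0 x * heat t (ramp (y + \<eta>) (y + 2 * \<eta>)) x \<partial>lebesgue) - pairing v0 (ramp (y + \<eta>) (y + 2 * \<eta>))\<bar> \<le> A / 12"
    using heat_pairing_near_0[OF v0_integrable ramps(1) A12] by blast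
  obtain e2 where e2: "e2 > 0" "\<And>t. t \<in> {0..e2} \<Longrightarrow> \<bar>(\<integral>x. v0 x * heat t (ramp (y + \<delta> - \<eta>) (y + \<delta>)) x \<partial>lebesgue) - pairing v0 (ramp (y + \<delta> - \<eta>) (y + \<delta>))\<bar> \<le> A / 12"
    using heat_pairing_near_0[OF v0_integrable ramps(2) A12] by blast
  define g where "g = K * (y - s0 + 2 * x)"
  have g: "g > 0" using K y x by (simp add: g_def)
  \<comment> \<open>The division by \<open>d\<close> is due to the heat flow running at speed
    \<open>d\<close>; the last entry of the minimum bounds the contribution of the diffusing source
    by \<open>A / 6\<close>.\<close>
  define \<epsilon> where "\<epsilon> = min (min e1 e2) (A * \<eta>\<^sup>2 / (6 * g)) / d"
  have \<epsilon>: "0 < \<epsilon>" "d * \<epsilon> \<le> e1" "d * \<epsilon> \<le> e2" "g * (d * \<epsilon> / \<eta>\<^sup>2) \<le> A / 6"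
  proof -
    show "0 < \<epsilon>" using e1 e2 A \<eta> g d by (simp add: \<epsilon>_def)
    have de: "d * \<epsilon> = min (min e1 e2) (A * \<eta>\<^sup>2 / (6 * g))" using d by (simp add: \<epsilon>_def)
    then show "d * \<epsilon> \<le> e1" "d * \<epsilon> \<le> e2" by simp_all
    have "g * (d * \<epsilon> / \<eta>\<^sup>2) \<le> g * ((A * \<eta>\<^sup>2 / (6 * g)) / \<eta>\<^sup>2)"
      unfolding de using g by (intro mult_left_mono divide_right_mono) auto
    also have "\<dots> = A / 6" using g \<eta> by simp
    finally show "g * (d * \<epsilon> / \<eta>\<^sup>2) \<le> A / 6" .
  qed
  have "- \<theta> \<noteq> 0" using \<theta>0 by simp
  from brownian_climb[OF this \<epsilon>(1) x(1), of "y + \<delta> - s0"]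
  obtain G where G: "G \<in> events" "prob G > 0" and climb: "AE \<omega> in M. \<omega> \<in> G \<longrightarrow>
     - \<theta> * W \<omega> \<epsilon> \<ge> y + \<delta> - s0 \<and> (\<forall>r t. 0 \<le> r \<and> r \<le> t \<and> t \<le> \<epsilon> \<longrightarrow> - \<theta> * W \<omega> t - - \<theta> * W \<omega> r \<ge> - 2 * x)" by blast
  have "AE \<omega> in M. \<omega> \<notin> G"
    using climb nj representation W_0 W_continuous AE_space
  proof eventually_elim
    case (elim \<omega>)
    note \<omega> = elim(6)
    show ?case
    proof
      assume "\<omega> \<in> G"
      have "(K + \<rho>) * (\<delta> - 3 * \<eta>) \<le> l * \<kappa> * (\<delta> + 2 * x) + 2 * (A / 12) + 2 * C * \<eta> +
         l * \<kappa> * (y - s0 + 2 * x) * ((2 * \<kappa> - \<theta>\<^sup>2) * \<epsilon> / \<eta>\<^sup>2)"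
      proof (rule sweep[OF \<omega> elim(4,5) _ _ C(1) C(2)[OF \<omega>] y \<eta>(1,2) \<epsilon>(1) v0K])
        show "0 < r \<Longrightarrow> left_lim (s \<omega>) r = s \<omega> r" for r using elim(2) by simp
        show "pairing (v \<omega> t) \<psi> = heat_solution \<omega> \<psi> t" if "0 < t" "\<psi> \<in> bcontfun" for t \<psi>
          using elim(2,3) that by (meson less_add_one)
        show "0 \<le> K + \<rho>" using K \<rho> by simp
        show "y + \<delta> - s0 \<le> - \<theta> * W \<omega> \<epsilon>" using elim(1) \<open>\<omega> \<in> G\<close> by simp
        show "- 2 * x \<le> - \<theta> * W \<omega> t - (- \<theta>) * W \<omega> r" if "0 \<le> r" "r \<le> t" "t \<le> \<epsilon>" for r t
          using elim(1) \<open>\<omega> \<in> G\<close> that by blast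
        fix \<phi> t assume \<phi>: "\<phi> \<in> {ramp (y + \<eta>) (y + 2 * \<eta>), ramp (y + \<delta> - \<eta>) (y + \<delta>)}" and t: "0 \<le> t" "t \<le> \<epsilon>"
        have "0 \<le> d * t" "d * t \<le> d * \<epsilon>" using d t by auto
        then show "\<bar>(\<integral>x. v0 x * heat ((2 * \<kappa> - \<theta>\<^sup>2) * t) \<phi> x \<partial>lebesgue) - pairing v0 \<phi>\<bar> \<le> A / 12"
          using \<phi> e1(2)[of "d * t"] e2(2)[of "d * t"] \<epsilon>(2,3) unfolding d_def[symmetric] by auto
      qed auto
      then have "K * \<delta> + A \<le> K * \<delta> + 2 * K * x + A / 6 + c * \<eta> + g * (d * \<epsilon> / \<eta>\<^sup>2)"
        unfolding K_def[symmetric] d_def[symmetric] g_def[symmetric] by (simp add: A_def c_def algebra_simps)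
      then show False using x(2) \<eta>(3) \<epsilon>(4) A by linarith
    qed
  qed
  then show False using G prob_eq_0[OF G(1)] by simp
qed

end

theorem theorem3p2:
  fixes M :: "'a measure" and W :: "'a \<Rightarrow> real \<Rightarrow> real"
    and \<kappa> l \<theta> s0 y :: real and v0 :: "real \<Rightarrow> real"
    and v :: "'a \<Rightarrow> real \<Rightarrow> real \<Rightarrow> real" and s :: "'a \<Rightarrow> real \<Rightarrow> real"
  assumes "\<kappa> > 0" and "l > 0" and "\<theta> \<noteq> 0" and "\<bar>\<theta>\<bar> < sqrt (2 * \<kappa>)"
    and "prob_space M" and "complete_measure M" and "brownian_motion M W"
    and "s0 \<in> {0..}"
    and "integrable lebesgue v0" and "Linf_norm v0 < \<infinity>"
    and "ess_supp v0 \<subseteq> {s0..}" and "AE x in lebesgue. v0 x \<le> 0"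
    and "y \<in> {s0<..}" and "v0 y < - l * \<kappa>" and "continuous (at_right y) v0"
    and "cadlag_weak_solution M W \<kappa> \<theta> l v0 s0 v s"
  shows "(AE \<omega> in M. first_jump_v (v \<omega>) = first_jump_s (s \<omega>)) \<and>
         measure M {\<omega> \<in> space M. first_jump_v (v \<omega>) < \<infinity>} > 0"
proof -
  obtain I where I: "\<forall>\<phi>\<in>C12b. has_ito_integral M (brownian_filtration M W) W
              (\<lambda>\<omega> r. LINT x:{s \<omega> r..}|lebesgue. v \<omega> r x * d_x \<phi> r x) (I \<phi>)"
    "AE \<omega> in M. \<forall>\<phi>\<in>C12b. \<forall>t>0. weak_identity \<kappa> \<theta> l v0 s0 (v \<omega>) (s \<omega>) \<phi> (I \<phi> \<omega> t) t"
    using assms(16) unfolding cadlag_weak_solution_def by blast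
  have "\<theta>\<^sup>2 < 2 * \<kappa>" using assms(4) by (metis real_sqrt_abs real_sqrt_less_iff)
  then interpret stefan M W \<kappa> \<theta> l s0 v0 v s I
    using assms I by (intro stefan.intro bm.intro bm_axioms.intro stefan_axioms.intro) (auto simp: cadlag_weak_solution_def)
  show ?thesis
    unfolding measure_first_jumps_eq using first_jumps_eq jump_probability_pos assms(3,13,14,15) by simp
qed

end
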